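(* There exists a smooth family of domains $\{A_\lambda\}_{\lambda\in(0,\lambda_0]}$ in $\mathcal{A}$ (for some $\lambda_0>0$) which $C^1$-converges to the unit ball $B$ of $\mathbb{C}^n$ for $\lambda\to0$, and such that $$\underline{c}(A_\lambda)<\mathrm{sys}(A_\lambda)\le\overline{c}(A_\lambda)\qquad\forall\lambda\in(0,\lambda_0].$$
   Context: $\mathbb{C}^n$ has coordinates $z_j=x_j+iy_j$, symplectic form $\omega_0=\sum_j dx_j\wedge dy_j$, with standard primitive $\frac12\sum_j(x_j\,dy_j-y_j\,dx_j)$. A symplectomorphism is a diffeomorphism preserving $\omega_0$. $B$ is the open unit Euclidean ball and $Z=\{z\in\mathbb{C}^n: |z_1|<1\}$. The ball and cylindrical capacities of an open set $A\subset\mathbb{C}^n$ are $\underline{c}(A)=\sup\{\pi r^2 : \exists \text{ symplectomorphism } \phi:\mathbb{C}^n\to\mathbb{C}^n,\ \phi(rB)\subset A\}$ and $\overline{c}(A)=\inf\{\pi r^2 : \exists \text{ symplectomorphism } \phi:\mathbb{C}^n\to\mathbb{C}^n,\ \phi(A)\subset rZ\}$. $\mathcal{A}$ is the set of bounded open neighborhoods of the origin in $\mathbb{C}^n$ whose boundary is smooth and transverse to the radial direction, equivalently the sets $A_f=\{rz: z\in S^{2n-1},\ 0\le r<f(z)\}$ with $f$ a smooth positive function on $S^{2n-1}$. The $C^k$-distance between $A_f$ and $A_g$ is the $C^k$-distance between $f$ and $g$ on $S^{2n-1}$ (so $B=A_1$); a family of domains is smooth if the corresponding family of functions is smooth. For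 $A\in\mathcal{A}$, a closed characteristic on $\partial A$ is a closed leaf of the line field $\ker(\omega_0|_{\partial A})$, oriented as a Reeb orbit of the contact form obtained by restricting the standard primitive to $\partial A$; its action is the integral of the standard primitive over it. $\mathrm{sys}(A)$ is the minimum of the actions of the closed characteristics on $\partial A$.
   Formalization: The dimension is assumed to satisfy n ≥ 2; for n = 1 the ball capacity and the systole of every domain in the class both equal its area, so the strict inequality fails. *)

theory Defs
  imports "HOL-Analysis.Analysis"
begin

text \<open>Smoothness. On an open set of a finite-dimensional space, a map is of class \<open>C\<^sup>k\<close>
  iff all its iterated directional derivatives up to order \<open>k\<close> exist and are continuous.\<close>

primrec Ck_on :: "nat \<Rightarrow> ('a::euclidean_space \<Rightarrow> 'b::real_normed_vector) \<Rightarrow> 'a set \<Rightarrow> bool" where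
  "Ck_on 0 f U \<longleftrightarrow> continuous_on U f"
| "Ck_on (Suc k) f U \<longleftrightarrow>
     f differentiable_on U \<and> (\<forall>v. Ck_on k (\<lambda>x. frechet_derivative f (at x) v) U)"

text \<open>On a set \<open>S\<close> that need not be open (a sphere, say, or the product of a half-open interval
  with a sphere): near each point of \<open>S\<close> there is a smooth extension to an open set.\<close>

definition smooth_on :: "('a::euclidean_space \<Rightarrow> 'b::real_normed_vector) \<Rightarrow> 'a set \<Rightarrow> bool" where
  "smooth_on f S \<longleftrightarrow>
     (\<forall>x\<in>S. \<exists>U g. open U \<and> x \<in> U \<and> (\<forall>k. Ck_on k g U) \<and> (\<forall>y \<in> U \<inter> S. g y = f y))"

definition diffeomorphism :: "('a::euclidean_space \<Rightarrow> 'a) \<Rightarrow> bool" where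
  "diffeomorphism \<phi> \<longleftrightarrow> bij \<phi> \<and> smooth_on \<phi> UNIV \<and> smooth_on (inv \<phi>) UNIV"

text \<open>The symplectic form \<open>\<Sum>\<^sub>j dx\<^sub>j \<and> dy\<^sub>j\<close> and its primitive
  \<open>1/2 \<Sum>\<^sub>j (x\<^sub>j dy\<^sub>j - y\<^sub>j dx\<^sub>j)\<close>; the first argument of the latter is the base point, the second
  the tangent vector.\<close>

definition symp_form :: "complex ^ 'n \<Rightarrow> complex ^ 'n \<Rightarrow> real" where
  "symp_form u v = (\<Sum>j\<in>UNIV. Re (u $ j) * Im (v $ j) - Im (u $ j) * Re (v $ j))"

definition liouville_form :: "complex ^ 'n \<Rightarrow> complex ^ 'n \<Rightarrow> real" where
  "liouville_form z v = (1/2) * (\<Sum>j\<in>UNIV. Re (z $ j) * Im (v $ j) - Im (z $ j) * Re (v $ j))"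

definition symplectomorphism :: "(complex ^ 'n \<Rightarrow> complex ^ 'n) \<Rightarrow> bool" where
  "symplectomorphism \<phi> \<longleftrightarrow> diffeomorphism \<phi> \<and>
     (\<forall>z u v. symp_form (frechet_derivative \<phi> (at z) u) (frechet_derivative \<phi> (at z) v)
              = symp_form u v)"

text \<open>The index \<open>i\<close> of \<open>cylinder\<close> plays the role of the first coordinate: the index type \<open>'n\<close>
  has no distinguished element.\<close>

definition cylinder :: "'n \<Rightarrow> real \<Rightarrow> (complex ^ 'n) set" where
  "cylinder i r = {z. cmod (z $ i) < r}"

definition ball_capacity :: "(complex ^ 'n) set \<Rightarrow> ereal" where
  "ball_capacity A =
     Sup {ereal (pi * r\<^sup>2) | r. 0 < r \<and> (\<exists>\<phi>. symplectomorphism \<phi> \<and> \<phi> ` ball 0 r \<subseteq> A)}"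

definition cylindrical_capacity :: "'n \<Rightarrow> (complex ^ 'n) set \<Rightarrow> ereal" where
  "cylindrical_capacity i A =
     Inf {ereal (pi * r\<^sup>2) | r. 0 < r \<and> (\<exists>\<phi>. symplectomorphism \<phi> \<and> \<phi> ` A \<subseteq> cylinder i r)}"

definition star_domain :: "(complex ^ 'n \<Rightarrow> real) \<Rightarrow> (complex ^ 'n) set" where
  "star_domain f = {r *\<^sub>R z | r z. z \<in> sphere 0 1 \<and> 0 \<le> r \<and> r < f z}"

definition star_domains :: "(complex ^ 'n) set set" where
  "star_domains =
     {star_domain f | f. smooth_on f (sphere 0 1) \<and> (\<forall>z \<in> sphere 0 1. 0 < f z)}"

definition radial_fun :: "(complex ^ 'n) set \<Rightarrow> complex ^ 'n \<Rightarrow> real" where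
  "radial_fun A z = Sup {r. 0 \<le> r \<and> r *\<^sub>R z \<in> A}"

lemma radial_fun_star_domain:
  assumes pos: "\<And>w. w \<in> sphere 0 1 \<Longrightarrow> 0 < f w" and z: "z \<in> sphere 0 1"
  shows "radial_fun (star_domain f) z = f z"
proof -
  have "r < f z" if "0 \<le> r" "r *\<^sub>R z \<in> star_domain f" for r
  proof (cases "r = 0")
    case False
    from that(2) obtain s w where w: "r *\<^sub>R z = s *\<^sub>R w" "w \<in> sphere 0 1" "0 \<le> s" "s < f w"
      by (auto simp: star_domain_def)
    from w(1) have "\<bar>r\<bar> * norm z = \<bar>s\<bar> * norm w" by (metis norm_scaleR)
    with w(2,3) z that(1) have "r = s" by simp
    with w(1) False have "z = w" by simp
    with \<open>r = s\<close> w show ?thesis by simp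
  qed (use pos z in auto)
  moreover have "r *\<^sub>R z \<in> star_domain f" if "0 \<le> r" "r < f z" for r
    using that z unfolding star_domain_def by blast
  ultimately have "{r. 0 \<le> r \<and> r *\<^sub>R z \<in> star_domain f} = {0..<f z}"
    by auto
  then show ?thesis
    using pos[OF z] by (simp add: radial_fun_def)
qed

lemma unit_ball_eq_star_domain: "ball 0 1 = star_domain (\<lambda>_ :: complex ^ 'n. 1)"
proof (intro set_eqI iffI)
  fix x :: "complex ^ 'n" assume x: "x \<in> ball 0 1"
  obtain e :: "complex ^ 'n" where e: "norm e = 1"
    using vector_choose_size[of 1] by auto
  show "x \<in> star_domain (\<lambda>_. 1)"
  proof (cases "x = 0")
    case True
    with e show ?thesis by (auto simp: star_domain_def intro!: exI[of _ 0] exI[of _ e])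
  next
    case False
    with x show ?thesis
      by (auto simp: star_domain_def intro!: exI[of _ "norm x"] exI[of _ "x /\<^sub>R norm x"])
  qed
qed (auto simp: star_domain_def)

text \<open>For functions on the sphere, the norm of the differential at \<open>z\<close> is computed from the
  extension that is constant on rays: its derivative at \<open>z\<close> vanishes in the radial direction and
  is the intrinsic differential on the tangent space of the sphere.\<close>

definition C1_dist_sphere :: "(complex ^ 'n \<Rightarrow> real) \<Rightarrow> (complex ^ 'n \<Rightarrow> real) \<Rightarrow> real" where
  "C1_dist_sphere f g =
     (SUP z \<in> sphere 0 1. \<bar>f z - g z\<bar>) +
     (SUP z \<in> sphere 0 1. onorm (frechet_derivative
        (\<lambda>w. f (w /\<^sub>R norm w) - g (w /\<^sub>R norm w)) (at z)))"

definition C1_dist :: "(complex ^ 'n) set \<Rightarrow> (complex ^ 'n) set \<Rightarrow> real" where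
  "C1_dist A A' = C1_dist_sphere (radial_fun A) (radial_fun A')"

definition smooth_family :: "real set \<Rightarrow> (real \<Rightarrow> (complex ^ 'n) set) \<Rightarrow> bool" where
  "smooth_family I A \<longleftrightarrow> (\<forall>l\<in>I. A l \<in> star_domains) \<and>
     smooth_on (\<lambda>(l, z). radial_fun (A l) z) (I \<times> sphere 0 1)"

text \<open>Tangent vectors of a submanifold \<open>M\<close> are the velocities of smooth curves in \<open>M\<close>.\<close>

definition tangent_space :: "'a::euclidean_space set \<Rightarrow> 'a \<Rightarrow> 'a set" where
  "tangent_space M z = {v. \<exists>c e. (0::real) < e \<and> smooth_on c {-e<..<e} \<and>
     c ` {-e<..<e} \<subseteq> M \<and> c 0 = z \<and> (c has_vector_derivative v) (at 0)}"

definition char_line :: "(complex ^ 'n) set \<Rightarrow> complex ^ 'n \<Rightarrow> (complex ^ 'n) set" where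
  "char_line M z = {u \<in> tangent_space M z. \<forall>v \<in> tangent_space M z. symp_form u v = 0}"

text \<open>A closed leaf is given by a regular periodic parametrization \<open>\<gamma>\<close> with minimal period \<open>T\<close>.
  Positivity of the primitive on the velocity makes \<open>\<gamma>\<close> run in the direction of the Reeb vector
  field, and entails that the velocity does not vanish.\<close>

definition closed_characteristic ::
    "(complex ^ 'n) set \<Rightarrow> real \<Rightarrow> (real \<Rightarrow> complex ^ 'n) \<Rightarrow> bool" where
  "closed_characteristic A T \<gamma> \<longleftrightarrow>
     0 < T \<and> smooth_on \<gamma> UNIV \<and> (\<forall>t. \<gamma> (t + T) = \<gamma> t) \<and> inj_on \<gamma> {0..<T} \<and>
     range \<gamma> \<subseteq> frontier A \<and>
     (\<forall>t. vector_derivative \<gamma> (at t) \<in> char_line (frontier A) (\<gamma> t) \<and>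
          0 < liouville_form (\<gamma> t) (vector_derivative \<gamma> (at t)))"

definition action :: "real \<Rightarrow> (real \<Rightarrow> complex ^ 'n) \<Rightarrow> real" where
  "action T \<gamma> = integral {0..T} (\<lambda>t. liouville_form (\<gamma> t) (vector_derivative \<gamma> (at t)))"

text \<open>\<open>Least\<close> is the minimum, not the infimum; it is meaningful for \<open>A \<in> star_domains\<close>, where
  closed characteristics exist and the least action is attained.\<close>

definition sys :: "(complex ^ 'n) set \<Rightarrow> real" where
  "sys A = (LEAST a. \<exists>T \<gamma>. closed_characteristic A T \<gamma> \<and> a = action T \<gamma>)"

end

theory Submission
  imports Defs "HOL-Complex_Analysis.Great_Picard"
begin

text \<open>\<open>A l\<close> is the set \<open>F < 1\<close> with \<open>F z = (norm z)\<^sup>2 / U z\<close> and \<open>U\<close> constant on rays: the unit sphere is pushed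
  outwards by order \<open>l\<^sup>2\<close> on a tube of width \<open>l\<close> around half of a Hopf circle, and inwards by order \<open>M l\<^sup>2\<close> on a
  tube of width a small constant times \<open>l\<close> around the opposite half of a Hopf circle at distance of order \<open>l\<close>
  from the first one. Away from the tubes the characteristics are Hopf circles, of action \<open>\<pi>\<close>. The
  outer tube slows the Reeb flow down; a shorter orbit would have to traverse the core of the inner tube
  once per turn, and it cannot, because the passage through the outer tube rotates it around the first
  Hopf circle by an angle bounded below. So the systole is \<open>\<pi>\<close>, whereas for \<open>M\<close> large the volume, hence the
  ball capacity, is smaller than that of the unit ball.

  As no closed characteristic has action less than \<open>\<pi>\<close>, the cylindrical capacity is at least \<open>\<pi>\<close> by
  the argument of Hofer and Zehnder: a Hamiltonian that is a slow function of \<open>F\<close> near the image of the domain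
  and quadratic at infinity has a periodic orbit of positive action. That orbit is obtained as a limit
  of critical points of finite-dimensional discretizations of the action functional, which a linking argument provides.\<close>

section \<open>Linking\<close>

text \<open>A tube of width l and height of order l^2 has gradient of order l but second derivatives
  of order 1, so the domains converge to the ball in C^1 and not in C^2. Added and removed volume
  are both of order l^2 times l^(2n-2), where n is the complex dimension; their comparison does not
  depend on l, and a fixed \<open>M\<close> decides it. The obstacle is that a dent alone lowers the
  systole: on its axis the flow is faster than the Hopf flow. The outward tube is there to spoil
  this. Its axis and that of the dent are only \<open>\<tau>\<close> = l / 2 apart, so an orbit that
  meets the dent also runs through the outward tube, where its transverse coordinate turns relative
  to the axial one by at least \<open>alp0\<close>, whatever l is. The dent is made so thin, by the
  factor \<open>del0\<close>, that an orbit cannot be near its axis both before and after this turn,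
  and \<open>M\<close> is then chosen large enough to pay for the lost width. Each bump covers less
  than half of a Hopf circle, so that an orbit feels one of them at a time and its distance from the
  axis of the active one is conserved.\<close>

lemma compact_fun_box:
  fixes lo hi :: "'i \<Rightarrow> real"
  shows "compact {x. (\<forall>j\<in>I. lo j \<le> x j \<and> x j \<le> hi j) \<and> (\<forall>j. j \<notin> I \<longrightarrow> x j = 0)}"
proof -
  have "compactin (product_topology (\<lambda>_. euclidean) (UNIV :: 'i set))
      (PiE UNIV (\<lambda>j. if j \<in> I then {lo j..hi j} else {0}))"
    by (subst compactin_PiE) auto
  moreover have "PiE UNIV (\<lambda>j. if j \<in> I then {lo j..hi j} else {0}) =
      {x. (\<forall>j\<in>I. lo j \<le> x j \<and> x j \<le> hi j) \<and> (\<forall>j. j \<notin> I \<longrightarrow> x j = 0)}"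
    by (fastforce simp: PiE_iff split: if_splits)
  ultimately show ?thesis
    by (simp add: euclidean_product_topology)
qed

lemma fun_tendsto_iff:
  fixes X :: "'b \<Rightarrow> 'a \<Rightarrow> 'c::topological_space"
  shows "(X \<longlongrightarrow> x) F \<longleftrightarrow> (\<forall>j. ((\<lambda>p. X p j) \<longlongrightarrow> x j) F)"
  using limitin_componentwise[of "\<lambda>_::'a. euclidean :: 'c topology" UNIV X x F]
  by (simp add: euclidean_product_topology)

lemma poincare_miranda_nat:
  fixes g :: "(nat \<Rightarrow> real) \<Rightarrow> nat \<Rightarrow> real"
  assumes cont: "\<And>i. i < n \<Longrightarrow> continuous_on UNIV (\<lambda>x. g x i)"
    and lo: "\<And>x i. i < n \<Longrightarrow> \<forall>j<n. 0 \<le> x j \<and> x j \<le> 1 \<Longrightarrow> \<forall>j\<ge>n. x j = 0 \<Longrightarrow> x i = 0 \<Longrightarrow> g x i \<le> 0"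
    and hi: "\<And>x i. i < n \<Longrightarrow> \<forall>j<n. 0 \<le> x j \<and> x j \<le> 1 \<Longrightarrow> \<forall>j\<ge>n. x j = 0 \<Longrightarrow> x i = 1 \<Longrightarrow> g x i \<ge> 0"
  shows "\<exists>x. (\<forall>j<n. 0 \<le> x j \<and> x j \<le> 1) \<and> (\<forall>j\<ge>n. x j = 0) \<and> (\<forall>i<n. g x i = 0)"
proof -
  define sc where "sc p r = (\<lambda>j. if j < n then real (r j) / real p else 0)" for p and r :: "nat \<Rightarrow> nat"
  \<comment> \<open>On the two faces the label is forced, as Kuhn's lemma demands; the hypotheses
    \<open>lo\<close> and \<open>hi\<close> make it agree there with a weak sign of
    \<open>g\<close>.\<close>
  define lab where "lab p r i = (if r i = 0 then 0 else if r i = p then 1 else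
      if g (sc p r) i \<le> 0 then 0 else (1::nat))" for p and r :: "nat \<Rightarrow> nat" and i
  have ex: "\<exists>q. (\<forall>i<n. q i < p) \<and> (\<forall>i<n. \<exists>r s. (\<forall>j<n. q j \<le> r j \<and> r j \<le> q j + 1) \<and>
      (\<forall>j<n. q j \<le> s j \<and> s j \<le> q j + 1) \<and> g (sc p r) i \<le> 0 \<and> g (sc p s) i \<ge> 0)"
    if p: "0 < p" for p
  proof -
    obtain q where q1: "\<forall>i<n. q i < p"
      and q2: "\<forall>i<n. \<exists>r s. (\<forall>j<n. q j \<le> r j \<and> r j \<le> q j + 1) \<and>
        (\<forall>j<n. q j \<le> s j \<and> s j \<le> q j + 1) \<and> lab p r i \<noteq> lab p s i"
      by (rule kuhn_lemma[of p n "lab p"]) (use p in \<open>auto simp: lab_def\<close>)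
    have lab0: "g (sc p r) i \<le> 0" if "lab p r i = 0" "i < n" "\<forall>j<n. q j \<le> r j \<and> r j \<le> q j + 1" for r i
    proof (cases "r i = 0")
      case True
      show ?thesis
      proof (rule lo[OF \<open>i < n\<close>])
        show "\<forall>j<n. 0 \<le> sc p r j \<and> sc p r j \<le> 1"
        proof (intro allI impI)
          fix j assume "j < n"
          then have "r j \<le> p" using that(3) q1 by (metis Suc_eq_plus1 Suc_leI le_trans)
          then show "0 \<le> sc p r j \<and> sc p r j \<le> 1" using p \<open>j < n\<close> by (auto simp: sc_def)
        qed
      qed (use True in \<open>auto simp: sc_def\<close>)
    next
      case False
      then show ?thesis using that by (auto simp: lab_def split: if_splits)
    qed
    have lab1: "g (sc p r) i \<ge> 0" if "lab p r i \<noteq> 0" "i < n" "\<forall>j<n. q j \<le> r j \<and> r j \<le> q j + 1" for r i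
    proof (cases "r i = p")
      case True
      show ?thesis
      proof (rule hi[OF \<open>i < n\<close>])
        show "\<forall>j<n. 0 \<le> sc p r j \<and> sc p r j \<le> 1"
        proof (intro allI impI)
          fix j assume "j < n"
          then have "r j \<le> p" using that(3) q1 by (metis Suc_eq_plus1 Suc_leI le_trans)
          then show "0 \<le> sc p r j \<and> sc p r j \<le> 1" using p \<open>j < n\<close> by (auto simp: sc_def)
        qed
      qed (use True p that in \<open>auto simp: sc_def\<close>)
    next
      case False
      then show ?thesis using that by (auto simp: lab_def split: if_splits)
    qed
    have "\<exists>r s. (\<forall>j<n. q j \<le> r j \<and> r j \<le> q j + 1) \<and>
      (\<forall>j<n. q j \<le> s j \<and> s j \<le> q j + 1) \<and> g (sc p r) i \<le> 0 \<and> g (sc p s) i \<ge> 0" if i: "i < n" for i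
    proof -
      obtain r s where rs: "\<forall>j<n. q j \<le> r j \<and> r j \<le> q j + 1"
        "\<forall>j<n. q j \<le> s j \<and> s j \<le> q j + 1" "lab p r i \<noteq> lab p s i"
        using q2 i by metis
      show ?thesis
      proof (cases "lab p r i = 0")
        case True
        then have "lab p s i \<noteq> 0" using rs by simp
        with True rs lab0 lab1 i show ?thesis by blast
      next
        case False
        then have "lab p s i = 0" using rs(3) by (auto simp: lab_def split: if_splits)
        with False rs lab0 lab1 i show ?thesis by blast
      qed
    qed
    with q1 show ?thesis by blast
  qed
  then obtain q where q1: "\<And>p i. i < n \<Longrightarrow> q p i \<le> p" and
    q2: "\<And>p i. i < n \<Longrightarrow> \<exists>r s. (\<forall>j<n. q p j \<le> r j \<and> r j \<le> q p j + 1) \<and>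
      (\<forall>j<n. q p j \<le> s j \<and> s j \<le> q p j + 1) \<and> g (sc (Suc p) r) i \<le> 0 \<and> g (sc (Suc p) s) i \<ge> 0"
  proof -
    have "\<forall>p. \<exists>q. (\<forall>i<n. q i < Suc p) \<and> (\<forall>i<n. \<exists>r s. (\<forall>j<n. q j \<le> r j \<and> r j \<le> q j + 1) \<and>
      (\<forall>j<n. q j \<le> s j \<and> s j \<le> q j + 1) \<and> g (sc (Suc p) r) i \<le> 0 \<and> g (sc (Suc p) s) i \<ge> 0)"
      using ex by blast
    then obtain q where "\<forall>p. (\<forall>i<n. q p i < Suc p) \<and> (\<forall>i<n. \<exists>r s. (\<forall>j<n. q p j \<le> r j \<and> r j \<le> q p j + 1) \<and>
      (\<forall>j<n. q p j \<le> s j \<and> s j \<le> q p j + 1) \<and> g (sc (Suc p) r) i \<le> 0 \<and> g (sc (Suc p) s) i \<ge> 0)"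
      by metis
    then show ?thesis using that by (metis less_Suc_eq_le)
  qed
  let ?K = "{x :: nat \<Rightarrow> real. (\<forall>j<n. 0 \<le> x j \<and> x j \<le> 1) \<and> (\<forall>j\<ge>n. x j = 0)}"
  define X where "X p = sc (Suc p) (q p)" for p
  have XK: "X p \<in> ?K" for p
  proof -
    have "real (q p j) \<le> real (Suc p)" if "j < n" for j
      using q1[OF that, of p] by (simp only: of_nat_le_iff)
    then show ?thesis by (auto simp: X_def sc_def divide_le_eq_1)
  qed
  have "seq_compact ?K"
    using compact_imp_seq_compact[OF compact_fun_box[of "{..<n}" "\<lambda>_. 0" "\<lambda>_. 1"]]
    by (simp add: Ball_def not_less)
  then obtain x \<rho> where x: "x \<in> ?K" and \<rho>: "strict_mono \<rho>" and lim: "(X \<circ> \<rho>) \<longlonglongrightarrow> x"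
    using seq_compactE[of ?K X] XK by blast
  have limj: "(\<lambda>p. X (\<rho> p) j) \<longlonglongrightarrow> x j" for j
    using lim by (simp add: fun_tendsto_iff o_def)
  \<comment> \<open>For each coordinate two vertices of a common small cube carry opposite weak
    signs of \<open>g\<close>. All vertices of these cubes tend to the same limit \<open>x\<close>,
    which forces \<open>g x i = 0\<close>.\<close>
  have near: "(\<lambda>p. sc (Suc (\<rho> p)) (r p)) \<longlonglongrightarrow> x"
    if r: "\<And>p. \<forall>j<n. q (\<rho> p) j \<le> r p j \<and> r p j \<le> q (\<rho> p) j + 1" for r
  proof -
    have "(\<lambda>p. sc (Suc (\<rho> p)) (r p) j) \<longlonglongrightarrow> x j" for j
    proof -
      have inv0: "(\<lambda>p. 1 / real (Suc (\<rho> p))) \<longlonglongrightarrow> 0"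
        using LIMSEQ_subseq_LIMSEQ[OF LIMSEQ_inverse_real_of_nat \<rho>]
        by (simp add: o_def inverse_eq_divide)
      have "(\<lambda>p. sc (Suc (\<rho> p)) (r p) j - X (\<rho> p) j) \<longlonglongrightarrow> 0"
      proof (rule Lim_null_comparison[OF _ inv0], rule always_eventually, rule allI)
        fix p
        show "norm (sc (Suc (\<rho> p)) (r p) j - X (\<rho> p) j) \<le> 1 / real (Suc (\<rho> p))"
        proof (cases "j < n")
          case True
          then have 1: "real (r p j) - real (q (\<rho> p) j) \<le> 1" "real (q (\<rho> p) j) \<le> real (r p j)"
            using r[of p] by (auto simp: of_nat_diff)
          have "sc (Suc (\<rho> p)) (r p) j - X (\<rho> p) j = (real (r p j) - real (q (\<rho> p) j)) / real (Suc (\<rho> p))"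
            using True by (simp add: sc_def X_def diff_divide_distrib)
          then show ?thesis using 1 by (simp add: divide_right_mono)
        qed (simp add: sc_def X_def)
      qed
      from tendsto_add[OF this limj[of j]] show ?thesis by simp
    qed
    then show ?thesis by (simp add: fun_tendsto_iff)
  qed
  have "g x i = 0" if i: "i < n" for i
  proof -
    obtain r s where r: "\<And>p. \<forall>j<n. q (\<rho> p) j \<le> r p j \<and> r p j \<le> q (\<rho> p) j + 1"
      and s: "\<And>p. \<forall>j<n. q (\<rho> p) j \<le> s p j \<and> s p j \<le> q (\<rho> p) j + 1"
      and gr: "\<And>p. g (sc (Suc (\<rho> p)) (r p)) i \<le> 0" and gs: "\<And>p. g (sc (Suc (\<rho> p)) (s p)) i \<ge> 0"
    proof -
      have "\<forall>p. \<exists>rs. (\<forall>j<n. q (\<rho> p) j \<le> fst rs j \<and> fst rs j \<le> q (\<rho> p) j + 1) \<and>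
          (\<forall>j<n. q (\<rho> p) j \<le> snd rs j \<and> snd rs j \<le> q (\<rho> p) j + 1) \<and>
          g (sc (Suc (\<rho> p)) (fst rs)) i \<le> 0 \<and> 0 \<le> g (sc (Suc (\<rho> p)) (snd rs)) i"
      proof
        fix p
        obtain r s where "\<forall>j<n. q (\<rho> p) j \<le> r j \<and> r j \<le> q (\<rho> p) j + 1"
          "\<forall>j<n. q (\<rho> p) j \<le> s j \<and> s j \<le> q (\<rho> p) j + 1"
          "g (sc (Suc (\<rho> p)) r) i \<le> 0" "0 \<le> g (sc (Suc (\<rho> p)) s) i"
          using q2[OF i, of "\<rho> p"] by blast
        then show "\<exists>rs. (\<forall>j<n. q (\<rho> p) j \<le> fst rs j \<and> fst rs j \<le> q (\<rho> p) j + 1) \<and>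
          (\<forall>j<n. q (\<rho> p) j \<le> snd rs j \<and> snd rs j \<le> q (\<rho> p) j + 1) \<and>
          g (sc (Suc (\<rho> p)) (fst rs)) i \<le> 0 \<and> 0 \<le> g (sc (Suc (\<rho> p)) (snd rs)) i"
          by (intro exI[of _ "(r, s)"]) simp
      qed
      from choice[OF this] obtain f where f: "\<forall>p. (\<forall>j<n. q (\<rho> p) j \<le> fst (f p) j \<and> fst (f p) j \<le> q (\<rho> p) j + 1) \<and>
          (\<forall>j<n. q (\<rho> p) j \<le> snd (f p) j \<and> snd (f p) j \<le> q (\<rho> p) j + 1) \<and>
          g (sc (Suc (\<rho> p)) (fst (f p))) i \<le> 0 \<and> 0 \<le> g (sc (Suc (\<rho> p)) (snd (f p))) i"
        by (rule exE)
      show ?thesis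
        using f by (intro that[of "\<lambda>p. fst (f p)" "\<lambda>p. snd (f p)"]; blast)
    qed
    have c: "isCont (\<lambda>x. g x i) x"
      using cont[OF i] by (simp add: continuous_on_eq_continuous_at)
    have "g x i \<le> 0"
      using isCont_tendsto_compose[OF c near[OF r]] gr by (intro LIMSEQ_le_const2) auto
    moreover have "g x i \<ge> 0"
      using isCont_tendsto_compose[OF c near[OF s]] gs by (intro LIMSEQ_le_const) auto
    ultimately show ?thesis by simp
  qed
  with x show ?thesis by blast
qed

text \<open>The box is indexed by a finite subset of an arbitrary type, the other coordinates being
  pinned at 0: the dimension of the Galerkin spaces below grows with the number of modes, so it
  cannot be part of a type.\<close>

lemma poincare_miranda:
  fixes g :: "('i \<Rightarrow> real) \<Rightarrow> 'i \<Rightarrow> real" and lo hi :: "'i \<Rightarrow> real"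
  assumes "finite I" and lh: "\<And>i. i \<in> I \<Longrightarrow> lo i < hi i"
    and cont: "\<And>i. i \<in> I \<Longrightarrow> continuous_on UNIV (\<lambda>x. g x i)"
    and lo: "\<And>x i. i \<in> I \<Longrightarrow> \<forall>j\<in>I. lo j \<le> x j \<and> x j \<le> hi j \<Longrightarrow> \<forall>j. j \<notin> I \<longrightarrow> x j = 0 \<Longrightarrow> x i = lo i \<Longrightarrow> g x i \<le> 0"
    and hi: "\<And>x i. i \<in> I \<Longrightarrow> \<forall>j\<in>I. lo j \<le> x j \<and> x j \<le> hi j \<Longrightarrow> \<forall>j. j \<notin> I \<longrightarrow> x j = 0 \<Longrightarrow> x i = hi i \<Longrightarrow> g x i \<ge> 0"
  shows "\<exists>x. (\<forall>j\<in>I. lo j \<le> x j \<and> x j \<le> hi j) \<and> (\<forall>j. j \<notin> I \<longrightarrow> x j = 0) \<and> (\<forall>i\<in>I. g x i = 0)"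
proof -
  obtain e where e: "bij_betw e {0..<card I} I"
    using ex_bij_betw_nat_finite[OF \<open>finite I\<close>] by blast
  define e' where "e' = inv_into {0..<card I} e"
  have e1: "e' (e k) = k" if "k < card I" for k
    using e that by (simp add: e'_def bij_betw_inv_into_left)
  have e2: "e (e' j) = j" "e' j < card I" if "j \<in> I" for j
    using e that bij_betwE[OF bij_betw_inv_into[OF e]] by (auto simp: e'_def bij_betw_inv_into_right)
  have e3: "e k \<in> I" if "k < card I" for k
    using e that by (auto dest: bij_betwE)
  define E where "E y = (\<lambda>j. if j \<in> I then lo j + (hi j - lo j) * y (e' j) else 0)" for y :: "nat \<Rightarrow> real"
  have contE: "continuous_on UNIV E"
  proof (rule continuous_on_coordinatewise_then_product)
    fix j
    show "continuous_on UNIV (\<lambda>x. E x j)"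
    proof (cases "j \<in> I")
      case True
      then show ?thesis
        by (auto simp: E_def intro!: continuous_intros)
    qed (simp add: E_def)
  qed
  have EB: "(\<forall>j\<in>I. lo j \<le> E y j \<and> E y j \<le> hi j) \<and> (\<forall>j. j \<notin> I \<longrightarrow> E y j = 0)"
    if "\<forall>j<card I. 0 \<le> y j \<and> y j \<le> 1" for y
  proof -
    have "lo j \<le> E y j \<and> E y j \<le> hi j" if "j \<in> I" for j
    proof -
      have y01: "0 \<le> y (e' j)" "y (e' j) \<le> 1" using \<open>\<forall>j<card I. _ j\<close> e2 that by auto
      have "(hi j - lo j) * y (e' j) \<le> (hi j - lo j) * 1" "0 \<le> (hi j - lo j) * y (e' j)"
        using lh[OF that] y01 by (intro mult_left_mono mult_nonneg_nonneg; simp)+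
      then show ?thesis using that by (auto simp: E_def)
    qed
    then show ?thesis by (auto simp: E_def)
  qed
  have "\<exists>y. (\<forall>j<card I. 0 \<le> y j \<and> y j \<le> 1) \<and> (\<forall>j\<ge>card I. y j = 0) \<and> (\<forall>k<card I. g (E y) (e k) = 0)"
  proof (rule poincare_miranda_nat)
    fix k assume k: "k < card I"
    show "continuous_on UNIV (\<lambda>x. g (E x) (e k))"
      using continuous_on_compose2[OF cont[OF e3[OF k]] contE] by auto
  next
    fix x k assume k: "k < card I" and x: "\<forall>j<card I. 0 \<le> x j \<and> x j \<le> 1" and "x k = (0::real)"
    then show "g (E x) (e k) \<le> 0"
      using EB[OF x] by (intro lo) (auto simp: e3 E_def e1)
  next
    fix x k assume k: "k < card I" and x: "\<forall>j<card I. 0 \<le> x j \<and> x j \<le> 1" and "x k = (1::real)"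
    then show "g (E x) (e k) \<ge> 0"
      using EB[OF x] by (intro hi) (auto simp: e3 E_def e1)
  qed
  then obtain y where y: "\<forall>j<card I. 0 \<le> y j \<and> y j \<le> 1" "\<forall>k<card I. g (E y) (e k) = 0" by blast
  show ?thesis
    using EB[OF y(1)] y(2) e2 by (intro exI[of _ "E y"]) metis
qed

lemma continuous_on_funpow:
  fixes f :: "'a::topological_space \<Rightarrow> 'a"
  assumes "continuous_on UNIV f"
  shows "continuous_on UNIV (f ^^ k)"
proof (induction k)
  case (Suc k)
  then show ?case
    using continuous_on_compose2[OF assms Suc] by (simp add: o_def)
qed (simp add: id_def)

text \<open>The negative gradient flow is replaced by iterates of a cut-off gradient descent step, which is
  the identity where \<open>\<Phi> \<le> \<beta> / 2\<close>; no differential equation has to be solved.\<close>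

lemma linking:
  fixes \<Phi> :: "('i \<Rightarrow> real) \<Rightarrow> real" and G :: "('i \<Rightarrow> real) \<Rightarrow> 'i \<Rightarrow> real"
  assumes fin: "finite I" and W: "W \<subseteq> I" and e: "e \<in> I" "e \<notin> W"
    and w: "\<And>i. i \<in> I - W \<Longrightarrow> 0 < w i" and we: "w e = 1"
    and contP: "continuous_on UNIV \<Phi>"
    and contG: "\<And>i. i \<in> I \<Longrightarrow> continuous_on UNIV (\<lambda>x. G x i)"
    and der: "\<And>x v t. ((\<lambda>t. \<Phi> (\<lambda>i. x i + t * v i)) has_real_derivative
      (\<Sum>i\<in>I. G (\<lambda>i. x i + t * v i) i * v i)) (at t)"
    and unif: "\<And>\<epsilon>. 0 < \<epsilon> \<Longrightarrow> \<exists>d>0. \<forall>x y. L2_set (\<lambda>i. x i - y i) I < d \<longrightarrow>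
      L2_set (\<lambda>i. G x i - G y i) I < \<epsilon>"
    and ab: "0 < \<alpha>" "\<alpha> < R" "0 < \<beta>" "0 < \<delta>"
    and Gam: "\<And>x. (\<And>i. i \<notin> I - W \<Longrightarrow> x i = 0) \<Longrightarrow> (\<Sum>i\<in>I - W. w i * (x i)\<^sup>2) = \<alpha>\<^sup>2 \<Longrightarrow> \<beta> \<le> \<Phi> x"
    and bdry: "\<And>x. (\<And>i. i \<notin> insert e W \<Longrightarrow> x i = 0) \<Longrightarrow> (\<And>i. i \<in> W \<Longrightarrow> \<bar>x i\<bar> \<le> R) \<Longrightarrow>
      0 \<le> x e \<Longrightarrow> x e \<le> R \<Longrightarrow> x e = 0 \<or> x e = R \<or> (\<exists>i\<in>W. \<bar>x i\<bar> = R) \<Longrightarrow> \<Phi> x \<le> 0"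
  shows "\<exists>x. (\<forall>i. i \<notin> I \<longrightarrow> x i = 0) \<and> \<beta> / 2 < \<Phi> x \<and> L2_set (G x) I \<le> \<delta>"
proof (rule ccontr)
  assume "\<not> ?thesis"
  then have noncrit: "\<delta> < L2_set (G x) I" if "\<And>i. i \<notin> I \<Longrightarrow> x i = 0" "\<beta> / 2 < \<Phi> x" for x
    using that by (meson not_le)
  \<comment> \<open>Zero up to \<beta> / 2, so that the step fixes the boundary of the box, where
    \<Phi> \<le> 0; one from 3 \<beta> / 4 on, so that above level \<beta> every step loses a fixed
    amount.\<close>
  define ch where "ch s = max 0 (min 1 ((s - \<beta> / 2) / (\<beta> / 4)))" for s :: real
  have ch01: "0 \<le> ch s" "ch s \<le> 1" for s by (auto simp: ch_def)
  have ch0: "ch s = 0" if "s \<le> \<beta> / 2" for s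
  proof -
    have "(s - \<beta> / 2) / (\<beta> / 4) \<le> 0"
      using that ab by (intro divide_nonpos_pos) auto
    then show ?thesis by (simp add: ch_def)
  qed
  have ch1: "ch s = 1" if "s \<ge> \<beta>" for s
    using that ab by (auto simp: ch_def max_def min_def divide_simps)
  define n where "n x = L2_set (G x) I" for x
  \<comment> \<open>Dividing by the maximum keeps the field continuous and of length at most 1 where
    the gradient is small. Where the cut-off is positive, the assumption that there is no almost
    critical point makes the divisor equal to \<open>n x\<close>.\<close>
  define v where "v x i = (if i \<in> I then ch (\<Phi> x) * G x i / max \<delta> (n x) else 0)" for x i
  obtain d where d: "d > 0" and dG: "\<And>x y. L2_set (\<lambda>i. x i - y i) I < d \<Longrightarrow>
      L2_set (\<lambda>i. G x i - G y i) I < \<delta> / 2"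
    using unif[of "\<delta> / 2"] ab by auto
  \<comment> \<open>Within this distance the gradient varies by less than \<delta> / 2, so a full
    step keeps at least half of the first order descent.\<close>
  define \<tau> where "\<tau> = d / 2"
  have \<tau>: "0 < \<tau>" "\<tau> < d" using d by (auto simp: \<tau>_def)
  define S where "S x i = x i - \<tau> * v x i" for x i
  have contS: "continuous_on UNIV S"
  proof (rule continuous_on_coordinatewise_then_product)
    fix i
    have cn: "continuous_on UNIV n"
      unfolding n_def L2_set_def by (intro continuous_intros contG)
    have cc: "continuous_on UNIV (\<lambda>x. ch (\<Phi> x))"
      unfolding ch_def using ab by (intro continuous_intros contP) auto
    show "continuous_on UNIV (\<lambda>x. S x i)"
    proof (cases "i \<in> I")
      case True
      then show ?thesis
        unfolding S_def v_def using ab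
        by (auto intro!: continuous_intros contG cc cn)
    qed (simp add: S_def v_def)
  qed
  have supS: "S x i = 0" if "\<And>i. i \<notin> I \<Longrightarrow> x i = 0" "i \<notin> I" for x i
    using that by (simp add: S_def v_def)
  have L2v: "L2_set (v x) I = ch (\<Phi> x) * n x / max \<delta> (n x)" for x
  proof -
    have "L2_set (v x) I = L2_set (\<lambda>i. (ch (\<Phi> x) / max \<delta> (n x)) * G x i) I"
      by (rule L2_set_cong) (auto simp: v_def)
    also have "\<dots> = (ch (\<Phi> x) / max \<delta> (n x)) * n x"
      using ch01 ab unfolding n_def by (subst L2_set_right_distrib) auto
    finally show ?thesis by simp
  qed
  have S_id: "S x = x" if "\<Phi> x \<le> \<beta> / 2" for x
    using ch0[OF that] by (auto simp: S_def v_def)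
  have desc: "\<Phi> (S x) \<le> \<Phi> x - \<tau> * (ch (\<Phi> x) * \<delta> / 2)" if x: "\<And>i. i \<notin> I \<Longrightarrow> x i = 0" for x
  proof (cases "\<Phi> x \<le> \<beta> / 2")
    case True
    then show ?thesis using S_id ch0 by simp
  next
    case False
    then have n: "\<delta> < n x" using noncrit[of x] x by (auto simp: n_def)
    then have L2v': "L2_set (v x) I = ch (\<Phi> x)" using ab L2v[of x] by simp
    let ?\<phi> = "\<lambda>t. \<Phi> (\<lambda>i. x i + t * (- v x i))"
    obtain t where t: "0 < t" "t < \<tau>" and mvt: "?\<phi> \<tau> - ?\<phi> 0 = (\<tau> - 0) *
        (\<Sum>i\<in>I. G (\<lambda>i. x i + t * (- v x i)) i * (- v x i))"
      using MVT2[OF \<tau>(1), of ?\<phi> "\<lambda>t. \<Sum>i\<in>I. G (\<lambda>i. x i + t * (- v x i)) i * (- v x i)",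
          OF der[of x "\<lambda>i. - v x i"]] by blast
    define y where "y = (\<lambda>i. x i + t * (- v x i))"
    have "L2_set (\<lambda>i. y i - x i) I = t * ch (\<Phi> x)"
    proof -
      have "L2_set (\<lambda>i. y i - x i) I = L2_set (\<lambda>i. t * v x i) I"
        unfolding L2_set_def y_def by (simp add: power2_eq_square)
      also have "\<dots> = t * L2_set (v x) I" using t by (subst L2_set_right_distrib) auto
      finally show ?thesis using L2v' by simp
    qed
    also have "\<dots> \<le> t * 1" using t ch01 by (intro mult_left_mono) auto
    finally have "L2_set (\<lambda>i. y i - x i) I < d" using t \<tau> by simp
    then have Gy: "L2_set (\<lambda>i. G y i - G x i) I < \<delta> / 2" by (rule dG)
    have "\<bar>\<Sum>i\<in>I. (G y i - G x i) * v x i\<bar> \<le> (\<Sum>i\<in>I. \<bar>G y i - G x i\<bar> * \<bar>v x i\<bar>)"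
      by (rule order_trans[OF sum_abs]) (simp add: abs_mult)
    also have "\<dots> \<le> L2_set (\<lambda>i. G y i - G x i) I * L2_set (v x) I" by (rule L2_set_mult_ineq)
    also have "\<dots> \<le> \<delta> / 2 * ch (\<Phi> x)"
      unfolding L2v' using Gy ch01 by (intro mult_right_mono) auto
    finally have 1: "\<bar>\<Sum>i\<in>I. (G y i - G x i) * v x i\<bar> \<le> \<delta> / 2 * ch (\<Phi> x)" .
    have 2: "(\<Sum>i\<in>I. G x i * v x i) = ch (\<Phi> x) * n x"
    proof -
      have "(\<Sum>i\<in>I. G x i * v x i) = (\<Sum>i\<in>I. ch (\<Phi> x) / n x * (G x i)\<^sup>2)"
        using n by (intro sum.cong) (auto simp: v_def power2_eq_square)
      also have "\<dots> = ch (\<Phi> x) / n x * (n x)\<^sup>2"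
        unfolding n_def L2_set_def by (simp add: sum_distrib_left sum_nonneg)
      finally show ?thesis using n ab by (simp add: power2_eq_square)
    qed
    have "(\<Sum>i\<in>I. G y i * v x i) = (\<Sum>i\<in>I. G x i * v x i) + (\<Sum>i\<in>I. (G y i - G x i) * v x i)"
      by (simp add: left_diff_distrib sum_subtractf)
    moreover have "ch (\<Phi> x) * n x \<ge> ch (\<Phi> x) * \<delta>" using n ch01 by (intro mult_left_mono) auto
    moreover have "- (ch (\<Phi> x) * \<delta> / 2) \<le> (\<Sum>i\<in>I. (G y i - G x i) * v x i)"
      using 1 by (simp add: abs_le_iff mult.commute)
    ultimately have "(\<Sum>i\<in>I. G y i * v x i) \<ge> ch (\<Phi> x) * \<delta> / 2" using 2 by linarith
    then have "\<tau> * (\<Sum>i\<in>I. G y i * v x i) \<ge> \<tau> * (ch (\<Phi> x) * \<delta> / 2)"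
      using \<tau> by (intro mult_left_mono) auto
    moreover have "\<Phi> (S x) - \<Phi> x = - (\<tau> * (\<Sum>i\<in>I. G y i * v x i))"
    proof -
      have "S x = (\<lambda>i. x i + \<tau> * - v x i)" by (simp add: S_def fun_eq_iff)
      then show ?thesis using mvt by (simp add: y_def sum_negf algebra_simps)
    qed
    ultimately show ?thesis by simp
  qed
  define B where "B = {x. (\<forall>j\<in>insert e W. (if j = e then 0 else - R) \<le> x j \<and> x j \<le> R) \<and>
    (\<forall>j. j \<notin> insert e W \<longrightarrow> x j = 0)}"
  have "compact B" unfolding B_def by (rule compact_fun_box)
  then have "bdd_above (\<Phi> ` B)"
    by (intro bounded_imp_bdd_above compact_imp_bounded compact_continuous_image
        continuous_on_subset[OF contP subset_UNIV])
  then obtain C where C: "\<And>x. x \<in> B \<Longrightarrow> \<Phi> x \<le> C" by (auto simp: bdd_above_def)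
  \<comment> \<open>Enough steps to bring the maximum \<open>C\<close> of \<Phi> on the box below
    \<beta>.\<close>
  obtain k :: nat where k: "C - \<beta> < real k * (\<tau> * \<delta> / 2)"
  proof -
    have "0 < \<tau> * \<delta> / 2" using \<tau> ab by simp
    from reals_Archimedean3[OF this] show ?thesis using that by blast
  qed
  have supk: "(S ^^ m) x i = 0" if "\<And>i. i \<notin> I \<Longrightarrow> x i = 0" "i \<notin> I" for x i m
    using that(2) by (induction m arbitrary: i) (auto simp: that(1) supS)
  have iter: "\<Phi> ((S ^^ m) x) < \<beta> \<or> \<Phi> ((S ^^ m) x) \<le> \<Phi> x - real m * (\<tau> * \<delta> / 2)"
    if x: "\<And>i. i \<notin> I \<Longrightarrow> x i = 0" for x m
  proof (induction m)
    case (Suc m)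
    let ?y = "(S ^^ m) x"
    have dsc: "\<Phi> (S ?y) \<le> \<Phi> ?y - \<tau> * (ch (\<Phi> ?y) * \<delta> / 2)"
      using supk[of x] x by (intro desc) auto
    moreover have "\<tau> * (ch (\<Phi> ?y) * \<delta> / 2) \<ge> 0" using \<tau> ch01 ab by simp
    ultimately show ?case
      using Suc ch1[of "\<Phi> ?y"] by (cases "\<Phi> ?y < \<beta>") (auto simp: algebra_simps add_divide_distrib)
  qed simp
  have below: "\<Phi> ((S ^^ k) x) < \<beta>" if "x \<in> B" for x
  proof -
    have "x i = 0" if "i \<notin> I" for i using \<open>x \<in> B\<close> that e W by (auto simp: B_def)
    then show ?thesis using iter[of x k] C[OF that] k by auto
  qed
  have fixk: "(S ^^ k) x = x" if "\<Phi> x \<le> 0" for x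
    using S_id[of x] that ab by (induction k) auto
  \<comment> \<open>A zero of \<open>g\<close> is a point of the box whose k-th iterate has
    vanishing \<open>W\<close>-coordinates and weighted norm \<alpha> in the others: an intersection
    of the deformed box with the ellipsoid of \<open>Gam\<close>. On the boundary the iterates are
    the identity, so the sign conditions can be read off from x itself.\<close>
  define g where "g x i = (if i = e then sqrt (\<Sum>i\<in>I - W. w i * ((S ^^ k) x i)\<^sup>2) - \<alpha> else (S ^^ k) x i)" for x i
  have "\<exists>x. (\<forall>j\<in>insert e W. (if j = e then 0 else - R) \<le> x j \<and> x j \<le> R) \<and>
    (\<forall>j. j \<notin> insert e W \<longrightarrow> x j = 0) \<and> (\<forall>i\<in>insert e W. g x i = 0)"
  proof (rule poincare_miranda)
    show "finite (insert e W)" using fin W finite_subset by auto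
  next
    fix i show "continuous_on UNIV (\<lambda>x. g x i)"
      unfolding g_def
      using continuous_on_product_then_coordinatewise[OF continuous_on_funpow[OF contS]]
      by (cases "i = e") (auto intro!: continuous_intros)
  next
    fix x i assume i: "i \<in> insert e W"
      and x: "\<forall>j\<in>insert e W. (if j = e then 0 else - R) \<le> x j \<and> x j \<le> R"
        "\<forall>j. j \<notin> insert e W \<longrightarrow> x j = 0"
    have xW: "\<bar>x j\<bar> \<le> R" if "j \<in> W" for j using x(1) that e by (metis abs_le_iff insert_iff minus_le_iff)
    have xe: "0 \<le> x e" "x e \<le> R" using x(1) by auto
    have fx: "(S ^^ k) x = x" if "x e = 0 \<or> x e = R \<or> (\<exists>i\<in>W. \<bar>x i\<bar> = R)"
      using that xW xe x(2) by (intro fixk bdry) auto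
    have sq: "(\<Sum>j\<in>I - W. w j * (x j)\<^sup>2) = (x e)\<^sup>2"
    proof -
      have "(\<Sum>j\<in>I - W. w j * (x j)\<^sup>2) = (\<Sum>j\<in>I - W. if j = e then (x e)\<^sup>2 else 0)"
        using x(2) we by (intro sum.cong) auto
      then show ?thesis using fin e by simp
    qed
    show "g x i \<le> 0" if "x i = (if i = e then 0 else - R)"
    proof (cases "i = e")
      case True
      then show ?thesis using fx that sq ab by (simp add: g_def)
    next
      case False
      then have "i \<in> W" "\<bar>x i\<bar> = R" using that i ab by auto
      then have "(S ^^ k) x = x" by (intro fx) blast
      then show ?thesis using False that ab by (simp add: g_def)
    qed
    show "g x i \<ge> 0" if "x i = R"
    proof (cases "i = e")
      case True
      then show ?thesis using fx that sq ab by (simp add: g_def)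
    next
      case False
      then have "i \<in> W" "\<bar>x i\<bar> = R" using that i ab by auto
      then have "(S ^^ k) x = x" by (intro fx) blast
      then show ?thesis using False that ab by (simp add: g_def)
    qed
  qed (use ab in auto)
  then obtain x where x: "\<And>j. j \<in> insert e W \<Longrightarrow> (if j = e then 0 else - R) \<le> x j \<and> x j \<le> R"
    "\<And>j. j \<notin> insert e W \<Longrightarrow> x j = 0" and g0: "\<And>i. i \<in> insert e W \<Longrightarrow> g x i = 0"
    by blast
  have xB: "x \<in> B" unfolding B_def mem_Collect_eq using x by blast
  have "\<beta> \<le> \<Phi> ((S ^^ k) x)"
  proof (rule Gam)
    fix i assume i: "i \<notin> I - W"
    show "(S ^^ k) x i = 0"
    proof (cases "i \<in> W")
      case True
      then have "i \<noteq> e" using e by auto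
      then show ?thesis using True g0[of i] unfolding g_def by simp
    next
      case False
      then have "i \<notin> I" using i by simp
      moreover have "x i = 0" if "i \<notin> I" for i using that e W by (intro x(2)) auto
      ultimately show ?thesis by (intro supk) auto
    qed
  next
    have "sqrt (\<Sum>i\<in>I - W. w i * ((S ^^ k) x i)\<^sup>2) = \<alpha>" using g0[of e] by (simp add: g_def)
    moreover have "0 \<le> (\<Sum>i\<in>I - W. w i * ((S ^^ k) x i)\<^sup>2)"
      using w by (intro sum_nonneg mult_nonneg_nonneg) (auto intro: less_imp_le)
    ultimately show "(\<Sum>i\<in>I - W. w i * ((S ^^ k) x i)\<^sup>2) = \<alpha>\<^sup>2"
      using real_sqrt_pow2 by metis
  qed
  with below[OF xB] show False by simp
qed

section \<open>Loops and their discrete Fourier coefficients\<close>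

definition ee :: "int \<Rightarrow> real \<Rightarrow> complex" where
  "ee k t = cis (2 * pi * of_int k * t)"

lemma ee_mult: "ee k t * ee l t = ee (k + l) t"
  by (simp add: ee_def cis_mult algebra_simps)

lemma cnj_ee: "cnj (ee k t) = ee (- k) t"
  by (simp add: ee_def cis_cnj)

lemma norm_ee [simp]: "cmod (ee k t) = 1"
  by (simp add: ee_def)

lemma ee_0 [simp]: "ee 0 t = 1" "ee k 0 = 1"
  by (simp_all add: ee_def)

lemma cis_2pi_int: "cis (2 * pi * of_int k) = 1"
  using cis_multiple_2pi[of "of_int k"] by simp

lemma ee_periodic: "ee k (t + 1) = ee k t"
proof -
  have "ee k (t + 1) = cis (2 * pi * of_int k * t) * cis (2 * pi * of_int k)"
    unfolding ee_def cis_mult by (simp add: algebra_simps)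
  then show ?thesis by (simp add: cis_2pi_int ee_def)
qed

lemma sum_ee_grid:
  assumes M: "0 < M" and k: "\<not> int M dvd k"
  shows "(\<Sum>m<M. ee k (real m / real M)) = 0"
proof -
  define z where "z = cis (2 * pi * of_int k / real M)"
  have ez: "ee k (real m / real M) = z ^ m" for m
  proof -
    have "z ^ m = cis (real m * (2 * pi * of_int k / real M))" by (simp only: z_def Complex.DeMoivre)
    then show ?thesis unfolding ee_def by (simp only: times_divide_eq_right mult_ac)
  qed
  have "z ^ M = 1"
  proof -
    have "z ^ M = cis (real M * (2 * pi * of_int k / real M))" by (simp only: z_def Complex.DeMoivre)
    also have "real M * (2 * pi * of_int k / real M) = 2 * pi * of_int k" using M by simp
    finally show ?thesis by (simp only: cis_2pi_int)
  qed
  moreover have "z \<noteq> 1"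
  proof
    assume "z = 1"
    then have "cos (2 * pi * of_int k / real M) = 1" by (simp add: z_def complex_eq_iff)
    then obtain n :: int where "2 * pi * of_int k / real M = of_int n * (2 * pi)"
      by (auto simp: cos_one_2pi_int)
    then have "2 * pi * of_int k = 2 * pi * (of_int n * of_int (int M))"
      using M by (simp add: field_simps)
    then have "real_of_int k = of_int (n * int M)" by simp
    then have "k = n * int M" by linarith
    with k show False by simp
  qed
  ultimately show ?thesis
    unfolding ez by (simp add: geometric_sum)
qed

lemma parseval_grid:
  fixes a b :: "int \<Rightarrow> complex"
  assumes M: "0 < M" and K: "finite K" "\<And>k l. k \<in> K \<Longrightarrow> l \<in> K \<Longrightarrow> k \<noteq> l \<Longrightarrow> \<not> int M dvd (k - l)"
  shows "(\<Sum>m<M. (\<Sum>k\<in>K. a k * ee k (real m / real M)) * cnj (\<Sum>k\<in>K. b k * ee k (real m / real M)))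
     = of_nat M * (\<Sum>k\<in>K. a k * cnj (b k))"
proof -
  have "(\<Sum>m<M. (\<Sum>k\<in>K. a k * ee k (real m / real M)) * cnj (\<Sum>k\<in>K. b k * ee k (real m / real M)))
     = (\<Sum>m<M. \<Sum>k\<in>K. \<Sum>l\<in>K. a k * cnj (b l) * ee (k - l) (real m / real M))"
    by (simp add: sum_product cnj_ee ee_mult[symmetric] algebra_simps)
      (simp add: diff_conv_add_uminus ee_mult[symmetric] mult_ac del: add_uminus_conv_diff)
  also have "\<dots> = (\<Sum>k\<in>K. \<Sum>l\<in>K. \<Sum>m<M. a k * cnj (b l) * ee (k - l) (real m / real M))"
    by (subst sum.swap, rule sum.cong[OF refl], rule sum.swap)
  also have "\<dots> = (\<Sum>k\<in>K. \<Sum>l\<in>K. a k * cnj (b l) * (if k = l then of_nat M else 0))"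
    using sum_ee_grid[OF M] K(2) by (intro sum.cong refl) (auto simp: sum_distrib_left[symmetric])
  also have "\<dots> = of_nat M * (\<Sum>k\<in>K. a k * cnj (b k))"
    using K(1) by (simp add: sum.delta' sum_distrib_left mult_ac if_distrib cong: if_cong)
  finally show ?thesis .
qed

lemma cmod_square_cnj: "(complex_of_real (cmod z))\<^sup>2 = z * cnj z"
  by (metis complex_norm_square of_real_power)

lemma parseval_grid_norm:
  fixes a :: "int \<Rightarrow> complex"
  assumes M: "0 < M" and K: "finite K" "\<And>k l. k \<in> K \<Longrightarrow> l \<in> K \<Longrightarrow> k \<noteq> l \<Longrightarrow> \<not> int M dvd (k - l)"
  shows "(\<Sum>m<M. (cmod (\<Sum>k\<in>K. a k * ee k (real m / real M)))\<^sup>2) = real M * (\<Sum>k\<in>K. (cmod (a k))\<^sup>2)"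
proof -
  have "complex_of_real (\<Sum>m<M. (cmod (\<Sum>k\<in>K. a k * ee k (real m / real M)))\<^sup>2) =
      of_real (real M * (\<Sum>k\<in>K. (cmod (a k))\<^sup>2))"
    using parseval_grid[OF M K, of a a] by (simp add: cmod_square_cnj)
  then show ?thesis by (rule of_real_eq_iff[THEN iffD1])
qed

definition dft :: "nat \<Rightarrow> (nat \<Rightarrow> complex) \<Rightarrow> int \<Rightarrow> complex" where
  "dft M g k = (\<Sum>m<M. g m * ee (- k) (real m / real M)) / of_nat M"

lemma bessel_grid:
  assumes M: "0 < M" and K: "finite K" "\<And>k l. k \<in> K \<Longrightarrow> l \<in> K \<Longrightarrow> k \<noteq> l \<Longrightarrow> \<not> int M dvd (k - l)"
  shows "real M * (\<Sum>k\<in>K. (cmod (dft M g k))\<^sup>2) \<le> (\<Sum>m<M. (cmod (g m))\<^sup>2)"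
proof -
  define p where "p m = (\<Sum>k\<in>K. dft M g k * ee k (real m / real M))" for m
  have pp: "(\<Sum>m<M. (cmod (p m))\<^sup>2) = real M * (\<Sum>k\<in>K. (cmod (dft M g k))\<^sup>2)"
    unfolding p_def by (rule parseval_grid_norm[OF M K])
  have "(\<Sum>m<M. g m * cnj (p m)) = (\<Sum>m<M. \<Sum>k\<in>K. cnj (dft M g k) * (g m * ee (- k) (real m / real M)))"
    by (simp add: p_def sum_distrib_left cnj_ee mult_ac)
  also have "\<dots> = (\<Sum>k\<in>K. cnj (dft M g k) * (\<Sum>m<M. g m * ee (- k) (real m / real M)))"
    by (subst sum.swap) (simp add: sum_distrib_left)
  also have "\<dots> = (\<Sum>k\<in>K. of_nat M * (dft M g k * cnj (dft M g k)))"
    using M by (intro sum.cong refl) (simp add: dft_def field_simps)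
  also have "\<dots> = of_real (real M * (\<Sum>k\<in>K. (cmod (dft M g k))\<^sup>2))"
    by (simp add: sum_distrib_left cmod_square_cnj)
  finally have gp: "(\<Sum>m<M. g m * cnj (p m)) = of_real (real M * (\<Sum>k\<in>K. (cmod (dft M g k))\<^sup>2))" .
  have "0 \<le> (\<Sum>m<M. (cmod (g m - p m))\<^sup>2)" by (simp add: sum_nonneg)
  also have "\<dots> = (\<Sum>m<M. (cmod (g m))\<^sup>2) - 2 * (\<Sum>m<M. Re (g m * cnj (p m))) + (\<Sum>m<M. (cmod (p m))\<^sup>2)"
    unfolding cmod_power2
    by (simp add: sum.distrib[symmetric] sum_subtractf[symmetric] sum_distrib_left power2_eq_square algebra_simps)
  also have "(\<Sum>m<M. Re (g m * cnj (p m))) = real M * (\<Sum>k\<in>K. (cmod (dft M g k))\<^sup>2)"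
    using arg_cong[OF gp, of Re] by (simp add: Re_sum)
  finally show ?thesis using pp by simp
qed

text \<open>A discrete form of the embedding of H^(1/2) into L^4 for loops with positive
  frequencies, with a constant independent of \<open>N\<close>. The fourth power of the modulus is
  the square of the modulus of the squared loop, whose coefficients \<open>q s\<close> are
  convolutions. Its frequencies 2, ..., 2 N are still distinct modulo the number 2 N + 1 of nodes,
  so Parseval applies, and Cauchy-Schwarz with the weights k l finishes.\<close>

lemma quartic_grid:
  fixes y :: "int \<Rightarrow> complex" and N :: nat
  defines "M \<equiv> 2 * N + 1"
  shows "(\<Sum>m<M. (cmod (\<Sum>k=1..int N. y k * ee k (real m / real M))) ^ 4)
     \<le> real M * (\<Sum>k=1..int N. of_int k * (cmod (y k))\<^sup>2)\<^sup>2"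
proof -
  let ?A = "{1..int N}" and ?K = "{2..2 * int N}"
  define P where "P s = {p \<in> ?A \<times> ?A. fst p + snd p = s}" for s
  define q where "q s = (\<Sum>p\<in>P s. y (fst p) * y (snd p))" for s
  have finP: "finite (P s)" for s by (simp add: P_def)
  have grp: "(\<Sum>s\<in>?K. \<Sum>p\<in>P s. f p) = (\<Sum>p\<in>?A \<times> ?A. f p)" for f :: "int \<times> int \<Rightarrow> 'z::comm_monoid_add"
    unfolding P_def by (rule sum.group) auto
  have sq: "(\<Sum>k\<in>?A. y k * ee k t)\<^sup>2 = (\<Sum>s\<in>?K. q s * ee s t)" for t
  proof -
    have "(\<Sum>k\<in>?A. y k * ee k t)\<^sup>2 = (\<Sum>p\<in>?A \<times> ?A. (y (fst p) * y (snd p)) * ee (fst p + snd p) t)"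
      by (simp add: power2_eq_square sum_product sum.cartesian_product case_prod_beta ee_mult[symmetric] mult_ac)
    also have "\<dots> = (\<Sum>s\<in>?K. \<Sum>p\<in>P s. (y (fst p) * y (snd p)) * ee (fst p + snd p) t)"
      by (rule grp[symmetric])
    also have "\<dots> = (\<Sum>s\<in>?K. q s * ee s t)"
      unfolding q_def sum_distrib_right by (intro sum.cong refl) (auto simp: P_def)
    finally show ?thesis .
  qed
  \<comment> \<open>From (k - 1)(l - 1) \<ge> 0 each product k l with k + l = s is at least s - 1,
    and there are at most s - 1 such pairs.\<close>
  have card_P: "(\<Sum>p\<in>P s. 1 / (of_int (fst p) * of_int (snd p))) \<le> (1::real)" if s: "s \<in> ?K" for s
  proof -
    have "(\<Sum>p\<in>P s. 1 / (of_int (fst p) * of_int (snd p))) \<le> (\<Sum>p\<in>P s. 1 / (of_int (s - 1) :: real))"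
    proof (rule sum_mono)
      fix p assume p: "p \<in> P s"
      have "(fst p - 1) * (snd p - 1) \<ge> 0" using p by (auto simp: P_def)
      then have "s - 1 \<le> fst p * snd p" using p by (auto simp: P_def algebra_simps)
      then have "(of_int (s - 1) :: real) \<le> of_int (fst p * snd p)" by (simp only: of_int_le_iff)
      then show "1 / (of_int (fst p) * of_int (snd p)) \<le> 1 / (of_int (s - 1) :: real)"
        using s by (intro divide_left_mono mult_pos_pos) (use p in \<open>auto simp: P_def\<close>)
    qed
    also have "\<dots> = of_nat (card (P s)) / of_int (s - 1)" by simp
    also have "card (P s) \<le> card {1..s - 1}"
    proof (rule card_inj_on_le[of fst])
      show "inj_on fst (P s)" by (auto simp: P_def inj_on_def)
    qed (auto simp: P_def)
    then have "real (card (P s)) \<le> real_of_int (s - 1)"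
      using s by auto
    then have "of_nat (card (P s)) / of_int (s - 1) \<le> (1::real)"
      using s by (simp add: divide_le_eq_1)
    finally show ?thesis .
  qed
  have qb: "(cmod (q s))\<^sup>2 \<le> (\<Sum>p\<in>P s. (of_int (fst p) * (cmod (y (fst p)))\<^sup>2) * (of_int (snd p) * (cmod (y (snd p)))\<^sup>2))"
    if s: "s \<in> ?K" for s
  proof -
    let ?w = "\<lambda>p. sqrt (of_int (fst p) * of_int (snd p))"
    have pos: "0 < real_of_int (fst p) * of_int (snd p)" if "p \<in> P s" for p
      using that by (auto simp: P_def)
    have "cmod (q s) \<le> (\<Sum>p\<in>P s. cmod (y (fst p)) * cmod (y (snd p)))"
      unfolding q_def by (rule order_trans[OF norm_sum]) (simp add: norm_mult)
    also have "\<dots> = (\<Sum>p\<in>P s. (?w p * (cmod (y (fst p)) * cmod (y (snd p)))) * (1 / ?w p))"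
    proof (rule sum.cong[OF refl])
      fix p assume "p \<in> P s"
      then have "?w p \<noteq> 0" using pos by (metis less_irrefl real_sqrt_eq_0_iff)
      then show "cmod (y (fst p)) * cmod (y (snd p)) =
          (?w p * (cmod (y (fst p)) * cmod (y (snd p)))) * (1 / ?w p)" by simp
    qed
    finally have "(cmod (q s))\<^sup>2 \<le> (\<Sum>p\<in>P s. (?w p * (cmod (y (fst p)) * cmod (y (snd p)))) * (1 / ?w p))\<^sup>2"
      by (intro power_mono) auto
    also have "\<dots> \<le> (\<Sum>p\<in>P s. (?w p * (cmod (y (fst p)) * cmod (y (snd p))))\<^sup>2) * (\<Sum>p\<in>P s. (1 / ?w p)\<^sup>2)"
      by (rule Cauchy_Schwarz_ineq_sum)
    also have "(\<Sum>p\<in>P s. (1 / ?w p)\<^sup>2) = (\<Sum>p\<in>P s. 1 / (of_int (fst p) * of_int (snd p)))"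
      using pos by (intro sum.cong refl) (simp add: power_divide less_imp_le)
    also have "(\<Sum>p\<in>P s. (?w p * (cmod (y (fst p)) * cmod (y (snd p))))\<^sup>2) * \<dots> \<le>
        (\<Sum>p\<in>P s. (?w p * (cmod (y (fst p)) * cmod (y (snd p))))\<^sup>2) * 1"
      using card_P[OF s] by (intro mult_left_mono sum_nonneg) auto
    also have "\<dots> = (\<Sum>p\<in>P s. (of_int (fst p) * (cmod (y (fst p)))\<^sup>2) * (of_int (snd p) * (cmod (y (snd p)))\<^sup>2))"
      unfolding mult_1_right
    proof (rule sum.cong[OF refl])
      fix p assume "p \<in> P s"
      then have "(?w p)\<^sup>2 = of_int (fst p) * of_int (snd p)" using pos[of p] by (simp add: less_imp_le)
      then show "(?w p * (cmod (y (fst p)) * cmod (y (snd p))))\<^sup>2 =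
          (of_int (fst p) * (cmod (y (fst p)))\<^sup>2) * (of_int (snd p) * (cmod (y (snd p)))\<^sup>2)"
        by (simp add: power_mult_distrib)
    qed
    finally show ?thesis .
  qed
  have "(\<Sum>m<M. (cmod (\<Sum>k\<in>?A. y k * ee k (real m / real M))) ^ 4) =
      (\<Sum>m<M. (cmod ((\<Sum>k\<in>?A. y k * ee k (real m / real M))\<^sup>2))\<^sup>2)"
    by (simp add: norm_power flip: power_mult)
  also have "\<dots> = (\<Sum>m<M. (cmod (\<Sum>s\<in>?K. q s * ee s (real m / real M)))\<^sup>2)"
    unfolding sq ..
  also have "\<dots> = real M * (\<Sum>s\<in>?K. (cmod (q s))\<^sup>2)"
  proof (rule parseval_grid_norm)
    fix k l assume "k \<in> ?K" "l \<in> ?K" "k \<noteq> l"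
    then have "k - l \<noteq> 0" "\<bar>k - l\<bar> < int M" by (auto simp: M_def)
    then show "\<not> int M dvd k - l" using dvd_imp_le_int[of "k - l" "int M"] by auto
  qed (auto simp: M_def)
  also have "\<dots> \<le> real M * (\<Sum>s\<in>?K. \<Sum>p\<in>P s. (of_int (fst p) * (cmod (y (fst p)))\<^sup>2) * (of_int (snd p) * (cmod (y (snd p)))\<^sup>2))"
    using qb by (intro mult_left_mono sum_mono) auto
  also have "\<dots> = real M * (\<Sum>k\<in>?A. of_int k * (cmod (y k))\<^sup>2)\<^sup>2"
    unfolding grp by (simp add: power2_eq_square[of "sum _ _"] sum_product sum.cartesian_product case_prod_beta)
  finally show ?thesis .
qed

section \<open>Galerkin approximation of the Hamiltonian action\<close>

definition coef :: "(int \<times> 'n::finite \<times> bool \<Rightarrow> real) \<Rightarrow> int \<Rightarrow> 'n \<Rightarrow> complex" where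
  "coef x k j = Complex (x (k, j, True)) (x (k, j, False))"

definition trig :: "nat \<Rightarrow> (int \<times> 'n::finite \<times> bool \<Rightarrow> real) \<Rightarrow> real \<Rightarrow> complex ^ 'n" where
  "trig N x t = (\<chi> j. \<Sum>k=-int N..int N. coef x k j * ee k t)"

definition grid :: "nat \<Rightarrow> nat \<Rightarrow> real" where
  "grid N m = real m / real (2 * N + 1)"

text \<open>The Hamiltonian action of the trigonometric loop \<open>trig N x\<close>, with the integral of \<open>H\<close> replaced by
  its mean over a grid of \<open>2 N + 1\<close> points: exact Fourier inversion on the grid then makes the gradient
  explicit, without any integration.\<close>

definition act :: "(complex ^ 'n::finite \<Rightarrow> real) \<Rightarrow> nat \<Rightarrow> (int \<times> 'n \<times> bool \<Rightarrow> real) \<Rightarrow> real" where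
  "act H N x = pi * (\<Sum>k=-int N..int N. \<Sum>j\<in>UNIV. of_int k * (cmod (coef x k j))\<^sup>2)
     - (\<Sum>m<2 * N + 1. H (trig N x (grid N m))) / real (2 * N + 1)"

text \<open>In Fourier coefficients this is - i x' - \<open>gH\<close> x, the L^2 gradient of the
  action; its zeros are discrete versions of loops with x' = i \<open>gH\<close> x.\<close>

definition gradc :: "(complex ^ 'n::finite \<Rightarrow> complex ^ 'n) \<Rightarrow> nat \<Rightarrow> (int \<times> 'n \<times> bool \<Rightarrow> real) \<Rightarrow> int \<Rightarrow> 'n \<Rightarrow> complex" where
  "gradc gH N x k j = of_real (2 * pi * of_int k) * coef x k j -
     dft (2 * N + 1) (\<lambda>m. gH (trig N x (grid N m)) $ j) k"

definition pt :: "bool \<Rightarrow> complex \<Rightarrow> real" where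
  "pt b z = (if b then Re z else Im z)"

definition grad :: "(complex ^ 'n::finite \<Rightarrow> complex ^ 'n) \<Rightarrow> nat \<Rightarrow> (int \<times> 'n \<times> bool \<Rightarrow> real) \<Rightarrow> int \<times> 'n \<times> bool \<Rightarrow> real" where
  "grad gH N x = (\<lambda>(k, j, b). pt b (gradc gH N x k j))"

definition modes :: "nat \<Rightarrow> (int \<times> 'n::finite \<times> bool) set" where
  "modes N = {-int N..int N} \<times> UNIV \<times> UNIV"

lemma finite_modes [simp]: "finite (modes N)"
  by (simp add: modes_def)

lemma sum_modes: "(\<Sum>\<iota>\<in>modes N. f \<iota>) = (\<Sum>k=-int N..int N. \<Sum>j\<in>UNIV. f (k, j, True) + f (k, j, False))"
  unfolding modes_def by (simp add: sum.cartesian_product' UNIV_bool add.commute)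

lemma coef_add: "coef (\<lambda>\<iota>. x \<iota> + t * v \<iota>) k j = coef x k j + t *\<^sub>R coef v k j"
  by (simp add: coef_def complex_eq_iff)

lemma trig_add: "trig N (\<lambda>\<iota>. x \<iota> + t * v \<iota>) s = trig N x s + t *\<^sub>R trig N v s"
  by (simp add: trig_def vec_eq_iff coef_add distrib_right sum.distrib scaleR_sum_right)

lemma coef_diff: "coef (\<lambda>\<iota>. x \<iota> - y \<iota>) k j = coef x k j - coef y k j"
  by (simp add: coef_def complex_eq_iff)

lemma trig_diff: "trig N (\<lambda>\<iota>. x \<iota> - y \<iota>) s = trig N x s - trig N y s"
  by (simp add: trig_def vec_eq_iff coef_diff left_diff_distrib sum_subtractf)

lemma inner_complex_Re: "z \<bullet> w = Re (z * cnj w)"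
  by (simp add: inner_complex_def)

lemma grid_not_dvd:
  assumes "k \<in> {-int N..int N}" "l \<in> {-int N..int N}" "k \<noteq> l"
  shows "\<not> int (2 * N + 1) dvd (k - l)"
proof
  assume "int (2 * N + 1) dvd (k - l)"
  moreover have "k - l \<noteq> 0" "\<bar>k - l\<bar> < int (2 * N + 1)" using assms by auto
  ultimately show False using dvd_imp_le_int[of "k - l" "int (2 * N + 1)"] by auto
qed

lemma of_nat_odd_neq_0: "of_nat (2 * N + 1) \<noteq> (0 :: 'a::semiring_char_0)"
  by (simp only: Suc_eq_plus1[symmetric] of_nat_neq_0 not_False_eq_True)

lemma Re_of_real_mult: "Re (of_real r * z * w) = r * Re (z * w)"
  by (simp add: algebra_simps)

lemma sum_inner_trig:
  fixes g :: "nat \<Rightarrow> complex ^ 'n::finite"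
  shows "(\<Sum>m<2 * N + 1. g m \<bullet> trig N v (grid N m)) / real (2 * N + 1) =
    (\<Sum>k=-int N..int N. \<Sum>j\<in>UNIV. Re (dft (2 * N + 1) (\<lambda>m. g m $ j) k * cnj (coef v k j)))"
proof -
  let ?M = "2 * N + 1"
  have "(\<Sum>m<?M. g m \<bullet> trig N v (grid N m)) =
      (\<Sum>m<?M. \<Sum>j\<in>UNIV. \<Sum>k=-int N..int N. Re (g m $ j * ee (- k) (grid N m) * cnj (coef v k j)))"
    by (simp add: inner_vec_def inner_complex_Re trig_def sum_distrib_left Re_sum cnj_ee mult_ac del: Re_complex_of_real times_complex.sel)
  also have "\<dots> = (\<Sum>j\<in>UNIV. \<Sum>k=-int N..int N. \<Sum>m<?M. Re (g m $ j * ee (- k) (grid N m) * cnj (coef v k j)))"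
    by (subst sum.swap, rule sum.cong[OF refl], rule sum.swap)
  also have "\<dots> = (\<Sum>k=-int N..int N. \<Sum>j\<in>UNIV. \<Sum>m<?M. Re (g m $ j * ee (- k) (grid N m) * cnj (coef v k j)))"
    by (rule sum.swap)
  also have "\<dots> = (\<Sum>k=-int N..int N. \<Sum>j\<in>UNIV. real ?M * Re (dft ?M (\<lambda>m. g m $ j) k * cnj (coef v k j)))"
  proof (intro sum.cong refl)
    fix k j
    have "(\<Sum>m<?M. Re (g m $ j * ee (- k) (grid N m) * cnj (coef v k j))) =
        Re ((\<Sum>m<?M. g m $ j * ee (- k) (grid N m)) * cnj (coef v k j))"
      by (simp only: Re_sum[symmetric] sum_distrib_right)
    also have "(\<Sum>m<?M. g m $ j * ee (- k) (grid N m)) = of_real (real ?M) * dft ?M (\<lambda>m. g m $ j) k"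
      by (simp only: dft_def grid_def of_real_of_nat_eq times_divide_eq_right
          nonzero_mult_div_cancel_left[OF of_nat_odd_neq_0])
    finally show "(\<Sum>m<?M. Re (g m $ j * ee (- k) (grid N m) * cnj (coef v k j))) =
        real ?M * Re (dft ?M (\<lambda>m. g m $ j) k * cnj (coef v k j))"
      by (simp only: Re_of_real_mult)
  qed
  finally have "(\<Sum>m<?M. g m \<bullet> trig N v (grid N m)) = real ?M *
      (\<Sum>k=-int N..int N. \<Sum>j\<in>UNIV. Re (dft ?M (\<lambda>m. g m $ j) k * cnj (coef v k j)))"
    by (simp only: sum_distrib_left[symmetric])
  then show ?thesis by (simp only: nonzero_mult_div_cancel_left[OF of_nat_odd_neq_0])
qed

lemma DERIV_line:
  assumes "(H has_derivative (\<lambda>v. g (X + t *\<^sub>R V) \<bullet> v)) (at (X + t *\<^sub>R V))"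
  shows "((\<lambda>t. H (X + t *\<^sub>R V)) has_real_derivative g (X + t *\<^sub>R V) \<bullet> V) (at t)"
proof -
  have "((\<lambda>t. X + t *\<^sub>R V) has_derivative (\<lambda>h. h *\<^sub>R V)) (at t)"
    by (auto intro!: derivative_eq_intros)
  from has_derivative_compose[OF this assms] show ?thesis
    by (simp add: has_field_derivative_def o_def mult_commute_abs)
qed

lemma act_deriv:
  fixes H :: "complex ^ 'n::finite \<Rightarrow> real"
  assumes der: "\<And>z. (H has_derivative (\<lambda>v. gH z \<bullet> v)) (at z)"
  shows "((\<lambda>t. act H N (\<lambda>\<iota>. x \<iota> + t * v \<iota>)) has_real_derivative
      (\<Sum>\<iota>\<in>modes N. grad gH N (\<lambda>\<iota>. x \<iota> + t * v \<iota>) \<iota> * v \<iota>)) (at t)"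
proof -
  let ?M = "2 * N + 1" and ?y = "\<lambda>\<iota>. x \<iota> + t * v \<iota>"
  have 1: "((\<lambda>t. (cmod (coef (\<lambda>\<iota>. x \<iota> + t * v \<iota>) k j))\<^sup>2) has_real_derivative
      2 * Re (coef ?y k j * cnj (coef v k j))) (at t)" for k j
    unfolding cmod_power2 coef_def by (auto intro!: derivative_eq_intros simp: algebra_simps)
  have 2: "((\<lambda>t. H (trig N (\<lambda>\<iota>. x \<iota> + t * v \<iota>) s)) has_real_derivative
      gH (trig N ?y s) \<bullet> trig N v s) (at t)" for s
    unfolding trig_add by (rule DERIV_line[where g = gH, OF der])
  have "((\<lambda>t. act H N (\<lambda>\<iota>. x \<iota> + t * v \<iota>)) has_real_derivative
      pi * (\<Sum>k=-int N..int N. \<Sum>j\<in>UNIV. of_int k * (2 * Re (coef ?y k j * cnj (coef v k j))))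
      - (\<Sum>m<?M. gH (trig N ?y (grid N m)) \<bullet> trig N v (grid N m)) / real ?M) (at t)"
    unfolding act_def by (intro DERIV_diff DERIV_cmult DERIV_sum DERIV_cdivide 1 2)
  also have "pi * (\<Sum>k=-int N..int N. \<Sum>j\<in>UNIV. of_int k * (2 * Re (coef ?y k j * cnj (coef v k j))))
      - (\<Sum>m<?M. gH (trig N ?y (grid N m)) \<bullet> trig N v (grid N m)) / real ?M =
      (\<Sum>k=-int N..int N. \<Sum>j\<in>UNIV. Re (gradc gH N ?y k j * cnj (coef v k j)))"
    unfolding sum_inner_trig gradc_def sum_distrib_left sum_subtractf[symmetric]
    by (intro sum.cong refl) (simp add: algebra_simps)
  also have "\<dots> = (\<Sum>\<iota>\<in>modes N. grad gH N ?y \<iota> * v \<iota>)"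
    unfolding sum_modes grad_def pt_def coef_def by (intro sum.cong refl) (simp add: algebra_simps)
  finally show ?thesis .
qed

lemma abs_le_L2_set: "finite A \<Longrightarrow> i \<in> A \<Longrightarrow> \<bar>f i\<bar> \<le> L2_set f A"
  using member_le_L2_set[of A i "\<lambda>i. \<bar>f i\<bar>"] by (simp add: L2_set_def)

lemma norm_trig_le: "norm (trig N x t) \<le> real (card (modes N :: (int \<times> 'n \<times> bool) set)) * L2_set x (modes N)"
  for x :: "int \<times> 'n::finite \<times> bool \<Rightarrow> real"
proof -
  have "norm (trig N x t) \<le> (\<Sum>j\<in>UNIV. cmod (trig N x t $ j))" unfolding norm_vec_def by (rule L2_set_le_sum) simp
  also have "\<dots> \<le> (\<Sum>j\<in>UNIV. \<Sum>k=-int N..int N. cmod (coef x k j))"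
    by (intro sum_mono) (simp add: trig_def, rule order_trans[OF norm_sum], simp add: norm_mult)
  also have "\<dots> \<le> (\<Sum>j\<in>UNIV. \<Sum>k=-int N..int N. \<bar>x (k, j, True)\<bar> + \<bar>x (k, j, False)\<bar>)"
  proof (intro sum_mono)
    fix j :: 'n and k :: int
    show "cmod (coef x k j) \<le> \<bar>x (k, j, True)\<bar> + \<bar>x (k, j, False)\<bar>"
      using cmod_le[of "coef x k j"] by (simp add: coef_def)
  qed
  also have "\<dots> = (\<Sum>\<iota>\<in>modes N. \<bar>x \<iota>\<bar>)" unfolding sum_modes by (rule sum.swap)
  also have "\<dots> \<le> (\<Sum>\<iota>\<in>(modes N :: (int \<times> 'n \<times> bool) set). L2_set x (modes N))"
    by (rule sum_mono) (auto intro: abs_le_L2_set)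
  finally show ?thesis by simp
qed

lemma norm_dft_le:
  assumes "\<And>m. m < M \<Longrightarrow> cmod (g m) \<le> B" "0 < M"
  shows "cmod (dft M g k) \<le> B"
proof -
  have "cmod (\<Sum>m<M. g m * ee (- k) (real m / real M)) \<le> (\<Sum>m<M. B)"
    by (rule order_trans[OF norm_sum], rule sum_mono) (simp add: norm_mult assms)
  then show ?thesis using assms(2) by (simp add: dft_def norm_divide divide_le_eq mult.commute)
qed

lemma dft_diff: "dft M g k - dft M h k = dft M (\<lambda>m. g m - h m) k"
  by (simp add: dft_def diff_divide_distrib[symmetric] sum_subtractf[symmetric] left_diff_distrib)

lemma dft_add: "dft M (\<lambda>m. g m + h m) k = dft M g k + dft M h k"
  by (simp add: dft_def add_divide_distrib[symmetric] sum.distrib[symmetric] distrib_right)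

lemma abs_pt_le: "\<bar>pt b z\<bar> \<le> cmod z"
  by (simp add: pt_def abs_Re_le_cmod abs_Im_le_cmod)

lemma pt_diff: "pt b z - pt b w = pt b (z - w)"
  by (simp add: pt_def)

lemma grad_unif:
  fixes gH :: "complex ^ 'n::finite \<Rightarrow> complex ^ 'n"
  assumes uc: "uniformly_continuous_on UNIV gH" and "0 < \<epsilon>"
  shows "\<exists>d>0. \<forall>x y. L2_set (\<lambda>\<iota>. x \<iota> - y \<iota>) (modes N) < d \<longrightarrow>
      L2_set (\<lambda>\<iota>. grad gH N x \<iota> - grad gH N y \<iota>) (modes N) < \<epsilon>"
proof -
  define c where "c = real (card (modes N :: (int \<times> 'n \<times> bool) set))"
  have c: "0 < c" unfolding c_def by (simp add: card_gt_0_iff modes_def)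
  define \<epsilon>' where "\<epsilon>' = \<epsilon> / (4 * c)"
  have e': "0 < \<epsilon>'" using \<open>0 < \<epsilon>\<close> c by (simp add: \<epsilon>'_def)
  obtain d0 where d0: "0 < d0" and uc': "\<And>z w. dist z w < d0 \<Longrightarrow> dist (gH z) (gH w) < \<epsilon>'"
    using uc e' unfolding uniformly_continuous_on_def by (metis UNIV_I)
  define d where "d = min (d0 / c) (\<epsilon>' / (4 * pi * (real N + 1)))"
  have dpos: "0 < d" unfolding d_def using d0 c e' by (simp add: add_nonneg_pos)
  have "L2_set (\<lambda>\<iota>. grad gH N x \<iota> - grad gH N y \<iota>) (modes N) < \<epsilon>"
    if xy: "L2_set (\<lambda>\<iota>. x \<iota> - y \<iota>) (modes N) < d" for x y
  proof -
    have tr: "dist (trig N x s) (trig N y s) < d0" for s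
    proof -
      have "dist (trig N x s) (trig N y s) \<le> c * L2_set (\<lambda>\<iota>. x \<iota> - y \<iota>) (modes N)"
        unfolding dist_norm trig_diff[symmetric] c_def by (rule norm_trig_le)
      also have "\<dots> < c * d" using xy c by simp
      also have "\<dots> \<le> c * (d0 / c)" using c by (intro mult_left_mono) (auto simp: d_def)
      finally show ?thesis using c by simp
    qed
    have each: "\<bar>grad gH N x \<iota> - grad gH N y \<iota>\<bar> \<le> 2 * \<epsilon>'" if i: "\<iota> \<in> modes N" for \<iota>
    proof -
      obtain k j b where \<iota>: "\<iota> = (k, j, b)" by (cases \<iota>) auto
      have k: "\<bar>real_of_int k\<bar> \<le> real N" using i \<iota> by (auto simp: modes_def abs_le_iff)
      have cf: "cmod (coef (\<lambda>\<iota>. x \<iota> - y \<iota>) k j) \<le> 2 * d"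
      proof -
        have "\<bar>x (k, j, b') - y (k, j, b')\<bar> \<le> d" for b'
          using abs_le_L2_set[of "modes N" "(k, j, b')" "\<lambda>\<iota>. x \<iota> - y \<iota>"] i \<iota> xy by (auto simp: modes_def)
        from this[of True] this[of False] show ?thesis
          using cmod_le[of "coef (\<lambda>\<iota>. x \<iota> - y \<iota>) k j"] by (simp add: coef_def)
      qed
      have df: "cmod (dft (2 * N + 1) (\<lambda>m. gH (trig N x (grid N m)) $ j - gH (trig N y (grid N m)) $ j) k) \<le> \<epsilon>'"
      proof (rule norm_dft_le)
        fix m
        have "cmod ((gH (trig N x (grid N m)) - gH (trig N y (grid N m))) $ j) \<le> dist (gH (trig N x (grid N m))) (gH (trig N y (grid N m)))"
          unfolding dist_norm by (rule Finite_Cartesian_Product.norm_nth_le)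
        then show "cmod (gH (trig N x (grid N m)) $ j - gH (trig N y (grid N m)) $ j) \<le> \<epsilon>'"
          using uc'[OF tr[of "grid N m"]] by simp
      qed simp
      have "gradc gH N x k j - gradc gH N y k j = of_real (2 * pi * of_int k) * coef (\<lambda>\<iota>. x \<iota> - y \<iota>) k j
          - dft (2 * N + 1) (\<lambda>m. gH (trig N x (grid N m)) $ j - gH (trig N y (grid N m)) $ j) k"
        by (simp add: gradc_def dft_diff[symmetric] coef_diff algebra_simps)
      then have "cmod (gradc gH N x k j - gradc gH N y k j) \<le> cmod (of_real (2 * pi * of_int k) * coef (\<lambda>\<iota>. x \<iota> - y \<iota>) k j) + \<epsilon>'"
        by (simp only:) (rule order_trans[OF norm_triangle_ineq4 add_left_mono[OF df]])
      also have "cmod (of_real (2 * pi * of_int k) * coef (\<lambda>\<iota>. x \<iota> - y \<iota>) k j) \<le> (2 * pi * real N) * (2 * d)"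
      proof -
        have "\<bar>2 * pi * real_of_int k\<bar> \<le> 2 * pi * real N" using k by (simp add: abs_mult)
        then show ?thesis unfolding norm_mult norm_of_real using cf by (intro mult_mono) auto
      qed
      also have "\<dots> \<le> (4 * pi * (real N + 1)) * d" using dpos by (simp add: algebra_simps)
      also have "\<dots> \<le> \<epsilon>'"
      proof -
        have "0 < 4 * pi * (real N + 1)" by (simp add: add_nonneg_pos)
        moreover have "d \<le> \<epsilon>' / (4 * pi * (real N + 1))" by (simp add: d_def)
        ultimately show ?thesis by (simp only: pos_le_divide_eq mult.commute)
      qed
      finally show ?thesis
        unfolding \<iota> grad_def using abs_pt_le[of b "gradc gH N x k j - gradc gH N y k j"] by (simp add: pt_diff)
    qed
    have "L2_set (\<lambda>\<iota>. grad gH N x \<iota> - grad gH N y \<iota>) (modes N) \<le> (\<Sum>\<iota>\<in>modes N. \<bar>grad gH N x \<iota> - grad gH N y \<iota>\<bar>)"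
      by (rule L2_set_le_sum_abs)
    also have "\<dots> \<le> (\<Sum>\<iota>\<in>(modes N :: (int \<times> 'n \<times> bool) set). 2 * \<epsilon>')" using each by (intro sum_mono)
    also have "\<dots> = \<epsilon> / 2" unfolding sum_constant c_def[symmetric] using c by (simp add: \<epsilon>'_def)
    finally show ?thesis using \<open>0 < \<epsilon>\<close> by simp
  qed
  with dpos show ?thesis by blast
qed

lemma continuous_trig: "continuous_on UNIV (\<lambda>x. trig N x s)"
  unfolding trig_def coef_def Complex_eq by (intro continuous_intros continuous_on_vec_lambda continuous_on_product_coordinates)

lemma continuous_act:
  fixes H :: "complex ^ 'n::finite \<Rightarrow> real"
  assumes "continuous_on UNIV H"
  shows "continuous_on UNIV (act H N)"
  unfolding act_def[abs_def] cmod_power2 coef_def complex.sel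
  by (intro continuous_intros continuous_on_product_coordinates continuous_on_compose2[OF assms continuous_trig]) auto

lemma continuous_grad:
  fixes gH :: "complex ^ 'n::finite \<Rightarrow> complex ^ 'n"
  assumes "continuous_on UNIV gH"
  shows "continuous_on UNIV (\<lambda>x. grad gH N x \<iota>)"
proof -
  obtain k j b where \<iota>: "\<iota> = (k, j, b)" by (cases \<iota>) auto
  have "continuous_on UNIV (\<lambda>x. gradc gH N x k j)"
    unfolding gradc_def coef_def Complex_eq dft_def divide_inverse
    by (intro continuous_intros continuous_on_product_coordinates continuous_on_compose2[OF assms continuous_trig]) auto
  then show ?thesis
    unfolding \<iota> grad_def pt_def by (cases b) (auto intro!: continuous_intros)
qed

lemma sum_trig_norm_square:
  "(\<Sum>m<2 * N + 1. (cmod (trig N x (grid N m) $ j))\<^sup>2) = real (2 * N + 1) * (\<Sum>k=-int N..int N. (cmod (coef x k j))\<^sup>2)"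
  unfolding trig_def grid_def vec_lambda_beta
  by (rule parseval_grid_norm) (simp, simp, rule grid_not_dvd)

lemma dft_trig:
  assumes k: "k \<in> {-int N..int N}"
  shows "dft (2 * N + 1) (\<lambda>m. trig N x (grid N m) $ j) k = coef x k j"
proof -
  define M where "M = 2 * N + 1"
  have M0: "(of_nat M :: complex) \<noteq> 0" unfolding M_def by (rule of_nat_odd_neq_0)
  let ?b = "\<lambda>l. if l = k then 1 else (0::complex)"
  have b: "cnj (\<Sum>l=-int N..int N. ?b l * ee l t) = ee (- k) t" for t
  proof -
    have "(\<Sum>l=-int N..int N. ?b l * ee l t) = (\<Sum>l=-int N..int N. if l = k then ee k t else 0)"
      by (intro sum.cong) auto
    also have "\<dots> = ee k t" using k by simp
    finally show ?thesis by (simp add: cnj_ee)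
  qed
  have "(\<Sum>m<M. (\<Sum>l=-int N..int N. coef x l j * ee l (real m / real M)) * cnj (\<Sum>l=-int N..int N. ?b l * ee l (real m / real M)))
     = of_nat M * (\<Sum>l=-int N..int N. coef x l j * cnj (?b l))"
    unfolding M_def by (rule parseval_grid) (simp, simp, rule grid_not_dvd)
  also have "(\<Sum>l=-int N..int N. coef x l j * cnj (?b l)) = (\<Sum>l=-int N..int N. if l = k then coef x k j else 0)"
    by (intro sum.cong) auto
  also have "\<dots> = coef x k j" using k by simp
  finally show ?thesis
    unfolding b dft_def trig_def grid_def M_def[symmetric] vec_lambda_beta using M0 by simp
qed

lemma sum_modes_coef:
  "(\<Sum>\<iota>\<in>modes N. f (fst \<iota>) (fst (snd \<iota>)) * (x \<iota>)\<^sup>2) =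
   (\<Sum>k=-int N..int N. \<Sum>j\<in>UNIV. f k j * (cmod (coef x k j))\<^sup>2)"
  unfolding sum_modes cmod_power2 coef_def by (simp add: distrib_left)

lemma norm_power2_vec: "(norm (z :: complex ^ 'n::finite))\<^sup>2 = (\<Sum>j\<in>UNIV. (cmod (z $ j))\<^sup>2)"
  unfolding norm_vec_def L2_set_def by (simp add: sum_nonneg)

lemma norm_power4_le:
  "(norm (z :: complex ^ 'n::finite)) ^ 4 \<le> real CARD('n) * (\<Sum>j\<in>UNIV. (cmod (z $ j)) ^ 4)"
proof -
  have "(norm z) ^ 4 = ((norm z)\<^sup>2)\<^sup>2" by (simp flip: power_mult)
  also have "\<dots> = (\<Sum>j\<in>UNIV. 1 * (cmod (z $ j))\<^sup>2)\<^sup>2" by (simp add: norm_power2_vec)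
  also have "\<dots> \<le> (\<Sum>j\<in>(UNIV::'n set). 1\<^sup>2) * (\<Sum>j\<in>UNIV. ((cmod (z $ j))\<^sup>2)\<^sup>2)"
    by (rule Cauchy_Schwarz_ineq_sum)
  finally show ?thesis by (simp flip: power_mult)
qed

text \<open>On the span of the positive modes the quadratic part is \<pi> \<alpha>^2, and the
  quartic bound on \<open>H\<close> together with \<open>quartic_grid\<close> makes the mean of
  \<open>H\<close> at most a multiple of \<alpha>^4. Neither estimate depends on \<open>N\<close>,
  so one radius \<alpha> serves all approximations.\<close>

lemma galerkin_lower:
  fixes H :: "complex ^ 'n::finite \<Rightarrow> real"
  assumes H4: "\<And>z. H z \<le> C * norm z ^ 4" and C: "0 \<le> C"
    and supp: "\<And>\<iota>. \<iota> \<notin> {\<iota>\<in>modes N. 1 \<le> fst \<iota>} \<Longrightarrow> x \<iota> = 0"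
    and x: "(\<Sum>k=-int N..int N. \<Sum>j\<in>UNIV. of_int k * (cmod (coef x k j))\<^sup>2) = \<alpha>\<^sup>2"
  shows "pi * \<alpha>\<^sup>2 - C * real CARD('n) * \<alpha> ^ 4 \<le> act H N x"
proof -
  define M where "M = 2 * N + 1"
  have M: "0 < real M" by (simp add: M_def)
  have c0: "coef x k j = 0" if "k \<le> 0" for k j
    using supp[of "(k, j, True)"] supp[of "(k, j, False)"] that by (simp add: coef_def complex_eq_iff)
  define S where "S j = (\<Sum>k=1..int N. of_int k * (cmod (coef x k j))\<^sup>2)" for j
  have S0: "0 \<le> S j" for j unfolding S_def by (intro sum_nonneg mult_nonneg_nonneg) auto
  have SS: "(\<Sum>j\<in>UNIV. S j) = \<alpha>\<^sup>2"
  proof -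
    have "(\<Sum>j\<in>UNIV. S j) = (\<Sum>j\<in>UNIV. \<Sum>k=-int N..int N. of_int k * (cmod (coef x k j))\<^sup>2)"
      unfolding S_def by (intro sum.cong refl sum.mono_neutral_left) (auto simp: c0)
    also have "\<dots> = \<alpha>\<^sup>2" unfolding x[symmetric] by (rule sum.swap)
    finally show ?thesis .
  qed
  have Sle: "S j \<le> \<alpha>\<^sup>2" for j
    unfolding SS[symmetric] using S0 by (intro member_le_sum) auto
  have tr: "trig N x t $ j = (\<Sum>k=1..int N. coef x k j * ee k t)" for t j
    unfolding trig_def vec_lambda_beta by (intro sum.mono_neutral_right) (auto simp: c0)
  have "(\<Sum>m<M. H (trig N x (grid N m))) \<le> (\<Sum>m<M. C * (real CARD('n) * (\<Sum>j\<in>UNIV. cmod (trig N x (grid N m) $ j) ^ 4)))"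
    by (intro sum_mono order_trans[OF H4] mult_left_mono norm_power4_le C)
  also have "\<dots> = C * real CARD('n) * (\<Sum>j\<in>UNIV. \<Sum>m<M. cmod (trig N x (grid N m) $ j) ^ 4)"
    by (subst sum.swap) (simp add: sum_distrib_left mult_ac)
  also have "\<dots> \<le> C * real CARD('n) * (\<Sum>j\<in>UNIV. real M * (\<alpha>\<^sup>2 * S j))"
  proof (intro mult_left_mono sum_mono)
    fix j
    have "(\<Sum>m<M. cmod (trig N x (grid N m) $ j) ^ 4) \<le> real M * (S j)\<^sup>2"
      unfolding tr grid_def S_def M_def by (rule quartic_grid)
    also have "(S j)\<^sup>2 \<le> \<alpha>\<^sup>2 * S j" using Sle[of j] S0[of j] by (simp add: power2_eq_square mult_right_mono)
    finally show "(\<Sum>m<M. cmod (trig N x (grid N m) $ j) ^ 4) \<le> real M * (\<alpha>\<^sup>2 * S j)"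
      using M by simp
  qed (use C in auto)
  also have "\<dots> = real M * (C * real CARD('n) * \<alpha> ^ 4)"
    by (simp add: sum_distrib_left[symmetric] SS power2_eq_square power4_eq_xxxx)
  finally have "(\<Sum>m<M. H (trig N x (grid N m))) / real M \<le> C * real CARD('n) * \<alpha> ^ 4"
    using M by (simp add: divide_le_eq mult.commute)
  then show ?thesis unfolding act_def x M_def[symmetric] by simp
qed

text \<open>Exact Parseval on the grid turns the quadratic lower bound on \<open>H\<close> into a
  form that is diagonal in the modes, from which the sign of the action on the boundary of the
  linking box can be read off.\<close>

lemma galerkin_upper:
  fixes H :: "complex ^ 'n::finite \<Rightarrow> real"
  assumes lower: "\<And>z. a * (\<Sum>j\<in>UNIV. lam j * (cmod (z $ j))\<^sup>2) - C \<le> H z"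
  shows "act H N x \<le> pi * (\<Sum>\<iota>\<in>modes N. of_int (fst \<iota>) * (x \<iota>)\<^sup>2)
      - a * (\<Sum>\<iota>\<in>modes N. lam (fst (snd \<iota>)) * (x \<iota>)\<^sup>2) + C"
proof -
  define M where "M = 2 * N + 1"
  have M: "0 < real M" by (simp add: M_def)
  have "(\<Sum>m<M. a * (\<Sum>j\<in>UNIV. lam j * (cmod (trig N x (grid N m) $ j))\<^sup>2) - C) \<le> (\<Sum>m<M. H (trig N x (grid N m)))"
    by (intro sum_mono lower)
  also have "(\<Sum>m<M. a * (\<Sum>j\<in>UNIV. lam j * (cmod (trig N x (grid N m) $ j))\<^sup>2) - C) =
      a * (\<Sum>j\<in>UNIV. lam j * (\<Sum>m<M. (cmod (trig N x (grid N m) $ j))\<^sup>2)) - real M * C"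
  proof -
    have "(\<Sum>m<M. \<Sum>j\<in>UNIV. lam j * (cmod (trig N x (grid N m) $ j))\<^sup>2) =
        (\<Sum>j\<in>UNIV. lam j * (\<Sum>m<M. (cmod (trig N x (grid N m) $ j))\<^sup>2))"
      by (subst sum.swap) (simp add: sum_distrib_left)
    then show ?thesis by (simp add: sum_subtractf sum_distrib_left[symmetric])
  qed
  also have "(\<Sum>j\<in>UNIV. lam j * (\<Sum>m<M. (cmod (trig N x (grid N m) $ j))\<^sup>2)) =
      real M * (\<Sum>\<iota>\<in>modes N. lam (fst (snd \<iota>)) * (x \<iota>)\<^sup>2)"
  proof -
    have "(\<Sum>j\<in>UNIV. lam j * (\<Sum>m<M. (cmod (trig N x (grid N m) $ j))\<^sup>2)) =
        real M * (\<Sum>j\<in>UNIV. \<Sum>k=-int N..int N. lam j * (cmod (coef x k j))\<^sup>2)"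
      unfolding M_def sum_trig_norm_square by (simp only: sum_distrib_left mult_ac)
    also have "(\<Sum>j\<in>UNIV. \<Sum>k=-int N..int N. lam j * (cmod (coef x k j))\<^sup>2) =
        (\<Sum>\<iota>\<in>modes N. lam (fst (snd \<iota>)) * (x \<iota>)\<^sup>2)"
      using sum_modes_coef[of "\<lambda>k j. lam j" x N] by (subst sum.swap) simp
    finally show ?thesis .
  qed
  finally have "a * (\<Sum>\<iota>\<in>modes N. lam (fst (snd \<iota>)) * (x \<iota>)\<^sup>2) - C \<le> (\<Sum>m<M. H (trig N x (grid N m))) / real M"
    using M by (simp add: le_divide_eq algebra_simps)
  then show ?thesis
    unfolding act_def M_def[symmetric] using sum_modes_coef[of "\<lambda>k j. of_int k" x N] by simp
qed

text \<open>The positive modes carry the ellipsoid; the box is spanned by the nonpositive modes and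
  the single mode of frequency 1 in the coordinate \<open>i\<close>, along which a slope above \<pi>
  drives the action down. The level \<beta> is fixed before \<open>N\<close> and \<delta>: it is
  what survives the limit.\<close>

lemma galerkin_critical:
  fixes H :: "complex ^ 'n::finite \<Rightarrow> real" and i :: 'n
  assumes der: "\<And>z. (H has_derivative (\<lambda>v. gH z \<bullet> v)) (at z)"
    and uc: "uniformly_continuous_on UNIV gH"
    and H0: "\<And>z. 0 \<le> H z" and H4: "\<And>z. H z \<le> C4 * norm z ^ 4" and C4: "0 < C4"
    and lower: "\<And>z. a * (\<Sum>j\<in>UNIV. lam j * (cmod (z $ j))\<^sup>2) - C \<le> H z"
    and a: "pi < a" and lam: "lam i = 1" "\<And>j. \<kappa> \<le> lam j" "0 < \<kappa>"
  shows "\<exists>\<beta>>0. \<forall>N\<ge>1. \<forall>\<delta>>0. \<exists>x. \<beta> < act H N x \<and>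
    (\<Sum>k=-int N..int N. \<Sum>j\<in>UNIV. (cmod (gradc gH N x k j))\<^sup>2) \<le> \<delta>\<^sup>2"
proof -
  define D where "D = C4 * real CARD('n)"
  have D: "0 < D" using C4 by (simp add: D_def)
  \<comment> \<open>With this radius the quartic loss is half of \<pi> \<alpha>^2.\<close>
  define \<alpha> where "\<alpha> = sqrt (pi / (2 * D))"
  have \<alpha>: "0 < \<alpha>" "\<alpha>\<^sup>2 = pi / (2 * D)" using D by (auto simp: \<alpha>_def)
  define \<beta> where "\<beta> = pi * \<alpha>\<^sup>2 / 2"
  have \<beta>: "0 < \<beta>" using \<alpha>(1) by (simp add: \<beta>_def)
  have \<beta>': "pi * \<alpha>\<^sup>2 - C4 * real CARD('n) * \<alpha> ^ 4 = \<beta>"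
  proof -
    have "D * \<alpha> ^ 4 = D * (\<alpha>\<^sup>2 * \<alpha>\<^sup>2)" by (simp add: power4_eq_xxxx power2_eq_square)
    also have "\<dots> = pi * \<alpha>\<^sup>2 / 2" using D by (subst (1) \<alpha>(2)) simp
    finally show ?thesis by (simp add: D_def \<beta>_def)
  qed
  have a0: "0 < a" using a pi_gt_zero by linarith
  \<comment> \<open>The two inequalities absorb the constant \<open>C\<close>: on the face where the
    distinguished mode equals \<open>R\<close>, and on the faces where a mode of \<open>W\<close>
    has modulus \<open>R\<close>.\<close>
  obtain R where R: "\<alpha> < R" "C \<le> (a - pi) * R\<^sup>2" "C \<le> a * \<kappa> * R\<^sup>2"
  proof -
    define q where "q = min (a - pi) (a * \<kappa>)"
    have q: "0 < q" using a a0 lam(3) by (auto simp: q_def)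
    define R where "R = \<alpha> + 1 + sqrt (\<bar>C\<bar> / q)"
    have sq: "0 \<le> sqrt (\<bar>C\<bar> / q)" using q by simp
    have "\<bar>C\<bar> / q = (sqrt (\<bar>C\<bar> / q))\<^sup>2" using q by simp
    also have "\<dots> \<le> R\<^sup>2" using \<alpha>(1) sq by (intro power_mono) (auto simp: R_def)
    finally have "\<bar>C\<bar> \<le> q * R\<^sup>2" using q by (simp add: divide_le_eq mult.commute)
    moreover have "q * R\<^sup>2 \<le> (a - pi) * R\<^sup>2" "q * R\<^sup>2 \<le> a * \<kappa> * R\<^sup>2"
      by (auto simp: q_def intro!: mult_right_mono)
    moreover have "\<alpha> < R" unfolding R_def using sq by linarith
    ultimately show ?thesis by (intro that[of R]) linarith+
  qed
  have contH: "continuous_on UNIV H"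
    using der has_derivative_continuous by (blast intro: continuous_at_imp_continuous_on)
  have "\<exists>x. \<beta> / 2 < act H N x \<and>
    (\<Sum>k=-int N..int N. \<Sum>j\<in>UNIV. (cmod (gradc gH N x k j))\<^sup>2) \<le> \<delta>\<^sup>2" if N: "1 \<le> N" and \<delta>: "0 < \<delta>" for N \<delta>
  proof -
    define W where "W = {\<iota> \<in> (modes N :: (int \<times> 'n \<times> bool) set). fst \<iota> \<le> 0}"
    define e where "e = (1::int, i, True)"
    have e: "e \<in> modes N" "e \<notin> W" "fst e = 1" "fst (snd e) = i" using N by (auto simp: e_def modes_def W_def)
    have IW: "modes N - W = {\<iota> \<in> modes N. 1 \<le> fst \<iota>}" by (auto simp: W_def)
    have "\<exists>x. (\<forall>\<iota>. \<iota> \<notin> modes N \<longrightarrow> x \<iota> = 0) \<and> \<beta> / 2 < act H N x \<and> L2_set (grad gH N x) (modes N) \<le> \<delta>"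
    proof (rule linking[where W = W and e = e and w = "\<lambda>\<iota>. of_int (fst \<iota>)" and R = R and \<alpha> = \<alpha>])
      show "continuous_on UNIV (act H N)" by (rule continuous_act[OF contH])
      show "continuous_on UNIV (\<lambda>x. grad gH N x \<iota>)" for \<iota>
        by (rule continuous_grad[OF uniformly_continuous_imp_continuous[OF uc]])
      show "((\<lambda>t. act H N (\<lambda>\<iota>. x \<iota> + t * v \<iota>)) has_real_derivative
        (\<Sum>\<iota>\<in>modes N. grad gH N (\<lambda>\<iota>. x \<iota> + t * v \<iota>) \<iota> * v \<iota>)) (at t)" for x v t
        by (rule act_deriv[OF der])
      show "\<exists>d>0. \<forall>x y. L2_set (\<lambda>\<iota>. x \<iota> - y \<iota>) (modes N) < d \<longrightarrow>
        L2_set (\<lambda>\<iota>. grad gH N x \<iota> - grad gH N y \<iota>) (modes N) < \<epsilon>" if "0 < \<epsilon>" for \<epsilon>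
        by (rule grad_unif[OF uc that])
    next
      fix x :: "int \<times> 'n \<times> bool \<Rightarrow> real"
      assume x0: "\<And>\<iota>. \<iota> \<notin> modes N - W \<Longrightarrow> x \<iota> = 0"
        and xs: "(\<Sum>\<iota>\<in>modes N - W. of_int (fst \<iota>) * (x \<iota>)\<^sup>2) = \<alpha>\<^sup>2"
      have "(\<Sum>\<iota>\<in>modes N. of_int (fst \<iota>) * (x \<iota>)\<^sup>2) = \<alpha>\<^sup>2"
        unfolding xs[symmetric] by (rule sum.mono_neutral_right) (auto simp: x0)
      then have "(\<Sum>k=-int N..int N. \<Sum>j\<in>UNIV. of_int k * (cmod (coef x k j))\<^sup>2) = \<alpha>\<^sup>2"
        using sum_modes_coef[of "\<lambda>k j. of_int k" x N] by simp
      then show "\<beta> \<le> act H N x"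
        unfolding \<beta>'[symmetric] using x0 C4 by (intro galerkin_lower H4) (auto simp: IW)
    next
      fix x :: "int \<times> 'n \<times> bool \<Rightarrow> real"
      assume x0: "\<And>\<iota>. \<iota> \<notin> insert e W \<Longrightarrow> x \<iota> = 0"
        and bd: "x e = 0 \<or> x e = R \<or> (\<exists>\<iota>\<in>W. \<bar>x \<iota>\<bar> = R)"
      have fW: "finite W" by (simp add: W_def)
      have red: "(\<Sum>\<iota>\<in>modes N. f \<iota> * (x \<iota>)\<^sup>2) = f e * (x e)\<^sup>2 + (\<Sum>\<iota>\<in>W. f \<iota> * (x \<iota>)\<^sup>2)" for f
      proof -
        have "(\<Sum>\<iota>\<in>modes N. f \<iota> * (x \<iota>)\<^sup>2) = (\<Sum>\<iota>\<in>insert e W. f \<iota> * (x \<iota>)\<^sup>2)"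
          using e(1) by (intro sum.mono_neutral_right) (auto simp: x0 W_def)
        then show ?thesis using fW e(2) by simp
      qed
      have W1: "(\<Sum>\<iota>\<in>W. of_int (fst \<iota>) * (x \<iota>)\<^sup>2) \<le> 0"
        by (intro sum_nonpos mult_nonpos_nonneg) (auto simp: W_def)
      have lam0: "0 < lam j" for j using lam(2)[of j] lam(3) by simp
      have W2: "0 \<le> (\<Sum>\<iota>\<in>W. lam (fst (snd \<iota>)) * (x \<iota>)\<^sup>2)"
        using lam0 by (intro sum_nonneg mult_nonneg_nonneg) (auto intro: less_imp_le)
      have k1: "(\<Sum>\<iota>\<in>modes N. of_int (fst \<iota>) * (x \<iota>)\<^sup>2) \<le> (x e)\<^sup>2"
        unfolding red using W1 e by simp
      have up: "act H N x \<le> (pi - a) * (x e)\<^sup>2 - a * (\<Sum>\<iota>\<in>W. lam (fst (snd \<iota>)) * (x \<iota>)\<^sup>2) + C"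
      proof -
        have "act H N x \<le> pi * (x e)\<^sup>2 - a * ((x e)\<^sup>2 + (\<Sum>\<iota>\<in>W. lam (fst (snd \<iota>)) * (x \<iota>)\<^sup>2)) + C"
        proof -
          have "pi * (\<Sum>\<iota>\<in>modes N. of_int (fst \<iota>) * (x \<iota>)\<^sup>2) \<le> pi * (x e)\<^sup>2"
            by (rule mult_left_mono[OF k1]) simp
          moreover have "act H N x \<le> pi * (\<Sum>\<iota>\<in>modes N. of_int (fst \<iota>) * (x \<iota>)\<^sup>2)
              - a * ((x e)\<^sup>2 + (\<Sum>\<iota>\<in>W. lam (fst (snd \<iota>)) * (x \<iota>)\<^sup>2)) + C"
            using galerkin_upper[OF lower, of N x] e lam(1)
            unfolding red[of "\<lambda>\<iota>. lam (fst (snd \<iota>))"] by simp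
          ultimately show ?thesis by linarith
        qed
        then show ?thesis by (simp add: algebra_simps)
      qed
      show "act H N x \<le> 0"
      proof (cases "x e = 0")
        case True
        have "(\<Sum>k=-int N..int N. \<Sum>j\<in>UNIV. of_int k * (cmod (coef x k j))\<^sup>2) \<le> 0"
          using sum_modes_coef[of "\<lambda>k j. of_int k" x N] k1 True by simp
        moreover have "0 \<le> (\<Sum>m<2 * N + 1. H (trig N x (grid N m))) / real (2 * N + 1)"
          by (intro divide_nonneg_nonneg sum_nonneg H0) auto
        ultimately show ?thesis unfolding act_def
          by (smt (verit) mult_nonneg_nonpos pi_ge_zero)
      next
        case False
        show ?thesis
        proof (cases "x e = R")
          case True
          have "0 \<le> a * (\<Sum>\<iota>\<in>W. lam (fst (snd \<iota>)) * (x \<iota>)\<^sup>2)"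
            using W2 a0 by (intro mult_nonneg_nonneg) auto
          then show ?thesis using up R(2) True by (simp add: left_diff_distrib)
        next
          case F2: False
          then obtain \<iota> where \<iota>: "\<iota> \<in> W" "\<bar>x \<iota>\<bar> = R" using False bd by blast
          have "\<kappa> * R\<^sup>2 \<le> lam (fst (snd \<iota>)) * (x \<iota>)\<^sup>2"
            unfolding \<iota>(2)[symmetric] using lam(2) by (simp add: mult_right_mono)
          also have "\<dots> \<le> (\<Sum>\<iota>\<in>W. lam (fst (snd \<iota>)) * (x \<iota>)\<^sup>2)"
            using lam0 fW \<iota>(1) by (intro member_le_sum mult_nonneg_nonneg) (auto intro: less_imp_le)
          finally have "a * (\<kappa> * R\<^sup>2) \<le> a * (\<Sum>\<iota>\<in>W. lam (fst (snd \<iota>)) * (x \<iota>)\<^sup>2)"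
            using a0 by (intro mult_left_mono) auto
          moreover have "(pi - a) * (x e)\<^sup>2 \<le> 0" using a by (intro mult_nonpos_nonneg) auto
          ultimately show ?thesis using up R(3) by (simp add: mult.assoc)
        qed
      qed
    qed (use e \<alpha> R \<beta> \<delta> in \<open>auto simp: W_def\<close>)
    then obtain x where x: "\<beta> / 2 < act H N x" "L2_set (grad gH N x) (modes N) \<le> \<delta>" by blast
    have "(\<Sum>k=-int N..int N. \<Sum>j\<in>UNIV. (cmod (gradc gH N x k j))\<^sup>2) = (L2_set (grad gH N x) (modes N))\<^sup>2"
      unfolding L2_set_def grad_def by (simp add: sum_nonneg sum_modes pt_def cmod_power2 del: sum.cong)
    also have "\<dots> \<le> \<delta>\<^sup>2" using x(2) by (intro power_mono) auto
    finally show ?thesis using x(1) by blast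
  qed
  then show ?thesis using \<beta> by (intro exI[of _ "\<beta> / 2"]) auto
qed

text \<open>Non-resonance makes the linear part of the gradient invertible with a gain of one power
  of the frequency, and Bessel's inequality on the grid controls the bounded remainder
  \<open>b\<close>. This is an H^1 bound on almost critical loops, uniform in
  \<open>N\<close>.\<close>

lemma galerkin_bound:
  fixes gH b :: "complex ^ 'n::finite \<Rightarrow> complex ^ 'n"
  assumes gH: "\<And>z. gH z = (\<chi> j. of_real (2 * a * lam j) * z $ j) + b z"
    and B: "\<And>z. norm (b z) \<le> B"
    and c: "0 < c" "\<And>k j. c * (1 + \<bar>of_int k\<bar>) \<le> \<bar>2 * pi * of_int k - 2 * a * lam j\<bar>"
    and small: "(\<Sum>k=-int N..int N. \<Sum>j\<in>UNIV. (cmod (gradc gH N x k j))\<^sup>2) \<le> \<delta>\<^sup>2"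
  shows "(\<Sum>k=-int N..int N. \<Sum>j\<in>UNIV. ((1 + \<bar>of_int k\<bar>) * cmod (coef x k j))\<^sup>2) \<le> 2 * (\<delta>\<^sup>2 + B\<^sup>2) / c\<^sup>2"
proof -
  define M where "M = 2 * N + 1"
  have M: "0 < M" by (simp add: M_def)
  define bh where "bh k j = dft M (\<lambda>m. b (trig N x (grid N m)) $ j) k" for k j
  have eq: "gradc gH N x k j + bh k j = of_real (2 * pi * of_int k - 2 * a * lam j) * coef x k j"
    if k: "k \<in> {-int N..int N}" for k j
  proof -
    have "dft M (\<lambda>m. gH (trig N x (grid N m)) $ j) k =
        of_real (2 * a * lam j) * dft M (\<lambda>m. trig N x (grid N m) $ j) k + bh k j"
      unfolding gH bh_def vector_add_component vec_lambda_beta dft_add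
      by (simp add: dft_def sum_distrib_left mult_ac)
    then show ?thesis
      unfolding gradc_def M_def[symmetric] using dft_trig[OF k, of x j] by (simp add: M_def algebra_simps)
  qed
  have each: "((1 + \<bar>of_int k\<bar>) * cmod (coef x k j))\<^sup>2 \<le> (2 * (cmod (gradc gH N x k j))\<^sup>2 + 2 * (cmod (bh k j))\<^sup>2) / c\<^sup>2"
    if k: "k \<in> {-int N..int N}" for k j
  proof -
    have "c * ((1 + \<bar>of_int k\<bar>) * cmod (coef x k j)) \<le> \<bar>2 * pi * of_int k - 2 * a * lam j\<bar> * cmod (coef x k j)"
      using mult_right_mono[OF c(2)[of k j]] by (simp add: mult.assoc)
    also have "\<dots> = cmod (gradc gH N x k j + bh k j)"
      unfolding eq[OF k] norm_mult norm_of_real ..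
    also have "\<dots> \<le> cmod (gradc gH N x k j) + cmod (bh k j)" by (rule norm_triangle_ineq)
    finally have "(c * ((1 + \<bar>of_int k\<bar>) * cmod (coef x k j)))\<^sup>2 \<le> (cmod (gradc gH N x k j) + cmod (bh k j))\<^sup>2"
      using c(1) by (intro power_mono mult_nonneg_nonneg) auto
    also have "\<dots> \<le> 2 * (cmod (gradc gH N x k j))\<^sup>2 + 2 * (cmod (bh k j))\<^sup>2"
      using sum_squares_bound[of "cmod (gradc gH N x k j)" "cmod (bh k j)"] by (simp add: power2_sum)
    finally show ?thesis using c(1) by (simp add: pos_le_divide_eq power_mult_distrib mult.commute)
  qed
  have bes: "(\<Sum>k=-int N..int N. \<Sum>j\<in>UNIV. (cmod (bh k j))\<^sup>2) \<le> B\<^sup>2"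
  proof -
    have "real M * (\<Sum>k=-int N..int N. \<Sum>j\<in>UNIV. (cmod (bh k j))\<^sup>2) =
       (\<Sum>j\<in>UNIV. real M * (\<Sum>k=-int N..int N. (cmod (bh k j))\<^sup>2))"
      by (subst sum.swap) (simp add: sum_distrib_left)
    also have "\<dots> \<le> (\<Sum>j\<in>UNIV. \<Sum>m<M. (cmod (b (trig N x (grid N m)) $ j))\<^sup>2)"
    proof (rule sum_mono)
      fix j
      show "real M * (\<Sum>k=-int N..int N. (cmod (bh k j))\<^sup>2) \<le> (\<Sum>m<M. (cmod (b (trig N x (grid N m)) $ j))\<^sup>2)"
        unfolding bh_def M_def by (rule bessel_grid) (simp, simp, rule grid_not_dvd)
    qed
    also have "\<dots> = (\<Sum>m<M. (norm (b (trig N x (grid N m))))\<^sup>2)"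
      unfolding norm_power2_vec by (rule sum.swap)
    also have "\<dots> \<le> (\<Sum>m<M. B\<^sup>2)" by (intro sum_mono power_mono B) auto
    finally show ?thesis using M by simp
  qed
  have "(\<Sum>k=-int N..int N. \<Sum>j\<in>UNIV. ((1 + \<bar>of_int k\<bar>) * cmod (coef x k j))\<^sup>2) \<le>
      (\<Sum>k=-int N..int N. \<Sum>j\<in>UNIV. (2 * (cmod (gradc gH N x k j))\<^sup>2 + 2 * (cmod (bh k j))\<^sup>2) / c\<^sup>2)"
    by (intro sum_mono each)
  also have "\<dots> = (2 * (\<Sum>k=-int N..int N. \<Sum>j\<in>UNIV. (cmod (gradc gH N x k j))\<^sup>2) +
      2 * (\<Sum>k=-int N..int N. \<Sum>j\<in>UNIV. (cmod (bh k j))\<^sup>2)) / c\<^sup>2"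
    by (simp add: sum_divide_distrib[symmetric] sum.distrib sum_distrib_left)
  also have "\<dots> \<le> 2 * (\<delta>\<^sup>2 + B\<^sup>2) / c\<^sup>2"
    using small bes by (intro divide_right_mono) auto
  finally show ?thesis .
qed

section \<open>Passage to the limit\<close>

lemma riemann_sum_error:
  fixes f :: "real \<Rightarrow> 'a::banach"
  assumes cont: "continuous_on {0..1} f" and "0 < e"
  shows "\<exists>d>0. \<forall>M>0. 1 / real M < d \<longrightarrow>
    norm (integral {0..1} f - (1 / real M) *\<^sub>R (\<Sum>m<M. f (real m / real M))) \<le> e"
proof -
  have "uniformly_continuous_on {0..1} f"
    using cont compact_Icc by (rule compact_uniformly_continuous)
  then obtain d where d: "0 < d" and
    uc: "\<And>s t. s \<in> {0..1} \<Longrightarrow> t \<in> {0..1} \<Longrightarrow> dist t s < d \<Longrightarrow> dist (f t) (f s) < e"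
    using \<open>0 < e\<close> unfolding uniformly_continuous_on_def by metis
  have "norm (integral {0..1} f - (1 / real M) *\<^sub>R (\<Sum>m<M. f (real m / real M))) \<le> e"
    if M: "0 < M" "1 / real M < d" for M :: nat
  proof -
    define F where "F m = integral {0..real m / real M} f" for m :: nat
    have piece: "norm (F (Suc m) - F m - (1 / real M) *\<^sub>R f (real m / real M)) \<le> e * (1 / real M)" if m: "m < M" for m
    proof -
      define a b where "a = real m / real M" and "b = real (Suc m) / real M"
      have ab: "0 \<le> a" "a \<le> b" "b \<le> 1" "b - a = 1 / real M"
        using M m by (auto simp: field_simps a_def b_def)
      have sub: "{a..b} \<subseteq> {0..1}" "{0..b} \<subseteq> {0..1}" using ab by auto
      have "F m + integral {a..b} f = F (Suc m)"
        unfolding F_def a_def[symmetric] b_def[symmetric] using ab(1,2)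
        by (rule Henstock_Kurzweil_Integration.integral_combine)
          (rule integrable_continuous_real[OF continuous_on_subset[OF cont sub(2)]])
      then have "F (Suc m) - F m = integral {a..b} f" by (simp add: algebra_simps)
      also have "\<dots> - (1 / real M) *\<^sub>R f a = integral {a..b} (\<lambda>t. f t - f a)"
        using ab by (subst Henstock_Kurzweil_Integration.integral_diff)
          (auto intro!: integrable_continuous_real continuous_on_subset[OF cont sub(1)])
      finally have eq: "F (Suc m) - F m - (1 / real M) *\<^sub>R f a = integral {a..b} (\<lambda>t. f t - f a)" .
      have "norm (integral {a..b} (\<lambda>t. f t - f a)) \<le> e * (b - a)"
      proof (rule integral_bound)
        show "continuous_on {a..b} (\<lambda>t. f t - f a)"
          by (intro continuous_intros continuous_on_subset[OF cont sub(1)])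
        show "norm (f t - f a) \<le> e" if "t \<in> {a..b}" for t
        proof -
          have "dist t a < d" using that ab M by (auto simp: dist_real_def)
          then have "dist (f t) (f a) < e" using that ab by (intro uc) auto
          then show ?thesis by (simp add: dist_norm)
        qed
      qed (use ab in auto)
      then show ?thesis unfolding a_def[symmetric] eq ab(4) .
    qed
    have "(\<Sum>m<M. F (Suc m) - F m) = integral {0..1} f"
      using M by (subst sum_lessThan_telescope) (simp add: F_def)
    then have "integral {0..1} f - (1 / real M) *\<^sub>R (\<Sum>m<M. f (real m / real M)) =
        (\<Sum>m<M. F (Suc m) - F m - (1 / real M) *\<^sub>R f (real m / real M))"
      by (simp add: sum_subtractf scaleR_sum_right)
    also have "norm \<dots> \<le> (\<Sum>m<M. e * (1 / real M))"
      by (rule order_trans[OF norm_sum], rule sum_mono, rule piece) simp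
    finally show ?thesis using M by simp
  qed
  with d show ?thesis by blast
qed

lemma riemann_sum_limit:
  fixes f :: "real \<Rightarrow> 'a::banach" and fn :: "nat \<Rightarrow> real \<Rightarrow> 'a" and Mn :: "nat \<Rightarrow> nat"
  assumes ul: "uniform_limit UNIV fn f sequentially" and cont: "continuous_on {0..1} f"
    and Mn: "filterlim Mn at_top sequentially"
  shows "(\<lambda>n. (1 / real (Mn n)) *\<^sub>R (\<Sum>m<Mn n. fn n (real m / real (Mn n)))) \<longlonglongrightarrow> integral {0..1} f"
proof (rule tendstoI)
  fix e :: real assume e: "0 < e"
  obtain d where d: "0 < d" and rs: "\<And>M. 0 < M \<Longrightarrow> 1 / real M < d \<Longrightarrow>
    norm (integral {0..1} f - (1 / real M) *\<^sub>R (\<Sum>m<M. f (real m / real M))) \<le> e / 3"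
    using riemann_sum_error[OF cont, of "e / 3"] e by auto
  have "\<forall>\<^sub>F n in sequentially. \<forall>t\<in>UNIV. dist (fn n t) (f t) < e / 3"
  proof -
    have "0 < e / 3" using e by simp
    with ul show ?thesis unfolding uniform_limit_iff by blast
  qed
  moreover have "\<forall>\<^sub>F n in sequentially. Suc (nat \<lceil>1 / d\<rceil>) \<le> Mn n"
    using Mn by (simp add: filterlim_at_top)
  ultimately show "\<forall>\<^sub>F n in sequentially. dist ((1 / real (Mn n)) *\<^sub>R (\<Sum>m<Mn n. fn n (real m / real (Mn n)))) (integral {0..1} f) < e"
  proof eventually_elim
    case (elim n)
    let ?M = "Mn n"
    have M: "0 < ?M" using elim by simp
    have "1 / d < real ?M" using elim(2) by linarith
    then have "1 / real ?M < d" using d M by (simp add: field_simps)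
    from rs[OF M this] have 1: "norm (integral {0..1} f - (1 / real ?M) *\<^sub>R (\<Sum>m<?M. f (real m / real ?M))) \<le> e / 3" .
    have "norm (\<Sum>m<?M. fn n (real m / real ?M) - f (real m / real ?M)) \<le> (\<Sum>m<?M. e / 3)"
      using elim(1) by (intro order_trans[OF norm_sum] sum_mono) (auto simp: dist_norm less_imp_le)
    then have "norm ((1 / real ?M) *\<^sub>R (\<Sum>m<?M. fn n (real m / real ?M) - f (real m / real ?M))) \<le> e / 3"
      using M by (simp add: field_simps)
    then have 2: "norm ((1 / real ?M) *\<^sub>R (\<Sum>m<?M. fn n (real m / real ?M)) - (1 / real ?M) *\<^sub>R (\<Sum>m<?M. f (real m / real ?M))) \<le> e / 3"
      by (simp add: sum_subtractf scaleR_diff_right)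
    show ?case
      using dist_triangle2[of "(1 / real ?M) *\<^sub>R (\<Sum>m<?M. fn n (real m / real ?M))" "integral {0..1} f"
          "(1 / real ?M) *\<^sub>R (\<Sum>m<?M. f (real m / real ?M))"] 1 2 e
      unfolding dist_norm by linarith
  qed
qed

section \<open>Trigonometric polynomials and uniqueness of Fourier coefficients\<close>

inductive trigpoly :: "(real \<Rightarrow> complex) \<Rightarrow> bool" where
  tp_ee: "trigpoly (ee k)"
| tp_add: "trigpoly f \<Longrightarrow> trigpoly g \<Longrightarrow> trigpoly (\<lambda>t. f t + g t)"
| tp_scale: "trigpoly f \<Longrightarrow> trigpoly (\<lambda>t. c * f t)"

lemma trigpoly_mult: "trigpoly f \<Longrightarrow> trigpoly g \<Longrightarrow> trigpoly (\<lambda>t. f t * g t)"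
proof (induction f rule: trigpoly.induct)
  case (tp_ee k)
  from tp_ee.prems show ?case
  proof (induction g rule: trigpoly.induct)
    case (tp_ee l)
    show ?case unfolding ee_mult by (rule trigpoly.tp_ee)
  next
    case (tp_add f g)
    then show ?case unfolding distrib_left by (intro trigpoly.tp_add)
  next
    case (tp_scale f c)
    then show ?case unfolding mult.left_commute[of _ c] by (intro trigpoly.tp_scale)
  qed
next
  case (tp_add f g)
  then show ?case unfolding distrib_right by (intro trigpoly.tp_add)
next
  case (tp_scale f c)
  then show ?case unfolding mult.assoc by (intro trigpoly.tp_scale)
qed

lemma continuous_on_ee [continuous_intros]: "continuous_on A (ee k)"
  unfolding ee_def by (intro continuous_intros)

lemma trigpoly_continuous: "trigpoly f \<Longrightarrow> continuous_on A f"
  by (induction rule: trigpoly.induct) (auto intro!: continuous_intros)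

lemma trigpoly_const: "trigpoly (\<lambda>t. c)"
  using tp_scale[OF tp_ee[of 0], of c] by simp

lemma trigpoly_real_polynomial:
  "real_polynomial_function p \<Longrightarrow> trigpoly (\<lambda>t. complex_of_real (p (ee 1 t)))"
proof (induction p rule: real_polynomial_function.induct)
  case (linear f)
  interpret bounded_linear f by fact
  have "complex_of_real (f (ee 1 t)) = of_real (f 1 / 2) * (ee 1 t + ee (- 1) t) + (of_real (f \<i>) * (- \<i> / 2)) * (ee 1 t + (- 1) * ee (- 1) t)" for t
  proof -
    have "ee 1 t = Re (ee 1 t) *\<^sub>R 1 + Im (ee 1 t) *\<^sub>R \<i>" by (simp add: complex_eq_iff)
    then have "f (ee 1 t) = Re (ee 1 t) * f 1 + Im (ee 1 t) * f \<i>" by (metis add scaleR real_scaleR_def)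
    then show ?thesis
      by (simp add: complex_eq_iff cnj_ee[of 1 t, symmetric, simplified])
  qed
  moreover have "trigpoly (\<lambda>t. of_real (f 1 / 2) * (ee 1 t + ee (- 1) t) + (of_real (f \<i>) * (- \<i> / 2)) * (ee 1 t + (- 1) * ee (- 1) t))"
    by (intro trigpoly.intros)
  ultimately show ?case by simp
next
  case (const c)
  show ?case by (rule trigpoly_const)
next
  case (add f g)
  then show ?case by (simp add: trigpoly.tp_add)
next
  case (mult f g)
  then show ?case by (simp add: trigpoly_mult)
qed

lemma trigpoly_dense:
  fixes E :: "real \<Rightarrow> complex"
  assumes cont: "continuous_on {0..1} E" and per: "E 0 = E 1" and "0 < e"
  shows "\<exists>p. trigpoly p \<and> (\<forall>t\<in>{0..1}. cmod (E t - p t) < e)"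
proof -
  define \<phi> where "\<phi> = E \<circ> (\<lambda>z. Arg2pi z / (2 * pi))"
  \<comment> \<open>A loop is homotopic to itself; the corresponding homotopy of circle maps yields
    the continuity of \<phi> on the whole circle, including the point 1 where \<open>Arg2pi\<close>
    jumps.\<close>
  have "homotopic_loops UNIV E E"
    using cont per by (simp add: homotopic_loops_refl path_def pathstart_def pathfinish_def)
  from homotopic_loops_imp_homotopic_circlemaps[OF this]
  have c\<phi>: "continuous_on (sphere 0 1) \<phi>"
    unfolding \<phi>_def using homotopic_with_imp_continuous by blast
  obtain g where g: "polynomial_function g" and close: "\<And>z. z \<in> sphere 0 1 \<Longrightarrow> cmod (\<phi> z - g z) < e"
    using Stone_Weierstrass_polynomial_function[OF compact_sphere c\<phi> \<open>0 < e\<close>] by blast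
  have "real_polynomial_function (Re \<circ> g)" "real_polynomial_function (Im \<circ> g)"
    using g bounded_linear_Re bounded_linear_Im unfolding polynomial_function_def by blast+
  from trigpoly_real_polynomial[OF this(1)] trigpoly_real_polynomial[OF this(2)]
  have "trigpoly (\<lambda>t. of_real (Re (g (ee 1 t))) + \<i> * of_real (Im (g (ee 1 t))))"
    by (intro trigpoly.intros) (simp_all add: o_def)
  then have tp: "trigpoly (\<lambda>t. g (ee 1 t))" by (simp flip: complex_eq)
  have 1: "cmod (E t - g (ee 1 t)) < e" if t: "0 \<le> t" "t < 1" for t
  proof -
    have "Arg2pi (ee 1 t) = 2 * pi * t"
      by (rule Arg2pi_unique[of 1]) (use t in \<open>auto simp: ee_def cis_conv_exp\<close>)
    then have "\<phi> (ee 1 t) = E t" by (simp add: \<phi>_def)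
    then show ?thesis using close[of "ee 1 t"] by simp
  qed
  have "cmod (E 1 - g (ee 1 1)) < e"
    using 1[of 0] ee_periodic[of 1 0] per by simp
  with 1 have "\<forall>t\<in>{0..1}. cmod (E t - g (ee 1 t)) < e"
    by (metis atLeastAtMost_iff less_eq_real_def)
  with tp show ?thesis by blast
qed

text \<open>Orthogonality to the exponentials extends to trigonometric polynomials; approximating
  the conjugate of \<open>E\<close> by one of them makes the integral of its squared modulus
  arbitrarily small.\<close>

lemma fourier_unique:
  fixes E :: "real \<Rightarrow> complex"
  assumes cont: "continuous_on {0..1} E" and per: "E 0 = E 1"
    and zero: "\<And>k. integral {0..1} (\<lambda>t. E t * ee k t) = 0"
    and t: "t \<in> {0..1}"
  shows "E t = 0"
proof -
  have tp0: "integral {0..1} (\<lambda>t. E t * p t) = 0" if "trigpoly p" for p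
    using that
  proof (induction p rule: trigpoly.induct)
    case (tp_ee k)
    show ?case by (rule zero)
  next
    case (tp_add f g)
    have "integral {0..1} (\<lambda>t. E t * f t + E t * g t) =
        integral {0..1} (\<lambda>t. E t * f t) + integral {0..1} (\<lambda>t. E t * g t)"
      using tp_add by (intro Henstock_Kurzweil_Integration.integral_add integrable_continuous_real continuous_intros cont trigpoly_continuous)
    then show ?case using tp_add by (simp add: distrib_left)
  next
    case (tp_scale f c)
    have "integral {0..1} (\<lambda>t. E t * (c * f t)) = integral {0..1} (\<lambda>t. c * (E t * f t))"
      by (simp add: mult_ac)
    then show ?case using tp_scale by simp
  qed
  obtain K where K: "0 < K" "\<And>t. t \<in> {0..1} \<Longrightarrow> cmod (E t) \<le> K"
    using compact_imp_bounded[OF compact_continuous_image[OF cont compact_Icc]]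
    unfolding bounded_pos by auto
  have small: "cmod (integral {0..1} (\<lambda>t. E t * cnj (E t))) \<le> e" if e: "0 < e" for e
  proof -
    have "continuous_on {0..1} (\<lambda>t. cnj (E t))" by (intro continuous_intros cont)
    then obtain p where p: "trigpoly p" "\<And>t. t \<in> {0..1} \<Longrightarrow> cmod (cnj (E t) - p t) < e / K"
      using trigpoly_dense[of "\<lambda>t. cnj (E t)" "e / K"] per e K(1) by auto
    have "integral {0..1} (\<lambda>t. E t * cnj (E t)) = integral {0..1} (\<lambda>t. E t * (cnj (E t) - p t) + E t * p t)"
      by (simp add: algebra_simps)
    also have "\<dots> = integral {0..1} (\<lambda>t. E t * (cnj (E t) - p t)) + integral {0..1} (\<lambda>t. E t * p t)"
      using p(1) by (intro Henstock_Kurzweil_Integration.integral_add integrable_continuous_real continuous_intros cont trigpoly_continuous)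
    finally have "cmod (integral {0..1} (\<lambda>t. E t * cnj (E t))) = cmod (integral {0..1} (\<lambda>t. E t * (cnj (E t) - p t)))"
      using tp0[OF p(1)] by simp
    also have "\<dots> \<le> K * (e / K) * (1 - 0)"
    proof (rule integral_bound)
      show "continuous_on {0..1} (\<lambda>t. E t * (cnj (E t) - p t))"
        using p(1) by (intro continuous_intros cont trigpoly_continuous)
      show "cmod (E t * (cnj (E t) - p t)) \<le> K * (e / K)" if "t \<in> {0..1}" for t
        unfolding norm_mult using K(1) K(2)[OF that] p(2)[OF that] by (intro mult_mono) (auto intro: less_imp_le)
    qed simp
    finally show ?thesis using K(1) by simp
  qed
  have sq: "((\<lambda>t. (cmod (E t))\<^sup>2) has_integral integral {0..1} (\<lambda>t. (cmod (E t))\<^sup>2)) {0..1}"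
    by (intro integrable_integral integrable_continuous_real continuous_intros cont)
  have "((\<lambda>t. E t * cnj (E t)) has_integral of_real (integral {0..1} (\<lambda>t. (cmod (E t))\<^sup>2))) {0..1}"
    unfolding cmod_square_cnj[symmetric] of_real_power[symmetric] by (rule has_integral_of_real[OF sq])
  then have "integral {0..1} (\<lambda>t. E t * cnj (E t)) = of_real (integral {0..1} (\<lambda>t. (cmod (E t))\<^sup>2))"
    by (rule integral_unique)
  then have "\<bar>integral {0..1} (\<lambda>t. (cmod (E t))\<^sup>2)\<bar> \<le> e" if "0 < e" for e
    using small[OF that] by simp
  then have "integral {0..1} (\<lambda>t. (cmod (E t))\<^sup>2) = 0"
    by (metis abs_le_zero_iff dense_le_bounded field_le_epsilon add_0)
  then have "\<forall>t\<in>{0..1}. (cmod (E t))\<^sup>2 = 0"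
    by (subst (asm) integral_eq_0_iff) (auto intro!: continuous_intros cont)
  with t show ?thesis by simp
qed

lemma integral_ee:
  assumes "k \<noteq> 0"
  shows "integral {0..1} (ee k) = 0"
proof -
  let ?c = "2 * pi * of_int k"
  have "((\<lambda>t. ee k t / (\<i> * of_real ?c)) has_vector_derivative ee k t) (at t within {0..1})" for t
  proof -
    have "(ee k has_vector_derivative (\<i> * of_real ?c) * ee k t) (at t within {0..1})"
      unfolding ee_def has_vector_derivative_def
      by (rule derivative_eq_intros refl | simp add: fun_eq_iff cis_conv_exp scaleR_conv_of_real)+
    from has_vector_derivative_divide[OF this, of "\<i> * of_real ?c"] show ?thesis using assms by simp
  qed
  then have "(ee k has_integral (ee k 1 / (\<i> * of_real ?c) - ee k 0 / (\<i> * of_real ?c))) {0..1}"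
    by (intro fundamental_theorem_of_calculus) auto
  moreover have "ee k 1 = 1" using ee_periodic[of k 0] by simp
  ultimately show ?thesis by (simp add: integral_unique)
qed

lemma ee_has_vector_derivative:
  "(ee k has_vector_derivative (2 * pi * of_int k * \<i>) * ee k t) (at t within S)"
  unfolding ee_def has_vector_derivative_def
  by (rule derivative_eq_intros refl | simp add: fun_eq_iff cis_conv_exp scaleR_conv_of_real)+

lemma fourier_constant:
  fixes E :: "real \<Rightarrow> complex"
  assumes cont: "continuous_on {0..1} E" and per: "E 0 = E 1"
    and zero: "\<And>k. k \<noteq> 0 \<Longrightarrow> integral {0..1} (\<lambda>t. E t * ee k t) = 0"
    and t: "t \<in> {0..1}"
  shows "E t = E 0"
proof -
  define c where "c = integral {0..1} E"
  have "E s - c = 0" if "s \<in> {0..1}" for s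
  proof (rule fourier_unique[of "\<lambda>s. E s - c"])
    show "integral {0..1} (\<lambda>t. (E t - c) * ee k t) = 0" for k
    proof -
      have "integral {0..1} (\<lambda>t. E t * ee k t - c * ee k t) = integral {0..1} (\<lambda>t. E t * ee k t) - integral {0..1} (\<lambda>t. c * ee k t)"
        by (intro Henstock_Kurzweil_Integration.integral_diff integrable_continuous_real continuous_intros cont)
      also have "\<dots> = 0"
        by (cases "k = 0") (auto simp: zero integral_ee c_def)
      finally show ?thesis by (simp add: left_diff_distrib)
    qed
  qed (use that per in \<open>auto intro!: continuous_intros cont\<close>)
  from this[OF t] this[of 0] show ?thesis by simp
qed

section \<open>Estimates uniform in the number of modes, and compactness\<close>

lemma norm_cis_diff_le: "cmod (cis a - cis b) \<le> \<bar>a - b\<bar>"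
proof -
  have "(cmod (cis a - cis b))\<^sup>2 = (2 * sin ((a - b) / 2))\<^sup>2"
  proof -
    have "sin ((b - a) / 2) = - sin ((a - b) / 2)"
      by (simp add: sin_minus[symmetric] minus_divide_left del: sin_minus)
    then have "(cmod (cis a - cis b))\<^sup>2 = (2 * sin ((a + b) / 2) * - sin ((a - b) / 2))\<^sup>2 +
        (2 * sin ((a - b) / 2) * cos ((a + b) / 2))\<^sup>2"
      by (simp add: cmod_power2 cos_diff_cos sin_diff_sin)
    also have "\<dots> = (2 * sin ((a - b) / 2))\<^sup>2 * ((sin ((a + b) / 2))\<^sup>2 + (cos ((a + b) / 2))\<^sup>2)"
      unfolding power2_eq_square by (simp only: distrib_left minus_mult_right[symmetric] minus_mult_left[symmetric] minus_minus mult_ac)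
    finally show ?thesis by simp
  qed
  also have "\<dots> \<le> (a - b)\<^sup>2"
    using abs_sin_x_le_abs_x[of "(a - b) / 2"] by (intro abs_le_square_iff[THEN iffD1]) (simp add: abs_mult)
  finally have "(cmod (cis a - cis b))\<^sup>2 \<le> \<bar>a - b\<bar>\<^sup>2" by simp
  then show ?thesis by (rule power2_le_imp_le) simp
qed

text \<open>For all but finitely many k the term 2 \<pi> |k|, which is at least 6 |k|, dominates
  both |\<theta>| and 1 + |k|; the remaining k have a positive minimum.\<close>

lemma nonresonance:
  assumes "\<And>k::int. 2 * pi * of_int k \<noteq> \<theta>"
  shows "\<exists>c>0. \<forall>k::int. c * (1 + \<bar>of_int k\<bar>) \<le> \<bar>2 * pi * of_int k - \<theta>\<bar>"
proof -
  define m where "m = \<lceil>\<bar>\<theta>\<bar> + 1\<rceil>"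
  define f where "f k = \<bar>2 * pi * of_int k - \<theta>\<bar> / (1 + \<bar>of_int k\<bar>)" for k :: int
  have fpos: "0 < f k" for k using assms[of k] by (auto simp: f_def intro!: divide_pos_pos)
  have m0: "0 \<le> m" unfolding m_def by linarith
  define c where "c = min 1 (Min (f ` {-m..m}))"
  have ne: "f ` {-m..m} \<noteq> {}" using m0 by simp
  have "0 < c" unfolding c_def using fpos ne by (subst min_less_iff_conj, subst Min_gr_iff) auto
  moreover have "c * (1 + \<bar>of_int k\<bar>) \<le> \<bar>2 * pi * of_int k - \<theta>\<bar>" for k :: int
  proof (cases "k \<in> {-m..m}")
    case True
    then have "c \<le> f k" unfolding c_def by (intro min.coboundedI2 Min_le) auto
    then show ?thesis by (simp add: f_def pos_le_divide_eq add_pos_nonneg)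
  next
    case False
    then have "m < \<bar>k\<bar>" by auto
    then have k: "\<bar>\<theta>\<bar> + 1 \<le> \<bar>real_of_int k\<bar>" unfolding m_def by linarith
    have "c * (1 + \<bar>of_int k\<bar>) \<le> 1 * (1 + \<bar>real_of_int k\<bar>)"
      by (intro mult_right_mono) (auto simp: c_def)
    also have "\<dots> \<le> 6 * \<bar>real_of_int k\<bar> - \<bar>\<theta>\<bar>" using k by simp
    also have "\<dots> \<le> \<bar>2 * pi * of_int k\<bar> - \<bar>\<theta>\<bar>"
      using pi_gt3 by (simp add: abs_mult mult_right_mono)
    also have "\<dots> \<le> \<bar>2 * pi * of_int k - \<theta>\<bar>" by linarith
    finally show ?thesis .
  qed
  ultimately show ?thesis by blast
qed

lemma nonresonance_all:
  assumes "\<And>(k::int) (j::'n::finite). 2 * pi * of_int k \<noteq> \<theta> j"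
  shows "\<exists>c>0. \<forall>(k::int) j. c * (1 + \<bar>of_int k\<bar>) \<le> \<bar>2 * pi * of_int k - \<theta> j\<bar>"
proof -
  have "\<forall>j. \<exists>c>0. \<forall>k::int. c * (1 + \<bar>of_int k\<bar>) \<le> \<bar>2 * pi * of_int k - \<theta> j\<bar>"
    using nonresonance assms by blast
  from choice[OF this] obtain c where c: "\<forall>j. 0 < c j \<and> (\<forall>k::int. c j * (1 + \<bar>of_int k\<bar>) \<le> \<bar>2 * pi * of_int k - \<theta> j\<bar>)"
    by (rule exE)
  have "0 < Min (range c)" using c by (subst Min_gr_iff) auto
  moreover have "Min (range c) * (1 + \<bar>of_int k\<bar>) \<le> \<bar>2 * pi * of_int k - \<theta> j\<bar>" for k :: int and j
  proof -
    have "Min (range c) * (1 + \<bar>real_of_int k\<bar>) \<le> c j * (1 + \<bar>of_int k\<bar>)"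
      by (intro mult_right_mono Min_le) auto
    then show ?thesis using c by (meson order_trans)
  qed
  ultimately show ?thesis by blast
qed

text \<open>The exponent is 2 - 1/2: half a power of the frequency is given up in
  \<open>trig_bound\<close> for a modulus of continuity, and the rest is still summable.\<close>

lemma weight_sum_bound: "\<exists>Q>0. \<forall>N. (\<Sum>k=-int N..int N. (1 + \<bar>real_of_int k\<bar>) powr (-3/2)) \<le> Q"
proof -
  define f where "f n = (1 + real n) powr (-3/2)" for n :: nat
  have "summable (\<lambda>n. real (Suc n) powr (-3/2))"
    using summable_real_powr_iff[of "-3/2"] by (subst summable_Suc_iff) simp
  moreover have "f = (\<lambda>n. real (Suc n) powr (-3/2))" by (simp add: f_def fun_eq_iff)
  ultimately have sf: "summable f" by simp
  have f0: "0 \<le> f n" for n by (simp add: f_def)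
  have "(\<Sum>k=-int N..int N. (1 + \<bar>real_of_int k\<bar>) powr (-3/2)) \<le> 2 * (\<Sum>n\<le>N. f n)" for N
  proof (induction N)
    case 0
    show ?case by (simp add: f_def)
  next
    case (Suc N)
    have "{-int (Suc N)..int (Suc N)} = insert (-int (Suc N)) (insert (int (Suc N)) {-int N..int N})" by auto
    then show ?case using Suc by (simp add: f_def)
  qed
  moreover have "(\<Sum>n\<le>N. f n) \<le> suminf f" for N
    using f0 sf by (intro sum_le_suminf) auto
  ultimately have bound: "(\<Sum>k=-int N..int N. (1 + \<bar>real_of_int k\<bar>) powr (-3/2)) \<le> 2 * suminf f + 1" for N
  proof -
    have "(\<Sum>k=-int N..int N. (1 + \<bar>real_of_int k\<bar>) powr (-3/2)) \<le> 2 * (\<Sum>n\<le>N. f n)"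
      "(\<Sum>n\<le>N. f n) \<le> suminf f" by fact+
    then show ?thesis by linarith
  qed
  moreover have "0 < 2 * suminf f + 1" using suminf_nonneg[OF sf f0] by simp
  ultimately show ?thesis by blast
qed

lemma coef_sum_le:
  assumes K: "(\<Sum>k=-int N..int N. \<Sum>j\<in>UNIV. ((1 + \<bar>real_of_int k\<bar>) * cmod (coef x k j))\<^sup>2) \<le> K"
  shows "(\<Sum>k=-int N..int N. cmod (coef x k j) * d k) \<le> sqrt K * sqrt (\<Sum>k=-int N..int N. (d k / (1 + \<bar>real_of_int k\<bar>))\<^sup>2)"
proof -
  have "(\<Sum>k=-int N..int N. cmod (coef x k j) * d k) =
      (\<Sum>k=-int N..int N. ((1 + \<bar>real_of_int k\<bar>) * cmod (coef x k j)) * (d k / (1 + \<bar>real_of_int k\<bar>)))"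
    by (intro sum.cong refl) (simp add: add_nonneg_eq_0_iff)
  also have "\<dots> \<le> sqrt (\<Sum>k=-int N..int N. ((1 + \<bar>real_of_int k\<bar>) * cmod (coef x k j))\<^sup>2) * sqrt (\<Sum>k=-int N..int N. (d k / (1 + \<bar>real_of_int k\<bar>))\<^sup>2)"
    unfolding real_sqrt_mult[symmetric] by (intro real_le_rsqrt Cauchy_Schwarz_ineq_sum)
  also have "\<dots> \<le> sqrt K * sqrt (\<Sum>k=-int N..int N. (d k / (1 + \<bar>real_of_int k\<bar>))\<^sup>2)"
  proof (intro mult_right_mono real_sqrt_le_mono)
    have "(\<Sum>k=-int N..int N. ((1 + \<bar>real_of_int k\<bar>) * cmod (coef x k j))\<^sup>2) \<le>
        (\<Sum>k=-int N..int N. \<Sum>j\<in>UNIV. ((1 + \<bar>real_of_int k\<bar>) * cmod (coef x k j))\<^sup>2)"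
      by (intro sum_mono member_le_sum) auto
    then show "(\<Sum>k=-int N..int N. ((1 + \<bar>real_of_int k\<bar>) * cmod (coef x k j))\<^sup>2) \<le> K" using K by simp
  qed (simp add: sum_nonneg)
  finally show ?thesis .
qed

text \<open>The H^1 bound yields a common Hoelder modulus of exponent 1/4, because the squared
  distance of \<open>ee k t\<close> and \<open>ee k s\<close> is at most 4 sqrt (\<pi> |k| |t -
  s|).\<close>

lemma trig_bound:
  assumes K: "(\<Sum>k=-int N..int N. \<Sum>j\<in>UNIV. ((1 + \<bar>real_of_int k\<bar>) * cmod (coef x k j))\<^sup>2) \<le> K"
    and Q: "(\<Sum>k=-int N..int N. (1 + \<bar>real_of_int k\<bar>) powr (-3/2)) \<le> Q"
  shows "norm (trig N x t :: complex ^ 'n::finite) \<le> real CARD('n) * (sqrt K * sqrt Q)"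
    and "norm (trig N x t - trig N x s :: complex ^ 'n::finite) \<le> real CARD('n) * (sqrt K * sqrt (4 * sqrt (pi * \<bar>t - s\<bar>) * Q))"
proof -
  have K0: "0 \<le> K" by (rule order_trans[OF _ K]) (intro sum_nonneg, simp)
  let ?w = "\<lambda>k. (1 + \<bar>real_of_int k\<bar>)"
  have w: "sqrt \<bar>real_of_int k\<bar> / (?w k)\<^sup>2 \<le> ?w k powr (-3/2)" "1 / (?w k)\<^sup>2 \<le> ?w k powr (-3/2)" for k
  proof -
    have pos: "0 < ?w k" by (simp add: add_pos_nonneg)
    have "?w k powr (-3/2) = ?w k powr (1/2 - 2)" by simp
    also have "\<dots> = ?w k powr (1/2) / ?w k powr 2" by (rule powr_diff)
    also have "?w k powr (1/2) = sqrt (?w k)" using pos by (simp add: powr_half_sqrt)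
    also have "?w k powr 2 = (?w k)\<^sup>2" using pos by (simp add: powr_numeral)
    finally have eq: "?w k powr (-3/2) = sqrt (?w k) / (?w k)\<^sup>2" .
    show "sqrt \<bar>real_of_int k\<bar> / (?w k)\<^sup>2 \<le> ?w k powr (-3/2)" unfolding eq
      by (intro divide_right_mono) auto
    show "1 / (?w k)\<^sup>2 \<le> ?w k powr (-3/2)" unfolding eq
      by (intro divide_right_mono) auto
  qed
  have comp: "norm v \<le> real CARD('n) * B" if "\<And>j. cmod (v $ j) \<le> B" for v :: "complex ^ 'n" and B
  proof -
    have "norm v \<le> (\<Sum>j\<in>UNIV. cmod (v $ j))" unfolding norm_vec_def by (rule L2_set_le_sum) simp
    also have "\<dots> \<le> (\<Sum>j\<in>(UNIV::'n set). B)" by (intro sum_mono that)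
    finally show ?thesis by simp
  qed
  show "norm (trig N x t) \<le> real CARD('n) * (sqrt K * sqrt Q)"
  proof (rule comp)
    fix j
    have "cmod (trig N x t $ j) \<le> (\<Sum>k=-int N..int N. cmod (coef x k j) * 1)"
      unfolding trig_def vec_lambda_beta by (rule order_trans[OF norm_sum]) (simp add: norm_mult)
    also have "\<dots> \<le> sqrt K * sqrt (\<Sum>k=-int N..int N. (1 / ?w k)\<^sup>2)" by (rule coef_sum_le[OF K])
    also have "\<dots> \<le> sqrt K * sqrt Q"
    proof (intro mult_left_mono real_sqrt_le_mono order_trans[OF _ Q] sum_mono)
      fix k show "(1 / ?w k)\<^sup>2 \<le> ?w k powr (-3/2)" using w(2)[of k] by (simp add: power_divide)
    qed (use K0 in simp)
    finally show "cmod (trig N x t $ j) \<le> sqrt K * sqrt Q" .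
  qed
  show "norm (trig N x t - trig N x s :: complex ^ 'n::finite) \<le> real CARD('n) * (sqrt K * sqrt (4 * sqrt (pi * \<bar>t - s\<bar>) * Q))"
  proof (rule comp)
    fix j
    let ?d = "\<lambda>k. cmod (ee k t - ee k s)" and ?h = "\<bar>t - s\<bar>"
    have d: "(?d k)\<^sup>2 \<le> 4 * sqrt (pi * ?h) * sqrt \<bar>real_of_int k\<bar>" for k
    proof -
      let ?z = "pi * ?h * \<bar>real_of_int k\<bar>"
      have z0: "0 \<le> ?z" by simp
      have d1: "?d k \<le> 2 * ?z"
      proof -
        have "2 * pi * of_int k * t - 2 * pi * of_int k * s = 2 * (pi * (t - s) * of_int k)"
          by (simp add: algebra_simps)
        then have "\<bar>2 * pi * of_int k * t - 2 * pi * of_int k * s\<bar> = 2 * ?z" by (simp add: abs_mult)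
        then show ?thesis
          using norm_cis_diff_le[of "2 * pi * of_int k * t" "2 * pi * of_int k * s"] by (simp only: ee_def)
      qed
      have d2: "?d k \<le> 2" using norm_triangle_ineq4[of "ee k t" "ee k s"] by simp
      have "(?d k)\<^sup>2 \<le> 4 * sqrt ?z"
      proof (cases "?z \<le> 1")
        case True
        have "(?d k)\<^sup>2 \<le> (2 * ?z)\<^sup>2" using d1 by (intro power_mono) auto
        also have "\<dots> = 4 * (?z * ?z)" by (simp add: power2_eq_square)
        also have "?z * ?z \<le> ?z * 1" using True z0 by (intro mult_left_mono) auto
        also have "?z * 1 \<le> sqrt ?z"
        proof (rule real_le_rsqrt)
          have "?z * ?z \<le> ?z * 1" using True z0 by (intro mult_left_mono) auto
          then show "(?z * 1)\<^sup>2 \<le> ?z" by (simp add: power2_eq_square)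
        qed
        finally show ?thesis by simp
      next
        case False
        then have "sqrt 1 \<le> sqrt ?z" by (intro real_sqrt_le_mono) linarith
        moreover have "(?d k)\<^sup>2 \<le> 2\<^sup>2" using d2 by (intro power_mono) auto
        ultimately show ?thesis unfolding real_sqrt_one power2_eq_square by linarith
      qed
      then show ?thesis by (simp add: real_sqrt_mult)
    qed
    have "cmod ((trig N x t - trig N x s) $ j) \<le> (\<Sum>k=-int N..int N. cmod (coef x k j) * ?d k)"
    proof -
      have "(trig N x t - trig N x s) $ j = (\<Sum>k=-int N..int N. coef x k j * (ee k t - ee k s))"
        by (simp add: trig_def sum_subtractf right_diff_distrib)
      then show ?thesis by (simp add: norm_mult order_trans[OF norm_sum])
    qed
    also have "\<dots> \<le> sqrt K * sqrt (\<Sum>k=-int N..int N. (?d k / ?w k)\<^sup>2)" by (rule coef_sum_le[OF K])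
    also have "\<dots> \<le> sqrt K * sqrt (4 * sqrt (pi * ?h) * Q)"
    proof (intro mult_left_mono real_sqrt_le_mono)
      have "(\<Sum>k=-int N..int N. (?d k / ?w k)\<^sup>2) \<le> (\<Sum>k=-int N..int N. 4 * sqrt (pi * ?h) * ?w k powr (-3/2))"
      proof (rule sum_mono)
        fix k
        have "(?d k / ?w k)\<^sup>2 \<le> (4 * sqrt (pi * ?h) * sqrt \<bar>real_of_int k\<bar>) / (?w k)\<^sup>2"
          unfolding power_divide by (intro divide_right_mono d) simp
        also have "\<dots> = 4 * sqrt (pi * ?h) * (sqrt \<bar>real_of_int k\<bar> / (?w k)\<^sup>2)" by simp
        also have "\<dots> \<le> 4 * sqrt (pi * ?h) * ?w k powr (-3/2)" by (intro mult_left_mono w) simp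
        finally show "(?d k / ?w k)\<^sup>2 \<le> 4 * sqrt (pi * ?h) * ?w k powr (-3/2)" .
      qed
      also have "\<dots> \<le> 4 * sqrt (pi * ?h) * Q"
        unfolding sum_distrib_left[symmetric] by (intro mult_left_mono Q) simp
      finally show "(\<Sum>k=-int N..int N. (?d k / ?w k)\<^sup>2) \<le> 4 * sqrt (pi * ?h) * Q" .
    qed (use K0 in simp)
    finally show "cmod ((trig N x t - trig N x s) $ j) \<le> sqrt K * sqrt (4 * sqrt (pi * ?h) * Q)" .
  qed
qed

lemma ee_periodic_int: "ee k (t + of_int m) = ee k t"
proof -
  have "ee k (t + of_int m) = cis (2 * pi * of_int k * t) * cis (2 * pi * of_int (k * m))"
    unfolding ee_def cis_mult by (simp add: algebra_simps)
  then show ?thesis by (simp add: cis_2pi_int ee_def)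
qed

lemma trig_periodic_int: "trig N x (t + of_int m) = trig N x t"
  by (simp add: trig_def ee_periodic_int)

lemma trig_continuous: "continuous_on A (trig N x)"
  unfolding trig_def[abs_def] by (intro continuous_intros continuous_on_vec_lambda)

text \<open>Arzela-Ascoli is applied on one period; periodicity of the trigonometric loops makes the
  convergence uniform on the line.\<close>

lemma trig_subsequence:
  fixes X :: "nat \<Rightarrow> int \<times> 'n::finite \<times> bool \<Rightarrow> real" and N :: "nat \<Rightarrow> nat"
  assumes K: "\<And>n. (\<Sum>k=-int (N n)..int (N n). \<Sum>j\<in>UNIV. ((1 + \<bar>real_of_int k\<bar>) * cmod (coef (X n) k j))\<^sup>2) \<le> K"
  shows "\<exists>x r. strict_mono (r :: nat \<Rightarrow> nat) \<and> uniform_limit UNIV (\<lambda>n. trig (N (r n)) (X (r n))) x sequentially \<and>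
    continuous_on UNIV x \<and> (\<forall>t. x (t + 1) = x t)"
proof -
  obtain Q where Q: "0 < Q" "\<And>N. (\<Sum>k=-int N..int N. (1 + \<bar>real_of_int k\<bar>) powr (-3/2)) \<le> Q"
    using weight_sum_bound by blast
  let ?X = "\<lambda>n. trig (N n) (X n)"
  define \<omega> where "\<omega> h = real CARD('n) * (sqrt K * sqrt (4 * sqrt (pi * \<bar>h\<bar>) * Q))" for h :: real
  have "isCont \<omega> 0" unfolding \<omega>_def by (intro continuous_intros)
  then have \<omega>: "\<exists>d>0. \<forall>h. \<bar>h\<bar> < d \<longrightarrow> \<omega> h < e" if e0: "0 < e" for e
  proof -
    have "\<omega> 0 = 0" by (simp add: \<omega>_def)
    then obtain d where "0 < d" "\<forall>h. \<bar>h\<bar> < d \<longrightarrow> \<bar>\<omega> h\<bar> < e"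
      using \<open>isCont \<omega> 0\<close> e0 unfolding continuous_at_eps_delta dist_real_def by auto
    then show ?thesis by (meson abs_ge_self le_less_trans)
  qed
  obtain g r where g: "continuous_on {0..1} g" and r: "strict_mono (r :: nat \<Rightarrow> nat)"
    and lim: "\<And>e. 0 < e \<Longrightarrow> \<exists>n0. \<forall>n t. n \<ge> n0 \<and> t \<in> {0..1} \<longrightarrow> norm (?X (r n) t - g t) < e"
  proof (rule Arzela_Ascoli[of "{0..1::real}" ?X "real CARD('n) * (sqrt K * sqrt Q)"])
    show "norm (?X n t) \<le> real CARD('n) * (sqrt K * sqrt Q)" for n t
      by (rule trig_bound(1)[OF K Q(2)])
    show "\<exists>d. 0 < d \<and> (\<forall>n s. s \<in> {0..1} \<and> norm (t - s) < d \<longrightarrow> norm (?X n t - ?X n s) < e)" if e0: "0 < e" for t e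
    proof -
      obtain d where d: "0 < d" "\<And>h. \<bar>h\<bar> < d \<Longrightarrow> \<omega> h < e" using \<omega>[OF e0] by blast
      have "norm (?X n t - ?X n s) < e" if "norm (t - s) < d" for n s
        using trig_bound(2)[OF K Q(2), of n t s] d(2)[of "t - s"] that by (simp add: \<omega>_def)
      with d show ?thesis by blast
    qed
  qed auto
  define x where "x t = g (frac t)" for t
  have Xf: "?X n t = ?X n (frac t)" for n t
    using trig_periodic_int[of "N n" "X n" "frac t" "\<lfloor>t\<rfloor>"] by (simp add: frac_def)
  have ul: "uniform_limit UNIV (\<lambda>n. ?X (r n)) x sequentially"
  proof (rule uniform_limitI)
    fix e :: real assume "0 < e"
    then obtain n0 where n0: "\<And>n t. n \<ge> n0 \<Longrightarrow> t \<in> {0..1} \<Longrightarrow> norm (?X (r n) t - g t) < e" using lim by blast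
    have "dist (?X (r n) t) (x t) < e" if "n0 \<le> n" for n t
      using n0[OF that, of "frac t"] frac_ge_0[of t] frac_lt_1[of t] Xf[of "r n" t] by (simp add: x_def dist_norm less_imp_le)
    then show "\<forall>\<^sub>F n in sequentially. \<forall>t\<in>UNIV. dist (?X (r n) t) (x t) < e"
      unfolding eventually_sequentially by blast
  qed
  have "continuous_on UNIV x"
    by (rule uniform_limit_theorem[OF _ ul]) (auto intro!: always_eventually trig_continuous)
  moreover have "x (t + 1) = x t" for t by (simp add: x_def frac_1_eq)
  ultimately show ?thesis using r ul by blast
qed

lemma dft_limit:
  fixes f :: "real \<Rightarrow> complex"
  assumes ul: "uniform_limit UNIV fn f sequentially" and cont: "continuous_on UNIV f"
    and Mn: "filterlim Mn at_top sequentially"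
  shows "(\<lambda>n. dft (Mn n) (\<lambda>m. fn n (real m / real (Mn n))) k) \<longlonglongrightarrow> integral {0..1} (\<lambda>t. f t * ee (- k) t)"
proof -
  have "uniform_limit UNIV (\<lambda>n t. fn n t * ee (- k) t) (\<lambda>t. f t * ee (- k) t) sequentially"
    using ul unfolding uniform_limit_iff dist_norm left_diff_distrib[symmetric] norm_mult by simp
  from riemann_sum_limit[OF this _ Mn] show ?thesis
    by (simp add: dft_def scaleR_conv_of_real divide_inverse mult.commute continuous_intros continuous_on_subset[OF cont])
qed

lemma uniform_limit_continuous_image:
  fixes \<Psi> :: "'a::euclidean_space \<Rightarrow> 'b::metric_space"
  assumes ul: "uniform_limit UNIV Y x sequentially" and x: "bounded (range x)" and \<Psi>: "continuous_on UNIV \<Psi>"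
  shows "uniform_limit UNIV (\<lambda>n t. \<Psi> (Y n t)) (\<lambda>t. \<Psi> (x t)) sequentially"
proof -
  obtain R where R: "\<And>t. norm (x t) \<le> R" using x unfolding bounded_iff by blast
  have "uniformly_continuous_on (cball 0 (R + 1)) \<Psi>"
    by (intro compact_uniformly_continuous continuous_on_subset[OF \<Psi>]) auto
  moreover have "\<forall>\<^sub>F n in sequentially. \<forall>t\<in>UNIV. Y n t \<in> cball 0 (R + 1)"
    using uniform_limitD[OF ul, of 1, simplified]
  proof eventually_elim
    case (elim n)
    have "norm (Y n t) \<le> R + 1" for t
    proof -
      have "norm (Y n t - x t) < 1" using elim by (simp add: dist_norm)
      moreover have "norm (Y n t) \<le> norm (Y n t - x t) + norm (x t)"
        using norm_triangle_ineq[of "Y n t - x t" "x t"] by simp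
      ultimately show ?thesis using R[of t] by linarith
    qed
    then show ?case by simp
  qed
  ultimately show ?thesis
    by (rule uniform_limit_compose_uniformly_continuous_on[OF ul]) simp
qed

section \<open>From the limit equation in Fourier coefficients to an orbit\<close>

lemma bounded_linear_iscale: "bounded_linear (\<lambda>v :: complex ^ 'n::finite. c *s v)"
  by (auto simp: linear_conv_bounded_linear[symmetric] vec_eq_iff algebra_simps intro!: linearI)

lemma integral_inner_unit:
  assumes "f integrable_on S"
  shows "integral S (\<lambda>t. (f t :: complex ^ 'n::finite) $ j) = integral S f $ j"
  using integral_linear[OF assms bounded_linear_vec_nth[of j]] by (simp add: o_def)

text \<open>By integration by parts the primitive \<open>y\<close> of i g has the same coefficients
  of nonzero frequency as \<open>x\<close>, so the two differ by a constant and \<open>x\<close>, so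
  far merely continuous, inherits the derivative of \<open>y\<close>.\<close>

lemma fourier_solution:
  fixes x g :: "real \<Rightarrow> complex ^ 'n::finite"
  assumes x: "continuous_on UNIV x" "\<And>t. x (t + 1) = x t"
    and g: "continuous_on UNIV g" "\<And>t. g (t + 1) = g t"
    and weak: "\<And>k j. of_real (2 * pi * of_int k) * integral {0..1} (\<lambda>t. x t $ j * ee (- k) t) =
      integral {0..1} (\<lambda>t. g t $ j * ee (- k) t)"
  shows "(x has_vector_derivative \<i> *s g t) (at t)"
proof -
  let ?h = "\<lambda>s. \<i> *s g s"
  have ch: "continuous_on A ?h" for A
    by (rule continuous_on_subset[OF bounded_linear.continuous_on[OF bounded_linear_iscale g(1)]]) simp
  have ch': "continuous_on A (\<lambda>s. ?h s $ j)" "continuous_on A (\<lambda>s. x s $ j)" "continuous_on A (\<lambda>s. g s $ j)" for A j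
    by (intro continuous_on_component ch continuous_on_subset[OF x(1)] continuous_on_subset[OF g(1)]; simp)+
  \<comment> \<open>Two periods are used so that the time 1 becomes an interior point; every real
    time is later translated into the open interval (0, 2).\<close>
  define y where "y t = integral {0..t} ?h" for t
  have yd: "(y has_vector_derivative ?h t) (at t within {0..2})" if "t \<in> {0..2}" for t
    unfolding y_def by (rule integral_has_vector_derivative[OF ch that])
  have ydj: "((\<lambda>t. y t $ j) has_vector_derivative ?h t $ j) (at t within {0..1})" if "t \<in> {0..1}" for t j
    using bounded_linear.has_vector_derivative[OF bounded_linear_vec_nth has_vector_derivative_within_subset[OF yd]] that by force
  have y0: "y 0 = 0" by (simp add: y_def)
  \<comment> \<open>The equation for frequency 0 says that \<open>g\<close> has mean zero, so
    \<open>y\<close> closes up.\<close>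
  have y1: "y 1 = 0"
  proof -
    have "y 1 $ j = \<i> * integral {0..1} (\<lambda>t. g t $ j * ee (- 0) t)" for j
      unfolding y_def by (subst integral_inner_unit[symmetric])
        (auto intro!: integrable_continuous_real ch)
    then have "y 1 $ j = 0" for j using weak[of 0 j] by simp
    then show ?thesis by (simp add: vec_eq_iff)
  qed
  have cy: "continuous_on {0..1} (\<lambda>t. y t $ j)" for j
    unfolding continuous_on_eq_continuous_within by (intro ballI has_vector_derivative_continuous[OF ydj])
  have coefs: "integral {0..1} (\<lambda>t. (x t $ j - y t $ j) * ee l t) = 0" if "l \<noteq> 0" for l j
  proof -
    let ?c = "2 * pi * of_int l * \<i>"
    have d: "((\<lambda>t. y t $ j * ee l t) has_vector_derivative (y t $ j * (?c * ee l t) + ?h t $ j * ee l t)) (at t within {0..1})"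
      if "t \<in> {0..1}" for t
      by (rule has_vector_derivative_mult[OF ydj[OF that] ee_has_vector_derivative])
    have "((\<lambda>t. y t $ j * (?c * ee l t) + ?h t $ j * ee l t) has_integral (y 1 $ j * ee l 1 - y 0 $ j * ee l 0)) {0..1}"
      by (rule fundamental_theorem_of_calculus) (simp, rule d)
    then have "0 = integral {0..1} (\<lambda>t. y t $ j * (?c * ee l t) + ?h t $ j * ee l t)"
      using y0 y1 by (simp add: integral_unique)
    also have "\<dots> = integral {0..1} (\<lambda>t. y t $ j * (?c * ee l t)) + integral {0..1} (\<lambda>t. ?h t $ j * ee l t)"
      by (intro Henstock_Kurzweil_Integration.integral_add integrable_continuous_real continuous_intros cy ch')
    also have "integral {0..1} (\<lambda>t. y t $ j * (?c * ee l t)) = ?c * integral {0..1} (\<lambda>t. y t $ j * ee l t)"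
      by (simp only: mult.left_commute[of _ ?c] integral_mult_right)
    also have "integral {0..1} (\<lambda>t. ?h t $ j * ee l t) = \<i> * integral {0..1} (\<lambda>t. g t $ j * ee l t)"
      by (simp add: mult.assoc)
    also have "integral {0..1} (\<lambda>t. g t $ j * ee l t) = of_real (2 * pi * of_int (- l)) * integral {0..1} (\<lambda>t. x t $ j * ee l t)"
      using weak[of "- l" j] by simp
    finally have "?c * (integral {0..1} (\<lambda>t. x t $ j * ee l t) - integral {0..1} (\<lambda>t. y t $ j * ee l t)) = 0"
      by (simp add: algebra_simps)
    then have "integral {0..1} (\<lambda>t. x t $ j * ee l t) - integral {0..1} (\<lambda>t. y t $ j * ee l t) = 0"
      using \<open>l \<noteq> 0\<close> by simp
    moreover have "integral {0..1} (\<lambda>t. (x t $ j - y t $ j) * ee l t) =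
        integral {0..1} (\<lambda>t. x t $ j * ee l t) - integral {0..1} (\<lambda>t. y t $ j * ee l t)"
      unfolding left_diff_distrib
      by (intro Henstock_Kurzweil_Integration.integral_diff integrable_continuous_real continuous_intros cy ch')
    ultimately show ?thesis by simp
  qed
  have xy1: "x t = x 0 + y t" if "t \<in> {0..1}" for t
  proof -
    have "x t $ j - y t $ j = x 0 $ j - y 0 $ j" for j
    proof (rule fourier_constant[of "\<lambda>t. x t $ j - y t $ j"])
      show "x 0 $ j - y 0 $ j = x 1 $ j - y 1 $ j" using x(2)[of 0] y0 y1 by simp
      show "continuous_on {0..1} (\<lambda>t. x t $ j - y t $ j)" by (intro continuous_intros ch' cy)
      show "integral {0..1} (\<lambda>t. (x t $ j - y t $ j) * ee k t) = 0" if "k \<noteq> 0" for k by (rule coefs[OF that])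
    qed (fact that)
    then show ?thesis using y0 by (simp add: vec_eq_iff algebra_simps)
  qed
  have yper: "y (t + 1) = y t" if "t \<in> {0..1}" for t
  proof -
    have "y (t + 1) - y t = y (0 + 1) - y 0"
    proof (rule has_derivative_zero_unique[where s = "{0..1::real}" and f = "\<lambda>t. y (t + 1) - y t" and x = t and y = 0], goal_cases)
      case (2 s)
      have "((\<lambda>t. y (t + 1)) has_vector_derivative ?h (s + 1)) (at s within {0..1})"
      proof -
        have "((y \<circ> (\<lambda>t. t + 1)) has_vector_derivative 1 *\<^sub>R ?h (s + 1)) (at s within {0..1})"
        proof (rule vector_diff_chain_within)
          show "((\<lambda>t. t + 1) has_vector_derivative 1) (at s within {0..1::real})"
            by (auto intro!: derivative_eq_intros)
          show "(y has_vector_derivative ?h (s + 1)) (at (s + 1) within (\<lambda>t. t + 1) ` {0..1})"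
            by (rule has_vector_derivative_within_subset[OF yd]) (use 2 in auto)
        qed
        then show ?thesis by (simp add: o_def)
      qed
      from has_vector_derivative_diff[OF this has_vector_derivative_within_subset[OF yd[of s], of "{0..1}"]]
      show ?case using 2 g(2)[of s] by (simp add: has_vector_derivative_def)
    qed (use that in auto)
    then show ?thesis using y0 y1 by simp
  qed
  have xy2: "x t = x 0 + y t" if t: "t \<in> {0..2}" for t
  proof (cases "t \<le> 1")
    case False
    then have t1: "t - 1 \<in> {0..1}" using t by auto
    have "x t = x (t - 1)" using x(2)[of "t - 1"] by simp
    then show ?thesis using xy1[OF t1] yper[OF t1] by simp
  next
    case True
    then have "t \<in> {0..1}" using t by auto
    then show ?thesis by (rule xy1)
  qed
  have main: "(x has_vector_derivative ?h t) (at t)" if t: "0 < t" "t < 2" for t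
  proof -
    have "(y has_vector_derivative ?h t) (at t)"
      using yd[of t] t by (simp add: at_within_Icc_at)
    then have "((\<lambda>t. x 0 + y t) has_vector_derivative ?h t) (at t)"
      using has_vector_derivative_add[OF has_vector_derivative_const] by fastforce
    then show ?thesis
      by (rule has_vector_derivative_transform_within_open[of _ _ _ "{0<..<2}"]) (use t in \<open>auto intro: xy2[symmetric]\<close>)
  qed
  define m where "m = \<lfloor>t\<rfloor> - 1"
  have per: "x (s + of_int m) = x s" "g (s + of_int m) = g s" for s and m :: int
  proof -
    have nat_per: "f (s + of_nat n) = f s" if f: "\<And>t. f (t + 1) = f t" for f :: "real \<Rightarrow> complex ^ 'n" and s n
    proof (induction n)
      case (Suc n)
      then show ?case using f[of "s + of_nat n"] by (simp add: add.assoc add.commute[of 1])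
    qed simp
    have "f (s + of_int m) = f s" if f: "\<And>t. f (t + 1) = f t" for f :: "real \<Rightarrow> complex ^ 'n"
      using nat_per[where f = f, OF f, of s "nat m"] nat_per[where f = f, OF f, of "s + of_int m" "nat (- m)"]
      by (cases "0 \<le> m") (auto simp: )
    then show "x (s + of_int m) = x s" "g (s + of_int m) = g s" using x(2) g(2) by blast+
  qed
  have t': "0 < t - of_int m" "t - of_int m < 2"
  proof -
    show "0 < t - of_int m" "t - of_int m < 2"
      unfolding m_def of_int_diff of_int_1 using floor_correct[of t] by linarith+
  qed
  have "((x \<circ> (\<lambda>s. s - of_int m)) has_vector_derivative 1 *\<^sub>R ?h (t - of_int m)) (at t)"
    by (rule vector_diff_chain_at[where f = "\<lambda>s. s - of_int m" and g = x and f' = 1, OF _ main[OF t']]) (auto intro!: derivative_eq_intros)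
  moreover have "x \<circ> (\<lambda>s. s - of_int m) = x" using per(1)[of _ "- m"] by (simp add: fun_eq_iff)
  moreover have "g (t - of_int m) = g t" using per(2)[of _ "- m"] by simp
  ultimately show ?thesis by simp
qed

text \<open>Where \<open>H\<close> does not vanish, norm z / \<rho> is at least 1 and the quadratic
  growth bound may be multiplied by powers of it. The fourth power is the one that
  \<open>quartic_grid\<close> can absorb.\<close>

lemma quartic_growth:
  fixes H :: "'a::euclidean_space \<Rightarrow> real"
  assumes der: "\<And>z. (H has_derivative (\<lambda>v. gH z \<bullet> v)) (at z)"
    and lin: "\<And>z. norm (gH z) \<le> A * norm z + B" and AB: "0 \<le> A" "0 \<le> B"
    and H0: "\<And>z. norm z < \<rho> \<Longrightarrow> H z = 0" and \<rho>: "0 < \<rho>"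
  shows "H z \<le> (A / \<rho>\<^sup>2 + B / \<rho> ^ 3) * norm z ^ 4"
proof (cases "norm z < \<rho>")
  case True
  then show ?thesis using H0 AB \<rho> by simp
next
  case False
  then have z: "\<rho> \<le> norm z" by simp
  have "norm (H z - H 0) \<le> (A * norm z + B) * norm (z - 0)"
  proof (rule differentiable_bound[of "cball 0 (norm z)" H "\<lambda>w v. gH w \<bullet> v"])
    show "(H has_derivative (\<lambda>v. gH w \<bullet> v)) (at w within cball 0 (norm z))" for w
      by (rule has_derivative_at_withinI[OF der])
    show "onorm (\<lambda>v. gH w \<bullet> v) \<le> A * norm z + B" if w: "w \<in> cball 0 (norm z)" for w
    proof (rule onorm_le)
      fix v
      have "norm (gH w) \<le> A * norm z + B"
        using lin[of w] mult_left_mono[of "norm w" "norm z" A] w AB by simp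
      then show "norm (gH w \<bullet> v) \<le> (A * norm z + B) * norm v"
        using Cauchy_Schwarz_ineq2[of "gH w" v] mult_right_mono[of "norm (gH w)" "A * norm z + B" "norm v"] by simp
    qed
  qed auto
  then have "H z \<le> A * (norm z)\<^sup>2 + B * norm z"
    using H0[of 0] \<rho> by (simp add: power2_eq_square distrib_right)
  also have "A * (norm z)\<^sup>2 \<le> A / \<rho>\<^sup>2 * norm z ^ 4"
  proof -
    have "A * (norm z)\<^sup>2 = A / \<rho>\<^sup>2 * (\<rho>\<^sup>2 * (norm z)\<^sup>2)" using \<rho> by simp
    also have "\<dots> \<le> A / \<rho>\<^sup>2 * ((norm z)\<^sup>2 * (norm z)\<^sup>2)"
      using z \<rho> AB by (intro mult_left_mono mult_right_mono power_mono) auto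
    finally show ?thesis by (simp add: power2_eq_square power4_eq_xxxx)
  qed
  also have "B * norm z \<le> B / \<rho> ^ 3 * norm z ^ 4"
  proof -
    have "B * norm z = B / \<rho> ^ 3 * (\<rho> ^ 3 * norm z)" using \<rho> by simp
    also have "\<dots> \<le> B / \<rho> ^ 3 * (norm z ^ 3 * norm z)"
      using z \<rho> AB by (intro mult_left_mono mult_right_mono power_mono) auto
    finally show ?thesis by (simp add: power3_eq_cube power4_eq_xxxx)
  qed
  finally show ?thesis by (simp add: distrib_right)
qed

text \<open>Only the coordinate \<open>i\<close> is asked to have weight 1 and thus a slope above
  \<pi>; the other weights may be small. Non-resonance of the quadratic form at infinity provides
  compactness of the almost critical loops. Positivity of the action rules out constant loops, since
  \<open>H\<close> \<ge> 0.\<close>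

theorem hofer_zehnder:
  fixes H :: "complex ^ 'n::finite \<Rightarrow> real" and i :: 'n and lam :: "'n \<Rightarrow> real"
  assumes der: "\<And>z. (H has_derivative (\<lambda>v. gH z \<bullet> v)) (at z)"
    and gH: "\<And>z. gH z = (\<chi> j. of_real (2 * a * lam j) * z $ j) + b z"
    and b: "uniformly_continuous_on UNIV b" "\<And>z. norm (b z) \<le> B"
    and al: "pi < al" and lam: "lam i = 1" "\<And>j. 0 < lam j"
    and nonres: "\<And>(k::int) j. 2 * pi * of_int k \<noteq> 2 * a * lam j"
    and Hpos: "\<And>z. 0 \<le> H z" and H0: "\<And>z. norm z < \<rho> \<Longrightarrow> H z = 0" and \<rho>: "0 < \<rho>"
    and lower: "\<And>z. al * (\<Sum>j\<in>UNIV. lam j * (cmod (z $ j))\<^sup>2) - C \<le> H z"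
  shows "\<exists>x. (\<forall>t. x (t + 1) = x t) \<and> (\<forall>t. (x has_vector_derivative \<i> *s gH (x t)) (at t)) \<and>
    0 < integral {0..1} (\<lambda>t. gH (x t) \<bullet> x t / 2 - H (x t))"
proof -
  let ?L = "\<lambda>z :: complex ^ 'n. (\<chi> j. of_real (2 * a * lam j) * z $ j) :: complex ^ 'n"
  have L: "bounded_linear ?L"
    by (auto simp: linear_conv_bounded_linear[symmetric] vec_eq_iff algebra_simps scaleR_conv_of_real[where 'a = complex] intro!: linearI)
  have uc: "uniformly_continuous_on UNIV gH"
  proof -
    have "uniformly_continuous_on UNIV (\<lambda>z. ?L z + b z)"
      by (intro uniformly_continuous_on_add bounded_linear.uniformly_continuous_on[OF L] uniformly_continuous_on_id b)
    moreover have "gH = (\<lambda>z. ?L z + b z)" by (rule ext) (rule gH)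
    ultimately show ?thesis by simp
  qed
  have cg: "continuous_on UNIV gH" by (rule uniformly_continuous_imp_continuous[OF uc])
  have cH: "continuous_on UNIV H"
    using der has_derivative_continuous by (blast intro: continuous_at_imp_continuous_on)
  have B0: "0 \<le> B" using b(2)[of 0] norm_ge_zero order_trans by blast
  obtain A where A: "0 \<le> A" "\<And>z. norm (?L z) \<le> norm z * A"
    using bounded_linear.nonneg_bounded[OF L] by blast
  have lin: "norm (gH z) \<le> A * norm z + B" for z
    unfolding gH using norm_triangle_ineq[of "?L z" "b z"] A(2)[of z] b(2)[of z] by (simp add: mult.commute)
  define C4 where "C4 = A / \<rho>\<^sup>2 + B / \<rho> ^ 3 + 1"
  have C4: "0 < C4" using A B0 \<rho> by (auto simp: C4_def intro!: add_nonneg_pos add_nonneg_nonneg)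
  have H4: "H z \<le> C4 * norm z ^ 4" for z
    by (rule order_trans[OF quartic_growth[OF der lin A(1) B0 H0 \<rho>]]) (auto simp: C4_def intro!: mult_right_mono)
  define \<kappa> where "\<kappa> = Min (range lam)"
  have \<kappa>: "0 < \<kappa>" "\<And>j. \<kappa> \<le> lam j" using lam(2) by (auto simp: \<kappa>_def)
  obtain \<beta> where \<beta>: "0 < \<beta>" and crit: "\<And>N \<delta>. 1 \<le> N \<Longrightarrow> 0 < \<delta> \<Longrightarrow> \<exists>x. \<beta> < act H N x \<and>
    (\<Sum>k=-int N..int N. \<Sum>j\<in>UNIV. (cmod (gradc gH N x k j))\<^sup>2) \<le> \<delta>\<^sup>2"
    using galerkin_critical[OF der uc Hpos H4 C4 lower al lam(1) \<kappa>(2) \<kappa>(1)] by blast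
  define \<delta> where "\<delta> n = 1 / (real n + 1)" for n :: nat
  have \<delta>: "0 < \<delta> n" "\<delta> n \<le> 1" for n by (auto simp: \<delta>_def)
  have "\<forall>n. \<exists>x. \<beta> < act H (Suc n) x \<and>
    (\<Sum>k=-int (Suc n)..int (Suc n). \<Sum>j\<in>UNIV. (cmod (gradc gH (Suc n) x k j))\<^sup>2) \<le> (\<delta> n)\<^sup>2"
  proof
    fix n
    have "1 \<le> Suc n" by simp
    from crit[OF this \<delta>(1)[of n]] show "\<exists>x. \<beta> < act H (Suc n) x \<and>
      (\<Sum>k=-int (Suc n)..int (Suc n). \<Sum>j\<in>UNIV. (cmod (gradc gH (Suc n) x k j))\<^sup>2) \<le> (\<delta> n)\<^sup>2" .
  qed
  from choice[OF this] obtain X where "\<forall>n. \<beta> < act H (Suc n) (X n) \<and>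
    (\<Sum>k=-int (Suc n)..int (Suc n). \<Sum>j\<in>UNIV. (cmod (gradc gH (Suc n) (X n) k j))\<^sup>2) \<le> (\<delta> n)\<^sup>2"
    by (rule exE)
  then have Xact: "\<And>n. \<beta> < act H (Suc n) (X n)" and
    Xg: "\<And>n. (\<Sum>k=-int (Suc n)..int (Suc n). \<Sum>j\<in>UNIV. (cmod (gradc gH (Suc n) (X n) k j))\<^sup>2) \<le> (\<delta> n)\<^sup>2"
    by auto
  obtain c where c: "0 < c" "\<And>(k::int) j. c * (1 + \<bar>of_int k\<bar>) \<le> \<bar>2 * pi * of_int k - 2 * a * lam j\<bar>"
    using nonresonance_all[of "\<lambda>j. 2 * a * lam j"] nonres by blast
  define K where "K = 2 * (1 + B\<^sup>2) / c\<^sup>2"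
  have XK: "(\<Sum>k=-int (Suc n)..int (Suc n). \<Sum>j\<in>UNIV. ((1 + \<bar>real_of_int k\<bar>) * cmod (coef (X n) k j))\<^sup>2) \<le> K" for n
  proof -
    have "(\<delta> n)\<^sup>2 \<le> 1" using \<delta>[of n] by (simp add: power_le_one)
    then have "2 * ((\<delta> n)\<^sup>2 + B\<^sup>2) / c\<^sup>2 \<le> K" unfolding K_def by (intro divide_right_mono) auto
    then show ?thesis using galerkin_bound[OF gH b(2) c Xg[of n]] by linarith
  qed
  obtain x r where r: "strict_mono (r :: nat \<Rightarrow> nat)"
    and ul: "uniform_limit UNIV (\<lambda>n. trig (Suc (r n)) (X (r n))) x sequentially"
    and cx: "continuous_on UNIV x" and px: "\<And>t. x (t + 1) = x t"
    using trig_subsequence[of X Suc K, OF XK] by blast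
  define Y where "Y n = trig (Suc (r n)) (X (r n))" for n
  define M where "M n = 2 * Suc (r n) + 1" for n
  note ul = ul[folded Y_def]
  have Mpos: "0 < real (M n)" for n by (simp add: M_def)
  have rlim: "filterlim r at_top sequentially" by (rule filterlim_subseq[OF r])
  have Mlim: "filterlim M at_top sequentially"
    by (rule filterlim_at_top_mono[OF rlim]) (auto simp: M_def)
  have \<delta>lim: "(\<lambda>n. \<delta> (r n)) \<longlonglongrightarrow> 0"
    using LIMSEQ_subseq_LIMSEQ[OF LIMSEQ_inverse_real_of_nat r]
    by (simp add: \<delta>_def o_def inverse_eq_divide add.commute)
  have bx: "bounded (range x)"
  proof -
    have "bounded (x ` {0..1})" by (intro compact_imp_bounded compact_continuous_image continuous_on_subset[OF cx]) auto
    moreover have "range x \<subseteq> x ` {0..1}"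
    proof
      fix z assume "z \<in> range x"
      then obtain t where "z = x t" by blast
      moreover have "x t = x (frac t)"
      proof -
        have Yf: "Y n t = Y n (frac t)" for n
          using trig_periodic_int[of "Suc (r n)" "X (r n)" "frac t" "\<lfloor>t\<rfloor>"] by (simp add: Y_def frac_def)
        have Yl: "(\<lambda>n. Y n s) \<longlonglongrightarrow> x s" for s using tendsto_uniform_limitI[OF ul, of s] by simp
        have "(\<lambda>n. Y n t) \<longlonglongrightarrow> x (frac t)" using Yl[of "frac t"] by (simp only: Yf[symmetric])
        with Yl[of t] show ?thesis by (rule LIMSEQ_unique)
      qed
      ultimately show "z \<in> x ` {0..1}" using frac_ge_0[of t] frac_lt_1[of t] by (intro image_eqI[of _ _ "frac t"]) auto
    qed
    ultimately show ?thesis by (rule bounded_subset)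
  qed
  have ulg: "uniform_limit UNIV (\<lambda>n t. gH (Y n t)) (\<lambda>t. gH (x t)) sequentially"
    by (rule uniform_limit_continuous_image[OF ul bx cg])
  have cgx: "continuous_on UNIV (\<lambda>t. gH (x t))" by (rule continuous_on_compose2[OF cg cx]) auto
  have comp: "uniform_limit UNIV (\<lambda>n t. f n t $ j) (\<lambda>t. h t $ j) sequentially"
    if "uniform_limit UNIV f h sequentially" for f :: "nat \<Rightarrow> real \<Rightarrow> complex ^ 'n" and h j
    by (rule bounded_linear.uniform_limit[OF bounded_linear_vec_nth that])
  have weak: "of_real (2 * pi * of_int k) * integral {0..1} (\<lambda>t. x t $ j * ee (- k) t) =
      integral {0..1} (\<lambda>t. gH (x t) $ j * ee (- k) t)" for k j
  proof -
    let ?d1 = "\<lambda>n. dft (M n) (\<lambda>m. Y n (real m / real (M n)) $ j) k"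
    let ?d2 = "\<lambda>n. dft (M n) (\<lambda>m. gH (Y n (real m / real (M n))) $ j) k"
    have l1: "?d1 \<longlonglongrightarrow> integral {0..1} (\<lambda>t. x t $ j * ee (- k) t)"
      by (rule dft_limit[OF comp[OF ul] continuous_on_component[OF cx] Mlim])
    have l2: "?d2 \<longlonglongrightarrow> integral {0..1} (\<lambda>t. gH (x t) $ j * ee (- k) t)"
      by (rule dft_limit[OF comp[OF ulg] continuous_on_component[OF cgx] Mlim])
    have ev: "\<forall>\<^sub>F n in sequentially. nat \<bar>k\<bar> \<le> r n"
      using rlim by (simp add: filterlim_at_top)
    have "(\<lambda>n. of_real (2 * pi * of_int k) * ?d1 n - ?d2 n) \<longlonglongrightarrow> 0"
    proof (rule Lim_null_comparison[OF _ \<delta>lim])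
      show "\<forall>\<^sub>F n in sequentially. cmod (of_real (2 * pi * of_int k) * ?d1 n - ?d2 n) \<le> \<delta> (r n)"
        using ev
      proof eventually_elim
        case (elim n)
        then have k: "k \<in> {-int (Suc (r n))..int (Suc (r n))}" by auto
        have "of_real (2 * pi * of_int k) * ?d1 n - ?d2 n = gradc gH (Suc (r n)) (X (r n)) k j"
          using dft_trig[OF k, of "X (r n)" j] unfolding gradc_def Y_def M_def grid_def by simp
        moreover have "(cmod (gradc gH (Suc (r n)) (X (r n)) k j))\<^sup>2 \<le> (\<delta> (r n))\<^sup>2"
        proof -
          have "(cmod (gradc gH (Suc (r n)) (X (r n)) k j))\<^sup>2 \<le> (\<Sum>j\<in>UNIV. (cmod (gradc gH (Suc (r n)) (X (r n)) k j))\<^sup>2)"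
            by (rule member_le_sum) auto
          also have "\<dots> \<le> (\<Sum>k=-int (Suc (r n))..int (Suc (r n)). \<Sum>j\<in>UNIV. (cmod (gradc gH (Suc (r n)) (X (r n)) k j))\<^sup>2)"
            by (rule member_le_sum[OF k, of "\<lambda>k. \<Sum>j\<in>UNIV. (cmod (gradc gH (Suc (r n)) (X (r n)) k j))\<^sup>2"]) (auto intro: sum_nonneg)
          also have "\<dots> \<le> (\<delta> (r n))\<^sup>2" by (rule Xg)
          finally show ?thesis .
        qed
        ultimately show ?case using power2_le_imp_le \<delta>(1)[of "r n"] by (simp add: less_imp_le)
      qed
    qed
    moreover have "(\<lambda>n. of_real (2 * pi * of_int k) * ?d1 n - ?d2 n) \<longlonglongrightarrow>
        of_real (2 * pi * of_int k) * integral {0..1} (\<lambda>t. x t $ j * ee (- k) t) - integral {0..1} (\<lambda>t. gH (x t) $ j * ee (- k) t)"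
      by (intro tendsto_intros l1 l2)
    ultimately show ?thesis using LIMSEQ_unique by fastforce
  qed
  have sol: "(x has_vector_derivative \<i> *s gH (x t)) (at t)" for t
    by (rule fourier_solution[OF cx px cgx _ weak]) (simp add: px)
  \<comment> \<open>At an almost critical point the frequency sum in the action is half the mean of
    \<open>gH z \<bullet> z\<close> up to the gradient error, so the action is nearly the mean of
    \<Psi>. That mean passes to the limit under uniform convergence alone.\<close>
  define \<Psi> where "\<Psi> z = gH z \<bullet> z / 2 - H z" for z
  have c\<Psi>: "continuous_on UNIV \<Psi>" unfolding \<Psi>_def[abs_def] by (intro continuous_intros cg cH) auto
  have lim\<Psi>: "(\<lambda>n. (1 / real (M n)) *\<^sub>R (\<Sum>m<M n. \<Psi> (Y n (real m / real (M n))))) \<longlonglongrightarrow> integral {0..1} (\<lambda>t. \<Psi> (x t))"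
  proof (rule riemann_sum_limit[OF uniform_limit_continuous_image[OF ul bx c\<Psi>] _ Mlim])
    show "continuous_on {0..1} (\<lambda>t. \<Psi> (x t))"
      by (rule continuous_on_compose2[OF c\<Psi> continuous_on_subset[OF cx]]) auto
  qed
  have low: "\<beta> - \<delta> (r n) * sqrt K / 2 \<le> (1 / real (M n)) *\<^sub>R (\<Sum>m<M n. \<Psi> (Y n (real m / real (M n))))" for n
  proof -
    let ?N = "Suc (r n)" and ?x = "X (r n)"
    let ?S = "\<lambda>f. \<Sum>k=-int ?N..int ?N. \<Sum>j\<in>UNIV. f k j"
    let ?G = "gradc gH ?N ?x" and ?c = "coef ?x"
    have g: "grid ?N m = real m / real (M n)" for m by (simp only: grid_def M_def)
    have inn: "(\<Sum>m<M n. gH (Y n (grid ?N m)) \<bullet> Y n (grid ?N m)) / real (M n) =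
        ?S (\<lambda>k j. Re (dft (M n) (\<lambda>m. gH (Y n (grid ?N m)) $ j) k * cnj (?c k j)))"
      unfolding Y_def M_def by (rule sum_inner_trig)
    have "?S (\<lambda>k j. Re (?G k j * cnj (?c k j))) = 2 * pi * ?S (\<lambda>k j. of_int k * (cmod (?c k j))\<^sup>2) -
        ?S (\<lambda>k j. Re (dft (M n) (\<lambda>m. gH (Y n (grid ?N m)) $ j) k * cnj (?c k j)))"
    proof -
      have "Re (?G k j * cnj (?c k j)) = 2 * pi * (of_int k * (cmod (?c k j))\<^sup>2) -
          Re (dft (M n) (\<lambda>m. gH (Y n (grid ?N m)) $ j) k * cnj (?c k j))" for k j
        unfolding gradc_def Y_def M_def left_diff_distrib minus_complex.sel cmod_power2
        by (simp only: Re_of_real_mult) (simp add: power2_eq_square)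
      then show ?thesis by (simp add: sum_subtractf sum_distrib_left[symmetric])
    qed
    then have eq: "pi * ?S (\<lambda>k j. of_int k * (cmod (?c k j))\<^sup>2) =
        ((\<Sum>m<M n. gH (Y n (grid ?N m)) \<bullet> Y n (grid ?N m)) / real (M n) + ?S (\<lambda>k j. Re (?G k j * cnj (?c k j)))) / 2"
      unfolding inn by simp
    have cs: "?S (\<lambda>k j. Re (?G k j * cnj (?c k j))) \<le> \<delta> (r n) * sqrt K"
    proof -
      let ?P = "{-int ?N..int ?N} \<times> (UNIV :: 'n set)"
      have "?S (\<lambda>k j. Re (?G k j * cnj (?c k j))) \<le> ?S (\<lambda>k j. cmod (?G k j) * cmod (?c k j))"
        by (intro sum_mono order_trans[OF complex_Re_le_cmod]) (simp add: norm_mult)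
      also have "\<dots> = (\<Sum>p\<in>?P. cmod (?G (fst p) (snd p)) * cmod (?c (fst p) (snd p)))"
        by (simp add: sum.cartesian_product case_prod_beta)
      also have "\<dots> \<le> sqrt (\<Sum>p\<in>?P. (cmod (?G (fst p) (snd p)))\<^sup>2) * sqrt (\<Sum>p\<in>?P. (cmod (?c (fst p) (snd p)))\<^sup>2)"
        unfolding real_sqrt_mult[symmetric] by (intro real_le_rsqrt Cauchy_Schwarz_ineq_sum)
      also have "\<dots> \<le> sqrt ((\<delta> (r n))\<^sup>2) * sqrt K"
      proof (intro mult_mono real_sqrt_le_mono)
        show "(\<Sum>p\<in>?P. (cmod (?G (fst p) (snd p)))\<^sup>2) \<le> (\<delta> (r n))\<^sup>2"
          using Xg[of "r n"] by (simp add: sum.cartesian_product case_prod_beta)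
        have "(\<Sum>p\<in>?P. (cmod (?c (fst p) (snd p)))\<^sup>2) = ?S (\<lambda>k j. (cmod (?c k j))\<^sup>2)"
          by (simp add: sum.cartesian_product case_prod_beta)
        also have "\<dots> \<le> ?S (\<lambda>k j. ((1 + \<bar>real_of_int k\<bar>) * cmod (?c k j))\<^sup>2)"
          by (intro sum_mono power_mono mult_le_cancel_right1[THEN iffD2]) auto
        also have "\<dots> \<le> K" by (rule XK)
        finally show "(\<Sum>p\<in>?P. (cmod (?c (fst p) (snd p)))\<^sup>2) \<le> K" .
      qed (auto intro: sum_nonneg)
      finally show ?thesis using \<delta>(1)[of "r n"] by simp
    qed
    have "\<beta> < act H ?N ?x" by (rule Xact)
    also have "act H ?N ?x = pi * ?S (\<lambda>k j. of_int k * (cmod (?c k j))\<^sup>2) - (\<Sum>m<M n. H (Y n (grid ?N m))) / real (M n)"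
      unfolding act_def Y_def M_def ..
    also have "\<dots> = (\<Sum>m<M n. \<Psi> (Y n (grid ?N m))) / real (M n) + ?S (\<lambda>k j. Re (?G k j * cnj (?c k j))) / 2"
      unfolding eq \<Psi>_def sum_subtractf sum_divide_distrib[symmetric] by (simp add: add_divide_distrib diff_divide_distrib)
    finally show ?thesis using cs unfolding g by simp
  qed
  have "\<beta> \<le> integral {0..1} (\<lambda>t. \<Psi> (x t))"
  proof (rule LIMSEQ_le[OF _ lim\<Psi>])
    have "(\<lambda>n. \<beta> - \<delta> (r n) * sqrt K / 2) \<longlonglongrightarrow> \<beta> - 0 * sqrt K / 2"
      by (intro tendsto_intros \<delta>lim) auto
    then show "(\<lambda>n. \<beta> - \<delta> (r n) * sqrt K / 2) \<longlonglongrightarrow> \<beta>" by simp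
  qed (use low in blast)
  with \<beta> sol px show ?thesis unfolding \<Psi>_def by (intro exI[of _ x]) auto
qed

section \<open>Non-squeezing for homogeneous Hamiltonians\<close>

lemma symp_form_inner: "symp_form u v = (\<i> *s u) \<bullet> v"
  by (simp add: symp_form_def inner_vec_def inner_complex_def algebra_simps)

lemma liouville_form_inner: "liouville_form z v = (\<i> *s z) \<bullet> v / 2"
  by (simp add: liouville_form_def inner_vec_def inner_complex_def algebra_simps)

lemma iscale_inner: "(\<i> *s u) \<bullet> v = - (u \<bullet> (\<i> *s (v :: complex ^ 'n::finite)))"
  by (simp add: inner_vec_def inner_complex_def sum_negf[symmetric])

lemma inner_iscale_self [simp]: "u \<bullet> (\<i> *s (u :: complex ^ 'n::finite)) = 0" "(\<i> *s u) \<bullet> u = 0"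
  by (simp_all add: inner_vec_def inner_complex_def)

lemma iscale_iscale [simp]: "\<i> *s (\<i> *s u) = - (u :: complex ^ 'n::finite)"
  by (simp add: vec_eq_iff flip: mult.assoc)

lemma inner_iscale_iscale [simp]: "(\<i> *s u) \<bullet> (\<i> *s v) = u \<bullet> (v :: complex ^ 'n::finite)"
  by (simp add: iscale_inner)

lemma iscale_add: "\<i> *s (u + v) = \<i> *s u + \<i> *s (v :: complex ^ 'n::finite)"
  and iscale_diff: "\<i> *s (u - v) = \<i> *s u - \<i> *s (v :: complex ^ 'n::finite)"
  and iscale_scaleR: "\<i> *s (r *\<^sub>R u) = r *\<^sub>R (\<i> *s (u :: complex ^ 'n::finite))"
  by (simp_all add: vec_eq_iff algebra_simps)

lemma symp_form_nondegenerate: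
  assumes "\<And>w. symp_form u w = symp_form v (w :: complex ^ 'n::finite)"
  shows "u = v"
proof -
  have "(\<i> *s (u - v)) \<bullet> (\<i> *s (u - v)) = 0"
    using assms[of "\<i> *s (u - v)"] by (simp add: symp_form_inner iscale_diff inner_diff_left)
  then have "norm (u - v) = 0" by (simp add: norm_eq_sqrt_inner)
  then show ?thesis by simp
qed

lemma smooth_on_UNIV_C1:
  assumes "smooth_on f UNIV"
  shows "f differentiable (at x)" and "continuous_on UNIV (\<lambda>x. frechet_derivative f (at x) v)"
proof -
  have *: "f differentiable (at y) \<and> isCont (\<lambda>x. frechet_derivative f (at x) v) y" for y
  proof -
    have "\<exists>U g. open U \<and> y \<in> U \<and> (\<forall>k. Ck_on k g U) \<and> (\<forall>z\<in>U \<inter> UNIV. g z = f z)"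
      using assms unfolding smooth_on_def by (rule bspec) simp
    then obtain U g where U: "open U" "y \<in> U" and Ck: "\<forall>k. Ck_on k g U" and eq': "\<forall>z\<in>U \<inter> UNIV. g z = f z"
      by (elim exE conjE)
    have C: "Ck_on (Suc 0) g U" using Ck by (rule spec)
    have eq: "g z = f z" if "z \<in> U" for z using eq' that by simp
    have dg: "g differentiable (at z)" if "z \<in> U" for z
      using C that U(1) by (simp add: differentiable_on_eq_differentiable_at)
    have df: "(f has_derivative frechet_derivative g (at z)) (at z)" if "z \<in> U" for z
      using dg[OF that, unfolded frechet_derivative_works] U(1) that eq
      by (rule has_derivative_transform_within_open)
    then have "frechet_derivative f (at z) = frechet_derivative g (at z)" if "z \<in> U" for z
      using frechet_derivative_at[OF df[OF that]] by simp
    moreover have "continuous_on U (\<lambda>x. frechet_derivative g (at x) v)" using C by simp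
    ultimately have "continuous_on U (\<lambda>x. frechet_derivative f (at x) v)"
      by (simp cong: continuous_on_cong)
    then show ?thesis using df U by (auto simp: continuous_on_eq_continuous_at differentiable_def)
  qed
  show "f differentiable (at x)" using * by blast
  show "continuous_on UNIV (\<lambda>x. frechet_derivative f (at x) v)"
    using * by (simp add: continuous_on_eq_continuous_at)
qed

section \<open>Cut-off functions of class C^1 and calculus along curves\<close>

lemma DERIV_max0_square: "((\<lambda>s::real. (max 0 s)\<^sup>2) has_real_derivative 2 * max 0 s) (at s)"
proof -
  consider "s < 0" | "0 < s" | "s = 0" by linarith
  then show ?thesis
  proof cases
    case 1
    have "((\<lambda>s::real. 0) has_real_derivative 2 * max 0 s) (at s)" using 1 by simp
    then show ?thesis
      by (rule has_field_derivative_transform_within_open[of _ _ _ "{..<0}"]) (use 1 in auto)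
  next
    case 2
    have "((\<lambda>s::real. s\<^sup>2) has_real_derivative 2 * max 0 s) (at s)"
      using 2 by (auto intro!: derivative_eq_intros)
    then show ?thesis
      by (rule has_field_derivative_transform_within_open[of _ _ _ "{0<..}"]) (use 2 in auto)
  next
    case 3
    have "((\<lambda>h. ((max 0 (0 + h))\<^sup>2 - (max 0 (0::real))\<^sup>2) / h) \<longlongrightarrow> 0) (at 0)"
    proof (rule Lim_null_comparison[of _ "\<lambda>h. \<bar>h\<bar>"])
      show "\<forall>\<^sub>F h in at 0. norm (((max 0 (0 + h))\<^sup>2 - (max 0 (0::real))\<^sup>2) / h) \<le> \<bar>h\<bar>"
        by (rule always_eventually) (auto simp: max_def power2_eq_square)
    qed (auto intro!: tendsto_eq_intros)
    then show ?thesis using 3 by (simp add: DERIV_def)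
  qed
qed

text \<open>A primitive of the piecewise linear step \<open>ramp'\<close>: zero up to 0 and of slope
  1 from \<open>e\<close> on. Class C^1 is enough, as the gradient of the Hamiltonian only has to be
  uniformly continuous.\<close>

definition ramp :: "real \<Rightarrow> real \<Rightarrow> real" where
  "ramp e s = ((max 0 s)\<^sup>2 - (max 0 (s - e))\<^sup>2) / (2 * e)"

definition ramp' :: "real \<Rightarrow> real \<Rightarrow> real" where
  "ramp' e s = (max 0 s - max 0 (s - e)) / e"

lemma DERIV_ramp: "0 < e \<Longrightarrow> (ramp e has_real_derivative ramp' e s) (at s)"
proof -
  assume e: "0 < e"
  have 1: "((\<lambda>s. (max 0 (s - e))\<^sup>2) has_real_derivative 2 * max 0 (s - e)) (at s)"
  proof -
    have "((\<lambda>s. s - e) has_real_derivative 1) (at s)" by (auto intro!: derivative_eq_intros)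
    from DERIV_chain2[where f = "\<lambda>s. (max 0 s)\<^sup>2", OF DERIV_max0_square this] show ?thesis by simp
  qed
  show ?thesis
    unfolding ramp_def[abs_def] ramp'_def
    using DERIV_cdivide[OF DERIV_diff[OF DERIV_max0_square 1], of "2 * e"] e
    by (simp add: diff_divide_distrib)
qed

lemma ramp_props:
  assumes "0 < e"
  shows "s \<le> 0 \<Longrightarrow> ramp e s = 0" "s \<le> 0 \<Longrightarrow> ramp' e s = 0" "e \<le> s \<Longrightarrow> ramp e s = s - e / 2" "e \<le> s \<Longrightarrow> ramp' e s = 1"
    "0 \<le> ramp' e s" "ramp' e s \<le> 1" "0 < s \<Longrightarrow> 0 < ramp' e s" "s < e \<Longrightarrow> ramp' e s < 1"
    "s \<le> t \<Longrightarrow> ramp' e s \<le> ramp' e t" "continuous_on UNIV (ramp' e)"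
proof -
  show "s \<le> 0 \<Longrightarrow> ramp e s = 0" "s \<le> 0 \<Longrightarrow> ramp' e s = 0" "e \<le> s \<Longrightarrow> ramp' e s = 1"
    "0 \<le> ramp' e s" "ramp' e s \<le> 1" "0 < s \<Longrightarrow> 0 < ramp' e s" "s < e \<Longrightarrow> ramp' e s < 1"
    using assms by (auto simp: ramp_def ramp'_def max_def divide_simps)
  show "s \<le> t \<Longrightarrow> ramp' e s \<le> ramp' e t"
    using assms unfolding ramp'_def by (intro divide_right_mono) (auto simp: max_def)
  show "e \<le> s \<Longrightarrow> ramp e s = s - e / 2"
    using assms by (simp add: ramp_def max_def power2_eq_square field_simps)
  show "continuous_on UNIV (ramp' e)"
    using assms unfolding ramp'_def[abs_def] by (intro continuous_intros) auto
qed

lemma ramp_mono: "0 < e \<Longrightarrow> s \<le> t \<Longrightarrow> ramp e s \<le> ramp e t"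
  by (rule DERIV_nonneg_imp_nondecreasing) (auto intro: DERIV_ramp ramp_props)

lemma ramp_nonneg: "0 < e \<Longrightarrow> 0 \<le> ramp e s"
  using ramp_mono[of e "min 0 s" s] ramp_props(1)[of e "min 0 s"] by simp

lemma ramp_strict: 
  assumes e: "0 < e" and "0 \<le> s" "s < t" shows "ramp e s < ramp e t"
proof (rule DERIV_pos_imp_increasing_open[OF \<open>s < t\<close>])
  show "\<And>x. s < x \<Longrightarrow> x < t \<Longrightarrow> \<exists>y. (ramp e has_real_derivative y) (at x) \<and> 0 < y"
    using DERIV_ramp[OF e] ramp_props(7)[OF e] \<open>0 \<le> s\<close> by (metis le_less_trans)
  show "continuous_on {s..t} (ramp e)"
    using DERIV_ramp[OF e] DERIV_isCont by (blast intro: continuous_at_imp_continuous_on)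
qed

lemma ramp_ge: "0 < e \<Longrightarrow> s - e \<le> ramp e s"
  using ramp_props(3)[of e s] ramp_nonneg[of e s] by (cases "e \<le> s") auto

lemma uniformly_continuous_compact_support:
  fixes f :: "'a::euclidean_space \<Rightarrow> 'b::real_normed_vector"
  assumes c: "continuous_on UNIV f" and 0: "\<And>x. R \<le> norm x \<Longrightarrow> f x = 0"
  shows "uniformly_continuous_on UNIV f" and "\<exists>B. \<forall>x. norm (f x) \<le> B"
proof -
  have uc: "uniformly_continuous_on (cball 0 (R + 1)) f"
    by (intro compact_uniformly_continuous continuous_on_subset[OF c]) auto
  show "uniformly_continuous_on UNIV f"
    unfolding uniformly_continuous_on_def
  proof (intro allI impI)
    fix e :: real assume "0 < e"
    then obtain d where d: "0 < d" "\<And>x y. x \<in> cball 0 (R + 1) \<Longrightarrow> y \<in> cball 0 (R + 1) \<Longrightarrow> dist y x < d \<Longrightarrow> dist (f y) (f x) < e"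
      using uc unfolding uniformly_continuous_on_def by metis
    have "dist (f y) (f x) < e" if xy: "dist y x < min d 1" for x y
    proof (cases "x \<in> cball 0 (R + 1) \<and> y \<in> cball 0 (R + 1)")
      case True
      then show ?thesis using d(2) xy by simp
    next
      case False
      have "\<bar>norm y - norm x\<bar> < 1" using xy norm_triangle_ineq3[of y x] by (simp add: dist_norm)
      then have "R \<le> norm x" "R \<le> norm y" using False by auto
      then show ?thesis using 0 \<open>0 < e\<close> by simp
    qed
    then show "\<exists>d>0. \<forall>x\<in>UNIV. \<forall>x'\<in>UNIV. dist x' x < d \<longrightarrow> dist (f x') (f x) < e"
      using d(1) by (intro exI[of _ "min d 1"]) auto
  qed
  have "bounded (f ` cball 0 R)"
    by (intro compact_imp_bounded compact_continuous_image continuous_on_subset[OF c]) auto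
  then obtain B where "\<forall>x\<in>cball 0 R. norm (f x) \<le> B" unfolding bounded_iff by auto
  then have B: "norm (f x) \<le> B" if "norm x \<le> R" for x using that by simp
  have "norm (f x) \<le> max B 0" for x
  proof (cases "norm x \<le> R")
    case True
    then show ?thesis using B[OF True] by simp
  next
    case False
    then show ?thesis using 0[of x] by simp
  qed
  then show "\<exists>B. \<forall>x. norm (f x) \<le> B" by blast
qed

lemma has_real_derivative_along:
  fixes P :: "'a::real_inner \<Rightarrow> real"
  assumes "\<And>z. (P has_derivative (\<lambda>v. gP z \<bullet> v)) (at z)" and "(x has_vector_derivative x') (at t)"
  shows "((\<lambda>t. P (x t)) has_real_derivative gP (x t) \<bullet> x') (at t)"
  using has_derivative_compose[OF assms(2)[unfolded has_vector_derivative_def] assms(1)]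
  by (simp add: has_field_derivative_def mult_commute_abs)

lemma const_of_zero_deriv:
  fixes f :: "real \<Rightarrow> real"
  assumes "\<And>t. (f has_real_derivative 0) (at t)"
  shows "f t = f s"
  using DERIV_isconst_all[of f t s] assms by blast

lemma inner_gradient_exists:
  fixes f' :: "'a::euclidean_space \<Rightarrow> real"
  assumes "linear f'"
  shows "f' v = (\<Sum>b\<in>Basis. f' b *\<^sub>R b) \<bullet> v"
proof -
  have "f' v = f' (\<Sum>b\<in>Basis. (v \<bullet> b) *\<^sub>R b)" by (simp add: euclidean_representation)
  also have "\<dots> = (\<Sum>b\<in>Basis. (v \<bullet> b) * f' b)"
    using assms by (simp add: linear_sum linear_scale)
  also have "\<dots> = (\<Sum>b\<in>Basis. f' b *\<^sub>R b) \<bullet> v"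
    by (simp add: inner_sum_left inner_commute[of v] mult.commute)
  finally show ?thesis .
qed

lemma linear_ode_scalar:
  fixes z :: "real \<Rightarrow> complex"
  assumes "\<And>t. (z has_vector_derivative (\<i> * of_real w) * z t) (at t)"
  shows "z t = cis (w * t) * z 0"
proof -
  have "((\<lambda>t. cis (- w * t) * z t) has_vector_derivative 0) (at t within UNIV)" for t
  proof -
    have "((\<lambda>t. cis (- w * t)) has_vector_derivative (- \<i> * of_real w) * cis (- w * t)) (at t)"
      unfolding has_vector_derivative_def
      by (rule derivative_eq_intros refl | simp add: fun_eq_iff cis_conv_exp scaleR_conv_of_real)+
    from has_vector_derivative_mult[OF this assms[of t]] show ?thesis by (simp add: algebra_simps)
  qed
  then obtain c where c: "\<And>t. cis (- w * t) * z t = c"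
    using has_vector_derivative_zero_constant[OF convex_UNIV, of "\<lambda>t. cis (- w * t) * z t"] by auto
  have "cis (w * t) * (cis (- w * t) * z t) = cis (w * t) * z 0" using c[of t] c[of 0] by simp
  then show ?thesis by (simp add: cis_mult flip: mult.assoc)
qed

text \<open>Regularity at the origin stops at C^1, because a function homogeneous of degree 2 that
  is twice differentiable there is a quadratic form.\<close>

definition hom_hamiltonian :: "(complex ^ 'n::finite \<Rightarrow> real) \<Rightarrow> (complex ^ 'n \<Rightarrow> complex ^ 'n) \<Rightarrow> bool" where
  "hom_hamiltonian F gF \<longleftrightarrow> (\<forall>z. (F has_derivative (\<lambda>v. gF z \<bullet> v)) (at z)) \<and> continuous_on UNIV gF \<and>
     (\<forall>c>0. \<forall>z. F (c *\<^sub>R z) = c\<^sup>2 * F z \<and> gF (c *\<^sub>R z) = c *\<^sub>R gF z) \<and>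
     F 0 = 0 \<and> (\<forall>z. z \<noteq> 0 \<longrightarrow> 0 < F z)"

lemma hom_hamiltonian_lower:
  fixes F :: "complex ^ 'n::finite \<Rightarrow> real"
  assumes "hom_hamiltonian F gF"
  shows "\<exists>m>0. \<forall>z. m * (norm z)\<^sup>2 \<le> F z"
proof -
  have der: "\<And>z. (F has_derivative (\<lambda>v. gF z \<bullet> v)) (at z)"
    and hom: "\<And>c z. 0 < c \<Longrightarrow> F (c *\<^sub>R z) = c\<^sup>2 * F z" and F0: "F 0 = 0" and pos: "\<And>z. z \<noteq> 0 \<Longrightarrow> 0 < F z"
    using assms unfolding hom_hamiltonian_def by auto
  have cF: "continuous_on UNIV F"
    using der has_derivative_continuous by (blast intro: continuous_at_imp_continuous_on)
  have ne: "sphere (0::complex ^ 'n) 1 \<noteq> {}" by simp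
  obtain z0 where z0: "z0 \<in> sphere 0 1" "\<And>z. z \<in> sphere 0 1 \<Longrightarrow> F z0 \<le> F z"
    using continuous_attains_inf[OF compact_sphere ne continuous_on_subset[OF cF subset_UNIV]] by blast
  have "F z0 * (norm z)\<^sup>2 \<le> F z" for z
  proof (cases "z = 0")
    case False
    have "F z = F (norm z *\<^sub>R (z /\<^sub>R norm z))" using False by simp
    also have "\<dots> = (norm z)\<^sup>2 * F (z /\<^sub>R norm z)" by (rule hom) (use False in simp)
    finally show ?thesis using z0(2)[of "z /\<^sub>R norm z"] False by (simp add: mult.commute mult_left_mono)
  qed (simp add: F0)
  moreover have "0 < F z0" using z0(1) by (intro pos) auto
  ultimately show ?thesis by blast
qed

text \<open>If \<open>{F < 1}\<close> were squeezed into a cylinder of capacity below \<open>\<pi>\<close>, a Hamiltonian equal to a slow function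
  of \<open>F\<close> on the image and to a quadratic form at infinity would, by \<open>hofer_zehnder\<close>, have a
  periodic orbit that rescales to an orbit of \<open>F\<close> of period below \<open>\<pi>\<close>.\<close>

lemma cylindrical_lower:
  fixes F :: "complex ^ 'n::finite \<Rightarrow> real" and i :: 'n
  assumes hF: "hom_hamiltonian F gF"
    and KEY: "\<And>\<gamma> T. 0 < T \<Longrightarrow> (\<And>t. (\<gamma> has_vector_derivative \<i> *s gF (\<gamma> t)) (at t)) \<Longrightarrow>
      (\<And>t. \<gamma> (t + T) = \<gamma> t) \<Longrightarrow> (\<And>t. F (\<gamma> t) = 1) \<Longrightarrow> pi \<le> T"
    and sym: "symplectomorphism \<phi>" and sub: "\<phi> ` {z. F z < 1} \<subseteq> cylinder i r" and r: "0 < r"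
  shows "1 \<le> r"
proof (rule ccontr)
  assume "\<not> 1 \<le> r"
  then have r1: "r < 1" by simp
  have derF: "\<And>z. (F has_derivative (\<lambda>v. gF z \<bullet> v)) (at z)" and cgF: "continuous_on UNIV gF"
    and hom: "\<And>c z. 0 < c \<Longrightarrow> F (c *\<^sub>R z) = c\<^sup>2 * F z" and homg: "\<And>c z. 0 < c \<Longrightarrow> gF (c *\<^sub>R z) = c *\<^sub>R gF z"
    and F0: "F 0 = 0" and pos: "\<And>z. z \<noteq> 0 \<Longrightarrow> 0 < F z"
    using hF unfolding hom_hamiltonian_def by auto
  have cF: "continuous_on UNIV F"
    using derF has_derivative_continuous by (blast intro: continuous_at_imp_continuous_on)
  obtain m0 where m0: "0 < m0" "\<And>z. m0 * (norm z)\<^sup>2 \<le> F z" using hom_hamiltonian_lower[OF hF] by blast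
  define \<psi> where "\<psi> = inv \<phi>"
  have bij: "bij \<phi>" and sm: "smooth_on \<phi> UNIV" "smooth_on \<psi> UNIV"
    and sy: "\<And>z u v. symp_form (frechet_derivative \<phi> (at z) u) (frechet_derivative \<phi> (at z) v) = symp_form u v"
    using sym unfolding symplectomorphism_def diffeomorphism_def \<psi>_def by auto
  have \<phi>\<psi>: "\<phi> (\<psi> z) = z" and \<psi>\<phi>: "\<psi> (\<phi> z) = z" for z
    using bij by (auto simp: \<psi>_def bij_def surj_f_inv_f inv_f_f)
  define D\<phi> where "D\<phi> z = frechet_derivative \<phi> (at z)" for z
  define D\<psi> where "D\<psi> z = frechet_derivative \<psi> (at z)" for z
  have d\<phi>: "(\<phi> has_derivative D\<phi> z) (at z)" and d\<psi>: "(\<psi> has_derivative D\<psi> z) (at z)" for z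
    using smooth_on_UNIV_C1(1)[OF sm(1)] smooth_on_UNIV_C1(1)[OF sm(2)]
    by (auto simp: D\<phi>_def D\<psi>_def frechet_derivative_works)
  have c\<phi>: "continuous_on UNIV \<phi>" "continuous_on UNIV \<psi>"
    using d\<phi> d\<psi> has_derivative_continuous by (blast intro: continuous_at_imp_continuous_on)+
  define P where "P z = F (\<psi> z)" for z
  define gP where "gP z = (\<Sum>b\<in>Basis. (gF (\<psi> z) \<bullet> D\<psi> z b) *\<^sub>R b)" for z
  have derP: "(P has_derivative (\<lambda>v. gP z \<bullet> v)) (at z)" for z
  proof -
    have lin: "linear (\<lambda>v. gF (\<psi> z) \<bullet> D\<psi> z v)"
      using has_derivative_linear[OF d\<psi>[of z]]
      by (intro linearI) (simp_all add: linear_add linear_scale inner_add_right)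
    have "(P has_derivative (\<lambda>v. gF (\<psi> z) \<bullet> D\<psi> z v)) (at z)"
      unfolding P_def by (rule has_derivative_compose[OF d\<psi> derF])
    also have "(\<lambda>v. gF (\<psi> z) \<bullet> D\<psi> z v) = (\<lambda>v. gP z \<bullet> v)"
      unfolding gP_def by (rule ext) (rule inner_gradient_exists[OF lin])
    finally show ?thesis .
  qed
  have gP: "gP z \<bullet> v = gF (\<psi> z) \<bullet> D\<psi> z v" for z v
  proof -
    have "(P has_derivative (\<lambda>v. gF (\<psi> z) \<bullet> D\<psi> z v)) (at z)"
      unfolding P_def by (rule has_derivative_compose[OF d\<psi> derF])
    from has_derivative_unique[OF this derP] show ?thesis by metis
  qed
  have cgP: "continuous_on UNIV gP"
    unfolding gP_def D\<psi>_def
    by (intro continuous_intros continuous_on_compose2[OF cgF c\<phi>(2)] smooth_on_UNIV_C1(2)[OF sm(2)]) auto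
  have cP: "continuous_on UNIV P" unfolding P_def by (rule continuous_on_compose2[OF cF c\<phi>(2)]) auto

  obtain Bd where Bd: "\<And>w. P w \<le> 1 \<Longrightarrow> norm w \<le> Bd" and Bd0: "0 < Bd"
  proof -
    have "{z. F z \<le> 1} \<subseteq> cball 0 (sqrt (1 / m0))"
    proof
      fix z assume "z \<in> {z. F z \<le> 1}"
      then have "m0 * (norm z)\<^sup>2 \<le> 1" using m0(2)[of z] by simp
      then have "(norm z)\<^sup>2 \<le> 1 / m0" using m0(1) by (simp add: field_simps)
      then show "z \<in> cball 0 (sqrt (1 / m0))" by (simp add: real_le_rsqrt)
    qed
    moreover have "closed {z. F z \<le> 1}" by (intro closed_Collect_le cF continuous_on_const)
    ultimately have "compact {z. F z \<le> 1}"
      using bounded_cball bounded_subset compact_eq_bounded_closed by blast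
    then have "bounded (\<phi> ` {z. F z \<le> 1})"
      by (intro compact_imp_bounded compact_continuous_image continuous_on_subset[OF c\<phi>(1)]) auto
    then obtain B where B: "\<And>w. w \<in> \<phi> ` {z. F z \<le> 1} \<Longrightarrow> norm w \<le> B" unfolding bounded_iff by blast
    have "norm w \<le> max B 1" if "P w \<le> 1" for w
    proof -
      have "w \<in> \<phi> ` {z. F z \<le> 1}" using that \<phi>\<psi>[of w] by (intro image_eqI[of _ _ "\<psi> w"]) (auto simp: P_def)
      from B[OF this] show ?thesis by simp
    qed
    then show ?thesis by (intro that[of "max B 1"]) auto
  qed

  \<comment> \<open>A level strictly between r^2 and 1: the image of the domain will lie in an
    ellipsoid \<open>q\<close> < \<open>Q\<close>, and the gap up to 1 is room for the
    ramps.\<close>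
  define Q where "Q = (1 + r\<^sup>2) / 2"
  have r2: "r\<^sup>2 < 1" using power_strict_mono[OF r1, of 2] r by simp
  have Q: "r\<^sup>2 < Q" "Q < 1" using r2 by (auto simp: Q_def)
  \<comment> \<open>A quarter of the gap 1 - \<open>Q\<close> as ramp width makes the plateau
    \<open>m\<close> of \<open>h\<close> at least \<pi> (\<open>Q\<close> + \<eta>). This dominates
    half of \<open>gH z \<bullet> z\<close> on the periodic orbits outside the image, so those have
    nonpositive action.\<close>
  define \<eta> where "\<eta> = (1 - Q) / 4"
  have Q0: "0 < Q" using Q(1) zero_le_power2[of r] by linarith
  have \<eta>: "0 < \<eta>" "\<eta> < 1 / 4" using Q Q0 by (auto simp: \<eta>_def)
  \<comment> \<open>The slope of \<open>h\<close> stays below \<pi>, so that a periodic orbit on a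
    level of \<open>P\<close> corresponds to an orbit of \<open>F\<close> of period below
    \<pi>.\<close>
  define b where "b = pi * (1 - \<eta>)"
  have b: "0 < b" "b < pi" using \<eta> by (auto simp: b_def)
  define m where "m = b * (1 - 2 * \<eta>)"
  have m: "pi * (Q + \<eta>) \<le> m"
  proof -
    have "Q + \<eta> = 1 - 3 * \<eta>" by (simp add: \<eta>_def field_simps)
    also have "\<dots> \<le> (1 - \<eta>) * (1 - 2 * \<eta>)" using \<eta> by (simp add: algebra_simps)
    finally show ?thesis unfolding m_def b_def mult.assoc by (intro mult_left_mono) auto
  qed
  define h where "h s = b * (ramp \<eta> (s - \<eta>) - ramp \<eta> (s - (1 - \<eta>)))" for s
  define h' where "h' s = b * (ramp' \<eta> (s - \<eta>) - ramp' \<eta> (s - (1 - \<eta>)))" for s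
  have dh: "(h has_real_derivative h' s) (at s)" for s
  proof -
    have "((\<lambda>s. ramp \<eta> (s - c)) has_real_derivative ramp' \<eta> (s - c)) (at s)" for c
    proof -
      have "((\<lambda>s. s - c) has_real_derivative 1) (at s)" by (auto intro!: derivative_eq_intros)
      from DERIV_chain2[where f = "ramp \<eta>", OF DERIV_ramp[OF \<eta>(1)] this] show ?thesis by simp
    qed
    then show ?thesis unfolding h_def[abs_def] h'_def by (intro DERIV_cmult DERIV_diff)
  qed
  have ch': "continuous_on UNIV h'"
    unfolding h'_def by (intro continuous_intros continuous_on_compose2[OF ramp_props(10)[OF \<eta>(1)]]) auto
  have h'0: "0 \<le> h' s" for s
    unfolding h'_def using b \<eta> ramp_props(9)[OF \<eta>(1), of "s - (1 - \<eta>)" "s - \<eta>"] by simp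
  have h'b: "h' s \<le> b" for s
  proof -
    have "ramp' \<eta> (s - \<eta>) - ramp' \<eta> (s - (1 - \<eta>)) \<le> 1"
      using ramp_props(5,6)[OF \<eta>(1), of "s - \<eta>"] ramp_props(5,6)[OF \<eta>(1), of "s - (1 - \<eta>)"] by linarith
    then show ?thesis unfolding h'_def using b by (simp add: mult_left_le)
  qed
  have h'1: "h' s = 0" "h s = m" if "1 \<le> s" for s
  proof -
    have le: "\<eta> \<le> s - \<eta>" "\<eta> \<le> s - (1 - \<eta>)" using that \<eta> by auto
    show "h' s = 0"
      unfolding h'_def ramp_props(4)[OF \<eta>(1) le(1)] ramp_props(4)[OF \<eta>(1) le(2)] by simp
    show "h s = m"
      unfolding h_def m_def ramp_props(3)[OF \<eta>(1) le(1)] ramp_props(3)[OF \<eta>(1) le(2)] by simp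
  qed
  have hs0: "h' s = 0" "h s = 0" if "s \<le> \<eta>" for s
  proof -
    have "s - \<eta> \<le> 0" "s - (1 - \<eta>) \<le> 0" using that \<eta> by auto
    then show "h' s = 0" "h s = 0" unfolding h'_def h_def using ramp_props(1,2)[OF \<eta>(1)] by simp_all
  qed
  have h0: "0 \<le> h s" for s
    unfolding h_def using b \<eta> ramp_mono[OF \<eta>(1), of "s - (1 - \<eta>)" "s - \<eta>"] by simp

  \<comment> \<open>The weight of the other coordinates is so small that the bounded image, whose
    \<open>i\<close>-th coordinate is below r in modulus, satisfies \<open>q\<close> <
    \<open>Q\<close>; the bound 1/2 is for non-resonance.\<close>
  define \<kappa> where "\<kappa> = min (1 / 2) ((Q - r\<^sup>2) / Bd\<^sup>2)"
  have \<kappa>: "0 < \<kappa>" "\<kappa> \<le> 1 / 2" "\<kappa> * Bd\<^sup>2 \<le> Q - r\<^sup>2"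
  proof -
    show "0 < \<kappa>" using Q Bd0 by (simp add: \<kappa>_def)
    show "\<kappa> \<le> 1 / 2" unfolding \<kappa>_def by (rule min.cobounded1)
    have "\<kappa> \<le> (Q - r\<^sup>2) / Bd\<^sup>2" by (simp add: \<kappa>_def)
    then show "\<kappa> * Bd\<^sup>2 \<le> Q - r\<^sup>2" using Bd0 by (simp add: pos_le_divide_eq)
  qed
  define lam where "lam j = (if j = i then 1 else \<kappa>)" for j
  have lam: "lam i = 1" "0 < lam j" "\<kappa> \<le> lam j" "lam j \<le> 1" for j using \<kappa> by (auto simp: lam_def)
  define L :: "complex ^ 'n \<Rightarrow> complex ^ 'n" where "L z = (\<chi> j. of_real (lam j) * z $ j)" for z
  have L: "bounded_linear L"
    unfolding L_def[abs_def]
    by (auto simp: linear_conv_bounded_linear[symmetric] vec_eq_iff algebra_simps scaleR_conv_of_real[where 'a = complex] intro!: linearI)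
  have Lsym: "L u \<bullet> v = L v \<bullet> u" for u v
    by (simp add: L_def inner_vec_def inner_complex_def algebra_simps)
  define q where "q z = L z \<bullet> z" for z
  have q: "q z = (\<Sum>j\<in>UNIV. lam j * (cmod (z $ j))\<^sup>2)" for z
    unfolding q_def L_def inner_vec_def inner_complex_def cmod_power2
    by (intro sum.cong refl) (simp add: power2_eq_square algebra_simps)
  have derq: "(q has_derivative (\<lambda>v. (2 *\<^sub>R L z) \<bullet> v)) (at z)" for z
  proof -
    have "(q has_derivative (\<lambda>v. L z \<bullet> v + L v \<bullet> z)) (at z)"
      unfolding q_def[abs_def] by (rule has_derivative_inner[OF bounded_linear.has_derivative[OF L has_derivative_ident] has_derivative_ident])
    moreover have "L z \<bullet> v + L v \<bullet> z = (2 *\<^sub>R L z) \<bullet> v" for v using Lsym[of v z] by simp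
    ultimately show ?thesis by simp
  qed
  have cq: "continuous_on UNIV q" using derq has_derivative_continuous by (blast intro: continuous_at_imp_continuous_on)
  have qn: "\<kappa> * (norm z)\<^sup>2 \<le> q z" for z
    unfolding q norm_power2_vec sum_distrib_left using lam by (intro sum_mono mult_right_mono) auto
  have q0: "0 \<le> q z" for z using qn[of z] \<kappa>(1) by (meson mult_nonneg_nonneg order_trans less_imp_le zero_le_power2)
  have inQ: "q w < Q" if "P w < 1" for w
  proof -
    have "w \<in> \<phi> ` {z. F z < 1}" using that \<phi>\<psi>[of w] by (intro image_eqI[of _ _ "\<psi> w"]) (auto simp: P_def)
    then have wi: "cmod (w $ i) < r" using sub by (auto simp: cylinder_def)
    have "q w = (cmod (w $ i))\<^sup>2 + (\<Sum>j\<in>UNIV - {i}. \<kappa> * (cmod (w $ j))\<^sup>2)"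
      unfolding q by (subst sum.remove[of _ i]) (auto simp: lam_def)
    also have "(\<Sum>j\<in>UNIV - {i}. \<kappa> * (cmod (w $ j))\<^sup>2) \<le> (\<Sum>j\<in>UNIV. \<kappa> * (cmod (w $ j))\<^sup>2)"
      using \<kappa>(1) by (intro sum_mono2) auto
    also have "\<dots> = \<kappa> * (norm w)\<^sup>2" by (simp add: norm_power2_vec sum_distrib_left)
    also have "\<dots> \<le> \<kappa> * Bd\<^sup>2" using Bd[of w] that \<kappa>(1) by (intro mult_left_mono power_mono) auto
    finally have "q w \<le> (cmod (w $ i))\<^sup>2 + (Q - r\<^sup>2)" using \<kappa>(3) by linarith
    moreover have "(cmod (w $ i))\<^sup>2 < r\<^sup>2" using wi by (intro power_strict_mono) auto
    ultimately show ?thesis by simp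
  qed

  \<comment> \<open>The frequencies 2 a = 3 \<pi> and 3 \<pi> \<kappa> are not multiples of 2 \<pi>,
    the second because it lies between 0 and 3 \<pi> / 2. The excess over \<pi> also leaves room for
    the translation below, which lowers the usable slope to 5 \<pi> / 4.\<close>
  define a where "a = 3 * pi / 2"
  define H where "H w = h (P w) + a * ramp \<eta> (q w - Q)" for w
  define gH where "gH w = h' (P w) *\<^sub>R gP w + (a * ramp' \<eta> (q w - Q)) *\<^sub>R (2 *\<^sub>R L w)" for w
  have derH: "(H has_derivative (\<lambda>v. gH w \<bullet> v)) (at w)" for w
  proof -
    have 1: "((\<lambda>w. h (P w)) has_derivative (\<lambda>v. h' (P w) * (gP w \<bullet> v))) (at w)"
      by (rule has_derivative_compose[OF derP dh[unfolded has_field_derivative_def]])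
    have "((\<lambda>w. q w - Q) has_derivative (\<lambda>v. (2 *\<^sub>R L w) \<bullet> v)) (at w)"
      using has_derivative_diff[OF derq has_derivative_const] by simp
    from has_derivative_compose[OF this DERIV_ramp[OF \<eta>(1), unfolded has_field_derivative_def]]
    have 2: "((\<lambda>w. ramp \<eta> (q w - Q)) has_derivative (\<lambda>v. ramp' \<eta> (q w - Q) * ((2 *\<^sub>R L w) \<bullet> v))) (at w)" .
    show ?thesis
      using has_derivative_add[OF 1 has_derivative_mult_right[OF 2, of a]]
      unfolding H_def[abs_def] gH_def inner_add_left inner_scaleR_left by (simp add: mult_ac)
  qed
  \<comment> \<open>On the image the ramp in \<open>q\<close> is zero and outside it
    \<open>h\<close> is constant, so at each point at most one of the two gradients acts.\<close>
  have cross: "h' (P w) = 0 \<or> ramp' \<eta> (q w - Q) = 0" for w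
  proof (cases "P w < 1")
    case True
    then show ?thesis using inQ[OF True] ramp_props(2)[OF \<eta>(1)] by simp
  next
    case False
    then show ?thesis using h'1 by simp
  qed
  define bb where "bb w = h' (P w) *\<^sub>R gP w + (2 * a * (ramp' \<eta> (q w - Q) - 1)) *\<^sub>R L w" for w
  have gHbb: "gH w = (2 * a) *\<^sub>R L w + bb w" for w
    by (simp add: gH_def bb_def algebra_simps)
  have cL: "continuous_on UNIV L" using L by (rule linear_continuous_on)
  have cbb: "continuous_on UNIV bb"
    unfolding bb_def[abs_def]
    by (intro continuous_intros cgP cL continuous_on_compose2[OF ch' cP]
        continuous_on_compose2[OF ramp_props(10)[OF \<eta>(1)]] cq) auto
  define R1 where "R1 = max Bd (sqrt ((Q + \<eta>) / \<kappa>)) + 1"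
  have bb0: "bb w = 0" if "R1 \<le> norm w" for w
  proof -
    have "Bd < norm w" using that by (simp add: R1_def)
    then have "1 \<le> P w" using Bd[of w] by (meson not_le less_imp_le)
    moreover have "\<eta> \<le> q w - Q"
    proof -
      have Qe: "0 \<le> (Q + \<eta>) / \<kappa>" using Q \<kappa> \<eta> by (simp add: Q_def)
      have "sqrt ((Q + \<eta>) / \<kappa>) \<le> norm w" using that by (simp add: R1_def)
      then have "(sqrt ((Q + \<eta>) / \<kappa>))\<^sup>2 \<le> (norm w)\<^sup>2" using Qe by (intro power_mono) auto
      then have "(Q + \<eta>) / \<kappa> \<le> (norm w)\<^sup>2" using Qe by simp
      then have "Q + \<eta> \<le> \<kappa> * (norm w)\<^sup>2" using \<kappa>(1) by (simp add: field_simps)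
      then show ?thesis using qn[of w] by linarith
    qed
    ultimately show ?thesis using h'1(1) ramp_props(4)[OF \<eta>(1)] by (simp add: bb_def)
  qed
  obtain Bb where Bb: "\<And>w. norm (bb w) \<le> Bb" using uniformly_continuous_compact_support(2)[OF cbb bb0] by blast

  \<comment> \<open>\<phi> may move the origin, whereas \<open>hofer_zehnder\<close> asks for a
    Hamiltonian that vanishes near 0; hence the translation by \<phi> 0.\<close>
  define x0 where "x0 = \<phi> 0"
  have Px0: "P x0 = 0" by (simp add: P_def x0_def \<psi>\<phi> F0)
  have "\<forall>\<^sub>F w in nhds x0. P w < \<eta> \<and> q w < Q"
  proof (rule eventually_conj)
    show "\<forall>\<^sub>F w in nhds x0. P w < \<eta>"
      by (rule eventually_nhds_in_open[of "{w. P w < \<eta>}", simplified]) (use Px0 \<eta> in \<open>auto intro!: open_Collect_less cP\<close>)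
    show "\<forall>\<^sub>F w in nhds x0. q w < Q"
      by (rule eventually_nhds_in_open[of "{w. q w < Q}", simplified]) (use inQ[of x0] Px0 in \<open>auto intro!: open_Collect_less cq\<close>)
  qed
  then obtain \<rho> where \<rho>: "0 < \<rho>" "\<And>w. dist w x0 < \<rho> \<Longrightarrow> P w < \<eta> \<and> q w < Q"
    unfolding eventually_nhds_metric by blast
  define H1 where "H1 z = H (z + x0)" for z
  define b1 where "b1 z = bb (z + x0) + (2 * a) *\<^sub>R L x0" for z
  have "\<exists>x. (\<forall>t. x (t + 1) = x t) \<and> (\<forall>t. (x has_vector_derivative \<i> *s gH (x t + x0)) (at t)) \<and>
    0 < integral {0..1} (\<lambda>t. gH (x t + x0) \<bullet> x t / 2 - H1 (x t))"
  proof (rule hofer_zehnder[where b = b1 and lam = lam and a = a and al = "5 * pi / 4" and i = i and \<rho> = \<rho> and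
        gH = "\<lambda>z. gH (z + x0)" and B = "Bb + norm ((2 * a) *\<^sub>R L x0)" and C = "a * (Q + \<eta>) + 6 * a * q x0"])
    show "(H1 has_derivative (\<lambda>v. gH (z + x0) \<bullet> v)) (at z)" for z
    proof -
      have "((\<lambda>z. z + x0) has_derivative (\<lambda>v. v)) (at z)" by (auto intro!: derivative_eq_intros)
      from has_derivative_compose[OF this derH] show ?thesis by (simp add: H1_def[abs_def])
    qed
    show "gH (z + x0) = (\<chi> j. of_real (2 * a * lam j) * z $ j) + b1 z" for z
      by (simp add: gHbb b1_def vec_eq_iff L_def scaleR_conv_of_real[where 'a = complex] algebra_simps)
    show "uniformly_continuous_on UNIV b1"
    proof -
      have "uniformly_continuous_on UNIV (\<lambda>z. bb (z + x0))"
        unfolding uniformly_continuous_on_def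
      proof (intro allI impI)
        fix e :: real assume "0 < e"
        with uniformly_continuous_compact_support(1)[OF cbb bb0]
        have "\<exists>d>0. \<forall>x\<in>UNIV. \<forall>x'\<in>UNIV. dist x' x < d \<longrightarrow> dist (bb x') (bb x) < e"
          unfolding uniformly_continuous_on_def by simp
        then obtain d where d: "0 < d" "\<forall>x\<in>UNIV. \<forall>x'\<in>UNIV. dist x' x < d \<longrightarrow> dist (bb x') (bb x) < e" by (elim exE conjE)
        show "\<exists>d>0. \<forall>x\<in>UNIV. \<forall>x'\<in>UNIV. dist x' x < d \<longrightarrow> dist (bb (x' + x0)) (bb (x + x0)) < e"
          using d by (intro exI[of _ d]) simp
      qed
      then show ?thesis unfolding b1_def[abs_def] by (intro uniformly_continuous_on_add uniformly_continuous_on_const)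
    qed
    show "norm (b1 z) \<le> Bb + norm ((2 * a) *\<^sub>R L x0)" for z
      unfolding b1_def using norm_triangle_ineq[of "bb (z + x0)" "(2 * a) *\<^sub>R L x0"] Bb[of "z + x0"] by linarith
    show "pi < 5 * pi / 4" by simp
    show "lam i = 1" "\<And>j. 0 < lam j" by (fact lam)+
    show "2 * pi * of_int k \<noteq> 2 * a * lam j" for k :: int and j
    proof
      assume "2 * pi * of_int k = 2 * a * lam j"
      then have "pi * (2 * of_int k) = pi * (3 * lam j)" unfolding a_def by (simp add: mult_ac)
      then have eq: "2 * real_of_int k = 3 * lam j" by simp
      show False
      proof (cases "j = i")
        case True
        then have "real_of_int (2 * k) = real_of_int 3" using eq lam(1) by simp
        then have "2 * k = 3" by (simp only: of_int_eq_iff)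
        then show False by presburger
      next
        case False
        then have "0 < 2 * real_of_int k" "2 * real_of_int k < 2" using eq \<kappa> by (auto simp: lam_def)
        then show False by simp
      qed
    qed
    show "0 \<le> H1 z" for z
      unfolding H1_def H_def using h0 ramp_nonneg[OF \<eta>(1)] by (simp add: a_def)
    show "H1 z = 0" if "norm z < \<rho>" for z
    proof -
      have "P (z + x0) < \<eta> \<and> q (z + x0) < Q" using that by (intro \<rho>) (simp add: dist_norm)
      then show ?thesis using hs0(2) ramp_props(1)[OF \<eta>(1)] by (simp add: H1_def H_def)
    qed
    show "0 < \<rho>" by (fact \<rho>)
    show "5 * pi / 4 * (\<Sum>j\<in>UNIV. lam j * (cmod (z $ j))\<^sup>2) - (a * (Q + \<eta>) + 6 * a * q x0) \<le> H1 z" for z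
    proof -
      \<comment> \<open>Completing the square: part of the coefficient 3/2 is traded for a bounded
        error in the translation vector.\<close>
      have one: "5 / 4 * (cmod u)\<^sup>2 \<le> 3 / 2 * (cmod (u + v))\<^sup>2 + 9 * (cmod v)\<^sup>2" for u v :: complex
      proof -
        have "5 / 4 * (A :: real)\<^sup>2 \<le> 3 / 2 * (A + C)\<^sup>2 + 9 * C\<^sup>2" for A C
        proof -
          have "3 / 2 * (A + C)\<^sup>2 + 9 * C\<^sup>2 - 5 / 4 * A\<^sup>2 = (A / 2 + 3 * C)\<^sup>2 + 3 / 2 * C\<^sup>2"
            by (simp add: power2_eq_square field_simps)
          then show ?thesis using zero_le_power2[of "A / 2 + 3 * C"] zero_le_power2[of C] by linarith
        qed
        from add_mono[OF this[of "Re u" "Re v"] this[of "Im u" "Im v"]] show ?thesis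
          by (simp add: cmod_power2 algebra_simps)
      qed
      have "5 * pi / 4 * q z = pi * (\<Sum>j\<in>UNIV. lam j * (5 / 4 * (cmod (z $ j))\<^sup>2))"
        unfolding q by (simp add: sum_distrib_left mult_ac)
      also have "\<dots> \<le> pi * (\<Sum>j\<in>UNIV. lam j * (3 / 2 * (cmod (z $ j + x0 $ j))\<^sup>2 + 9 * (cmod (x0 $ j))\<^sup>2))"
        using lam(2) by (intro mult_left_mono sum_mono one) (auto intro: less_imp_le)
      also have "\<dots> = a * q (z + x0) + 6 * a * q x0"
        unfolding q a_def by (simp add: distrib_left sum.distrib sum_distrib_left mult_ac)
      finally have "5 * pi / 4 * q z \<le> a * q (z + x0) + 6 * a * q x0" .
      moreover have "a * (q (z + x0) - Q - \<eta>) \<le> a * ramp \<eta> (q (z + x0) - Q)"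
        using ramp_ge[OF \<eta>(1), of "q (z + x0) - Q"] by (intro mult_left_mono) (auto simp: a_def)
      moreover have "a * ramp \<eta> (q (z + x0) - Q) \<le> H1 z" using h0 by (simp add: H1_def H_def)
      ultimately show ?thesis unfolding q[symmetric] by (simp add: algebra_simps)
    qed
  qed
  then obtain x where px: "\<And>t. x (t + 1) = x t"
    and dx: "\<And>t. (x has_vector_derivative \<i> *s gH (x t + x0)) (at t)"
    and act: "0 < integral {0..1} (\<lambda>t. gH (x t + x0) \<bullet> x t / 2 - H1 (x t))" by blast
  define X where "X t = x t + x0" for t
  have pX: "X (t + 1) = X t" for t by (simp add: X_def px)
  have dX: "(X has_vector_derivative \<i> *s gH (X t)) (at t)" for t
    unfolding X_def using has_vector_derivative_add[OF dx has_vector_derivative_const] by simp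
  have cX: "continuous_on A X" for A
    using has_vector_derivative_continuous[OF dX] by (meson continuous_at_imp_continuous_on)
  have cH: "continuous_on UNIV H" using derH has_derivative_continuous by (blast intro: continuous_at_imp_continuous_on)
  have cgH: "continuous_on UNIV gH" unfolding gHbb[abs_def] by (intro continuous_intros cL cbb)
  have cgX: "continuous_on A (\<lambda>t. gH (X t))" for A by (rule continuous_on_compose2[OF cgH cX]) auto
  have cHX: "continuous_on A (\<lambda>t. H (X t))" for A by (rule continuous_on_compose2[OF cH cX]) auto
  \<comment> \<open>The velocity of a closed orbit has mean zero, so the translation does not change
    the action.\<close>
  have actX: "0 < integral {0..1} (\<lambda>t. gH (X t) \<bullet> X t / 2 - H (X t))"
  proof -
    have "((\<lambda>t. \<i> *s gH (X t)) has_integral X 1 - X 0) {0..1}"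
      by (rule fundamental_theorem_of_calculus) (auto intro: has_vector_derivative_at_within dX)
    then have "((\<lambda>t. \<i> *s gH (X t)) has_integral 0) {0..1}" using pX[of 0] by simp
    from has_integral_linear[OF this bounded_linear_inner_left[of "\<i> *s x0"]]
    have "((\<lambda>t. gH (X t) \<bullet> x0) has_integral 0) {0..1}" by (simp add: o_def)
    then have i0: "integral {0..1} (\<lambda>t. gH (X t) \<bullet> x0) = 0" by (rule integral_unique)
    have "integral {0..1} (\<lambda>t. gH (X t) \<bullet> X t / 2 - H (X t)) =
        integral {0..1} (\<lambda>t. (gH (x t + x0) \<bullet> x t / 2 - H1 (x t)) + (1 / 2) * (gH (X t) \<bullet> x0))"
      by (simp add: X_def H1_def inner_add_right add_divide_distrib algebra_simps)
    also have "\<dots> = integral {0..1} (\<lambda>t. gH (x t + x0) \<bullet> x t / 2 - H1 (x t)) + integral {0..1} (\<lambda>t. (1 / 2) * (gH (X t) \<bullet> x0))"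
    proof (rule Henstock_Kurzweil_Integration.integral_add; rule integrable_continuous_real)
      have "continuous_on {0..1} x" using cX[of "{0..1}"] continuous_on_diff[OF cX continuous_on_const[of _ x0]] by (simp add: X_def)
      then show "continuous_on {0..1} (\<lambda>t. gH (x t + x0) \<bullet> x t / 2 - H1 (x t))"
        using cgX[of "{0..1}"] cHX[of "{0..1}"] unfolding H1_def X_def by (intro continuous_intros) auto
      show "continuous_on {0..1} (\<lambda>t. (1 / 2) * (gH (X t) \<bullet> x0))" by (intro continuous_intros cgX)
    qed
    finally show ?thesis using act i0 by simp
  qed
  have nonpos: False if "\<And>t. gH (X t) \<bullet> X t / 2 - H (X t) \<le> 0"
  proof -
    have "integral {0..1} (\<lambda>t. gH (X t) \<bullet> X t / 2 - H (X t)) \<le> integral {0..1::real} (\<lambda>t. 0::real)"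
      by (rule Henstock_Kurzweil_Integration.integral_le;
          (rule that | intro integrable_continuous_real continuous_intros cgX cHX cX; simp))
    then show False using actX by simp
  qed
  have along: "((\<lambda>t. P (X t)) has_real_derivative gP (X t) \<bullet> (\<i> *s gH (X t))) (at t)"
    "((\<lambda>t. q (X t)) has_real_derivative (2 *\<^sub>R L (X t)) \<bullet> (\<i> *s gH (X t))) (at t)" for t
    by (rule has_real_derivative_along[OF derP dX], rule has_real_derivative_along[OF derq dX])
  have ramp_const: "ramp \<eta> (q (X t) - Q) = ramp \<eta> (q (X s) - Q)" for t s
  proof (rule const_of_zero_deriv[where f = "\<lambda>t. ramp \<eta> (q (X t) - Q)"])
    fix t
    have "((\<lambda>t. q (X t) - Q) has_real_derivative (2 *\<^sub>R L (X t)) \<bullet> (\<i> *s gH (X t))) (at t)"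
      using DERIV_diff[OF along(2) DERIV_const] by simp
    from DERIV_chain2[where f = "ramp \<eta>", OF DERIV_ramp[OF \<eta>(1)] this]
    show "((\<lambda>t. ramp \<eta> (q (X t) - Q)) has_real_derivative 0) (at t)"
      using cross[of "X t"] by (auto simp: gH_def iscale_add iscale_scaleR inner_add_right)
  qed
  show False
  proof (cases "\<exists>t. Q < q (X t)")
    case True
    then obtain t0 where t0: "Q < q (X t0)" by blast
    have qc: "q (X t) = q (X t0)" for t
    proof (rule ccontr)
      assume ne: "q (X t) \<noteq> q (X t0)"
      show False
      proof (cases "q (X t) < q (X t0)")
        case True
        show False
        proof (cases "0 \<le> q (X t) - Q")
          case T2: True
          then show False using ramp_strict[OF \<eta>(1) T2, of "q (X t0) - Q"] True ramp_const[of t t0] by simp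
        next
          case False
          then show False using ramp_strict[OF \<eta>(1), of 0 "q (X t0) - Q"] t0 ramp_const[of t t0] ramp_props(1)[OF \<eta>(1)] by simp
        qed
      next
        case False
        then show False using ramp_strict[OF \<eta>(1), of "q (X t0) - Q" "q (X t) - Q"] t0 ne ramp_const[of t t0] by simp
      qed
    qed
    \<comment> \<open>Here the flow is the linear one slowed down by \<tau>, and a nonzero
      coordinate j closes up after time 1 only if 3 \<tau> \<open>lam j\<close> is an even integer.
      The bound \<kappa> \<le> 1/2 excludes j \<noteq> i, and \<tau> \<le> 1 leaves \<tau> = 2/3; as
      this is less than 1, the orbit still lies in the ramp, where \<open>q\<close> <
      \<open>Q\<close> + \<eta>.\<close>
    define \<tau> where "\<tau> = ramp' \<eta> (q (X t0) - Q)"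
    have \<tau>: "0 < \<tau>" "\<tau> \<le> 1" unfolding \<tau>_def using ramp_props(6,7)[OF \<eta>(1)] t0 by auto
    have h0X: "h' (P (X t)) = 0" for t using cross[of "X t"] \<tau>(1) unfolding \<tau>_def qc[of t] by linarith
    have PX: "1 \<le> P (X t)" for t using inQ[of "X t"] t0 qc[of t] by linarith
    have gX: "gH (X t) = (2 * a * \<tau>) *\<^sub>R L (X t)" for t unfolding gH_def h0X qc[of t] \<tau>_def[symmetric] by (simp add: mult_ac)
    have comp: "((\<lambda>t. X t $ j) has_vector_derivative (\<i> * of_real (2 * a * \<tau> * lam j)) * X t $ j) (at t)" for t j
      using bounded_linear.has_vector_derivative[OF bounded_linear_vec_nth[of j] dX[of t]]
      unfolding gX by (simp add: L_def scaleR_conv_of_real[where 'a = complex] mult_ac)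
    have rot: "X 0 $ j = 0 \<or> (\<exists>k::int. 2 * a * \<tau> * lam j = of_int k * (2 * pi))" for j
    proof (cases "X 0 $ j = 0")
      case False
      have "X 1 $ j = cis (2 * a * \<tau> * lam j * 1) * X 0 $ j" by (rule linear_ode_scalar[OF comp])
      then have "cis (2 * a * \<tau> * lam j) = 1" using pX[of 0] False by simp
      then have "cos (2 * a * \<tau> * lam j) = 1" by (simp add: complex_eq_iff)
      then show ?thesis by (auto simp: cos_one_2pi_int)
    qed simp
    have i0: "X 0 $ j = 0" if "j \<noteq> i" for j
    proof (rule ccontr)
      assume "X 0 $ j \<noteq> 0"
      then obtain k :: int where k: "2 * a * \<tau> * lam j = of_int k * (2 * pi)" using rot[of j] by blast
      then have "pi * (3 * \<tau> * lam j) = pi * (2 * of_int k)" by (simp add: a_def mult_ac)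
      then have k2: "3 * \<tau> * lam j = 2 * of_int k" by simp
      have "\<tau> * lam j \<le> 1 * (1 / 2)" using \<tau> \<kappa> that by (intro mult_mono) (auto simp: lam_def)
      moreover have "0 < \<tau> * lam j" using \<tau> lam by simp
      ultimately have "0 < real_of_int k" "real_of_int k < 1" using k2 by auto
      then show False by simp
    qed
    have "X 0 $ i \<noteq> 0"
    proof
      assume "X 0 $ i = 0"
      then have "X 0 = 0" using i0 by (metis vec_eq_iff zero_index)
      then have "q (X 0) = 0" by (simp add: q_def)
      then show False using qc[of 0] t0 Q(1) zero_le_power2[of r] by linarith
    qed
    then obtain k :: int where "2 * a * \<tau> * lam i = of_int k * (2 * pi)" using rot[of i] by blast
    then have "pi * (3 * \<tau>) = pi * (2 * of_int k)" by (simp add: a_def lam(1) mult_ac)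
    then have k: "3 * \<tau> = 2 * of_int k" by simp
    then have "0 < real_of_int k" "real_of_int k < 2" using \<tau> by auto
    then have "k = 1" by simp
    then have \<tau>23: "\<tau> = 2 / 3" using k by simp
    have sm: "q (X t0) - Q < \<eta>"
    proof (rule ccontr)
      assume "\<not> ?thesis"
      then have "\<tau> = 1" unfolding \<tau>_def using ramp_props(4)[OF \<eta>(1)] by simp
      then show False using \<tau>23 by simp
    qed
    have "gH (X t) \<bullet> X t / 2 - H (X t) \<le> 0" for t
    proof -
      have "gH (X t) \<bullet> X t / 2 = pi * q (X t0)"
        unfolding gX inner_scaleR_left using qc[of t] by (simp add: q_def \<tau>23 a_def)
      moreover have "m \<le> H (X t)"
        unfolding H_def using h'1(2)[OF PX[of t]] ramp_nonneg[OF \<eta>(1)] by (simp add: a_def)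
      moreover have "pi * q (X t0) \<le> pi * (Q + \<eta>)" using sm by (intro mult_left_mono) auto
      ultimately show ?thesis using m by linarith
    qed
    then show False by (rule nonpos)
  next
    case False
    then have r0: "ramp' \<eta> (q (X t) - Q) = 0" for t using ramp_props(2)[OF \<eta>(1)] by (simp add: not_less)
    have gX: "gH (X t) = h' (P (X t)) *\<^sub>R gP (X t)" for t by (simp add: gH_def r0)
    have PXc: "P (X t) = P (X 0)" for t
      by (rule const_of_zero_deriv[where f = "\<lambda>t. P (X t)"]) (use along(1) in \<open>simp add: gX iscale_scaleR\<close>)
    define s where "s = P (X 0)"
    \<comment> \<open>The value of \<open>P\<close> is constant along the orbit, which therefore
      follows the flow of \<open>P\<close> at the constant speed \<open>T\<close>, at most
      \<open>b\<close> < \<pi>.\<close>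
    define T where "T = h' s"
    have gX': "gH (X t) = T *\<^sub>R gP (X t)" for t using gX[of t] PXc[of t] by (simp add: T_def s_def)
    show False
    proof (cases "T = 0")
      case True
      have "0 \<le> H w" for w
        unfolding H_def using h0 ramp_nonneg[OF \<eta>(1)] by (simp add: a_def)
      then have "gH (X t) \<bullet> X t / 2 - H (X t) \<le> 0" for t
        unfolding gX' using True by simp
      then show False by (rule nonpos)
    next
      case Tne: False
      then have T: "0 < T" "T < pi" using h'0[of s] h'b[of s] b by (auto simp: T_def)
      have s: "0 < s" using hs0(1)[of s] Tne \<eta> by (cases "s \<le> \<eta>") (auto simp: T_def)
      define Y where "Y t = \<psi> (X t)" for t
      have XY: "X t = \<phi> (Y t)" for t by (simp add: Y_def \<phi>\<psi>)
      have FY: "F (Y t) = s" for t using PXc[of t] by (simp add: P_def Y_def s_def)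
      have dY: "(Y has_vector_derivative T *\<^sub>R (\<i> *s gF (Y t))) (at t)" for t
      proof -
        have dY0: "(Y has_vector_derivative D\<psi> (X t) (\<i> *s gH (X t))) (at t)"
        proof -
          have "(Y has_derivative (\<lambda>h. D\<psi> (X t) (h *\<^sub>R (\<i> *s gH (X t))))) (at t)"
            unfolding Y_def by (rule has_derivative_compose[OF dX[unfolded has_vector_derivative_def] d\<psi>])
          then show ?thesis
            unfolding has_vector_derivative_def using linear_scale[OF has_derivative_linear[OF d\<psi>]] by simp
        qed
        let ?Y' = "D\<psi> (X t) (\<i> *s gH (X t))"
        have inv1: "D\<phi> (Y t) (D\<psi> (X t) v) = v" for v
        proof -
          have "((\<lambda>z. \<phi> (\<psi> z)) has_derivative (\<lambda>v. D\<phi> (\<psi> (X t)) (D\<psi> (X t) v))) (at (X t))"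
            by (rule has_derivative_compose[OF d\<psi> d\<phi>])
          from has_derivative_unique[OF this[unfolded \<phi>\<psi>] has_derivative_ident] show ?thesis by (metis Y_def)
        qed
        have inv2: "D\<psi> (X t) (D\<phi> (Y t) v) = v" for v
        proof -
          have "((\<lambda>z. \<psi> (\<phi> z)) has_derivative (\<lambda>v. D\<psi> (\<phi> (Y t)) (D\<phi> (Y t) v))) (at (Y t))"
            by (rule has_derivative_compose[OF d\<phi> d\<psi>])
          from has_derivative_unique[OF this[unfolded \<psi>\<phi>] has_derivative_ident] show ?thesis by (metis XY)
        qed
        \<comment> \<open>A symplectomorphism carries the Hamiltonian field of \<open>P\<close> to
          that of \<open>F\<close>; by nondegeneracy it suffices to pair with an arbitrary
          vector.\<close>
        have "?Y' = T *\<^sub>R (\<i> *s gF (Y t))"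
        proof (rule symp_form_nondegenerate)
          fix w
          have "symp_form ?Y' w = symp_form (D\<phi> (Y t) ?Y') (D\<phi> (Y t) w)"
            using sy[of "Y t" ?Y' w] by (simp add: D\<phi>_def)
          also have "\<dots> = symp_form (\<i> *s gH (X t)) (D\<phi> (Y t) w)" by (simp add: inv1)
          also have "\<dots> = - (T * (gP (X t) \<bullet> D\<phi> (Y t) w))" by (simp add: symp_form_inner gX')
          also have "\<dots> = - (T * (gF (Y t) \<bullet> w))" by (simp add: gP inv2 Y_def[symmetric])
          also have "\<dots> = symp_form (T *\<^sub>R (\<i> *s gF (Y t))) w"
            by (simp add: symp_form_inner iscale_scaleR)
          finally show "symp_form ?Y' w = symp_form (T *\<^sub>R (\<i> *s gF (Y t))) w" .
        qed
        with dY0 show ?thesis by simp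
      qed
      \<comment> \<open>Homogeneity of degree 2 moves the level \<open>s\<close> to 1 without
        changing time, and the division of time by \<open>T\<close> turns the period 1 into
        \<open>T\<close>.\<close>
      define \<gamma> where "\<gamma> t = (1 / sqrt s) *\<^sub>R Y (t / T)" for t
      have "pi \<le> T"
      proof (rule KEY[of T \<gamma>])
        show "0 < T" by (fact T)
        show "(\<gamma> has_vector_derivative \<i> *s gF (\<gamma> t)) (at t)" for t
        proof -
          have "((Y \<circ> (\<lambda>t. t / T)) has_vector_derivative (1 / T) *\<^sub>R (T *\<^sub>R (\<i> *s gF (Y (t / T))))) (at t)"
            by (rule vector_diff_chain_at[where f = "\<lambda>t. t / T" and g = Y and f' = "1 / T"])
              (use T in \<open>auto intro!: derivative_eq_intros dY simp: has_real_derivative_iff_has_vector_derivative[symmetric]\<close>)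
          then have "((\<lambda>t. Y (t / T)) has_vector_derivative \<i> *s gF (Y (t / T))) (at t)"
            using T by (simp add: o_def)
          from has_vector_derivative_scaleR[OF DERIV_const this, of "1 / sqrt s"]
          have "(\<gamma> has_vector_derivative (1 / sqrt s) *\<^sub>R (\<i> *s gF (Y (t / T)))) (at t)"
            by (simp add: \<gamma>_def[abs_def])
          then show ?thesis using homg[of "1 / sqrt s" "Y (t / T)"] s by (simp add: \<gamma>_def iscale_scaleR)
        qed
        show "\<gamma> (t + T) = \<gamma> t" for t
        proof -
          have "(t + T) / T = t / T + 1" using T by (simp add: field_simps)
          then show ?thesis using pX[of "t / T"] by (simp add: \<gamma>_def Y_def)
        qed
        show "F (\<gamma> t) = 1" for t
          unfolding \<gamma>_def using hom[of "1 / sqrt s" "Y (t / T)"] s FY by (simp add: power_divide)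
      qed
      then show False using T by simp
    qed
  qed
qed

section \<open>Smooth functions\<close>

lemma Ck_on_Suc_open:
  "open U \<Longrightarrow> Ck_on (Suc k) f U \<longleftrightarrow>
    (\<forall>x\<in>U. f differentiable (at x)) \<and> (\<forall>v. Ck_on k (\<lambda>x. frechet_derivative f (at x) v) U)"
  by (simp add: differentiable_on_eq_differentiable_at)

lemma Ck_on_cong_aux:
  assumes "open U" "\<And>x. x \<in> U \<Longrightarrow> f x = g x" "Ck_on k f U"
  shows "Ck_on k g U"
  using assms(2,3)
proof (induction k arbitrary: f g)
  case 0
  then show ?case by (simp cong: continuous_on_cong)
next
  case (Suc k)
  have d: "(g has_derivative frechet_derivative f (at x)) (at x)" if "x \<in> U" for x
  proof -
    have "f differentiable (at x)"
      using Suc.prems(2) that unfolding Ck_on_Suc_open[OF \<open>open U\<close>] by blast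
    from this[unfolded frechet_derivative_works] show ?thesis
      by (rule has_derivative_transform_within_open[OF _ \<open>open U\<close> that]) (rule Suc.prems(1))
  qed
  have "Ck_on k (\<lambda>x. frechet_derivative g (at x) v) U" for v
  proof (rule Suc.IH)
    show "Ck_on k (\<lambda>x. frechet_derivative f (at x) v) U"
      using Suc.prems(2) unfolding Ck_on_Suc_open[OF \<open>open U\<close>] by blast
    show "frechet_derivative f (at x) v = frechet_derivative g (at x) v" if "x \<in> U" for x
      using frechet_derivative_at[OF d[OF that]] by simp
  qed
  then show ?case
    unfolding Ck_on_Suc_open[OF \<open>open U\<close>] using d by (auto simp: differentiable_def)
qed

lemma Ck_on_SucI:
  assumes U: "open U" and d: "\<And>x. x \<in> U \<Longrightarrow> (f has_derivative f' x) (at x)"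
    and C: "\<And>v. Ck_on k (\<lambda>x. f' x v) U"
  shows "Ck_on (Suc k) f U"
  unfolding Ck_on_Suc_open[OF U]
proof (intro conjI ballI allI)
  show "f differentiable (at x)" if "x \<in> U" for x using d[OF that] by (auto simp: differentiable_def)
  show "Ck_on k (\<lambda>x. frechet_derivative f (at x) v) U" for v
    by (rule Ck_on_cong_aux[OF U _ C[of v]]) (simp add: frechet_derivative_at[OF d, symmetric])
qed

lemma Ck_on_SucD:
  assumes U: "open U" and C: "Ck_on (Suc k) f U"
  shows "x \<in> U \<Longrightarrow> (f has_derivative frechet_derivative f (at x)) (at x)"
    and "Ck_on k (\<lambda>x. frechet_derivative f (at x) v) U"
  using C unfolding Ck_on_Suc_open[OF U] frechet_derivative_works by auto

lemma Ck_on_less: "open U \<Longrightarrow> Ck_on (Suc k) f U \<Longrightarrow> Ck_on k f U"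
proof (induction k arbitrary: f)
  case 0
  then show ?case by (simp add: differentiable_imp_continuous_on)
next
  case (Suc k)
  show ?case
    by (rule Ck_on_SucI[OF \<open>open U\<close> Ck_on_SucD(1)[OF \<open>open U\<close> Suc.prems(2)]])
      (auto intro: Suc.IH[OF \<open>open U\<close> Ck_on_SucD(2)[OF \<open>open U\<close> Suc.prems(2)]])
qed

lemma Ck_on_const: "open U \<Longrightarrow> Ck_on k (\<lambda>x. c) U"
proof (induction k arbitrary: c)
  case (Suc k)
  show ?case by (rule Ck_on_SucI[OF \<open>open U\<close> has_derivative_const]) (rule Suc.IH[OF \<open>open U\<close>])
qed simp

lemma Ck_on_linear: "open U \<Longrightarrow> bounded_linear f \<Longrightarrow> Ck_on k f U"
proof (cases k)
  case 0
  then show "bounded_linear f \<Longrightarrow> ?thesis" by (simp add: linear_continuous_on)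
next
  case (Suc k)
  assume "open U" "bounded_linear f"
  then show ?thesis unfolding Suc
    by (intro Ck_on_SucI[where f' = "\<lambda>_. f"] Ck_on_const bounded_linear_imp_has_derivative)
qed

lemma Ck_on_add: "open U \<Longrightarrow> Ck_on k f U \<Longrightarrow> Ck_on k g U \<Longrightarrow> Ck_on k (\<lambda>x. f x + g x) U"
proof (induction k arbitrary: f g)
  case 0
  then show ?case by (auto intro: continuous_on_add)
next
  case (Suc k)
  note U = \<open>open U\<close>
  show ?case
    by (rule Ck_on_SucI[OF U has_derivative_add[OF Ck_on_SucD(1)[OF U Suc.prems(2)] Ck_on_SucD(1)[OF U Suc.prems(3)]]])
      (auto intro: Suc.IH[OF U Ck_on_SucD(2)[OF U Suc.prems(2)] Ck_on_SucD(2)[OF U Suc.prems(3)]])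
qed

lemma Ck_on_scaleR:
  fixes f :: "'a::euclidean_space \<Rightarrow> real" and g :: "'a \<Rightarrow> 'b::real_normed_vector"
  shows "open U \<Longrightarrow> Ck_on k f U \<Longrightarrow> Ck_on k g U \<Longrightarrow> Ck_on k (\<lambda>x. f x *\<^sub>R g x) U"
proof (induction k arbitrary: f g)
  case 0
  then show ?case by (auto intro: continuous_on_scaleR)
next
  case (Suc k)
  note U = \<open>open U\<close>
  show ?case
  proof (rule Ck_on_SucI[OF U has_derivative_scaleR[OF Ck_on_SucD(1)[OF U Suc.prems(2)] Ck_on_SucD(1)[OF U Suc.prems(3)]]])
    fix v
    show "Ck_on k (\<lambda>x. f x *\<^sub>R frechet_derivative g (at x) v + frechet_derivative f (at x) v *\<^sub>R g x) U"
      by (intro Ck_on_add[OF U] Suc.IH[OF U] Ck_on_SucD(2)[OF U] Suc.prems Ck_on_less[OF U])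
  qed
qed

lemma Ck_on_mult:
  fixes f g :: "'a::euclidean_space \<Rightarrow> real"
  shows "open U \<Longrightarrow> Ck_on k f U \<Longrightarrow> Ck_on k g U \<Longrightarrow> Ck_on k (\<lambda>x. f x * g x) U"
  using Ck_on_scaleR[of U k f g] by simp

lemma Ck_on_uminus:
  fixes f :: "'a::euclidean_space \<Rightarrow> real"
  shows "open U \<Longrightarrow> Ck_on k f U \<Longrightarrow> Ck_on k (\<lambda>x. - f x) U"
  using Ck_on_mult[of U k "\<lambda>x. - 1" f] Ck_on_const[of U k "- 1 :: real"] by simp

lemma Ck_on_diff:
  fixes f g :: "'a::euclidean_space \<Rightarrow> real"
  shows "open U \<Longrightarrow> Ck_on k f U \<Longrightarrow> Ck_on k g U \<Longrightarrow> Ck_on k (\<lambda>x. f x - g x) U"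
  using Ck_on_add[of U k f "\<lambda>x. - g x"] Ck_on_uminus[of U k g] by simp

lemma Ck_on_power:
  fixes f :: "'a::euclidean_space \<Rightarrow> real"
  shows "open U \<Longrightarrow> Ck_on k f U \<Longrightarrow> Ck_on k (\<lambda>x. f x ^ n) U"
  by (induction n) (auto intro: Ck_on_const Ck_on_mult)

lemma Ck_on_sum:
  "open U \<Longrightarrow> (\<And>i. i \<in> I \<Longrightarrow> Ck_on k (f i) U) \<Longrightarrow> Ck_on k (\<lambda>x. \<Sum>i\<in>I. f i x) U"
  by (induction I rule: infinite_finite_induct) (auto intro: Ck_on_const Ck_on_add)

text \<open>The whole sequence of derivatives \<open>D\<close> is carried along, since the chain
  rule replaces \<open>D i\<close> by its successor in the induction step.\<close>

lemma Ck_on_compose_real: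
  fixes f :: "'a::euclidean_space \<Rightarrow> real" and D :: "nat \<Rightarrow> real \<Rightarrow> real"
  assumes U: "open U" and D: "\<And>i s. s \<in> S \<Longrightarrow> (D i has_real_derivative D (Suc i) s) (at s)"
    and f: "\<And>x. x \<in> U \<Longrightarrow> f x \<in> S" and C: "Ck_on k f U"
  shows "Ck_on k (\<lambda>x. D i (f x)) U"
  using C
proof (induction k arbitrary: i)
  case 0
  have cD: "continuous_on S (D i)"
    using D DERIV_isCont by (blast intro: continuous_at_imp_continuous_on)
  have "continuous_on U f" using 0 by simp
  then have "continuous_on U (\<lambda>x. D i (f x))"
    by (rule continuous_on_compose2[OF cD]) (use f in auto)
  then show ?case by simp
next
  case (Suc k)
  show ?case
  proof (rule Ck_on_SucI[OF U has_derivative_compose[OF Ck_on_SucD(1)[OF U Suc.prems] D[OF f, unfolded has_field_derivative_def]]])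
    fix v
    show "Ck_on k (\<lambda>x. D (Suc i) (f x) * frechet_derivative f (at x) v) U"
      by (rule Ck_on_mult[OF U Suc.IH[OF Ck_on_less[OF U Suc.prems]] Ck_on_SucD(2)[OF U Suc.prems]])
  qed
qed

lemma Ck_on_powr:
  fixes f :: "'a::euclidean_space \<Rightarrow> real"
  assumes U: "open U" and f: "\<And>x. x \<in> U \<Longrightarrow> 0 < f x" and C: "Ck_on k f U"
  shows "Ck_on k (\<lambda>x. f x powr a) U"
proof -
  have "Ck_on k (\<lambda>x. (\<lambda>i s. (\<Prod>j<i. a - real j) * s powr (a - real i)) 0 (f x)) U"
  proof (rule Ck_on_compose_real[OF U _ _ C, where S = "{0<..}"])
    fix i and s :: real assume "s \<in> {0<..}"
    then show "((\<lambda>s. (\<Prod>j<i. a - real j) * s powr (a - real i)) has_real_derivative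
        (\<Prod>j<Suc i. a - real j) * s powr (a - real (Suc i))) (at s)"
      by (auto intro!: derivative_eq_intros simp: algebra_simps)
  qed (use f in auto)
  then show ?thesis by simp
qed

lemma Ck_on_sqrt:
  fixes f :: "'a::euclidean_space \<Rightarrow> real"
  assumes "open U" "\<And>x. x \<in> U \<Longrightarrow> 0 < f x" "Ck_on k f U"
  shows "Ck_on k (\<lambda>x. sqrt (f x)) U"
proof (rule Ck_on_cong_aux[OF assms(1) _ Ck_on_powr[OF assms, of "1 / 2"]])
  fix x assume "x \<in> U"
  from assms(2)[OF this] show "f x powr (1 / 2) = sqrt (f x)" by (simp add: powr_half_sqrt)
qed

lemma Ck_on_inverse:
  fixes f :: "'a::euclidean_space \<Rightarrow> real"
  assumes "open U" "\<And>x. x \<in> U \<Longrightarrow> 0 < f x" "Ck_on k f U"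
  shows "Ck_on k (\<lambda>x. inverse (f x)) U"
proof (rule Ck_on_cong_aux[OF assms(1) _ Ck_on_powr[OF assms, of "- 1"]])
  fix x assume "x \<in> U"
  from assms(2)[OF this] show "f x powr - 1 = inverse (f x)" by (simp add: powr_minus)
qed

lemma Ck_on_divide:
  fixes f :: "'a::euclidean_space \<Rightarrow> real"
  assumes "open U" "\<And>x. x \<in> U \<Longrightarrow> 0 < g x" "Ck_on k f U" "Ck_on k g U"
  shows "Ck_on k (\<lambda>x. f x / g x) U"
  unfolding divide_inverse by (intro Ck_on_mult Ck_on_inverse assms)

section \<open>A smooth function that is flat at 0\<close>

definition eta :: "real \<Rightarrow> real" where
  "eta s = (if s \<le> 0 then 0 else exp (- (1 / s)))"

definition eta' :: "real \<Rightarrow> real" where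
  "eta' s = (if s \<le> 0 then 0 else exp (- (1 / s)) / s\<^sup>2)"

text \<open>A class closed under differentiation: on positive s the derivative of p (1 / s) exp (- 1
  / s) has the same form, with X^2 (p - p') in place of p.\<close>

definition etaD :: "real poly \<Rightarrow> real \<Rightarrow> real" where
  "etaD p s = (if s \<le> 0 then 0 else poly p (1 / s) * exp (- (1 / s)))"

lemma poly_exp_tendsto: "((\<lambda>y. poly p y * exp (- y)) \<longlongrightarrow> (0::real)) at_top"
proof -
  have "((\<lambda>y. \<Sum>i\<le>degree p. coeff p i * (y ^ i / exp y)) \<longlongrightarrow> (\<Sum>i\<le>degree p. coeff p i * 0)) at_top"
    by (intro tendsto_intros tendsto_power_div_exp_0)
  then show ?thesis
    by (simp add: poly_altdef sum_distrib_right exp_minus divide_inverse mult.assoc)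
qed

lemma etaD_tendsto: "(etaD p \<longlongrightarrow> 0) (at 0)"
proof -
  have "((\<lambda>s. poly p (inverse s) * exp (- inverse s)) \<longlongrightarrow> (0::real)) (at_right 0)"
    using filterlim_compose[OF poly_exp_tendsto filterlim_inverse_at_top_right, of p] by simp
  moreover have "\<forall>\<^sub>F s in at_right 0. poly p (inverse s) * exp (- inverse s) = etaD p s"
    by (auto simp: etaD_def inverse_eq_divide eventually_at_filter)
  ultimately have "(etaD p \<longlongrightarrow> 0) (at_right 0)" by (rule Lim_transform_eventually)
  moreover have "(etaD p \<longlongrightarrow> 0) (at_left 0)"
    by (rule Lim_transform_eventually[OF tendsto_const]) (auto simp: etaD_def eventually_at_filter)
  ultimately show ?thesis by (simp add: filterlim_at_split)
qed

lemma DERIV_etaD: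
  "(etaD p has_real_derivative etaD ([:0, 0, 1:] * (p - pderiv p)) s) (at s)"
proof -
  consider "s < 0" | "0 < s" | "s = 0" by linarith
  then show ?thesis
  proof cases
    case 1
    have "((\<lambda>s::real. 0) has_real_derivative etaD ([:0, 0, 1:] * (p - pderiv p)) s) (at s)"
      using 1 by (simp add: etaD_def)
    then show ?thesis
      by (rule has_field_derivative_transform_within_open[of _ _ _ "{..<0}"]) (use 1 in \<open>auto simp: etaD_def\<close>)
  next
    case 2
    have inv: "((\<lambda>s. 1 / s) has_real_derivative - (1 / s\<^sup>2)) (at s)"
      using 2 by (auto intro!: derivative_eq_intros simp: power2_eq_square field_simps)
    have "((\<lambda>s. poly p (1 / s) * exp (- (1 / s))) has_real_derivative
        (poly (pderiv p) (1 / s) * - (1 / s\<^sup>2)) * exp (- (1 / s)) + (exp (- (1 / s)) * - (- (1 / s\<^sup>2))) * poly p (1 / s)) (at s)"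
      by (intro DERIV_mult DERIV_chain2[OF poly_DERIV inv] DERIV_chain2[OF DERIV_exp DERIV_minus[OF inv]])
    also have "(poly (pderiv p) (1 / s) * - (1 / s\<^sup>2)) * exp (- (1 / s)) + (exp (- (1 / s)) * - (- (1 / s\<^sup>2))) * poly p (1 / s) =
        etaD ([:0, 0, 1:] * (p - pderiv p)) s"
      using 2 by (simp add: etaD_def power2_eq_square algebra_simps)
    finally show ?thesis
      by (rule has_field_derivative_transform_within_open[of _ _ _ "{0<..}"]) (use 2 in \<open>auto simp: etaD_def\<close>)
  next
    case 3
    have "((\<lambda>h. (etaD p (0 + h) - etaD p 0) / h) \<longlongrightarrow> 0) (at 0)"
    proof (rule Lim_transform_eventually[OF etaD_tendsto[of "[:0, 1:] * p"]])
      show "\<forall>\<^sub>F h in at 0. etaD ([:0, 1:] * p) h = (etaD p (0 + h) - etaD p 0) / h"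
        by (auto simp: etaD_def eventually_at_filter)
    qed
    then show ?thesis using 3 by (simp add: DERIV_def etaD_def)
  qed
qed

lemma eta_etaD: "eta = etaD 1" "eta' = etaD ([:0, 0, 1:] * (1 - pderiv 1))"
  by (auto simp: eta_def eta'_def etaD_def fun_eq_iff power2_eq_square)

lemma DERIV_eta: "(eta has_real_derivative eta' s) (at s)"
  unfolding eta_etaD by (rule DERIV_etaD)

lemma continuous_eta: "continuous_on UNIV eta" "continuous_on UNIV eta'"
  unfolding eta_etaD using DERIV_etaD DERIV_isCont by (blast intro: continuous_at_imp_continuous_on)+

lemma Ck_on_eta:
  fixes f :: "'a::euclidean_space \<Rightarrow> real"
  assumes U: "open U" and C: "Ck_on k f U"
  shows "Ck_on k (\<lambda>x. eta (f x)) U"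
proof -
  let ?P = "\<lambda>i. ((\<lambda>p. [:0, 0, 1:] * (p - pderiv p)) ^^ i) (1 :: real poly)"
  have "Ck_on k (\<lambda>x. (\<lambda>i. etaD (?P i)) 0 (f x)) U"
    by (rule Ck_on_compose_real[OF U _ _ C, where S = UNIV]) (use DERIV_etaD in auto)
  then show ?thesis by (simp add: eta_etaD)
qed

lemma eta_props:
  "0 \<le> eta s" "eta s \<le> 1" "0 \<le> eta' s" "eta' s \<le> 1" "eta s = 0 \<longleftrightarrow> s \<le> 0" "eta' s = 0 \<longleftrightarrow> s \<le> 0"
proof -
  show "0 \<le> eta s" "eta s \<le> 1" "0 \<le> eta' s" "eta s = 0 \<longleftrightarrow> s \<le> 0" "eta' s = 0 \<longleftrightarrow> s \<le> 0"
    by (auto simp: eta_def eta'_def)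
  show "eta' s \<le> 1"
  proof (cases "s \<le> 0")
    case False
    define y where "y = 1 / s"
    have y: "0 < y" using False by (simp add: y_def)
    have "y\<^sup>2 \<le> exp y"
    proof -
      \<comment> \<open>Squaring this and comparing with the fourth power of 1 + y / 4 \<le> exp (y
        / 4) gives y^2 \<le> exp y, which is the bound on \<open>eta'\<close> at s = 1 / y.\<close>
      have "y \<le> (1 + y / 4)\<^sup>2" using zero_le_power2[of "1 - y / 4"] by (simp add: power2_eq_square field_simps)
      then have "y\<^sup>2 \<le> ((1 + y / 4)\<^sup>2)\<^sup>2" using y by (intro power_mono) auto
      also have "\<dots> = (1 + y / 4) ^ 4" by (simp flip: power_mult)
      also have "\<dots> \<le> exp (y / 4) ^ 4" using y by (intro power_mono exp_ge_add_one_self) auto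
      also have "\<dots> = exp y" by (simp flip: exp_of_nat_mult)
      finally show ?thesis .
    qed
    then have "exp (- y) * y\<^sup>2 \<le> 1" by (simp add: exp_minus field_simps)
    then show ?thesis using False by (simp add: eta'_def y_def power_divide)
  qed (simp add: eta'_def)
qed

lemma eta_mono: "s \<le> t \<Longrightarrow> eta s \<le> eta t"
  by (rule DERIV_nonneg_imp_nondecreasing) (auto intro: DERIV_eta eta_props)

section \<open>The domains\<close>

definition hproj :: "complex ^ 'n \<Rightarrow> complex ^ 'n::finite \<Rightarrow> complex ^ 'n" where
  "hproj p z = (z \<bullet> p) *\<^sub>R p + (z \<bullet> (\<i> *s p)) *\<^sub>R (\<i> *s p)"

definition hsq :: "complex ^ 'n \<Rightarrow> complex ^ 'n::finite \<Rightarrow> real" where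
  "hsq p z = (z \<bullet> p)\<^sup>2 + (z \<bullet> (\<i> *s p))\<^sup>2"

definition b1 :: "complex ^ 'n \<Rightarrow> complex ^ 'n::finite \<Rightarrow> real" where
  "b1 p z = (z \<bullet> p) / norm z - 1 / 4"

text \<open>For a unit vector \<open>p\<close> and z \<noteq> 0, the quantity 1 -
  \<open>hsq p z\<close> / (norm z)^2 is the squared sine of the angle between z and the complex
  line of \<open>p\<close>.\<close>

definition b2 :: "complex ^ 'n \<Rightarrow> real \<Rightarrow> complex ^ 'n::finite \<Rightarrow> real" where
  "b2 p \<rho> z = 1 - (1 - hsq p z / (norm z)\<^sup>2) / \<rho>\<^sup>2"

text \<open>For a unit vector \<open>p\<close>, \<open>hproj p\<close> is the orthogonal projection onto the complex line of \<open>p\<close>. The bump is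
  constant on rays and supported in the angular tube of radius \<open>\<rho>\<close> around that line, on the part of it
  where \<open>z \<bullet> p > norm z / 4\<close>, which a Hopf circle crosses in less than half of its period.\<close>

definition bump :: "complex ^ 'n \<Rightarrow> real \<Rightarrow> complex ^ 'n::finite \<Rightarrow> real" where
  "bump p \<rho> z = eta (b1 p z) * eta (b2 p \<rho> z)"

text \<open>The gradient is split along p, along the projection and along z because the first two
  coefficients alone drive the rotation of the transverse coordinates relative to the axial
  one.\<close>

definition bump_p :: "complex ^ 'n \<Rightarrow> real \<Rightarrow> complex ^ 'n::finite \<Rightarrow> real" where
  "bump_p p \<rho> z = eta' (b1 p z) * eta (b2 p \<rho> z) / norm z"

definition bump_h :: "complex ^ 'n \<Rightarrow> real \<Rightarrow> complex ^ 'n::finite \<Rightarrow> real" where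
  "bump_h p \<rho> z = eta (b1 p z) * eta' (b2 p \<rho> z) * (2 / (\<rho>\<^sup>2 * (norm z)\<^sup>2))"

definition gbump :: "complex ^ 'n \<Rightarrow> real \<Rightarrow> complex ^ 'n::finite \<Rightarrow> complex ^ 'n" where
  "gbump p \<rho> z = bump_p p \<rho> z *\<^sub>R (p - ((z \<bullet> p) / (norm z)\<^sup>2) *\<^sub>R z)
     + bump_h p \<rho> z *\<^sub>R (hproj p z - (hsq p z / (norm z)\<^sup>2) *\<^sub>R z)"

lemma norm_iscale [simp]: "norm (\<i> *s z) = norm (z :: complex ^ 'n::finite)"
  by (simp add: norm_eq_sqrt_inner)

lemma hproj_inner: "hproj p z \<bullet> z = hsq p z"
  by (simp add: hproj_def hsq_def inner_add_left inner_add_right power2_eq_square inner_commute[of _ z])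

lemma hproj_norm:
  assumes "norm p = 1"
  shows "(norm (hproj p z))\<^sup>2 = hsq p z"
proof -
  have "p \<bullet> p = 1" using assms by (simp add: norm_eq_1)
  then show ?thesis
    unfolding power2_norm_eq_inner hproj_def hsq_def
    by (simp add: inner_add_left inner_add_right power2_eq_square)
qed

lemma hsq_perp:
  assumes "norm p = 1"
  shows "(norm (z - hproj p z))\<^sup>2 = (norm z)\<^sup>2 - hsq p z"
  using hproj_norm[OF assms, of z] hproj_inner[of p z]
  by (simp add: power2_norm_eq_inner inner_diff_left inner_diff_right inner_commute)

lemma hsq_le: "norm p = 1 \<Longrightarrow> hsq p z \<le> (norm z)\<^sup>2"
  using hsq_perp[of p z] zero_le_power2[of "norm (z - hproj p z)"] by linarith

lemma hsq_nonneg: "0 \<le> hsq p z"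
  by (simp add: hsq_def)

lemma derivative_hsq: "(hsq p has_derivative (\<lambda>v. 2 * (hproj p z \<bullet> v))) (at z)"
  unfolding hsq_def[abs_def] hproj_def
  by (auto intro!: derivative_eq_intros simp: inner_add_left inner_add_right inner_commute mult_ac)

lemma derivative_norm_square: "((\<lambda>z. (norm z)\<^sup>2) has_derivative (\<lambda>v. 2 * (z \<bullet> v))) (at z)"
  for z :: "'a::real_inner"
  unfolding power2_norm_eq_inner by (auto intro!: derivative_eq_intros simp: inner_commute)

lemma derivative_bump:
  fixes z :: "complex ^ 'n::finite"
  assumes z: "z \<noteq> 0"
  shows "(bump p \<rho> has_derivative (\<lambda>v. gbump p \<rho> z \<bullet> v)) (at z)"
proof -
  let ?n = "norm z"
  have n: "0 < ?n" using z by simp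
  have dn: "(norm has_derivative (\<lambda>v. (z \<bullet> v) / ?n)) (at z)"
    using has_derivative_norm[OF z] by (simp add: sgn_div_norm inner_commute divide_inverse mult.commute)
  have d1: "(b1 p has_derivative (\<lambda>v. ((1 / ?n) *\<^sub>R (p - ((z \<bullet> p) / ?n\<^sup>2) *\<^sub>R z)) \<bullet> v)) (at z)"
  proof -
    have "((\<lambda>z. z \<bullet> p) has_derivative (\<lambda>v. v \<bullet> p)) (at z)" by (auto intro!: derivative_eq_intros)
    from has_derivative_divide'[OF this dn] n
    have "((\<lambda>z. (z \<bullet> p) / norm z) has_derivative (\<lambda>v. ((v \<bullet> p) * ?n - (z \<bullet> p) * ((z \<bullet> v) / ?n)) / (?n * ?n))) (at z)" by simp
    from has_derivative_diff[OF this has_derivative_const[of "1 / 4"]]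
    have "(b1 p has_derivative (\<lambda>v. ((v \<bullet> p) * ?n - (z \<bullet> p) * ((z \<bullet> v) / ?n)) / (?n * ?n))) (at z)"
      by (simp add: b1_def[abs_def])
    moreover have "((v \<bullet> p) * ?n - (z \<bullet> p) * ((z \<bullet> v) / ?n)) / (?n * ?n) = ((1 / ?n) *\<^sub>R (p - ((z \<bullet> p) / ?n\<^sup>2) *\<^sub>R z)) \<bullet> v" for v
      using n by (simp add: inner_diff_left inner_commute[of v] field_simps power2_eq_square)
    ultimately show ?thesis by simp
  qed
  have d2: "(b2 p \<rho> has_derivative (\<lambda>v. ((2 / (\<rho>\<^sup>2 * ?n\<^sup>2)) *\<^sub>R (hproj p z - (hsq p z / ?n\<^sup>2) *\<^sub>R z)) \<bullet> v)) (at z)"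
  proof -
    have "((\<lambda>z. hsq p z / (norm z)\<^sup>2) has_derivative
        (\<lambda>v. (2 * (hproj p z \<bullet> v) * ?n\<^sup>2 - hsq p z * (2 * (z \<bullet> v))) / (?n\<^sup>2 * ?n\<^sup>2))) (at z)"
      by (rule has_derivative_divide'[OF derivative_hsq derivative_norm_square]) (use z in simp)
    from has_derivative_diff[OF has_derivative_const has_derivative_mult_right[OF has_derivative_diff[OF has_derivative_const this], of "1 / \<rho>\<^sup>2"], of 1 1]
    have "(b2 p \<rho> has_derivative (\<lambda>v. - (1 / \<rho>\<^sup>2 * - ((2 * (hproj p z \<bullet> v) * ?n\<^sup>2 - hsq p z * (2 * (z \<bullet> v))) / (?n\<^sup>2 * ?n\<^sup>2))))) (at z)"
      by (simp add: b2_def[abs_def])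
    moreover have "- (1 / \<rho>\<^sup>2 * - ((2 * (hproj p z \<bullet> v) * ?n\<^sup>2 - hsq p z * (2 * (z \<bullet> v))) / (?n\<^sup>2 * ?n\<^sup>2)))
        = ((2 / (\<rho>\<^sup>2 * ?n\<^sup>2)) *\<^sub>R (hproj p z - (hsq p z / ?n\<^sup>2) *\<^sub>R z)) \<bullet> v" for v
    proof -
      have "(2 * (hproj p z \<bullet> v) * ?n\<^sup>2 - hsq p z * (2 * (z \<bullet> v))) / (?n\<^sup>2 * ?n\<^sup>2) =
          2 / ?n\<^sup>2 * (hproj p z \<bullet> v - hsq p z / ?n\<^sup>2 * (z \<bullet> v))"
        using n by (simp add: field_simps power2_eq_square)
      then show ?thesis by (simp add: inner_diff_left)
    qed
    ultimately show ?thesis by simp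
  qed
  have e1: "((\<lambda>z. eta (b1 p z)) has_derivative (\<lambda>v. eta' (b1 p z) * (((1 / ?n) *\<^sub>R (p - ((z \<bullet> p) / ?n\<^sup>2) *\<^sub>R z)) \<bullet> v))) (at z)"
    by (rule has_derivative_compose[OF d1 DERIV_eta[unfolded has_field_derivative_def]])
  have e2: "((\<lambda>z. eta (b2 p \<rho> z)) has_derivative (\<lambda>v. eta' (b2 p \<rho> z) * (((2 / (\<rho>\<^sup>2 * ?n\<^sup>2)) *\<^sub>R (hproj p z - (hsq p z / ?n\<^sup>2) *\<^sub>R z)) \<bullet> v))) (at z)"
    by (rule has_derivative_compose[OF d2 DERIV_eta[unfolded has_field_derivative_def]])
  show ?thesis
    using has_derivative_mult[OF e1 e2]
    unfolding bump_def[abs_def] gbump_def bump_p_def bump_h_def inner_add_left inner_scaleR_left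
    by (simp add: mult_ac add.commute)
qed

text \<open>Differentiating \<open>b2\<close> costs a factor 1 / \<rho>^2, but inside the tube the
  non-radial part of the projection is at most \<rho> times norm z, so only 1 / \<rho> is
  lost.\<close>

lemma gbump_bound:
  fixes z :: "complex ^ 'n::finite"
  assumes z: "z \<noteq> 0" and p: "norm p = 1" and \<rho>: "0 < \<rho>"
  shows "norm (gbump p \<rho> z) \<le> (2 + 2 / \<rho>) / norm z"
proof -
  let ?n = "norm z" and ?W = "hproj p z - (hsq p z / (norm z)\<^sup>2) *\<^sub>R z"
  have n: "0 < ?n" using z by simp
  have 1: "norm (bump_p p \<rho> z *\<^sub>R (p - ((z \<bullet> p) / ?n\<^sup>2) *\<^sub>R z)) \<le> 2 / ?n"
  proof -
    have "\<bar>z \<bullet> p\<bar> \<le> ?n * 1" using Cauchy_Schwarz_ineq2[of z p] p by simp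
    then have "norm (((z \<bullet> p) / ?n\<^sup>2) *\<^sub>R z) \<le> 1" using n by (simp add: power2_eq_square field_simps)
    then have "norm (p - ((z \<bullet> p) / ?n\<^sup>2) *\<^sub>R z) \<le> 2"
      using norm_triangle_ineq4[of p "((z \<bullet> p) / ?n\<^sup>2) *\<^sub>R z"] p by linarith
    moreover have "eta' (b1 p z) * eta (b2 p \<rho> z) \<le> 1 * 1" by (intro mult_mono eta_props) auto
    then have "\<bar>bump_p p \<rho> z\<bar> \<le> 1 / ?n"
      unfolding bump_p_def using n eta_props by (simp add: divide_right_mono abs_mult)
    ultimately have "\<bar>bump_p p \<rho> z\<bar> * norm (p - ((z \<bullet> p) / ?n\<^sup>2) *\<^sub>R z) \<le> 1 / ?n * 2"
      using n by (intro mult_mono) auto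
    then show ?thesis by simp
  qed
  have 2: "norm (bump_h p \<rho> z *\<^sub>R ?W) \<le> 2 / \<rho> / ?n"
  proof (cases "b2 p \<rho> z \<le> 0")
    case True
    then show ?thesis using eta_props(6)[of "b2 p \<rho> z"] \<rho> n by (simp add: bump_h_def)
  next
    case False
    then have s: "(1 - hsq p z / ?n\<^sup>2) < \<rho>\<^sup>2" using \<rho> by (simp add: b2_def field_simps)
    have "(norm ?W)\<^sup>2 = hsq p z * (1 - hsq p z / ?n\<^sup>2)"
    proof -
      have "hproj p z \<bullet> hproj p z = hsq p z" using hproj_norm[OF p, of z] by (simp add: power2_norm_eq_inner)
      then have "(norm (hproj p z - r *\<^sub>R z))\<^sup>2 = hsq p z - 2 * r * hsq p z + r\<^sup>2 * (norm z)\<^sup>2" for r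
        using hproj_inner[of p z] unfolding power2_norm_eq_inner
        by (simp add: inner_diff_left inner_diff_right inner_commute[of z "hproj p z"] power2_eq_square algebra_simps)
      then have "(norm ?W)\<^sup>2 = hsq p z - 2 * (hsq p z / ?n\<^sup>2) * hsq p z + (hsq p z / ?n\<^sup>2)\<^sup>2 * ?n\<^sup>2" .
      also have "(hsq p z / ?n\<^sup>2)\<^sup>2 * ?n\<^sup>2 = (hsq p z / ?n\<^sup>2) * hsq p z" using n by (simp add: power2_eq_square)
      finally show ?thesis by (simp add: algebra_simps)
    qed
    also have "\<dots> \<le> ?n\<^sup>2 * \<rho>\<^sup>2"
      using hsq_le[OF p, of z] hsq_nonneg[of p z] s by (intro mult_mono) (auto simp: divide_le_eq_1)
    finally have "(norm ?W)\<^sup>2 \<le> (?n * \<rho>)\<^sup>2" by (simp add: power_mult_distrib)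
    then have W: "norm ?W \<le> ?n * \<rho>" by (rule power2_le_imp_le) (use n \<rho> in simp)
    have "eta (b1 p z) * eta' (b2 p \<rho> z) \<le> 1 * 1" by (intro mult_mono eta_props) auto
    then have "eta (b1 p z) * eta' (b2 p \<rho> z) * (2 / (\<rho>\<^sup>2 * ?n\<^sup>2)) \<le> 1 * (2 / (\<rho>\<^sup>2 * ?n\<^sup>2))"
      by (intro mult_right_mono) auto
    then have "\<bar>bump_h p \<rho> z\<bar> \<le> 2 / (\<rho>\<^sup>2 * ?n\<^sup>2)"
      unfolding bump_h_def using eta_props by (simp add: abs_mult)
    then have "\<bar>bump_h p \<rho> z\<bar> * norm ?W \<le> 2 / (\<rho>\<^sup>2 * ?n\<^sup>2) * (?n * \<rho>)"
      using W by (intro mult_mono) auto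
    also have "\<dots> = 2 / \<rho> / ?n" using n \<rho> by (simp add: field_simps power2_eq_square)
    finally show ?thesis by simp
  qed
  have "norm (gbump p \<rho> z) \<le> 2 / ?n + 2 / \<rho> / ?n"
    unfolding gbump_def by (rule order_trans[OF norm_triangle_ineq add_mono[OF 1 2]])
  then show ?thesis by (simp add: add_divide_distrib)
qed

lemma bump_bounds: "0 \<le> bump p \<rho> z" "bump p \<rho> z \<le> 1"
  unfolding bump_def using eta_props mult_mono[of "eta (b1 p z)" 1 "eta (b2 p \<rho> z)" 1] by auto

lemma bump_inactive:
  assumes "b1 p z \<le> 0 \<or> b2 p \<rho> z \<le> 0"
  shows "bump p \<rho> z = 0" "gbump p \<rho> z = 0" "bump_p p \<rho> z = 0" "bump_h p \<rho> z = 0"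
proof -
  have "eta (b1 p z) = 0 \<and> eta' (b1 p z) = 0 \<or> eta (b2 p \<rho> z) = 0 \<and> eta' (b2 p \<rho> z) = 0"
    using assms eta_props(5,6) by blast
  then show "bump p \<rho> z = 0" "gbump p \<rho> z = 0" "bump_p p \<rho> z = 0" "bump_h p \<rho> z = 0"
    by (auto simp: bump_def gbump_def bump_p_def bump_h_def)
qed

lemma scale_bump:
  assumes c: "0 < c"
  shows "bump p \<rho> (c *\<^sub>R z) = bump p \<rho> z" "gbump p \<rho> (c *\<^sub>R z) = (1 / c) *\<^sub>R gbump p \<rho> z"
proof -
  have h: "hsq p (c *\<^sub>R z) = c\<^sup>2 * hsq p z" "hproj p (c *\<^sub>R z) = c *\<^sub>R hproj p z"
    by (simp_all add: hsq_def hproj_def power_mult_distrib distrib_left scaleR_add_right)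
  have b: "b1 p (c *\<^sub>R z) = b1 p z" "b2 p \<rho> (c *\<^sub>R z) = b2 p \<rho> z"
    using c by (simp_all add: b1_def b2_def h power_mult_distrib)
  show "bump p \<rho> (c *\<^sub>R z) = bump p \<rho> z" by (simp add: bump_def b)
  show "gbump p \<rho> (c *\<^sub>R z) = (1 / c) *\<^sub>R gbump p \<rho> z"
  proof (cases "z = 0")
    case True
    then show ?thesis by (simp add: gbump_def bump_p_def bump_h_def hproj_def)
  next
    case False
    have "(c * (z \<bullet> p)) / (c * norm z)\<^sup>2 * c = (z \<bullet> p) / (norm z)\<^sup>2"
      "c\<^sup>2 * hsq p z / (c * norm z)\<^sup>2 = hsq p z / (norm z)\<^sup>2"
      using c by (simp_all add: power2_eq_square)
    then have v: "p - ((c *\<^sub>R z) \<bullet> p / (norm (c *\<^sub>R z))\<^sup>2) *\<^sub>R (c *\<^sub>R z) = p - ((z \<bullet> p) / (norm z)\<^sup>2) *\<^sub>R z"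
      "hproj p (c *\<^sub>R z) - (hsq p (c *\<^sub>R z) / (norm (c *\<^sub>R z))\<^sup>2) *\<^sub>R (c *\<^sub>R z) =
        c *\<^sub>R (hproj p z - (hsq p z / (norm z)\<^sup>2) *\<^sub>R z)"
      using c by (simp_all add: h scaleR_diff_right)
    have w: "bump_p p \<rho> (c *\<^sub>R z) = (1 / c) * bump_p p \<rho> z" "bump_h p \<rho> (c *\<^sub>R z) * c = (1 / c) * bump_h p \<rho> z"
      using c by (simp_all add: bump_p_def bump_h_def b power2_eq_square mult_ac)
    show ?thesis unfolding gbump_def unfolding v by (simp add: w scaleR_add_right)
  qed
qed

lemma continuous_gbump:
  fixes p :: "complex ^ 'n::finite"
  assumes "0 < \<rho>"
  shows "continuous_on (- {0}) (gbump p \<rho>)"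
proof -
  have c: "continuous_on (- {0}) (b1 p)" "continuous_on (- {0}) (b2 p \<rho>)"
    using assms unfolding b1_def[abs_def] b2_def[abs_def] hsq_def by (intro continuous_intros; auto)+
  show ?thesis
    using assms unfolding gbump_def[abs_def] bump_p_def bump_h_def hproj_def hsq_def
    by (intro continuous_intros continuous_on_compose2[OF continuous_eta(1) c(1)] continuous_on_compose2[OF continuous_eta(1) c(2)]
        continuous_on_compose2[OF continuous_eta(2) c(1)] continuous_on_compose2[OF continuous_eta(2) c(2)]; auto)
qed

section \<open>The squared radial function \<open>U\<close> and the homogeneous Hamiltonian
  \<open>F\<close>\<close>

locale bumps =
  fixes p q :: "complex ^ 'n::finite" and l \<delta> M :: real
  assumes p: "norm p = 1" and q: "norm q = 1" and l: "0 < l" "l \<le> 1" and \<delta>: "0 < \<delta>" and M: "0 \<le> M" "M * l\<^sup>2 \<le> 1 / 2"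
begin

definition U :: "complex ^ 'n \<Rightarrow> real" where
  "U z = 1 + l\<^sup>2 * bump p l z - M * l\<^sup>2 * bump q (\<delta> * l) z"

definition gU :: "complex ^ 'n \<Rightarrow> complex ^ 'n" where
  "gU z = l\<^sup>2 *\<^sub>R gbump p l z - (M * l\<^sup>2) *\<^sub>R gbump q (\<delta> * l) z"

definition F :: "complex ^ 'n \<Rightarrow> real" where
  "F z = (norm z)\<^sup>2 / U z"

definition gF :: "complex ^ 'n \<Rightarrow> complex ^ 'n" where
  "gF z = (2 / U z) *\<^sub>R z - ((norm z)\<^sup>2 / (U z)\<^sup>2) *\<^sub>R gU z"

definition K0 :: real where
  "K0 = 4 + M * (2 + 2 / \<delta>)"

lemma K0: "4 \<le> K0"
  unfolding K0_def using M \<delta> by (intro add_increasing2 mult_nonneg_nonneg) auto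

lemma U_bounds: "1 / 2 \<le> U z" "U z \<le> 2" "\<bar>U z - 1\<bar> \<le> (1 + M) * l\<^sup>2"
proof -
  have 1: "0 \<le> l\<^sup>2 * bump p l z" "l\<^sup>2 * bump p l z \<le> l\<^sup>2" "l\<^sup>2 \<le> 1"
    using bump_bounds[of p l z] l by (auto simp: mult_left_le power_le_one)
  have 2: "0 \<le> M * l\<^sup>2 * bump q (\<delta> * l) z" "M * l\<^sup>2 * bump q (\<delta> * l) z \<le> M * l\<^sup>2"
    using bump_bounds[of q "\<delta> * l" z] M by (auto simp: mult_left_le)
  show "1 / 2 \<le> U z" "U z \<le> 2" unfolding U_def using 1 2 M by linarith+
  have "0 \<le> l\<^sup>2" "0 \<le> M * l\<^sup>2" using M by auto
  then show "\<bar>U z - 1\<bar> \<le> (1 + M) * l\<^sup>2" unfolding U_def distrib_right using 1 2 by (simp add: abs_le_iff)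
qed

lemma U_pos: "0 < U z" using U_bounds(1)[of z] by linarith

lemma derivative_U: "z \<noteq> 0 \<Longrightarrow> (U has_derivative (\<lambda>v. gU z \<bullet> v)) (at z)"
proof -
  assume z: "z \<noteq> 0"
  have "(U has_derivative (\<lambda>v. 0 + l\<^sup>2 * (gbump p l z \<bullet> v) - M * l\<^sup>2 * (gbump q (\<delta> * l) z \<bullet> v))) (at z)"
    unfolding U_def[abs_def]
    by (intro has_derivative_add has_derivative_diff has_derivative_const has_derivative_mult_right derivative_bump z)
  then show ?thesis by (simp add: gU_def inner_diff_left)
qed

text \<open>Heights of order l^2 against gradients of order 1 / l leave order l. Both the C^1
  convergence and the closeness of the flow to the Hopf flow rest on this.\<close>

lemma gU_bound: "z \<noteq> 0 \<Longrightarrow> norm (gU z) \<le> K0 * l / norm z"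
proof -
  assume z: "z \<noteq> 0"
  have ll: "l\<^sup>2 \<le> l" using l by (simp add: power2_eq_square mult_left_le)
  have 1: "l\<^sup>2 * norm (gbump p l z) \<le> 4 * l / norm z"
  proof -
    have "l\<^sup>2 * norm (gbump p l z) \<le> l\<^sup>2 * ((2 + 2 / l) / norm z)"
      by (intro mult_left_mono gbump_bound z p l) simp
    also have "\<dots> = (2 * l\<^sup>2 + 2 * l) / norm z" using l z by (simp add: power2_eq_square field_simps)
    also have "\<dots> \<le> 4 * l / norm z" using ll by (intro divide_right_mono) auto
    finally show ?thesis .
  qed
  have 2: "M * l\<^sup>2 * norm (gbump q (\<delta> * l) z) \<le> M * (2 + 2 / \<delta>) * l / norm z"
  proof -
    have "M * l\<^sup>2 * norm (gbump q (\<delta> * l) z) \<le> M * l\<^sup>2 * ((2 + 2 / (\<delta> * l)) / norm z)"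
      using M l \<delta> by (intro mult_left_mono gbump_bound z q) auto
    also have "\<dots> = M * (2 * l\<^sup>2 + 2 / \<delta> * l) / norm z" using l \<delta> z by (simp add: power2_eq_square field_simps)
    also have "\<dots> \<le> M * (2 * l + 2 / \<delta> * l) / norm z" using ll M by (intro divide_right_mono mult_left_mono) auto
    finally show ?thesis by (simp add: algebra_simps)
  qed
  have "norm (gU z) \<le> l\<^sup>2 * norm (gbump p l z) + M * l\<^sup>2 * norm (gbump q (\<delta> * l) z)"
    unfolding gU_def by (rule order_trans[OF norm_triangle_ineq4]) (use M in simp)
  also have "\<dots> \<le> 4 * l / norm z + M * (2 + 2 / \<delta>) * l / norm z" by (intro add_mono 1 2)
  finally show ?thesis by (simp add: K0_def add_divide_distrib distrib_right)
qed

lemma scale_U: "0 < c \<Longrightarrow> U (c *\<^sub>R z) = U z" "0 < c \<Longrightarrow> gU (c *\<^sub>R z) = (1 / c) *\<^sub>R gU z"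
  by (simp_all add: U_def gU_def scale_bump scaleR_diff_right)

lemma continuous_U: "continuous_on (- {0}) U"
  using derivative_U has_derivative_continuous by (blast intro: continuous_at_imp_continuous_on)

lemma F_bounds: "(norm z)\<^sup>2 / 2 \<le> F z" "F z \<le> 2 * (norm z)\<^sup>2"
proof -
  have "(norm z)\<^sup>2 / 2 \<le> (norm z)\<^sup>2 / U z" using U_bounds[of z] by (intro divide_left_mono) auto
  then show "(norm z)\<^sup>2 / 2 \<le> F z" by (simp add: F_def)
  have "(norm z)\<^sup>2 / U z \<le> (norm z)\<^sup>2 / (1 / 2)" using U_bounds[of z] by (intro divide_left_mono) auto
  then show "F z \<le> 2 * (norm z)\<^sup>2" by (simp add: F_def)
qed

lemma gF_bound: "norm (gF z) \<le> (4 + 4 * K0) * norm z"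
proof (cases "z = 0")
  case False
  have U: "1 / 2 \<le> U z" by (rule U_bounds)
  have "norm ((2 / U z) *\<^sub>R z) \<le> 4 * norm z"
  proof -
    have "2 / U z \<le> 4" using U by (simp add: divide_le_eq)
    then have "2 / U z * norm z \<le> 4 * norm z" by (intro mult_right_mono) auto
    then show ?thesis using U_pos[of z] by simp
  qed
  moreover have "norm (((norm z)\<^sup>2 / (U z)\<^sup>2) *\<^sub>R gU z) \<le> 4 * K0 * norm z"
  proof -
    have "1 / (U z)\<^sup>2 \<le> 1 / (1 / 2)\<^sup>2" using U by (intro divide_left_mono power_mono) (auto simp: U_pos)
    then have i1: "(norm z)\<^sup>2 * (1 / (U z)\<^sup>2) \<le> (norm z)\<^sup>2 * (1 / (1 / 2)\<^sup>2)" by (rule mult_left_mono) simp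
    have i2: "norm (gU z) \<le> K0 / norm z"
    proof -
      have "K0 * l / norm z \<le> K0 * 1 / norm z" using l K0 by (intro divide_right_mono mult_left_mono) auto
      then show ?thesis using gU_bound[OF False] by simp
    qed
    have "(norm z)\<^sup>2 * (1 / (U z)\<^sup>2) * norm (gU z) \<le> (norm z)\<^sup>2 * (1 / (1 / 2)\<^sup>2) * (K0 / norm z)"
      by (rule mult_mono[OF i1 i2]) auto
    also have "\<dots> = 4 * K0 * norm z" using False by (simp add: power2_eq_square field_simps)
    finally show ?thesis by simp
  qed
  ultimately show ?thesis unfolding gF_def
    using norm_triangle_ineq4[of "(2 / U z) *\<^sub>R z" "((norm z)\<^sup>2 / (U z)\<^sup>2) *\<^sub>R gU z"] by (simp add: distrib_right)
qed (simp add: gF_def)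

lemma derivative_F: "(F has_derivative (\<lambda>v. gF z \<bullet> v)) (at z)"
proof (cases "z = 0")
  case False
  have "(F has_derivative (\<lambda>v. (2 * (z \<bullet> v) * U z - (norm z)\<^sup>2 * (gU z \<bullet> v)) / (U z * U z))) (at z)"
    unfolding F_def[abs_def]
    by (rule has_derivative_divide'[OF derivative_norm_square derivative_U[OF False]]) (use U_pos[of z] in simp)
  moreover have "(2 * (z \<bullet> v) * U z - (norm z)\<^sup>2 * (gU z \<bullet> v)) / (U z * U z) = gF z \<bullet> v" for v
    using U_pos[of z] by (simp add: gF_def inner_diff_left power2_eq_square diff_divide_distrib)
  ultimately show ?thesis by simp
next
  case True
  \<comment> \<open>\<open>U\<close> is constant on rays and in general has no limit at 0;
    differentiability of \<open>F\<close> there comes from 0 \<le> F z \<le> 2 (norm z)^2.\<close>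
  have "(F has_derivative (\<lambda>v. 0)) (at 0)"
    unfolding has_derivative_at
  proof (intro conjI)
    show "((\<lambda>h. norm (F (0 + h) - F 0 - 0) / norm h) \<longlongrightarrow> 0) (at 0)"
    proof (rule Lim_null_comparison[of _ "\<lambda>h. 2 * norm h"])
      show "\<forall>\<^sub>F h in at 0. norm (norm (F (0 + h) - F 0 - 0) / norm h) \<le> 2 * norm h"
      proof (rule always_eventually, rule allI)
        fix h
        have "0 \<le> F h" using F_bounds(1)[of h] by (meson zero_le_power2 divide_nonneg_pos order_trans zero_less_numeral)
        then show "norm (norm (F (0 + h) - F 0 - 0) / norm h) \<le> 2 * norm h"
          using F_bounds(2)[of h] by (cases "h = 0") (auto simp: F_def[of 0] divide_le_eq power2_eq_square)
      qed
      show "((\<lambda>h. 2 * norm (h :: complex ^ 'n)) \<longlongrightarrow> 0) (at 0)"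
      proof -
        have "((\<lambda>h. 2 * norm (h :: complex ^ 'n)) \<longlongrightarrow> 2 * norm (0 :: complex ^ 'n)) (at 0)"
          by (rule tendsto_mult[OF tendsto_const tendsto_norm[OF tendsto_ident_at]])
        then show ?thesis by simp
      qed
    qed
  qed simp
  then show ?thesis using True by (simp add: gF_def)
qed

lemma continuous_gF: "continuous_on UNIV gF"
proof -
  have "isCont gF z" for z
  proof (cases "z = 0")
    case True
    have "((\<lambda>z :: complex ^ 'n. (4 + 4 * K0) * norm z) \<longlongrightarrow> (4 + 4 * K0) * norm (0 :: complex ^ 'n)) (at 0)"
      by (rule tendsto_mult[OF tendsto_const tendsto_norm[OF tendsto_ident_at]])
    then have "(gF \<longlongrightarrow> 0) (at 0)"
      by (intro Lim_null_comparison[of gF "\<lambda>z. (4 + 4 * K0) * norm z"]) (auto simp: gF_bound intro: always_eventually)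
    then show ?thesis using True by (simp add: isCont_def gF_def)
  next
    case False
    have "continuous_on (- {0}) gU"
      unfolding gU_def[abs_def] using l \<delta> by (intro continuous_intros continuous_gbump) auto
    then have "continuous_on (- {0}) gF"
      unfolding gF_def[abs_def] using U_pos
      by (intro continuous_intros continuous_U) (auto simp: less_imp_neq[THEN not_sym])
    then show ?thesis using False by (simp add: continuous_on_eq_continuous_at open_Compl)
  qed
  then show ?thesis by (simp add: continuous_on_eq_continuous_at)
qed

lemma hom_F: "hom_hamiltonian F gF"
proof -
  have "F (c *\<^sub>R z) = c\<^sup>2 * F z" "gF (c *\<^sub>R z) = c *\<^sub>R gF z" if c: "0 < c" for c z
    using c by (simp_all add: F_def gF_def scale_U power_mult_distrib scaleR_diff_right power2_eq_square mult_ac)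
  moreover have "0 < F z" if "z \<noteq> 0" for z unfolding F_def using that U_pos[of z] by simp
  moreover have "F 0 = 0" by (simp add: F_def)
  ultimately show ?thesis
    unfolding hom_hamiltonian_def using derivative_F continuous_gF by blast
qed

end

section \<open>Scalar linear equations, conserved distances and comparison with the Hopf
  flow\<close>

lemma exp_ode:
  fixes f w :: "real \<Rightarrow> complex"
  assumes ab: "a \<le> b" and w: "continuous_on {a..b} w"
    and f: "\<And>t. t \<in> {a..b} \<Longrightarrow> (f has_vector_derivative w t * f t) (at t)"
  shows "f b = exp (integral {a..b} w) * f a"
proof -
  define W where "W t = integral {a..t} w" for t
  have W: "(W has_vector_derivative w t) (at t within {a..b})" if "t \<in> {a..b}" for t
    unfolding W_def by (rule integral_has_vector_derivative[OF w that])
  have "((\<lambda>t. exp (- W t) * f t) has_vector_derivative 0) (at t within {a..b})" if t: "t \<in> {a..b}" for t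
  proof -
    have "((\<lambda>t. - W t) has_vector_derivative - w t) (at t within {a..b})"
      by (rule has_vector_derivative_minus[OF W[OF t]])
    from field_vector_diff_chain_within[OF this, of exp "exp (- W t)"]
    have "((\<lambda>t. exp (- W t)) has_vector_derivative - w t * exp (- W t)) (at t within {a..b})"
      by (simp add: o_def DERIV_exp has_field_derivative_at_within)
    from has_vector_derivative_mult[OF this has_vector_derivative_at_within[OF f[OF t]]]
    show ?thesis by (simp add: algebra_simps)
  qed
  then have "((\<lambda>t. exp (- W t) * f t) has_derivative (\<lambda>h. 0)) (at t within {a..b})" if "t \<in> {a..b}" for t
    using that by (simp add: has_vector_derivative_def)
  from has_derivative_zero_unique[OF convex_real_interval(5) this, of b a] ab
  have "exp (- W b) * f b = exp (- W a) * f a" by simp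
  then have "exp (W b) * (exp (- W b) * f b) = exp (W b) * f a" by (simp add: W_def)
  then show ?thesis unfolding mult.assoc[symmetric] exp_add[symmetric] by (simp add: W_def)
qed

text \<open>For an argument below \<pi> / 2 the modulus is at least the distance of 1 from the ray
  through \<open>exp w\<close>, which is the sine of the argument; beyond, \<open>exp w\<close> has
  nonpositive real part. The bound 3 \<pi> / 2 keeps full turns out.\<close>

lemma exp_minus_1_lower:
  assumes "\<alpha> \<le> Im w" "Im w \<le> 3 * pi / 2" "0 < \<alpha>" "\<alpha> \<le> pi / 2"
  shows "sin \<alpha> \<le> cmod (exp w - 1)"
proof (cases "Im w < pi / 2")
  case True
  let ?r = "exp (Re w)" and ?a = "Im w"
  have "(cmod (exp w - 1))\<^sup>2 = (?r * cos ?a - 1)\<^sup>2 + (?r * sin ?a)\<^sup>2"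
    by (simp add: cmod_power2 Re_exp Im_exp)
  also have "\<dots> = ?r\<^sup>2 * ((sin ?a)\<^sup>2 + (cos ?a)\<^sup>2) - 2 * ?r * cos ?a + 1"
    by algebra
  also have "\<dots> = (?r - cos ?a)\<^sup>2 + (1 - (cos ?a)\<^sup>2)"
    unfolding sin_cos_squared_add by algebra
  also have "1 - (cos ?a)\<^sup>2 = (sin ?a)\<^sup>2" by (simp add: sin_squared_eq)
  finally have "(sin ?a)\<^sup>2 \<le> (cmod (exp w - 1))\<^sup>2" by simp
  then have "sin ?a \<le> cmod (exp w - 1)" by (rule power2_le_imp_le) simp
  moreover have "sin \<alpha> \<le> sin ?a" using True assms by (intro sin_monotone_2pi_le) auto
  ultimately show ?thesis by linarith
next
  case False
  have "cos (Im w) \<le> 0"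
  proof -
    have "0 \<le> sin (Im w - pi / 2)" using False assms by (intro sin_ge_zero) auto
    then show ?thesis by (simp add: sin_diff)
  qed
  then have "Re (exp w - 1) \<le> -1" by (simp add: Re_exp mult_nonneg_nonpos)
  then have "1 \<le> cmod (exp w - 1)" using abs_Re_le_cmod[of "exp w - 1"] by linarith
  then show ?thesis using sin_le_one[of \<alpha>] by linarith
qed

lemma Complex_scale: "Complex a b *s v = a *\<^sub>R v + b *\<^sub>R (\<i> *s (v :: complex ^ 'n::finite))"
  by (simp add: vec_eq_iff complex_eq_iff)

lemma norm_cscale: "norm (c *s v) = cmod c * norm (v :: complex ^ 'n::finite)"
proof -
  have "(norm (c *s v))\<^sup>2 = (cmod c * norm v)\<^sup>2"
    by (simp add: norm_power2_vec norm_mult power_mult_distrib sum_distrib_left)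
  then show ?thesis by (simp add: power2_eq_iff_nonneg)
qed

text \<open>The component of z orthogonal to the complex line of \<open>p\<close> is orthogonal to i
  times that line and to i times itself, and z and the gradient of the bump are combinations of
  these pieces. Conservation of the distance from the axis follows.\<close>

lemma perp_orth:
  assumes "norm p = 1"
  shows "(z - hproj p z) \<bullet> (\<i> *s z) = 0" "(z - hproj p z) \<bullet> (\<i> *s gbump p \<rho> z) = 0"
proof -
  have pp: "p \<bullet> p = 1" using assms by (simp add: norm_eq_1)
  have 1: "(z - hproj p z) \<bullet> p = 0" "(z - hproj p z) \<bullet> (\<i> *s p) = 0"
    by (simp_all add: hproj_def inner_diff_left inner_add_left pp)
  have 2: "(z - hproj p z) \<bullet> (\<i> *s hproj p z) = 0"
  proof -
    define W where "W = z - hproj p z"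
    show ?thesis
      using 1 unfolding W_def[symmetric] hproj_def iscale_add iscale_scaleR inner_add_right by simp
  qed
  show 3: "(z - hproj p z) \<bullet> (\<i> *s z) = 0"
  proof -
    have "(z - hproj p z) \<bullet> (\<i> *s z) = (z - hproj p z) \<bullet> (\<i> *s (z - hproj p z)) + (z - hproj p z) \<bullet> (\<i> *s hproj p z)"
      by (simp only: iscale_diff inner_diff_right)
    then show ?thesis using 2 inner_iscale_self(1)[of "z - hproj p z"] by linarith
  qed
  show "(z - hproj p z) \<bullet> (\<i> *s gbump p \<rho> z) = 0"
    unfolding gbump_def iscale_add iscale_scaleR iscale_diff inner_add_right inner_scaleR_right inner_diff_right
    using 1 2 3 by simp
qed

context bumps
begin

definition orbit :: "(real \<Rightarrow> complex ^ 'n) \<Rightarrow> bool" where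
  "orbit \<gamma> \<longleftrightarrow> (\<forall>t. (\<gamma> has_vector_derivative \<i> *s gF (\<gamma> t)) (at t)) \<and> (\<forall>t. F (\<gamma> t) = 1)"

definition K1 :: real where
  "K1 = 6 * (1 + M) + 3 * K0"

lemma level_set:
  assumes "F z = 1"
  shows "(norm z)\<^sup>2 = U z" "2 / 3 \<le> norm z" "norm z \<le> 3 / 2" "z \<noteq> 0" "gF z = (1 / U z) *\<^sub>R (2 *\<^sub>R z - gU z)"
    "norm (gF z - 2 *\<^sub>R z) \<le> K1 * l" "\<bar>norm z - 1\<bar> \<le> (1 + M) * l"
proof -
  show n: "(norm z)\<^sup>2 = U z" using assms U_pos[of z] by (simp add: F_def)
  show n1: "2 / 3 \<le> norm z"
    by (rule power2_le_imp_le) (use n U_bounds(1)[of z] in \<open>auto simp: power2_eq_square\<close>)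
  show n2: "norm z \<le> 3 / 2"
    by (rule power2_le_imp_le) (use n U_bounds(2)[of z] in \<open>auto simp: power2_eq_square\<close>)
  show z: "z \<noteq> 0" using n1 by auto
  show g: "gF z = (1 / U z) *\<^sub>R (2 *\<^sub>R z - gU z)"
    unfolding gF_def n using U_pos[of z] by (simp add: scaleR_diff_right power2_eq_square)
  have ll: "l\<^sup>2 \<le> l" using l by (simp add: power2_eq_square mult_left_le)
  have Ml: "(1 + M) * l\<^sup>2 \<le> (1 + M) * l" using ll M by (intro mult_left_mono) auto
  have U1: "\<bar>U z - 1\<bar> \<le> (1 + M) * l" using U_bounds(3)[of z] Ml by linarith
  have "gF z - 2 *\<^sub>R z = (2 / U z - 2) *\<^sub>R z - (1 / U z) *\<^sub>R gU z"
    by (simp add: g algebra_simps)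
  then have "norm (gF z - 2 *\<^sub>R z) \<le> \<bar>2 / U z - 2\<bar> * norm z + \<bar>1 / U z\<bar> * norm (gU z)"
    by (metis norm_scaleR norm_triangle_ineq4)
  also have "\<bar>2 / U z - 2\<bar> * norm z \<le> 4 * ((1 + M) * l) * (3 / 2)"
  proof (intro mult_mono n2)
    have "\<bar>2 / U z - 2\<bar> = 2 * \<bar>U z - 1\<bar> / U z" using U_pos[of z] by (simp add: abs_if field_simps)
    also have "\<dots> \<le> 2 * ((1 + M) * l) / (1 / 2)"
      using U_bounds(1)[of z] U1 M l by (intro frac_le mult_left_mono) auto
    finally show "\<bar>2 / U z - 2\<bar> \<le> 4 * ((1 + M) * l)" by simp
  qed (use M l in auto)
  also have "\<bar>1 / U z\<bar> * norm (gU z) \<le> 2 * (K0 * l / (2 / 3))"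
  proof (intro mult_mono)
    show "\<bar>1 / U z\<bar> \<le> 2" using U_bounds[of z] by (simp add: divide_le_eq)
    have "K0 * l / norm z \<le> K0 * l / (2 / 3)" using n1 K0 l by (intro divide_left_mono) auto
    then show "norm (gU z) \<le> K0 * l / (2 / 3)" using gU_bound[OF z] by linarith
  qed auto
  finally show "norm (gF z - 2 *\<^sub>R z) \<le> K1 * l" by (simp add: K1_def algebra_simps)
  have "\<bar>norm z - 1\<bar> * 1 \<le> \<bar>norm z - 1\<bar> * (norm z + 1)" by (intro mult_left_mono) auto
  also have "\<dots> = \<bar>(norm z - 1) * (norm z + 1)\<bar>" by (simp add: abs_mult)
  also have "(norm z - 1) * (norm z + 1) = (norm z)\<^sup>2 - 1" by (simp add: power2_eq_square algebra_simps)
  also have "\<bar>(norm z)\<^sup>2 - 1\<bar> \<le> (1 + M) * l" using U1 unfolding n .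
  finally show "\<bar>norm z - 1\<bar> \<le> (1 + M) * l" by simp
qed

lemma K1_pos: "0 < K1" using K0 M by (simp add: K1_def)

text \<open>In the frame rotating with the Hopf flow the velocity has the norm of \<open>gF\<close>
  z - 2 z, so the drift grows at most linearly.\<close>

lemma orbit_near_hopf:
  assumes "orbit \<gamma>" and B: "\<And>t. norm (gF (\<gamma> t) - 2 *\<^sub>R \<gamma> t) \<le> B"
  shows "norm (\<gamma> t - cis (2 * (t - s)) *s \<gamma> s) \<le> B * \<bar>t - s\<bar>"
proof -
  have d: "(\<gamma> has_vector_derivative \<i> *s gF (\<gamma> t)) (at t)" for t
    using assms unfolding orbit_def by auto
  define v where "v t = cis (- 2 * t) *s \<gamma> t" for t
  define v' where "v' t = cis (- 2 * t) *s (\<i> *s (gF (\<gamma> t) - 2 *\<^sub>R \<gamma> t))" for t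
  have dv: "(v has_vector_derivative v' t) (at t)" for t
  proof -
    let ?i = "\<lambda>z :: complex ^ 'n. \<i> *s z"
    have di: "((\<lambda>t. ?i (\<gamma> t)) has_vector_derivative ?i (\<i> *s gF (\<gamma> t))) (at t)"
      by (rule bounded_linear.has_vector_derivative[OF bounded_linear_iscale d])
    have 1: "((\<lambda>t. cos (- 2 * t)) has_real_derivative 2 * sin (- 2 * t)) (at t)"
      "((\<lambda>t. sin (- 2 * t)) has_real_derivative - 2 * cos (- 2 * t)) (at t)"
      by (auto intro!: derivative_eq_intros)
    have "v = (\<lambda>t. cos (- 2 * t) *\<^sub>R \<gamma> t + sin (- 2 * t) *\<^sub>R ?i (\<gamma> t))"
      by (rule ext) (simp only: v_def cis.code Complex_scale)
    moreover have "v' t = (cos (- 2 * t) *\<^sub>R (\<i> *s gF (\<gamma> t)) + (2 * sin (- 2 * t)) *\<^sub>R \<gamma> t) +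
        (sin (- 2 * t) *\<^sub>R ?i (\<i> *s gF (\<gamma> t)) + (- 2 * cos (- 2 * t)) *\<^sub>R ?i (\<gamma> t))"
      by (simp only: v'_def cis.code Complex_scale iscale_diff iscale_scaleR iscale_iscale) (simp add: algebra_simps)
    ultimately show ?thesis
      using has_vector_derivative_add[OF has_vector_derivative_scaleR[OF 1(1) d] has_vector_derivative_scaleR[OF 1(2) di]]
      by simp
  qed
  have "norm (v' t) \<le> B" for t
    unfolding v'_def norm_cscale using B[of t] by simp
  then have "norm (v t - v s) \<le> B * norm (t - s)"
    using dv unfolding has_vector_derivative_def
    by (intro differentiable_bound[of UNIV v "\<lambda>t h. h *\<^sub>R v' t"] onorm_le) (auto simp: mult.commute[of B] intro: mult_left_mono)
  moreover have "\<gamma> t - cis (2 * (t - s)) *s \<gamma> s = cis (2 * t) *s (v t - v s)"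
  proof -
    have "cis (2 * t) * cis (- 2 * s) = cis (2 * (t - s))" "cis (2 * t) * cis (- 2 * t) = 1"
      by (simp_all add: cis_mult algebra_simps)
    then show ?thesis by (simp add: v_def vec_eq_iff right_diff_distrib flip: mult.assoc)
  qed
  ultimately show ?thesis by (simp only: norm_cscale norm_cis mult_1_left real_norm_def)
qed

end

section \<open>Short periodic orbits\<close>

text \<open>\<open>alp0\<close> is a lower bound for the angle by which a passage through the bump at \<open>pp\<close> turns the
  transverse coordinate of an orbit near its axis: the rate is at least \<open>exp (- 6) / 2\<close> for a time \<open>pi / 4\<close>.
  The relative radius \<open>del0\<close> of the second bump is too small for an orbit turned by that angle to lie in
  it both before and after the passage. \<open>Kbig\<close> collects all first order error constants.\<close>

definition alp0 :: real where "alp0 = pi / 8 * exp (- 6)"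

definition del0 :: real where "del0 = sin alp0 / 64"

definition Kbig :: "real \<Rightarrow> real" where
  "Kbig M = 8 * (6 * (1 + M) + 3 * (4 + M * (2 + 2 / del0))) + 5 + M"

lemma alp0: "0 < alp0" "alp0 \<le> pi / 2"
proof -
  show "0 < alp0" by (simp add: alp0_def)
  have "pi / 8 * exp (- 6) \<le> pi / 8 * 1" by (intro mult_left_mono) auto
  then show "alp0 \<le> pi / 2" unfolding alp0_def using pi_gt_zero by linarith
qed

lemma del0: "0 < del0" "del0 \<le> 1 / 64"
  unfolding del0_def using alp0 sin_gt_zero_02[of alp0] sin_gt_zero[of alp0] sin_le_one[of alp0] by auto

section \<open>Two tubes around neighbouring Hopf circles\<close>

locale tube =
  fixes k1 k2 :: "'n::finite" and l M :: real
  assumes k12: "k1 \<noteq> k2" and l0: "0 < l" and M0: "0 \<le> M" and small: "Kbig M * l \<le> 1 / 100"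
begin

text \<open>The tilt between the axes is half the width of the outer tube: the axis of the dent then
  runs at a depth where the outer bump has a definite transverse slope, yet away from the axis of
  that tube.\<close>

definition \<tau> :: real where "\<tau> = l / 2"
definition N :: real where "N = sqrt (1 + \<tau>\<^sup>2)"
definition pp :: "complex ^ 'n" where "pp = axis k1 1"
text \<open>The sign puts the dent over the half opposite to that of the first bump.\<close>

definition qq :: "complex ^ 'n" where "qq = - ((1 / N) *\<^sub>R (axis k1 1 + \<tau> *\<^sub>R axis k2 1))"

lemma Kbig_ge: "65 + M \<le> Kbig M"
proof -
  have "0 \<le> M * (2 + 2 / del0)" using M0 del0 by (intro mult_nonneg_nonneg add_nonneg_nonneg) auto
  then have "65 + M \<le> 8 * (6 * (1 + M) + 3 * (4 + M * (2 + 2 / del0))) + 5 + M"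
    using M0 by (simp only: distrib_left)
  then show ?thesis by (simp add: Kbig_def)
qed

lemma l_small: "l \<le> 1 / 1000" "M * l \<le> 1 / 100"
proof -
  have "65 * l \<le> Kbig M * l" "M * l \<le> Kbig M * l" using Kbig_ge M0 l0 by (intro mult_right_mono; simp)+
  then show "l \<le> 1 / 1000" "M * l \<le> 1 / 100" using small by linarith+
qed

lemma \<tau>: "0 < \<tau>" "\<tau> \<le> 1 / 2000" using l0 l_small by (auto simp: \<tau>_def)

lemma N: "1 \<le> N" "N\<^sup>2 = 1 + \<tau>\<^sup>2" "N \<le> 1 + \<tau>"
proof -
  show "1 \<le> N" by (simp add: N_def)
  show "N\<^sup>2 = 1 + \<tau>\<^sup>2" by (simp add: N_def add_nonneg_nonneg)
  show "N \<le> 1 + \<tau>" unfolding N_def using \<tau> by (intro real_le_lsqrt) (auto simp: power2_eq_square algebra_simps)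
qed

lemma inner_pp: "z \<bullet> pp = Re (z $ k1)" "z \<bullet> (\<i> *s pp) = Im (z $ k1)"
proof -
  show "z \<bullet> pp = Re (z $ k1)" by (simp add: pp_def inner_axis inner_complex_def)
  have "\<i> *s axis k1 1 = (axis k1 \<i> :: complex ^ 'n)" by (simp add: vec_eq_iff axis_def)
  then show "z \<bullet> (\<i> *s pp) = Im (z $ k1)" by (simp add: pp_def inner_axis inner_complex_def)
qed

lemma inner_qq: "z \<bullet> qq = - (1 / N) * Re (z $ k1 + \<tau> * z $ k2)" "z \<bullet> (\<i> *s qq) = - (1 / N) * Im (z $ k1 + \<tau> * z $ k2)"
proof -
  show "z \<bullet> qq = - (1 / N) * Re (z $ k1 + \<tau> * z $ k2)"
    by (simp add: qq_def inner_add_right inner_axis inner_complex_def)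
  have "\<i> *s qq = - ((1 / N) *\<^sub>R (axis k1 \<i> + \<tau> *\<^sub>R axis k2 \<i>))"
    using k12 by (auto simp: qq_def vec_eq_iff axis_def scaleR_conv_of_real)
  then show "z \<bullet> (\<i> *s qq) = - (1 / N) * Im (z $ k1 + \<tau> * z $ k2)"
    by (simp add: inner_add_right inner_axis inner_complex_def)
qed

lemma hsq_pp: "hsq pp z = (cmod (z $ k1))\<^sup>2" and hsq_qq: "hsq qq z = (cmod (z $ k1 + \<tau> * z $ k2))\<^sup>2 / N\<^sup>2"
proof -
  show "hsq pp z = (cmod (z $ k1))\<^sup>2" unfolding hsq_def inner_pp cmod_power2 ..
  have "(- (1 / N) * a)\<^sup>2 + (- (1 / N) * b)\<^sup>2 = (a\<^sup>2 + b\<^sup>2) / N\<^sup>2" for a b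
    by (simp add: power_mult_distrib power_divide add_divide_distrib)
  then show "hsq qq z = (cmod (z $ k1 + \<tau> * z $ k2))\<^sup>2 / N\<^sup>2" unfolding hsq_def inner_qq cmod_power2 .
qed

lemma hproj_pp: "hproj pp z = axis k1 (z $ k1)"
  unfolding hproj_def inner_pp by (simp add: pp_def vec_eq_iff axis_def complex_eq_iff)

lemma norm_pp: "norm pp = 1"
  by (simp add: pp_def norm_eq_sqrt_inner inner_axis_axis)

lemma norm_qq: "norm qq = 1"
proof -
  have "(norm qq)\<^sup>2 = qq \<bullet> qq" by (rule power2_norm_eq_inner)
  also have "\<dots> = 1"
  proof -
    have "Re (qq $ k1 + \<tau> * qq $ k2) = - (1 / N) * N\<^sup>2"
      unfolding N(2) using k12 by (simp add: qq_def axis_def power2_eq_square algebra_simps)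
    then show ?thesis unfolding inner_qq(1) using N(1) by (simp add: power2_eq_square)
  qed
  finally show ?thesis by (simp add: power2_eq_1_iff) (metis norm_ge_zero neg_0_le_iff_le not_one_le_zero)
qed

sublocale bumps pp qq l del0 M
proof
  show "M * l\<^sup>2 \<le> 1 / 2"
  proof -
    have "M * l * l \<le> 1 / 100 * 1" using l_small l0 M0 by (intro mult_mono) auto
    then show ?thesis by (simp add: power2_eq_square mult.assoc)
  qed
qed (use norm_pp norm_qq l_small l0 M0 del0 in auto)

lemma K1_small: "K1 * l \<le> 1 / 800"
proof -
  have "8 * K1 \<le> Kbig M" using M0 by (simp add: K1_def K0_def Kbig_def)
  then have "8 * K1 * l \<le> Kbig M * l" using l0 by (intro mult_right_mono) auto
  then show ?thesis using small by simp
qed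

text \<open>Lagrange's identity: for the coordinates a and b at \<open>k1\<close> and
  \<open>k2\<close>, |b - \<tau> a|^2 and |a + \<tau> b|^2 add up to N^2 (|a|^2 + |b|^2), and the
  second is N^2 \<open>hsq qq z\<close>.\<close>

lemma perp_le: "(cmod (z $ k2 - \<tau> * z $ k1))\<^sup>2 \<le> N\<^sup>2 * ((norm z)\<^sup>2 - hsq qq z)"
proof -
  let ?a = "z $ k1" and ?b = "z $ k2"
  have "(norm z)\<^sup>2 = (\<Sum>j\<in>UNIV. (cmod (z $ j))\<^sup>2)" by (rule norm_power2_vec)
  also have "\<dots> \<ge> (\<Sum>j\<in>{k1, k2}. (cmod (z $ j))\<^sup>2)" by (rule sum_mono2) auto
  finally have "(cmod ?a)\<^sup>2 + (cmod ?b)\<^sup>2 \<le> (norm z)\<^sup>2" using k12 by simp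
  then have "N\<^sup>2 * ((cmod ?a)\<^sup>2 + (cmod ?b)\<^sup>2) \<le> N\<^sup>2 * (norm z)\<^sup>2" by (rule mult_left_mono) simp
  moreover have "N\<^sup>2 * hsq qq z = (cmod (?a + \<tau> * ?b))\<^sup>2" using N(1) by (simp add: hsq_qq)
  moreover have "(cmod (?b - \<tau> * ?a))\<^sup>2 + (cmod (?a + \<tau> * ?b))\<^sup>2 = N\<^sup>2 * ((cmod ?a)\<^sup>2 + (cmod ?b)\<^sup>2)"
    unfolding N(2) cmod_power2 by (simp add: power2_eq_square algebra_simps)
  ultimately show ?thesis by (simp add: right_diff_distrib)
qed

text \<open>Triangle inequality: the distance from the line of \<open>pp\<close> exceeds the one
  from the line of \<open>qq\<close> by at most the tilt times the norm.\<close>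

lemma perp_pp_le: "(norm z)\<^sup>2 - (cmod (z $ k1))\<^sup>2 \<le> (sqrt ((norm z)\<^sup>2 - hsq qq z) + \<tau> * norm z)\<^sup>2"
proof -
  define P where "P v = (\<chi> j. if j = k1 then 0 else v $ j)" for v :: "complex ^ 'n"
  have Pn: "(norm (P v))\<^sup>2 = (norm v)\<^sup>2 - (cmod (v $ k1))\<^sup>2" for v
  proof -
    have "(norm v)\<^sup>2 = (cmod (v $ k1))\<^sup>2 + (\<Sum>j\<in>UNIV - {k1}. (cmod (v $ j))\<^sup>2)"
      unfolding norm_power2_vec by (rule sum.remove) auto
    moreover have "(norm (P v))\<^sup>2 = (\<Sum>j\<in>UNIV - {k1}. (cmod (v $ j))\<^sup>2)"
      unfolding norm_power2_vec by (subst sum.remove[of _ k1]) (auto simp: P_def intro!: sum.cong)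
    ultimately show ?thesis by simp
  qed
  have Ple: "norm (P v) \<le> norm v" for v
    by (rule power2_le_imp_le) (use Pn[of v] in auto)
  define W where "W = z - hproj qq z"
  have W: "norm W = sqrt ((norm z)\<^sup>2 - hsq qq z)"
    using hsq_perp[OF norm_qq, of z] by (simp add: W_def real_sqrt_unique)
  have h: "norm (P (hproj qq z)) \<le> \<tau> * norm z"
  proof -
    let ?c = "Complex (z \<bullet> qq) (z \<bullet> (\<i> *s qq))"
    have hq: "hproj qq z = ?c *s qq" unfolding Complex_scale hproj_def ..
    have cz: "cmod ?c \<le> norm z"
      by (rule power2_le_imp_le) (use hsq_le[OF norm_qq, of z] in \<open>simp_all add: hsq_def cmod_power2\<close>)
    have "P (hproj qq z) = axis k2 (- (?c * of_real (\<tau> / N)))"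
      unfolding hq using k12 by (auto simp: P_def qq_def vec_eq_iff axis_def scaleR_conv_of_real[where 'a = complex])
    then have "norm (P (hproj qq z)) = cmod ?c * (\<tau> / N)"
      using \<tau> N by (simp add: norm_eq_sqrt_inner[of "axis k2 _"] inner_axis_axis norm_mult norm_divide flip: norm_eq_sqrt_inner)
    also have "\<dots> \<le> norm z * (\<tau> / 1)"
      using cz \<tau> N by (intro mult_mono divide_left_mono) auto
    finally show ?thesis by (simp add: mult.commute)
  qed
  have "P z = P W + P (hproj qq z)" by (simp add: P_def W_def vec_eq_iff)
  then have "norm (P z) \<le> norm W + \<tau> * norm z"
    using norm_triangle_ineq[of "P W" "P (hproj qq z)"] Ple[of W] h by simp
  then have "(norm (P z))\<^sup>2 \<le> (norm W + \<tau> * norm z)\<^sup>2" by (intro power_mono) auto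
  then show ?thesis unfolding Pn W .
qed

text \<open>By periodicity such an orbit starts, passes through the bump at \<open>pp\<close> during \<open>[0, pi / 2]\<close> and then
  possibly through the one at \<open>qq\<close>. If its distance from the axis of the latter is too large for it to be
  active, the orbit is nowhere faster than a Hopf circle and cannot close up before time \<open>pi\<close>;
  otherwise it is close to that axis at times \<open>0\<close> and \<open>pi / 2\<close>, which the rotation \<open>\<xi> (pi / 2) = exp (\<integral> w) \<xi> 0\<close> of \<open>\<xi> = Y / C\<close> forbids.\<close>

lemma no_short_orbit_centered:
  assumes orb: "orbit \<gamma>" and T: "pi / 2 < T" "T < pi" and per: "\<And>t. \<gamma> (t + T) = \<gamma> t"
    and near: "\<And>t. 0 \<le> t \<Longrightarrow> t \<le> pi \<Longrightarrow> norm (\<gamma> t - (- \<i> * cis (2 * t)) *s pp) \<le> 1 / 100"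
  shows False
proof -
  have d: "(\<gamma> has_vector_derivative \<i> *s gF (\<gamma> t)) (at t)" and F1: "F (\<gamma> t) = 1" for t
    using orb unfolding orbit_def by auto
  note ls = level_set[OF F1]
  define C where "C t = \<gamma> t $ k1" for t
  define Y where "Y t = \<gamma> t $ k2" for t
  define C' where "C' t = (\<i> *s gF (\<gamma> t)) $ k1" for t
  define Y' where "Y' t = (\<i> *s gF (\<gamma> t)) $ k2" for t
  have dC: "(C has_vector_derivative C' t) (at t)" and dY: "(Y has_vector_derivative Y' t) (at t)" for t
    unfolding C_def C'_def Y_def Y'_def
    by (rule bounded_linear.has_vector_derivative[OF bounded_linear_vec_nth d])+
  have cg: "continuous_on A \<gamma>" for A
    using has_vector_derivative_continuous[OF d] by (meson continuous_at_imp_continuous_on)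
  have cgF: "continuous_on A (\<lambda>t. gF (\<gamma> t))" for A
    by (rule continuous_on_compose2[OF continuous_gF cg]) auto
  have cC: "continuous_on A C" "continuous_on A C'" "continuous_on A Y" "continuous_on A Y'" for A
    unfolding C_def C'_def Y_def Y'_def
    by (intro continuous_on_component cg bounded_linear.continuous_on[OF bounded_linear_iscale] cgF)+
  have nearC: "cmod (C t + \<i> * cis (2 * t)) \<le> 1 / 100" and nearY: "cmod (Y t) \<le> 1 / 100" if t: "0 \<le> t" "t \<le> pi" for t
  proof -
    have "cmod ((\<gamma> t - (- \<i> * cis (2 * t)) *s pp) $ j) \<le> 1 / 100" for j
      using near[OF t] Finite_Cartesian_Product.norm_nth_le[of "\<gamma> t - (- \<i> * cis (2 * t)) *s pp" j] by linarith
    from this[of k1] this[of k2] show "cmod (C t + \<i> * cis (2 * t)) \<le> 1 / 100" "cmod (Y t) \<le> 1 / 100"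
      using k12 by (simp_all add: C_def Y_def pp_def axis_def)
  qed
  have ReC: "\<bar>Re (C t) - sin (2 * t)\<bar> \<le> 1 / 100" and Cn: "99 / 100 \<le> cmod (C t)" if t: "0 \<le> t" "t \<le> pi" for t
  proof -
    show "\<bar>Re (C t) - sin (2 * t)\<bar> \<le> 1 / 100"
      using abs_Re_le_cmod[of "C t + \<i> * cis (2 * t)"] nearC[OF t] by simp
    have "cmod (\<i> * cis (2 * t)) \<le> cmod (C t + \<i> * cis (2 * t)) + cmod (C t)"
      using norm_triangle_ineq4[of "C t + \<i> * cis (2 * t)" "C t"] by simp
    then show "99 / 100 \<le> cmod (C t)" using nearC[OF t] by (simp add: norm_mult)
  qed
  have C0: "C t \<noteq> 0" if "0 \<le> t" "t \<le> pi" for t using Cn[OF that] by auto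
  \<comment> \<open>The phase is such that the coordinate along \<open>pp\<close> has real part
    close to sin (2 t), nonnegative on [0, \<pi> / 2] and nonpositive on [\<pi> / 2, \<pi>]. The
    threshold 1/4 in \<open>b1\<close> absorbs the errors, so one bump is off in each half.\<close>
  have q_off: "b1 qq (\<gamma> t) \<le> 0" if t: "0 \<le> t" "t \<le> pi / 2" for t
  proof -
    have t': "0 \<le> t" "t \<le> pi" using t by auto
    have "0 \<le> sin (2 * t)" using t by (intro sin_ge_zero) auto
    then have 1: "- (1 / 100) \<le> Re (C t)" using ReC[OF t'] by linarith
    have "\<bar>Re (\<tau> * Y t)\<bar> \<le> 1 * (1 / 100)"
    proof -
      have "\<bar>Re (\<tau> * Y t)\<bar> \<le> cmod (\<tau> * Y t)" by (rule abs_Re_le_cmod)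
      also have "\<dots> \<le> 1 * (1 / 100)" unfolding norm_mult using \<tau> nearY[OF t'] by (intro mult_mono) auto
      finally show ?thesis .
    qed
    then have 2: "- (2 / 100) \<le> Re (C t + \<tau> * Y t)" using 1 unfolding plus_complex.sel by linarith
    have "\<gamma> t \<bullet> qq = (1 / N) * (- Re (C t + \<tau> * Y t))" unfolding inner_qq C_def Y_def by (simp only: mult_minus_left mult_minus_right)
    also have "\<dots> \<le> (1 / N) * (2 / 100)" using 2 N by (intro mult_left_mono) auto
    also have "\<dots> \<le> 1 * (2 / 100)" using N by (intro mult_right_mono) auto
    finally have "(\<gamma> t \<bullet> qq) / norm (\<gamma> t) \<le> (2 / 100) / norm (\<gamma> t)" by (intro divide_right_mono) auto
    also have "\<dots> \<le> (2 / 100) / (2 / 3)" using ls(2)[of t] by (intro divide_left_mono) auto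
    finally have "(\<gamma> t \<bullet> qq) / norm (\<gamma> t) \<le> 1 / 4" by (rule order_trans) simp
    then show ?thesis unfolding b1_def by linarith
  qed
  have p_off: "b1 pp (\<gamma> t) \<le> 0" if t: "pi / 2 \<le> t \<and> t \<le> pi \<or> t = 0" for t
  proof -
    have t': "0 \<le> t" "t \<le> pi" using t by auto
    have "sin (2 * t) \<le> 0"
    proof (cases "t = 0")
      case False
      then have "0 \<le> sin (2 * t - pi)" using t by (intro sin_ge_zero) auto
      then show ?thesis by (simp add: sin_diff)
    qed simp
    then have 1: "Re (C t) \<le> 1 / 100" using ReC[OF t'] by linarith
    have "Re (C t) / norm (\<gamma> t) \<le> (1 / 100) / norm (\<gamma> t)" using 1 by (intro divide_right_mono) auto
    also have "\<dots> \<le> (1 / 100) / (2 / 3)" using ls(2)[of t] by (intro divide_left_mono) auto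
    finally have "Re (C t) / norm (\<gamma> t) \<le> 1 / 4" by (rule order_trans) simp
    then show ?thesis unfolding b1_def inner_pp C_def[symmetric] by linarith
  qed
  note qo = bump_inactive[OF disjI1[OF q_off]] and po = bump_inactive[OF disjI1[OF p_off]]
  \<comment> \<open>Neither bump is active at the two ends of the passage, so there the orbit lies
    on the unit sphere.\<close>
  have n1: "norm (\<gamma> 0) = 1" "norm (\<gamma> (pi / 2)) = 1"
  proof -
    have "U (\<gamma> 0) = 1" "U (\<gamma> (pi / 2)) = 1"
      using qo(1)[of _ "del0 * l"] po(1)[of _ l] pi_gt_zero by (simp_all add: U_def)
    then have "(norm (\<gamma> 0))\<^sup>2 = 1" "(norm (\<gamma> (pi / 2)))\<^sup>2 = 1" using ls(1) by auto
    then show "norm (\<gamma> 0) = 1" "norm (\<gamma> (pi / 2)) = 1"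
      by (metis abs_norm_cancel power2_eq_1_iff abs_1 abs_minus_cancel)+
  qed
  text \<open>While a single bump is active, the part of the orbit orthogonal to the complex line of that
    bump only rotates, so its length is conserved.\<close>
  have cons: "(norm (\<gamma> t))\<^sup>2 - hsq v (\<gamma> t) = (norm (\<gamma> s))\<^sup>2 - hsq v (\<gamma> s)"
    if v: "norm v = 1" and S: "\<And>t. t \<in> {a..b} \<Longrightarrow> \<exists>c. gU (\<gamma> t) = c *\<^sub>R gbump v r (\<gamma> t)"
      and ts: "t \<in> {a..b}" "s \<in> {a..b}" for v r a b t s
  proof (rule has_derivative_zero_unique[of "{a..b}" "\<lambda>t. (norm (\<gamma> t))\<^sup>2 - hsq v (\<gamma> t)"])
    fix t assume t: "t \<in> {a..b}"
    have dd: "((\<lambda>z. (norm z)\<^sup>2 - hsq v z) has_derivative (\<lambda>w. (2 *\<^sub>R (z - hproj v z)) \<bullet> w)) (at z)" for z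
      using has_derivative_diff[OF derivative_norm_square derivative_hsq] by (simp add: inner_diff_left algebra_simps)
    have "((\<lambda>t. (norm (\<gamma> t))\<^sup>2 - hsq v (\<gamma> t)) has_real_derivative (2 *\<^sub>R (\<gamma> t - hproj v (\<gamma> t))) \<bullet> (\<i> *s gF (\<gamma> t))) (at t)"
      by (rule has_real_derivative_along[OF dd d])
    moreover obtain c where "gU (\<gamma> t) = c *\<^sub>R gbump v r (\<gamma> t)" using S[OF t] by blast
    then have "(2 *\<^sub>R (\<gamma> t - hproj v (\<gamma> t))) \<bullet> (\<i> *s gF (\<gamma> t)) = 0"
      using perp_orth[OF v, of "\<gamma> t"] by (simp add: ls(5) iscale_scaleR iscale_diff inner_diff_right)
    ultimately have "((\<lambda>t. (norm (\<gamma> t))\<^sup>2 - hsq v (\<gamma> t)) has_real_derivative 0) (at t)" by simp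
    then have "((\<lambda>t. (norm (\<gamma> t))\<^sup>2 - hsq v (\<gamma> t)) has_derivative (*) 0) (at t within {a..b})"
      unfolding has_field_derivative_def by (rule has_derivative_at_withinI)
    then show "((\<lambda>t. (norm (\<gamma> t))\<^sup>2 - hsq v (\<gamma> t)) has_derivative (\<lambda>h. 0)) (at t within {a..b})"
      by (simp add: lambda_zero)
  qed (use ts in auto)
  have consK: "(norm (\<gamma> t))\<^sup>2 - hsq pp (\<gamma> t) = (norm (\<gamma> s))\<^sup>2 - hsq pp (\<gamma> s)" if "t \<in> {0..pi / 2}" "s \<in> {0..pi / 2}" for t s
    by (rule cons[OF norm_pp _ that, where r = l]) (auto simp: gU_def qo)
  have consG: "(norm (\<gamma> t))\<^sup>2 - hsq qq (\<gamma> t) = (norm (\<gamma> s))\<^sup>2 - hsq qq (\<gamma> s)" if "t \<in> {pi / 2..pi}" "s \<in> {pi / 2..pi}" for t s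
    by (rule cons[OF norm_qq _ that, where r = "del0 * l"]) (auto simp: gU_def po intro: exI[of _ "- (M * l\<^sup>2)"])
  \<comment> \<open>The squared distance from the axis of the dent, conserved on [\<pi> / 2, \<pi>].
    As \<open>T\<close> lies there and the orbit closes up, it has the same value at the times 0 and
    \<pi> / 2, although it need not be conserved in between.\<close>
  define s where "s = (norm (\<gamma> T))\<^sup>2 - hsq qq (\<gamma> T)"
  have gT: "\<gamma> T = \<gamma> 0" using per[of 0] by simp
  have s0: "s = (norm (\<gamma> 0))\<^sup>2 - hsq qq (\<gamma> 0)" "s = (norm (\<gamma> (pi / 2)))\<^sup>2 - hsq qq (\<gamma> (pi / 2))"
    using gT consG[of T "pi / 2"] T by (auto simp: s_def)
  have sge: "0 \<le> s" unfolding s_def using hsq_le[OF norm_qq, of "\<gamma> T"] by simp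
  \<comment> \<open>On the first half the coordinates orthogonal to the axis rotate at the common
    rate \<open>A\<close>, while the axial one \<open>C\<close> acquires the additional terms
    \<open>B\<close> and \<open>E\<close>. In the ratio Y / C the rate \<open>A\<close>
    cancels.\<close>
  define A where "A t = (1 / U (\<gamma> t)) * (2 + l\<^sup>2 * bump_p pp l (\<gamma> t) * Re (C t) / (norm (\<gamma> t))\<^sup>2
      + l\<^sup>2 * bump_h pp l (\<gamma> t) * (cmod (C t))\<^sup>2 / (norm (\<gamma> t))\<^sup>2)" for t
  define B where "B t = (1 / U (\<gamma> t)) * (l\<^sup>2 * bump_p pp l (\<gamma> t))" for t
  define E where "E t = (1 / U (\<gamma> t)) * (l\<^sup>2 * bump_h pp l (\<gamma> t))" for t
  have eqC: "C' t = \<i> * (A t * C t - B t - E t * C t)" and eqY: "Y' t = \<i> * (A t * Y t)" if t: "0 \<le> t" "t \<le> pi / 2" for t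
  proof -
    have gUe: "gU (\<gamma> t) = l\<^sup>2 *\<^sub>R gbump pp l (\<gamma> t)" using qo[OF t] by (simp add: gU_def)
    have g: "gF (\<gamma> t) = A t *\<^sub>R \<gamma> t - B t *\<^sub>R pp - E t *\<^sub>R hproj pp (\<gamma> t)"
      unfolding ls(5) gUe gbump_def A_def B_def E_def inner_pp hsq_pp C_def
      by (simp add: scaleR_diff_right scaleR_add_right scaleR_add_left algebra_simps)
    then show "C' t = \<i> * (A t * C t - B t - E t * C t)" "Y' t = \<i> * (A t * Y t)"
      using k12 unfolding C'_def Y'_def C_def Y_def g hproj_pp
      by (simp_all add: pp_def right_diff_distrib axis_def scaleR_conv_of_real[where 'a = complex])
  qed
  have UK: "1 \<le> U (\<gamma> t)" if t: "0 \<le> t" "t \<le> pi / 2" for t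
    using qo[OF t] bump_bounds(1)[of pp l "\<gamma> t"] by (simp add: U_def)
  have bp0: "0 \<le> bump_p pp l (\<gamma> t)" "0 \<le> bump_h pp l (\<gamma> t)" "0 \<le> bump_p pp l (\<gamma> t) * Re (C t)" for t
  proof -
    show 1: "0 \<le> bump_p pp l (\<gamma> t)" "0 \<le> bump_h pp l (\<gamma> t)"
      using eta_props by (simp_all add: bump_p_def bump_h_def)
    show "0 \<le> bump_p pp l (\<gamma> t) * Re (C t)"
    proof (cases "b1 pp (\<gamma> t) \<le> 0")
      case True
      then show ?thesis by (simp add: bump_inactive)
    next
      case False
      then have "1 / 4 < Re (C t) / norm (\<gamma> t)" by (simp add: b1_def inner_pp C_def)
      then have "0 < Re (C t) / norm (\<gamma> t)" by (rule less_trans[rotated]) simp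
      then have "0 < Re (C t)" using norm_ge_zero[of "\<gamma> t"] unfolding zero_less_divide_iff by linarith
      then show ?thesis using 1 by simp
    qed
  qed
  have Cle: "(cmod (C t))\<^sup>2 \<le> (norm (\<gamma> t))\<^sup>2" for t
    unfolding C_def by (intro power_mono Finite_Cartesian_Product.norm_nth_le) auto
  \<comment> \<open>The logarithmic derivative of \<open>C\<close>; its imaginary part is the
    angular speed in the plane of \<open>pp\<close>, which is 2 for the Hopf flow.\<close>
  define k where "k t = C' t / C t" for t
  have ck: "continuous_on {a..b} k" if "0 \<le> a" "b \<le> pi" for a b
    unfolding k_def using that C0 by (intro continuous_intros cC) auto
  have dCk: "(C has_vector_derivative k t * C t) (at t)" if "0 \<le> t" "t \<le> pi" for t
    using dC[of t] C0[OF that] by (simp add: k_def)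
  have ImC: "Im (\<i> * (of_real a + of_real b * (1 / C t))) = a + b * (Re (C t) / (cmod (C t))\<^sup>2)" for a b t
    by (simp add: Re_divide cmod_power2)
  have kK: "k t = \<i> * (of_real (A t - E t) - B t * (1 / C t))" if t: "0 \<le> t" "t \<le> pi / 2" for t
  proof -
    have "C t \<noteq> 0" using C0 t by auto
    then show ?thesis unfolding k_def eqC[OF t] by (simp add: field_simps)
  qed
  show False
  proof (cases "del0\<^sup>2 * l\<^sup>2 \<le> s")
    case True
    \<comment> \<open>Without the dent the angular speed is at most 2: under the first bump U \<ge>
      1, and both corrections are nonpositive because cmod (C t) \<le> norm (\<gamma> t). A total
      angle in [T, 2 T] with 0 < T < \<pi> is not a multiple of 2 \<pi>.\<close>
    have Imk: "Im (k t) \<le> 2" "1 \<le> Im (k t)" if t: "0 \<le> t" "t \<le> T" for t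
    proof -
      have t': "0 \<le> t" "t \<le> pi" using t T by auto
      show "Im (k t) \<le> 2"
      proof (cases "t \<le> pi / 2")
        case True
        note tK = t(1) True
        have "Im (k t) = A t - E t - B t * (Re (C t) / (cmod (C t))\<^sup>2)"
          using ImC[of "A t - E t" "- B t" t] unfolding kK[OF tK] by simp
        also have "\<dots> = (1 / U (\<gamma> t)) * (2 - l\<^sup>2 * bump_h pp l (\<gamma> t) * (1 - (cmod (C t))\<^sup>2 / (norm (\<gamma> t))\<^sup>2)
            - l\<^sup>2 * (bump_p pp l (\<gamma> t) * Re (C t)) * (1 / (cmod (C t))\<^sup>2 - 1 / (norm (\<gamma> t))\<^sup>2))"
          unfolding A_def B_def E_def by (simp add: algebra_simps)
        also have "\<dots> \<le> (1 / U (\<gamma> t)) * 2"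
        proof (intro mult_left_mono)
          have "0 \<le> 1 - (cmod (C t))\<^sup>2 / (norm (\<gamma> t))\<^sup>2" using Cle[of t] ls(4)[of t] by (simp add: divide_le_eq_1)
          then have 1: "0 \<le> l\<^sup>2 * bump_h pp l (\<gamma> t) * (1 - (cmod (C t))\<^sup>2 / (norm (\<gamma> t))\<^sup>2)"
            using bp0(2)[of t] by (intro mult_nonneg_nonneg) auto
          have "1 / (norm (\<gamma> t))\<^sup>2 \<le> 1 / (cmod (C t))\<^sup>2" using Cle[of t] C0[OF t'] ls(4)[of t] by (intro divide_left_mono) auto
          then have 2: "0 \<le> l\<^sup>2 * (bump_p pp l (\<gamma> t) * Re (C t)) * (1 / (cmod (C t))\<^sup>2 - 1 / (norm (\<gamma> t))\<^sup>2)"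
            using bp0(3)[of t] by simp
          show "2 - l\<^sup>2 * bump_h pp l (\<gamma> t) * (1 - (cmod (C t))\<^sup>2 / (norm (\<gamma> t))\<^sup>2)
            - l\<^sup>2 * (bump_p pp l (\<gamma> t) * Re (C t)) * (1 / (cmod (C t))\<^sup>2 - 1 / (norm (\<gamma> t))\<^sup>2) \<le> 2"
            using 1 2 by linarith
        qed (use UK[OF tK] in auto)
        also have "\<dots> \<le> 2" using UK[OF tK] by (simp add: divide_le_eq)
        finally show ?thesis .
      next
        case False
        then have tG: "t \<in> {pi / 2..pi}" using t' by auto
        have po': "bump pp l (\<gamma> t) = 0" "gbump pp l (\<gamma> t) = 0" using po[of t l] tG by auto
        have nU: "(norm (\<gamma> t))\<^sup>2 \<le> 1"
        proof -
          have "0 \<le> M * l\<^sup>2 * bump qq (del0 * l) (\<gamma> t)" using M0 bump_bounds(1)[of qq "del0 * l" "\<gamma> t"] by simp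
          then show ?thesis unfolding ls(1) U_def po' by simp
        qed
        have st: "s = (norm (\<gamma> t))\<^sup>2 - hsq qq (\<gamma> t)" unfolding s_def using consG[OF _ tG, of T] T by simp
        \<comment> \<open>On this half norm (\<gamma> t) \<le> 1, so the squared angular distance
          from the axis of the dent is at least the conserved \<open>s\<close>.\<close>
        have "b2 qq (del0 * l) (\<gamma> t) \<le> 0"
        proof -
          have n0: "0 < (norm (\<gamma> t))\<^sup>2" using ls(4)[of t] by simp
          have "1 - hsq qq (\<gamma> t) / (norm (\<gamma> t))\<^sup>2 = s / (norm (\<gamma> t))\<^sup>2" using n0 unfolding st by (simp add: diff_divide_distrib)
          also have "\<dots> \<ge> s / 1" using nU n0 sge by (intro divide_left_mono) auto
          finally have "(del0 * l)\<^sup>2 \<le> 1 - hsq qq (\<gamma> t) / (norm (\<gamma> t))\<^sup>2" using True by (simp add: power_mult_distrib)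
          then show ?thesis using del0 l0 by (simp add: b2_def le_divide_eq)
        qed
        then have "bump qq (del0 * l) (\<gamma> t) = 0" "gbump qq (del0 * l) (\<gamma> t) = 0" by (simp_all add: bump_inactive)
        then have "gU (\<gamma> t) = 0" "U (\<gamma> t) = 1" using po' by (simp_all add: gU_def U_def)
        then have "C' t = 2 * \<i> * C t" by (simp add: C'_def C_def ls(5) scaleR_conv_of_real[where 'a = complex])
        then have "k t = 2 * \<i>" using C0[OF t'] by (simp add: k_def)
        then show ?thesis by simp
      qed
      have "cmod (C' t - 2 * \<i> * C t) \<le> 1 / 800"
      proof -
        have "C' t - 2 * \<i> * C t = \<i> * ((gF (\<gamma> t) - 2 *\<^sub>R \<gamma> t) $ k1)"
          by (simp add: C'_def C_def scaleR_conv_of_real[where 'a = complex] algebra_simps)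
        then have "cmod (C' t - 2 * \<i> * C t) \<le> norm (gF (\<gamma> t) - 2 *\<^sub>R \<gamma> t)"
          using Finite_Cartesian_Product.norm_nth_le[of "gF (\<gamma> t) - 2 *\<^sub>R \<gamma> t" k1] by (simp add: norm_mult)
        then show ?thesis using ls(6)[of t] K1_small by linarith
      qed
      then have "cmod (C' t - 2 * \<i> * C t) / cmod (C t) \<le> (1 / 800) / (99 / 100)"
        using Cn[OF t'] by (intro frac_le) auto
      moreover have "k t - 2 * \<i> = (C' t - 2 * \<i> * C t) / C t" using C0[OF t'] by (simp add: k_def field_simps)
      ultimately have "cmod (k t - 2 * \<i>) \<le> (1 / 800) / (99 / 100)" by (simp only: norm_divide)
      then have "cmod (k t - 2 * \<i>) \<le> 1" by simp
      then show "1 \<le> Im (k t)" using abs_Im_le_cmod[of "k t - 2 * \<i>"] by simp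
    qed
    have ckT: "continuous_on {0..T} k" using T by (intro ck) auto
    have "C T = exp (integral {0..T} k) * C 0"
      by (rule exp_ode[OF _ ckT dCk]) (use T in auto)
    moreover have "C T = C 0" using gT by (simp add: C_def)
    ultimately have "exp (integral {0..T} k) = 1" using C0[of 0] by simp
    then obtain n :: int where n: "Im (integral {0..T} k) = of_int (2 * n) * pi" unfolding exp_eq_1 by blast
    have ik: "k integrable_on {0..T}" by (rule integrable_continuous_real[OF ckT])
    have Im_int: "Im (integral {0..T} k) = integral {0..T} (\<lambda>t. Im (k t))"
      using integral_linear[OF ik bounded_linear_Im] by (simp add: o_def)
    have iI: "(\<lambda>t. Im (k t)) integrable_on {0..T}" by (intro integrable_continuous_real continuous_intros ckT)
    have "integral {0..T} (\<lambda>t. Im (k t)) \<le> integral {0..T} (\<lambda>t. 2)"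
      by (rule Henstock_Kurzweil_Integration.integral_le[OF iI]) (auto intro: Imk)
    moreover have "integral {0..T} (\<lambda>t. 1::real) \<le> integral {0..T} (\<lambda>t. Im (k t))"
      by (rule Henstock_Kurzweil_Integration.integral_le[OF _ iI]) (auto intro: Imk)
    ultimately have "T \<le> of_int (2 * n) * pi" "of_int (2 * n) * pi \<le> 2 * T"
      using T n Im_int by auto
    then have "0 < of_int n * (2 * pi)" "of_int n * (2 * pi) < 1 * (2 * pi)" using T by linarith+
    then have "0 < real_of_int n" "real_of_int n < 1" by (auto simp: zero_less_mult_iff)
    then show False by simp
  next
    case False
    then have ss: "sqrt s \<le> del0 * l"
      using del0 l0 by (intro real_le_lsqrt) (auto simp: power_mult_distrib)
    \<comment> \<open>On the axis of the dent \<xi> equals \<tau>; closeness to that axis at the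
      times 0 and \<pi> / 2 therefore pins \<xi> near \<tau> at both.\<close>
    define \<xi> where "\<xi> t = Y t / C t" for t
    have xi: "cmod (\<xi> t - \<tau>) \<le> 4 * del0 * l" if t: "t = 0 \<or> t = pi / 2" for t
    proof -
      have t': "0 \<le> t" "t \<le> pi" using t pi_gt_zero by (elim disjE; linarith)+
      have "(cmod (Y t - \<tau> * C t))\<^sup>2 \<le> N\<^sup>2 * s"
        using perp_le[of "\<gamma> t"] t unfolding Y_def C_def by (elim disjE) (simp_all only: s0(1)[symmetric] s0(2)[symmetric])
      also have "\<dots> \<le> 2\<^sup>2 * (del0 * l)\<^sup>2"
      proof (intro mult_mono power_mono)
        show "N \<le> 2" using N \<tau> by linarith
        show "s \<le> (del0 * l)\<^sup>2" using False by (simp add: power_mult_distrib)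
      qed (use N sge in auto)
      finally have "(cmod (Y t - \<tau> * C t))\<^sup>2 \<le> (2 * (del0 * l))\<^sup>2" by (simp add: power_mult_distrib)
      then have 1: "cmod (Y t - \<tau> * C t) \<le> 2 * (del0 * l)"
        by (rule power2_le_imp_le) (use del0 l0 in auto)
      have "\<xi> t - \<tau> = (Y t - \<tau> * C t) / C t" using C0[OF t'] by (simp add: \<xi>_def field_simps)
      then have "cmod (\<xi> t - \<tau>) = cmod (Y t - \<tau> * C t) / cmod (C t)" by (simp add: norm_divide)
      also have "\<dots> \<le> 2 * (del0 * l) / (1 / 2)" using 1 Cn[OF t'] del0 l0 by (intro frac_le) auto
      finally show ?thesis by simp
    qed
    define w where "w t = \<i> * (B t * (1 / C t) + E t)" for t
    have cU: "continuous_on {0..pi / 2} (\<lambda>t. U (\<gamma> t))"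
      by (rule continuous_on_compose2[OF continuous_U cg]) (use ls(4) in auto)
    have cw: "continuous_on {0..pi / 2} w"
    proof -
      have "continuous_on {0..pi / 2} (\<lambda>t. b1 pp (\<gamma> t))" "continuous_on {0..pi / 2} (\<lambda>t. b2 pp l (\<gamma> t))"
        unfolding b1_def b2_def hsq_def using ls(4) l0 by (intro continuous_intros cg; auto)+
      note ce = continuous_on_compose2[OF continuous_eta(1) this(1)] continuous_on_compose2[OF continuous_eta(1) this(2)]
        continuous_on_compose2[OF continuous_eta(2) this(1)] continuous_on_compose2[OF continuous_eta(2) this(2)]
      have "U (\<gamma> t) \<noteq> 0" for t using U_pos[of "\<gamma> t"] by simp
      then show ?thesis
        unfolding w_def B_def E_def bump_p_def bump_h_def using ls(4) l0 C0
        by (intro continuous_intros ce cU cC cg; auto)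
    qed
    have dxi: "(\<xi> has_vector_derivative w t * \<xi> t) (at t)" if t: "t \<in> {0..pi / 2}" for t
    proof -
      have t': "0 \<le> t" "t \<le> pi / 2" "C t \<noteq> 0" using t C0 by auto
      have "(\<xi> has_vector_derivative (Y' t * C t - Y t * C' t) / (C t * C t)) (at t)"
      proof -
        have "((\<lambda>t. inverse (C t)) has_vector_derivative - (inverse (C t) * C' t * inverse (C t))) (at t)"
          using Deriv.has_derivative_inverse[OF t'(3) dC[of t, unfolded has_vector_derivative_def]]
          unfolding has_vector_derivative_def by (simp add: scaleR_minus_right mult_ac)
        from has_vector_derivative_mult[OF dY[of t] this] show ?thesis
          unfolding \<xi>_def[abs_def] divide_inverse using t'(3) by (simp add: field_simps)
      qed
      also have "(Y' t * C t - Y t * C' t) / (C t * C t) = w t * \<xi> t"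
        unfolding eqC[OF t'(1,2)] eqY[OF t'(1,2)] w_def \<xi>_def using t'(3) by (simp add: field_simps)
      finally show ?thesis .
    qed
    have ex: "\<xi> (pi / 2) = exp (integral {0..pi / 2} w) * \<xi> 0"
      by (rule exp_ode[OF _ cw dxi]) auto
    have Imw: "Im (w t) = B t * (Re (C t) / (cmod (C t))\<^sup>2) + E t" for t
      using ImC[of "E t" "B t" t] unfolding w_def by (simp add: add.commute)
    have Bnn: "0 \<le> B t * (Re (C t) / (cmod (C t))\<^sup>2)" for t
    proof -
      have "B t * (Re (C t) / (cmod (C t))\<^sup>2) = (1 / U (\<gamma> t)) * l\<^sup>2 * (bump_p pp l (\<gamma> t) * Re (C t)) / (cmod (C t))\<^sup>2"
        by (simp add: B_def)
      then show ?thesis using bp0(3)[of t] U_pos[of "\<gamma> t"] by simp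
    qed
    have Enn: "0 \<le> E t" for t unfolding E_def using bp0(2)[of t] U_pos[of "\<gamma> t"] by simp
    have Eeq: "E t = 2 * (eta (b1 pp (\<gamma> t)) * eta' (b2 pp l (\<gamma> t))) / (U (\<gamma> t))\<^sup>2" for t
      unfolding E_def bump_h_def ls(1) using l0 by (simp add: power2_eq_square)
    \<comment> \<open>This bounds the total angle over [0, \<pi> / 2] by 3 \<pi> / 2, so that the
      rotation cannot return to the identity by completing a turn.\<close>
    have Imw_up: "Im (w t) \<le> 3" if t: "t \<in> {0..pi / 2}" for t
    proof -
      have tt: "0 \<le> t" "t \<le> pi / 2" "t \<le> pi" using t by auto
      have U1: "1 \<le> U (\<gamma> t)" using UK tt by simp
      then have iU: "1 / U (\<gamma> t) \<le> 1" "0 \<le> 1 / U (\<gamma> t)" by auto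
      have "bump_p pp l (\<gamma> t) \<le> 3 / 2"
      proof -
        have "eta' (b1 pp (\<gamma> t)) * eta (b2 pp l (\<gamma> t)) \<le> 1 * 1" by (intro mult_mono eta_props) auto
        then have "bump_p pp l (\<gamma> t) \<le> 1 / norm (\<gamma> t)" unfolding bump_p_def by (intro divide_right_mono) auto
        also have "\<dots> \<le> 1 / (2 / 3)" using ls(2)[of t] by (intro divide_left_mono) auto
        finally show ?thesis by simp
      qed
      moreover have "l\<^sup>2 \<le> 1 / 10" using l0 l_small mult_mono[of l "1 / 1000" l 1] by (simp add: power2_eq_square)
      ultimately have "l\<^sup>2 * bump_p pp l (\<gamma> t) \<le> 1 / 10 * (3 / 2)" using bp0(1)[of t] by (intro mult_mono) auto
      then have "(1 / U (\<gamma> t)) * (l\<^sup>2 * bump_p pp l (\<gamma> t)) \<le> 1 * (1 / 10 * (3 / 2))"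
        by (rule mult_mono[OF iU(1)]) (use bp0(1)[of t] in auto)
      then have "B t \<le> 1 * (1 / 10 * (3 / 2))" unfolding B_def .
      then have B1: "B t \<le> 1 / 2" "0 \<le> B t" using iU(2) bp0(1)[of t] by (linarith, simp add: B_def)
      have "Re (C t) / (cmod (C t))\<^sup>2 \<le> cmod (C t) / (cmod (C t))\<^sup>2" by (intro divide_right_mono complex_Re_le_cmod) simp
      also have "\<dots> = 1 / cmod (C t)" by (simp add: power2_eq_square)
      also have "\<dots> \<le> 1 / (99 / 100)" using Cn[of t] tt by (intro divide_left_mono) auto
      finally have R1: "Re (C t) / (cmod (C t))\<^sup>2 \<le> 2" by (rule order_trans) simp
      have "B t * (Re (C t) / (cmod (C t))\<^sup>2) \<le> B t * 2" using R1 B1 by (intro mult_left_mono) auto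
      then have P1: "B t * (Re (C t) / (cmod (C t))\<^sup>2) \<le> 1" using B1 by linarith
      have E1: "E t \<le> 2"
      proof -
        have "eta (b1 pp (\<gamma> t)) * eta' (b2 pp l (\<gamma> t)) \<le> 1 * 1" by (intro mult_mono eta_props) auto
        moreover have "1 \<le> (U (\<gamma> t))\<^sup>2" using U1 by simp
        ultimately have "2 * (eta (b1 pp (\<gamma> t)) * eta' (b2 pp l (\<gamma> t))) / (U (\<gamma> t))\<^sup>2 \<le> 2 / 1"
          using eta_props by (intro frac_le) auto
        then show ?thesis unfolding Eeq by simp
      qed
      show ?thesis unfolding Imw using P1 E1 by simp
    qed
    \<comment> \<open>In the middle of the passage \<open>b1\<close> \<ge> 1/4 contributes exp (- 4)
      through \<open>eta\<close>, \<open>b2\<close> \<ge> 1/2 contributes exp (- 2) through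
      \<open>eta'\<close>, and the square of U is at most 4.\<close>
    have Imw_low: "exp (- 6) / 2 \<le> Im (w t)" if t: "t \<in> {pi / 8..3 * pi / 8}" for t
    proof -
      have tt: "0 \<le> t" "t \<le> pi / 2" "t \<le> pi" "t \<in> {0..pi / 2}" using t by auto
      have U1: "1 \<le> U (\<gamma> t)" using UK tt by simp
      have "sin (pi / 4) \<le> sin (2 * t)"
      proof (cases "2 * t \<le> pi / 2")
        case True
        then show ?thesis using t by (intro sin_monotone_2pi_le) auto
      next
        case False
        have "sin (pi / 4) \<le> sin (pi - 2 * t)" using t False by (intro sin_monotone_2pi_le) auto
        then show ?thesis by simp
      qed
      moreover have "7 / 10 \<le> sin (pi / 4)"
        unfolding sin_45 using real_le_rsqrt[of "14 / 10" 2] by (simp add: power2_eq_square)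
      ultimately have ReC1: "69 / 100 \<le> Re (C t)" using ReC[OF tt(1,3)] by linarith
      have "(1 + M) * l \<le> 2 / 100" using l_small by (simp add: distrib_right)
      then have "norm (\<gamma> t) \<le> 102 / 100" using ls(7)[of t] by linarith
      then have "(69 / 100) / (102 / 100) \<le> Re (C t) / norm (\<gamma> t)" using ReC1 ls(4)[of t] by (intro frac_le) auto
      then have b1: "1 / 4 \<le> b1 pp (\<gamma> t)" by (simp add: b1_def inner_pp C_def)
      have "exp (- 4) \<le> eta (b1 pp (\<gamma> t))"
      proof -
        have "1 / b1 pp (\<gamma> t) \<le> 1 / (1 / 4)" using b1 by (intro divide_left_mono) auto
        then show ?thesis using b1 by (simp add: eta_def)
      qed
      moreover have "exp (- 2) \<le> eta' (b2 pp l (\<gamma> t))"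
      proof -
        define b where "b = b2 pp l (\<gamma> t)"
        have n2: "1 \<le> (norm (\<gamma> t))\<^sup>2" unfolding ls(1) by (rule U1)
        define s1 where "s1 = (norm (\<gamma> t))\<^sup>2 - hsq pp (\<gamma> t)"
        \<comment> \<open>The distance from the axis of \<open>pp\<close> is conserved on this half.
          At time 0 it is at most (1/64 + 1/2) l, the distance from the axis of the dent plus the
          tilt, so the orbit is well inside the outer tube.\<close>
        have s1: "s1 \<le> (sqrt s + \<tau> * norm (\<gamma> 0))\<^sup>2"
          using consK[OF tt(4), of 0] perp_pp_le[of "\<gamma> 0"] pi_gt_zero unfolding s1_def s0(1) hsq_pp by simp
        also have "\<dots> \<le> (1 / 64 * l + l / 2 * 1)\<^sup>2"
        proof (intro power_mono add_mono)
          have "del0 * l \<le> 1 / 64 * l" using del0 l0 by (intro mult_right_mono) auto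
          then show "sqrt s \<le> 1 / 64 * l" using ss by linarith
          show "\<tau> * norm (\<gamma> 0) \<le> l / 2 * 1" by (simp add: \<tau>_def n1)
        qed (use sge \<tau> in auto)
        also have "\<dots> = (33 / 64)\<^sup>2 * l\<^sup>2" by (simp add: power2_eq_square field_simps)
        also have "\<dots> \<le> 1 / 2 * l\<^sup>2" by (intro mult_right_mono) (auto simp: power2_eq_square)
        finally have s2: "s1 \<le> 1 / 2 * l\<^sup>2" .
        have s3: "0 \<le> s1" unfolding s1_def using hsq_le[OF norm_pp, of "\<gamma> t"] by simp
        have "1 - hsq pp (\<gamma> t) / (norm (\<gamma> t))\<^sup>2 = s1 / (norm (\<gamma> t))\<^sup>2"
          using ls(4)[of t] unfolding s1_def by (simp add: diff_divide_distrib)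
        then have beq: "b = 1 - s1 / (norm (\<gamma> t))\<^sup>2 / l\<^sup>2" by (simp add: b_def b2_def)
        have "s1 / (norm (\<gamma> t))\<^sup>2 \<le> s1 / 1" using s3 n2 by (intro divide_left_mono) auto
        then have "s1 / (norm (\<gamma> t))\<^sup>2 / l\<^sup>2 \<le> (1 / 2 * l\<^sup>2) / l\<^sup>2" using s2 by (intro divide_right_mono) (linarith, simp)
        then have bl: "1 / 2 \<le> b" unfolding beq using l0 by simp
        have bu: "b \<le> 1" unfolding beq using s3 by simp
        have "1 / b \<le> 1 / (1 / 2)" using bl by (intro divide_left_mono) auto
        then have e2: "exp (- 2) \<le> exp (- 1 / b)" by simp
        have "b\<^sup>2 \<le> 1" using bl bu by (simp add: power_le_one)
        then have "exp (- 1 / b) / 1 \<le> exp (- 1 / b) / b\<^sup>2" using bl by (intro divide_left_mono) auto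
        then have "exp (- 2) \<le> exp (- 1 / b) / b\<^sup>2" using e2 by linarith
        then show ?thesis using bl by (simp add: eta'_def flip: b_def)
      qed
      ultimately have "exp (- 4) * exp (- 2) \<le> eta (b1 pp (\<gamma> t)) * eta' (b2 pp l (\<gamma> t))"
        by (intro mult_mono) (auto simp: eta_props)
      then have e6: "exp (- 6) \<le> eta (b1 pp (\<gamma> t)) * eta' (b2 pp l (\<gamma> t))" by (simp flip: exp_add)
      have "(U (\<gamma> t))\<^sup>2 \<le> 2\<^sup>2" using U1 U_bounds(2) by (intro power_mono) auto
      then have "2 * exp (- 6) / 4 \<le> 2 * (eta (b1 pp (\<gamma> t)) * eta' (b2 pp l (\<gamma> t))) / (U (\<gamma> t))\<^sup>2"
        using e6 U1 eta_props by (intro frac_le) auto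
      then have "exp (- 6) / 2 \<le> E t" unfolding Eeq by simp
      then show ?thesis unfolding Imw using Bnn[of t] by linarith
    qed
    have Imw_nn: "0 \<le> Im (w t)" for t unfolding Imw using Bnn[of t] Enn[of t] by simp
    have iw: "w integrable_on {0..pi / 2}" by (rule integrable_continuous_real[OF cw])
    have Im_int: "Im (integral {0..pi / 2} w) = integral {0..pi / 2} (\<lambda>t. Im (w t))"
      using integral_linear[OF iw bounded_linear_Im] by (simp add: o_def)
    have iI: "(\<lambda>t. Im (w t)) integrable_on {0..pi / 2}"
      by (intro integrable_continuous_real continuous_intros cw)
    have iJ: "(\<lambda>t. Im (w t)) integrable_on {pi / 8..3 * pi / 8}"
      by (rule integrable_on_subinterval[OF iI]) auto
    have "integral {0..pi / 2} (\<lambda>t. Im (w t)) \<le> integral {0..pi / 2} (\<lambda>t. 3)"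
      by (rule Henstock_Kurzweil_Integration.integral_le[OF iI]) (auto intro: Imw_up)
    then have up: "Im (integral {0..pi / 2} w) \<le> 3 * pi / 2" unfolding Im_int by simp
    have "integral {pi / 8..3 * pi / 8} (\<lambda>t. exp (- 6) / 2) \<le> integral {pi / 8..3 * pi / 8} (\<lambda>t. Im (w t))"
      by (rule Henstock_Kurzweil_Integration.integral_le[OF _ iJ]) (use Imw_low in auto)
    also have "\<dots> \<le> integral {0..pi / 2} (\<lambda>t. Im (w t))"
      by (rule integral_subset_le[OF _ iJ iI]) (auto intro: Imw_nn)
    finally have "alp0 \<le> Im (integral {0..pi / 2} w)" unfolding Im_int alp0_def by (simp add: field_simps)
    from exp_minus_1_lower[OF this up alp0] have lower: "sin alp0 \<le> cmod (exp (integral {0..pi / 2} w) - 1)" .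
    have sa: "sin alp0 = 64 * del0" by (simp add: del0_def)
    have "\<tau> \<le> cmod (\<xi> 0) + cmod (\<xi> 0 - \<tau>)"
      using norm_triangle_ineq4[of "\<xi> 0" "\<xi> 0 - \<tau>"] \<tau> by simp
    moreover have "4 * del0 * l \<le> 4 * (1 / 64) * l" using del0 l0 by (intro mult_right_mono) auto
    ultimately have x0: "l / 4 \<le> cmod (\<xi> 0)" using xi[OF disjI1[OF refl]] l0 unfolding \<tau>_def by argo
    \<comment> \<open>The rotation displaces \<xi> by at least 16 \<open>del0\<close> l, while both
      ends lie within 4 \<open>del0\<close> l of \<tau>; the denominator 64 in \<open>del0\<close>
      provides this contradiction.\<close>
    have "64 * del0 * (l / 4) \<le> cmod (exp (integral {0..pi / 2} w) - 1) * cmod (\<xi> 0)"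
      using lower x0 del0 l0 unfolding sa by (intro mult_mono) auto
    also have "\<dots> = cmod (\<xi> (pi / 2) - \<xi> 0)" unfolding ex norm_mult[symmetric] by (simp add: algebra_simps)
    also have "\<dots> \<le> cmod (\<xi> (pi / 2) - \<tau>) + cmod (\<xi> 0 - \<tau>)"
      using norm_triangle_ineq4[of "\<xi> (pi / 2) - \<tau>" "\<xi> 0 - \<tau>"] by simp
    also have "\<dots> \<le> 8 * (del0 * l)" using xi[of 0] xi[of "pi / 2"] by simp
    finally show False using del0 l0 by (simp add: mult_le_0_iff)
  qed
qed

end

section \<open>Reduction of all short periodic orbits to the centered ones\<close>

lemma sin_lower_half:
  assumes "0 \<le> x" "x \<le> pi / 2"
  shows "x / 4 \<le> sin x"
proof (cases "x \<le> pi / 3")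
  case True
  show ?thesis
  proof (cases "x = 0")
    case False
    with assms have "0 < x" by simp
    from MVT2[OF this, of sin cos] obtain z where z: "0 < z" "z < x" "sin x - sin 0 = (x - 0) * cos z"
      by (auto intro: DERIV_sin)
    have "cos (pi / 3) \<le> cos z" using z True by (intro cos_monotone_0_pi_le) auto
    then have "x * (1 / 2) \<le> x * cos z" using assms by (intro mult_left_mono) (auto simp: cos_60)
    then show ?thesis using z(3) assms by simp
  qed simp
next
  case False
  have "sin (pi / 6) \<le> sin x" using False assms pi_gt_zero by (intro sin_monotone_2pi_le) auto
  then show ?thesis using assms pi_less_4 by (simp add: sin_30)
qed

lemma cmod_cis_minus_1: "cmod (cis (2 * x) - 1) = 2 * \<bar>sin x\<bar>"
proof -
  have "cis (2 * x) - 1 = 2 * \<i> * of_real (sin x) * cis x"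
    by (simp add: complex_eq_iff sin_double cos_double_sin power2_eq_square)
  then show ?thesis by (simp add: norm_mult)
qed

context tube
begin

text \<open>An active bump bounds the distance of z from the complex line of \<open>w\<close>, and
  the level set is within order l of the unit sphere; normalizing the projection to that line gives
  a nearby point of the Hopf circle.\<close>

lemma near_pp_of_active:
  assumes F1: "F z = 1" and w: "norm w = 1" and act: "0 < b2 w \<rho> z" and \<rho>: "0 < \<rho>" "\<rho> \<le> l"
  obtains a where "cmod a = 1" "norm (z - a *s w) \<le> (4 + M) * l"
proof -
  note ls = level_set[OF F1]
  define c where "c = Complex (z \<bullet> w) (z \<bullet> (\<i> *s w))"
  have hp: "hproj w z = c *s w" unfolding c_def Complex_scale hproj_def ..
  have cn: "(cmod c)\<^sup>2 = hsq w z" by (simp add: c_def cmod_power2 hsq_def)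
  have n: "0 < norm z" using ls(4) by simp
  have h: "(norm (z - c *s w))\<^sup>2 = (norm z)\<^sup>2 - hsq w z" using hsq_perp[OF w, of z] by (simp add: hp)
  have "1 - hsq w z / (norm z)\<^sup>2 < \<rho>\<^sup>2" using act \<rho> by (simp add: b2_def field_simps)
  then have "(1 - hsq w z / (norm z)\<^sup>2) * (norm z)\<^sup>2 \<le> \<rho>\<^sup>2 * (norm z)\<^sup>2" by (intro mult_right_mono) auto
  then have "(norm z)\<^sup>2 - hsq w z \<le> \<rho>\<^sup>2 * (norm z)\<^sup>2" using n by (simp add: left_diff_distrib)
  also have "\<dots> \<le> l\<^sup>2 * (3 / 2)\<^sup>2" using ls(3) \<rho> n by (intro mult_mono power_mono) auto
  finally have "(norm (z - c *s w))\<^sup>2 \<le> (3 / 2 * l)\<^sup>2" unfolding h power_mult_distrib by (simp only: mult.commute)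
  then have d1: "norm (z - c *s w) \<le> 3 / 2 * l" by (rule power2_le_imp_le) (use l0 in simp)
  have "\<bar>norm z - cmod c\<bar> \<le> norm (z - c *s w)"
    using norm_triangle_ineq3[of z "c *s w"] w by (simp add: norm_cscale)
  then have d2: "\<bar>cmod c - 1\<bar> \<le> 3 / 2 * l + (1 + M) * l" using ls(7) d1 by linarith
  have "(1 + M) * l \<le> 2 / 100" using l_small by (simp add: distrib_right)
  then have c0: "c \<noteq> 0" using d2 l_small by auto
  define a where "a = c / cmod c"
  have a1: "cmod a = 1" using c0 by (simp add: a_def norm_divide)
  have ca: "c = of_real (cmod c) * a" using c0 by (simp add: a_def)
  have "norm (c *s w - a *s w) = \<bar>cmod c - 1\<bar>"
  proof -
    have "c *s w - a *s w = (of_real (cmod c - 1) * a) *s w"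
      by (subst ca) (simp add: vec_eq_iff left_diff_distrib)
    then show ?thesis by (simp only: norm_cscale norm_mult a1 w norm_of_real mult_1_right)
  qed
  then have "norm (z - a *s w) \<le> 3 / 2 * l + (3 / 2 * l + (1 + M) * l)"
    using norm_triangle_ineq[of "z - c *s w" "c *s w - a *s w"] d1 d2 by simp
  also have "\<dots> = (4 + M) * l" by (simp add: distrib_right)
  finally show thesis using that a1 by blast
qed

lemma qq_near: "norm (qq + pp) \<le> l"
proof -
  have "qq + pp = (1 - 1 / N) *\<^sub>R axis k1 1 - (\<tau> / N) *\<^sub>R axis k2 1"
    by (simp add: qq_def pp_def algebra_simps)
  then have "norm (qq + pp) \<le> norm ((1 - 1 / N) *\<^sub>R (axis k1 1 :: complex ^ 'n)) + norm ((\<tau> / N) *\<^sub>R (axis k2 1 :: complex ^ 'n))"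
    by (metis norm_triangle_ineq4)
  also have "\<dots> = (1 - 1 / N) + \<tau> / N"
    using N \<tau> by (simp add: norm_eq_sqrt_inner[of "axis _ _"] inner_axis_axis)
  also have "\<dots> \<le> \<tau> + \<tau>"
  proof (intro add_mono)
    have "1 \<le> N * N" using N(1) mult_mono[of 1 N 1 N] by simp
    have "1 - 1 / N = (N - 1) / N" using N(1) by (simp add: field_simps)
    also have "\<dots> \<le> (N - 1) / 1" using N(1) by (intro divide_left_mono) auto
    finally show "1 - 1 / N \<le> \<tau>" using N(3) by simp
    have "\<tau> / N \<le> \<tau> / 1" using N(1) \<tau> by (intro divide_left_mono) auto
    then show "\<tau> / N \<le> \<tau>" by simp
  qed
  finally show ?thesis by (simp add: \<tau>_def)
qed

text \<open>Comparison with the Hopf flow excludes periods up to \<pi> / 2, and an orbit that stays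
  away from the circle of \<open>pp\<close> is itself a Hopf orbit. What is left is shifted in time
  into the position of \<open>no_short_orbit_centered\<close>.\<close>

lemma period_ge_pi:
  assumes orb: "orbit \<gamma>" and T: "0 < T" and per: "\<And>t. \<gamma> (t + T) = \<gamma> t"
  shows "pi \<le> T"
proof (rule ccontr)
  assume "\<not> pi \<le> T"
  then have Tpi: "T < pi" by simp
  have d: "(\<gamma> has_vector_derivative \<i> *s gF (\<gamma> t)) (at t)" and F1: "F (\<gamma> t) = 1" for t
    using orb unfolding orbit_def by auto
  note ls = level_set[OF F1]
  have gT: "\<gamma> T = \<gamma> 0" using per[of 0] by simp
  have sT: "0 < sin T" using T Tpi by (intro sin_gt_zero) auto
  \<comment> \<open>In time T the Hopf flow displaces the starting point by 2 sin T times its norm,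
    which is at least 2/3; on a periodic orbit the drift, at most \<open>B\<close> T, has to make up
    for this.\<close>
  have ret: "4 / 3 * sin T \<le> B * T" if "\<And>t. norm (gF (\<gamma> t) - 2 *\<^sub>R \<gamma> t) \<le> B" for B
  proof -
    have "\<gamma> 0 - cis (2 * T) *s \<gamma> 0 = - ((cis (2 * T) - 1) *s \<gamma> 0)" by (simp add: vec_eq_iff left_diff_distrib)
    then have "norm (\<gamma> T - cis (2 * (T - 0)) *s \<gamma> 0) = 2 * sin T * norm (\<gamma> 0)"
      using sT unfolding gT by (simp only: diff_zero norm_minus_cancel norm_cscale cmod_cis_minus_1 abs_of_pos)
    moreover have "2 * sin T * (2 / 3) \<le> 2 * sin T * norm (\<gamma> 0)" using ls(2)[of 0] sT by (intro mult_left_mono) auto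
    ultimately show ?thesis using orbit_near_hopf[OF orb that, of T 0] T by simp
  qed
  have Tlow: "pi / 2 < T"
  proof (rule ccontr)
    assume "\<not> pi / 2 < T"
    then have "T / 4 \<le> sin T" using T by (intro sin_lower_half) auto
    moreover have "4 / 3 * sin T \<le> (K1 * l) * T" by (rule ret) (rule ls(6))
    moreover have "(K1 * l) * T \<le> 1 / 800 * T" using K1_small T by (intro mult_right_mono) auto
    ultimately show False using T by argo
  qed
  have ex: "\<exists>t a. cmod a = 1 \<and> norm (\<gamma> t - a *s pp) \<le> (5 + M) * l"
  proof (rule ccontr)
    assume none: "\<not> ?thesis"
    have pin: "b2 pp l (\<gamma> t) \<le> 0" for t
    proof (rule ccontr)
      assume "\<not> ?thesis"
      then obtain a where "cmod a = 1" "norm (\<gamma> t - a *s pp) \<le> (4 + M) * l"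
        using near_pp_of_active[OF F1 norm_pp, of l t] l0 by auto
      moreover have "(4 + M) * l \<le> (5 + M) * l" using l0 by (intro mult_right_mono) auto
      ultimately show False using none order_trans by blast
    qed
    have qin: "b2 qq (del0 * l) (\<gamma> t) \<le> 0" for t
    proof (rule ccontr)
      assume nq: "\<not> ?thesis"
      have "del0 * l \<le> 1 * l" using del0 l0 by (intro mult_right_mono) auto
      then obtain a where a: "cmod a = 1" "norm (\<gamma> t - a *s qq) \<le> (4 + M) * l"
        using near_pp_of_active[OF F1 norm_qq, of "del0 * l" t] l0 del0 nq by auto
      have "norm (a *s (qq + pp)) \<le> l" using qq_near a(1) unfolding norm_cscale by simp
      moreover have "\<gamma> t - (- a) *s pp = (\<gamma> t - a *s qq) + a *s (qq + pp)" by (simp add: vec_eq_iff distrib_left)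
      ultimately have "norm (\<gamma> t - (- a) *s pp) \<le> (4 + M) * l + l"
        using norm_triangle_ineq[of "\<gamma> t - a *s qq" "a *s (qq + pp)"] a(2) by simp
      also have "\<dots> = (5 + M) * l" by (simp add: distrib_right)
      finally show False using none a(1) norm_minus_cancel[of a] by metis
    qed
    have "gF (\<gamma> t) = 2 *\<^sub>R \<gamma> t" for t
      using bump_inactive[OF disjI2[OF pin[of t]]] bump_inactive[OF disjI2[OF qin[of t]]]
      by (simp add: ls(5) U_def gU_def)
    then have "4 / 3 * sin T \<le> 0 * T" by (intro ret) simp
    then show False using sT by simp
  qed
  then obtain t0 a where a: "cmod a = 1" and na: "norm (\<gamma> t0 - a *s pp) \<le> (5 + M) * l" by blast
  \<comment> \<open>The shifted orbit starts near - i \<open>pp\<close>, which is the phase for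
    which the real part of the coordinate along \<open>pp\<close> follows sin (2 t).\<close>
  define t1 where "t1 = t0 - pi / 4 - Arg a / 2"
  have acis: "a = cis (Arg a)" using a cis_Arg[of a] by (cases "a = 0") (auto simp: sgn_div_norm)
  have "orbit (\<lambda>t. \<gamma> (t + t1))"
    unfolding orbit_def
  proof (intro conjI allI)
    fix t
    have "((\<lambda>t. t + t1) has_vector_derivative 1) (at t)"
      by (auto intro!: derivative_eq_intros simp: has_vector_derivative_def)
    from vector_diff_chain_at[OF this d] show "((\<lambda>t. \<gamma> (t + t1)) has_vector_derivative \<i> *s gF (\<gamma> (t + t1))) (at t)"
      by (simp add: o_def)
  qed (rule F1)
  then show False
  proof (rule no_short_orbit_centered[OF _ Tlow Tpi])
    fix t
    show "\<gamma> (t + T + t1) = \<gamma> (t + t1)" using per[of "t + t1"] by (simp add: add_ac)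
    assume t: "0 \<le> t" "t \<le> pi"
    have "cis (2 * (t + t1 - t0)) * a = cis (2 * t - pi / 2)"
      by (subst acis) (simp add: cis_mult t1_def algebra_simps)
    also have "\<dots> = - \<i> * cis (2 * t)" by (simp add: complex_eq_iff cos_diff sin_diff)
    finally have "\<gamma> (t + t1) - (- \<i> * cis (2 * t)) *s pp =
        (\<gamma> (t + t1) - cis (2 * (t + t1 - t0)) *s \<gamma> t0) + cis (2 * (t + t1 - t0)) *s (\<gamma> t0 - a *s pp)"
      by (simp add: vec_eq_iff algebra_simps flip: mult.assoc)
    then have "norm (\<gamma> (t + t1) - (- \<i> * cis (2 * t)) *s pp) \<le>
        norm (\<gamma> (t + t1) - cis (2 * (t + t1 - t0)) *s \<gamma> t0) + norm (\<gamma> t0 - a *s pp)"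
      using norm_triangle_ineq[of "\<gamma> (t + t1) - cis (2 * (t + t1 - t0)) *s \<gamma> t0" "cis (2 * (t + t1 - t0)) *s (\<gamma> t0 - a *s pp)"]
      by (simp only: norm_cscale norm_cis mult_1_left)
    also have "\<dots> \<le> K1 * l * 8 + (5 + M) * l"
    proof (intro add_mono na)
      \<comment> \<open>Here t is at most \<pi> and the shift at most 3 \<pi> / 4; the crude bound 8
        is the factor of the first term of \<open>Kbig\<close>.\<close>
      have "\<bar>t + t1 - t0\<bar> \<le> 8"
        using t Arg_bounded[of a] pi_less_4 pi_gt_zero unfolding t1_def by (simp add: abs_le_iff field_simps)
      then have "K1 * l * \<bar>t + t1 - t0\<bar> \<le> K1 * l * 8" using K1_pos l0 by (intro mult_left_mono) auto
      then show "norm (\<gamma> (t + t1) - cis (2 * (t + t1 - t0)) *s \<gamma> t0) \<le> K1 * l * 8"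
        using orbit_near_hopf[OF orb ls(6), of "t + t1" t0] by linarith
    qed
    also have "\<dots> = Kbig M * l" by (simp add: Kbig_def K1_def K0_def algebra_simps)
    finally show "norm (\<gamma> (t + t1) - (- \<i> * cis (2 * t)) *s pp) \<le> 1 / 100" using small by linarith
  qed
qed

end

section \<open>Closed characteristics\<close>

lemma Ck_on_bounded_linear:
  assumes L: "bounded_linear L" and U: "open U"
  shows "Ck_on k f U \<Longrightarrow> Ck_on k (\<lambda>x. L (f x)) U"
proof (induction k arbitrary: f)
  case 0
  then show ?case using bounded_linear.continuous_on[OF L] by simp
next
  case (Suc k)
  show ?case
    by (rule Ck_on_SucI[OF U bounded_linear.has_derivative[OF L Ck_on_SucD(1)[OF U Suc.prems]]])
      (auto intro: Suc.IH[OF Ck_on_SucD(2)[OF U Suc.prems]])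
qed

lemma Ck_on_inner:
  fixes f g :: "'a::euclidean_space \<Rightarrow> 'b::euclidean_space"
  assumes U: "open U" and f: "Ck_on k f U" and g: "Ck_on k g U"
  shows "Ck_on k (\<lambda>x. f x \<bullet> g x) U"
  unfolding euclidean_inner[of "f _" "g _"]
  by (intro Ck_on_sum Ck_on_mult U Ck_on_bounded_linear[OF bounded_linear_inner_left U] f g)

lemma Ck_on_norm:
  fixes f :: "'a::euclidean_space \<Rightarrow> 'b::euclidean_space"
  assumes U: "open U" and f: "Ck_on k f U" and 0: "\<And>x. x \<in> U \<Longrightarrow> f x \<noteq> 0"
  shows "Ck_on k (\<lambda>x. norm (f x)) U"
  unfolding norm_eq_sqrt_inner using 0 by (intro Ck_on_sqrt U Ck_on_inner f) auto

text \<open>Axis and radius may vary with the point because the family has to be smooth in l and z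
  jointly.\<close>

lemma Ck_on_bump:
  fixes p z :: "'a::euclidean_space \<Rightarrow> complex ^ 'n::finite" and \<rho> :: "'a \<Rightarrow> real"
  assumes U: "open U" and C: "Ck_on k p U" "Ck_on k \<rho> U" "Ck_on k z U"
    and 0: "\<And>x. x \<in> U \<Longrightarrow> 0 < \<rho> x" "\<And>x. x \<in> U \<Longrightarrow> z x \<noteq> 0"
  shows "Ck_on k (\<lambda>x. bump (p x) (\<rho> x) (z x)) U"
  unfolding bump_def b1_def b2_def hsq_def
  using 0(2) less_imp_neq[OF 0(1), symmetric] by (intro Ck_on_mult Ck_on_eta Ck_on_diff Ck_on_add Ck_on_divide Ck_on_power Ck_on_inner Ck_on_norm Ck_on_const
      Ck_on_bounded_linear[OF bounded_linear_iscale U] C U) auto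

lemma (in bumps) Ck_on_F:
  fixes z :: "'a::euclidean_space \<Rightarrow> complex ^ 'n"
  assumes W: "open W" and z: "Ck_on k z W" and 0: "\<And>x. x \<in> W \<Longrightarrow> z x \<noteq> 0"
  shows "Ck_on k (\<lambda>x. U (z x)) W" "Ck_on k (\<lambda>x. F (z x)) W"
proof -
  show 1: "Ck_on k (\<lambda>x. U (z x)) W"
    unfolding U_def using l \<delta> 0 by (intro Ck_on_diff Ck_on_add Ck_on_mult Ck_on_const Ck_on_bump W z) auto
  show "Ck_on k (\<lambda>x. F (z x)) W"
    unfolding F_def using 0 U_pos by (intro Ck_on_divide 1 Ck_on_power Ck_on_norm W z)
qed

lemma smooth_on_openI: "open S \<Longrightarrow> (\<And>k. Ck_on k f S) \<Longrightarrow> smooth_on f S"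
  unfolding smooth_on_def by blast

lemma antiderivative_real:
  fixes c :: "real \<Rightarrow> real"
  assumes c: "continuous_on UNIV c"
  obtains S where "S 0 = 0" "\<And>t. (S has_real_derivative c t) (at t)"
proof -
  \<comment> \<open>An integral over an interval with reversed end points is 0, so for t \<noteq> 0
    just one of the two terms counts.\<close>
  define S where "S t = integral {0..t} c - integral {t..0} c" for t
  have "(S has_real_derivative c t) (at t)" for t
  proof -
  define n where "n = \<bar>t\<bar> + 1"
  have i: "c integrable_on {a..b}" for a b
    by (rule integrable_continuous_real[OF continuous_on_subset[OF c subset_UNIV]])
  have S: "S s = integral {-n..s} c - integral {-n..0} c" if "s \<in> {-n<..<n}" for s
  proof (cases "0 \<le> s")
    case True
    have "integral {-n..0} c + integral {0..s} c = integral {-n..s} c"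
      by (rule Henstock_Kurzweil_Integration.integral_combine[OF _ True i]) (simp add: n_def)
    moreover have "integral {s..0} c = 0" using True by (cases "s = 0") auto
    ultimately show ?thesis by (simp add: S_def)
  next
    case False
    then have "integral {-n..s} c + integral {s..0} c = integral {-n..0} c"
      using that by (intro Henstock_Kurzweil_Integration.integral_combine i) auto
    then show ?thesis using False by (simp add: S_def)
  qed
  have t: "t \<in> {-n<..<n}" by (auto simp: n_def)
  have "((\<lambda>s. integral {-n..s} c) has_real_derivative c t) (at t within {-n..n})"
    using t by (intro integral_has_real_derivative continuous_on_subset[OF c]) auto
  then have "((\<lambda>s. integral {-n..s} c) has_real_derivative c t) (at t)"
    using t at_within_Icc_at[of "-n" t n] by simp
  then have "((\<lambda>s. integral {-n..s} c - integral {-n..0} c) has_real_derivative c t - 0) (at t)"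
    by (intro DERIV_diff DERIV_const)
  then show "(S has_real_derivative c t) (at t)"
    using S[symmetric] t by (auto intro: has_field_derivative_transform_within_open[OF _ open_greaterThanLessThan[of "-n" n]])
  qed
  then show thesis using that[of S] by (simp add: S_def)
qed

text \<open>Smoothness is asked along curves avoiding the origin, which is the form in which tangent
  vectors of the level set are constructed.\<close>

locale smooth_hamiltonian =
  fixes F :: "complex ^ 'n::finite \<Rightarrow> real" and gF
  assumes hF: "hom_hamiltonian F gF"
    and smF: "\<And>k c W. open W \<Longrightarrow> Ck_on k c W \<Longrightarrow> (\<And>s. s \<in> W \<Longrightarrow> c s \<noteq> 0) \<Longrightarrow> Ck_on k (\<lambda>s::real. F (c s)) W"
begin

lemma derF: "(F has_derivative (\<lambda>v. gF z \<bullet> v)) (at z)"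
  and homF: "0 < c \<Longrightarrow> F (c *\<^sub>R z) = c\<^sup>2 * F z"
  and F0: "F 0 = 0" and posF: "z \<noteq> 0 \<Longrightarrow> 0 < F z"
  using hF unfolding hom_hamiltonian_def by auto

lemma contF: "continuous_on S F"
  using derF has_derivative_continuous by (blast intro: continuous_at_imp_continuous_on)

lemma euler: "gF z \<bullet> z = 2 * F z"
proof -
  have "((\<lambda>c. c *\<^sub>R z) has_vector_derivative z) (at 1)"
    by (auto intro!: derivative_eq_intros simp: has_vector_derivative_def)
  from has_real_derivative_along[OF derF this] have "((\<lambda>c. F (c *\<^sub>R z)) has_real_derivative gF z \<bullet> z) (at 1)" by simp
  moreover have "((\<lambda>c. F (c *\<^sub>R z)) has_real_derivative 2 * F z) (at 1)"
  proof (rule has_field_derivative_transform_within_open[where S = "{0<..}"])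
    show "((\<lambda>c. c\<^sup>2 * F z) has_real_derivative 2 * F z) (at 1)" by (auto intro!: derivative_eq_intros)
  qed (use homF in auto)
  ultimately show ?thesis by (rule DERIV_unique)
qed

lemma gF_nonzero: "F z = 1 \<Longrightarrow> 0 < gF z \<bullet> gF z"
  using euler[of z] by fastforce

lemma frontier_sublevel: "frontier {z. F z < 1} = {z. F z = 1}"
proof -
  have o: "open {z. F z < 1}" by (intro open_Collect_less continuous_on_const contF)
  have "closure {z. F z < 1} = {z. F z \<le> 1}"
  proof
    show "closure {z. F z < 1} \<subseteq> {z. F z \<le> 1}"
      by (rule closure_minimal) (auto intro: closed_Collect_le contF continuous_on_const)
    show "{z. F z \<le> 1} \<subseteq> closure {z. F z < 1}"
    proof
      fix z assume z: "z \<in> {z. F z \<le> 1}"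
      have "(1 - inverse (real (Suc (Suc n)))) *\<^sub>R z \<in> {z. F z < 1}" for n
      proof -
        have s: "0 < 1 - inverse (real (Suc (Suc n)))" "1 - inverse (real (Suc (Suc n))) < 1"
          by (auto simp: inverse_eq_divide)
        have "x\<^sup>2 * F z < 1" if "0 < x" "x < 1" for x :: real
        proof -
          have "x\<^sup>2 < 1" using power_strict_mono[of x 1 2] that by simp
          moreover have "x\<^sup>2 * F z \<le> x\<^sup>2 * 1" using z by (intro mult_left_mono) auto
          ultimately show ?thesis by linarith
        qed
        from this[OF s]
        show ?thesis using homF[OF s(1)] by simp
      qed
      moreover have "(\<lambda>n. (1 - inverse (real (Suc (Suc n)))) *\<^sub>R z) \<longlonglongrightarrow> (1 - 0) *\<^sub>R z"
        by (intro tendsto_intros LIMSEQ_Suc[OF LIMSEQ_inverse_real_of_nat])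
      ultimately show "z \<in> closure {z. F z < 1}" unfolding closure_sequential
        by (intro exI[of _ "\<lambda>n. (1 - inverse (real (Suc (Suc n)))) *\<^sub>R z"]) auto
    qed
  qed
  then show ?thesis unfolding frontier_def interior_open[OF o] by auto
qed

text \<open>One inclusion differentiates F = 1 along a curve. For the other, the line z + s v is
  projected radially to the level set; the scaling factor has derivative 0 at s = 0 when v is
  orthogonal to the gradient.\<close>

lemma tangent_level:
  assumes z: "F z = 1"
  shows "tangent_space {z. F z = 1} z = {v. gF z \<bullet> v = 0}"
proof
  show "tangent_space {z. F z = 1} z \<subseteq> {v. gF z \<bullet> v = 0}"
  proof
    fix v assume "v \<in> tangent_space {z. F z = 1} z"
    then obtain c e where c: "(0::real) < e" "c ` {-e<..<e} \<subseteq> {z. F z = 1}" "c 0 = z" "(c has_vector_derivative v) (at 0)"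
      unfolding tangent_space_def by blast
    have "((\<lambda>s. F (c s)) has_real_derivative gF z \<bullet> v) (at 0)"
      using has_real_derivative_along[OF derF c(4)] c(3) by simp
    moreover have "((\<lambda>s. F (c s)) has_real_derivative 0) (at 0)"
    proof (rule has_field_derivative_transform_within_open[where S = "{-e<..<e}"])
      show "((\<lambda>s. 1) has_real_derivative 0) (at 0)" by simp
      show "1 = F (c s)" if "s \<in> {-e<..<e}" for s using subsetD[OF c(2) imageI[OF that]] by simp
    qed (use c(1) in auto)
    ultimately show "v \<in> {v. gF z \<bullet> v = 0}" using DERIV_unique by blast
  qed
  show "{v. gF z \<bullet> v = 0} \<subseteq> tangent_space {z. F z = 1} z"
  proof
    fix v assume "v \<in> {v. gF z \<bullet> v = 0}"
    then have v: "gF z \<bullet> v = 0" by simp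
    have z0: "z \<noteq> 0" using z F0 by auto
    define e where "e = norm z / (norm v + 1)"
    have nv: "0 < norm v + 1" using norm_ge_zero[of v] by linarith
    have e: "0 < e" using z0 nv by (simp add: e_def)
    have ne: "z + s *\<^sub>R v \<noteq> 0" if s: "s \<in> {-e<..<e}" for s
    proof
      assume "z + s *\<^sub>R v = 0"
      then have "norm z = \<bar>s\<bar> * norm v" by (metis add_eq_0_iff norm_minus_cancel norm_scaleR)
      also have "\<dots> \<le> \<bar>s\<bar> * (norm v + 1)" by (intro mult_left_mono) auto
      also have "\<dots> < e * (norm v + 1)" using s nv by (intro mult_strict_right_mono) auto
      also have "\<dots> = norm z" using nv by (simp add: e_def)
      finally show False by simp
    qed
    have F: "0 < F (z + s *\<^sub>R v)" if "s \<in> {-e<..<e}" for s using ne[OF that] posF by blast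
    define c where "c s = inverse (sqrt (F (z + s *\<^sub>R v))) *\<^sub>R (z + s *\<^sub>R v)" for s
    have dl: "((\<lambda>s. z + s *\<^sub>R v) has_vector_derivative v) (at 0)"
      by (auto intro!: derivative_eq_intros simp: has_vector_derivative_def)
    show "v \<in> tangent_space {z. F z = 1} z"
      unfolding tangent_space_def mem_Collect_eq
    proof (intro exI conjI)
      show "0 < e" by (rule e)
      have lin: "Ck_on k (\<lambda>s. z + s *\<^sub>R v) {-e<..<e}" for k
        by (intro Ck_on_add Ck_on_const Ck_on_linear bounded_linear_scaleR_left open_greaterThanLessThan)
      show "smooth_on c {-e<..<e}"
      proof (rule smooth_on_openI[OF open_greaterThanLessThan])
        fix k show "Ck_on k c {-e<..<e}"
          unfolding c_def using F ne
          by (intro Ck_on_scaleR Ck_on_inverse Ck_on_sqrt smF lin open_greaterThanLessThan) auto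
      qed
      show "c ` {-e<..<e} \<subseteq> {z. F z = 1}"
      proof (rule image_subsetI)
        fix s assume s: "s \<in> {-e<..<e}"
        show "c s \<in> {z. F z = 1}"
          unfolding mem_Collect_eq c_def using F[OF s] by (subst homF) (auto simp: power_inverse)
      qed
      show "c 0 = z" by (simp add: c_def z)
      have "((\<lambda>s. F (z + s *\<^sub>R v)) has_real_derivative 0) (at 0)"
        using has_real_derivative_along[OF derF dl] v by simp
      from DERIV_inverse'[OF DERIV_chain2[where f = sqrt, OF DERIV_real_sqrt this]] z
      have "((\<lambda>s. inverse (sqrt (F (z + s *\<^sub>R v)))) has_real_derivative 0) (at 0)" by simp
      from has_vector_derivative_scaleR[OF this dl]
      show "(c has_vector_derivative v) (at 0)" unfolding c_def[abs_def] by (simp add: z)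
    qed
  qed
qed

text \<open>With the symplectic form written as (i u) . v, a vector u is characteristic if i u is
  orthogonal to the tangent hyperplane, that is, parallel to the gradient.\<close>

lemma char_line_level:
  assumes z: "F z = 1"
  shows "char_line {z. F z = 1} z = range (\<lambda>c. c *\<^sub>R (\<i> *s gF z))"
proof (intro equalityI subsetI)
  fix u assume "u \<in> char_line {z. F z = 1} z"
  then have u: "(\<i> *s u) \<bullet> v = 0" if "gF z \<bullet> v = 0" for v
    using that unfolding char_line_def tangent_level[OF z] symp_form_inner by blast
  define a where "a = ((\<i> *s u) \<bullet> gF z) / (gF z \<bullet> gF z)"
  define w where "w = \<i> *s u - a *\<^sub>R gF z"
  have gw: "gF z \<bullet> w = 0"
    using gF_nonzero[OF z] by (simp add: w_def a_def inner_diff_right inner_commute)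
  have "w \<bullet> w = 0" using u[OF gw] gw by (simp add: w_def inner_diff_left)
  then have "\<i> *s u = a *\<^sub>R gF z" by (simp add: w_def)
  then have "\<i> *s (\<i> *s u) = \<i> *s (a *\<^sub>R gF z)" by (rule arg_cong)
  then have "u = (- a) *\<^sub>R (\<i> *s gF z)" unfolding iscale_scaleR by simp (metis minus_minus)
  then show "u \<in> range (\<lambda>c. c *\<^sub>R (\<i> *s gF z))" by blast
next
  fix u assume "u \<in> range (\<lambda>c. c *\<^sub>R (\<i> *s gF z))"
  then obtain c where u: "u = c *\<^sub>R (\<i> *s gF z)" by blast
  show "u \<in> char_line {z. F z = 1} z"
    unfolding char_line_def tangent_level[OF z] symp_form_inner u by (simp add: iscale_scaleR)
qed

lemma liouville_ham: "F z = 1 \<Longrightarrow> liouville_form z (c *\<^sub>R (\<i> *s gF z)) = c"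
  unfolding liouville_form_inner using euler[of z] by (simp add: inner_commute)

text \<open>By Euler's identity the Liouville form is 1 on i \<open>gF\<close> over the level set.
  Reparametrizing by the accumulated action \<open>S\<close> therefore turns a closed characteristic
  into a periodic orbit of the flow whose period is the action.\<close>

lemma action_lower:
  assumes KEY: "\<And>\<gamma> T. 0 < T \<Longrightarrow> (\<And>t. (\<gamma> has_vector_derivative \<i> *s gF (\<gamma> t)) (at t)) \<Longrightarrow>
      (\<And>t. \<gamma> (t + T) = \<gamma> t) \<Longrightarrow> (\<And>t. F (\<gamma> t) = 1) \<Longrightarrow> \<tau> \<le> T"
    and cc: "closed_characteristic {z. F z < 1} T \<gamma>"
  shows "\<tau> \<le> action T \<gamma>"
proof -
  have T: "0 < T" and sm: "smooth_on \<gamma> UNIV" and per: "\<gamma> (t + T) = \<gamma> t" and lev: "F (\<gamma> t) = 1" for t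
    using cc unfolding closed_characteristic_def frontier_sublevel by auto
  define g' where "g' t = vector_derivative \<gamma> (at t)" for t
  define c where "c t = liouville_form (\<gamma> t) (g' t)" for t
  have ch: "g' t \<in> char_line {z. F z = 1} (\<gamma> t)" and cpos: "0 < c t" for t
    using cc unfolding closed_characteristic_def frontier_sublevel g'_def c_def by auto
  have g'eq: "g' t = c t *\<^sub>R (\<i> *s gF (\<gamma> t))" for t
    using ch[of t] unfolding char_line_level[OF lev] c_def by (auto simp: liouville_ham[OF lev])
  have dg: "(\<gamma> has_vector_derivative g' t) (at t)" for t
    unfolding g'_def using smooth_on_UNIV_C1(1)[OF sm] by (simp add: vector_derivative_works[symmetric])
  have cg: "continuous_on UNIV \<gamma>"
    using has_vector_derivative_continuous[OF dg] by (meson continuous_at_imp_continuous_on)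
  have cg': "continuous_on UNIV g'"
  proof -
    have "frechet_derivative \<gamma> (at t) 1 = g' t" for t
      using frechet_derivative_at[OF dg[of t, unfolded has_vector_derivative_def], symmetric] by simp
    then show ?thesis using smooth_on_UNIV_C1(2)[OF sm, of 1] by simp
  qed
  have cc: "continuous_on UNIV c"
    unfolding c_def liouville_form_inner
    by (intro continuous_intros bounded_linear.continuous_on[OF bounded_linear_iscale] cg cg') auto
  have perc: "c (t + T) = c t" for t
  proof -
    have "((\<lambda>s. s + T) has_vector_derivative 1) (at t)"
      by (auto intro!: derivative_eq_intros simp: has_vector_derivative_def)
    from vector_diff_chain_at[OF this dg] have "(\<gamma> has_vector_derivative g' (t + T)) (at t)" by (simp add: o_def per)
    then have "g' (t + T) = g' t" using dg[of t] by (rule vector_derivative_unique_at)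
    then show ?thesis by (simp add: c_def per)
  qed
  obtain S where S0: "S 0 = 0" and dS: "\<And>t. (S has_real_derivative c t) (at t)"
    using antiderivative_real[OF cc] by blast
  define P where "P = S T"
  have incr: "S a < S b" if "a < b" for a b
    by (rule DERIV_pos_imp_increasing[OF that]) (use dS cpos in blast)
  have P0: "0 < P" using incr[OF T] S0 by (simp add: P_def)
  have SP: "S (t + T) = S t + P" for t
  proof -
    have "((\<lambda>t. S (t + T) - S t) has_real_derivative c (t + T) * 1 - c t) (at t)" for t
      by (intro DERIV_diff dS DERIV_chain2[where f = S, OF dS]) (auto intro!: derivative_eq_intros)
    then have "((\<lambda>t. S (t + T) - S t) has_real_derivative 0) (at t)" for t by (simp add: perc)
    from DERIV_isconst_all[of "\<lambda>t. S (t + T) - S t" t 0] this show ?thesis using S0 by (simp add: P_def)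
  qed
  \<comment> \<open>The values at multiples of \<open>T\<close> show that \<open>S\<close> is
    unbounded in both directions, hence onto.\<close>
  have SnP: "S (real n * T) = real n * P" "S (- real n * T) = - real n * P" for n
  proof -
    show "S (real n * T) = real n * P" for n
      by (induction n) (simp_all add: S0 distrib_right SP add.commute[of T])
    show "S (- real n * T) = - real n * P" for n
    proof (induction n)
      case (Suc n)
      have "- real (Suc n) * T + T = - real n * T" by (simp add: algebra_simps)
      then have "S (- real (Suc n) * T) + P = - real n * P" using SP[of "- real (Suc n) * T"] Suc by (simp only:)
      then have "S (- real (Suc n) * T) = - real n * P - P" by linarith
      moreover have "- real n * P - P = - real (Suc n) * P" by (simp add: algebra_simps)
      ultimately show ?case by (simp only:)
    qed (simp add: S0)
  qed
  have cS: "isCont S t" for t using dS DERIV_isCont by blast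
  have "\<exists>t. S t = y" for y
  proof -
    obtain n :: nat where n: "\<bar>y\<bar> < real n * P" using reals_Archimedean3[OF P0] by blast
    have "\<exists>t\<ge>- real n * T. t \<le> real n * T \<and> S t = y"
      by (rule IVT) (use n SnP cS T in auto)
    then show ?thesis by blast
  qed
  then obtain \<sigma> where S\<sigma>: "S (\<sigma> y) = y" for y by metis
  have injS: "S a = S b \<Longrightarrow> a = b" for a b using incr[of a b] incr[of b a] by fastforce
  have \<sigma>S: "\<sigma> (S t) = t" for t by (rule injS) (rule S\<sigma>)
  have d\<sigma>: "(\<sigma> has_real_derivative inverse (c (\<sigma> y))) (at y)" for y
  proof (rule DERIV_inverse_function[where f = S and a = "y - 1" and b = "y + 1"])
    show "isCont \<sigma> y"
      using isCont_inverse_function2[of "\<sigma> y - 1" "\<sigma> y" "\<sigma> y + 1" \<sigma> S] \<sigma>S cS by (simp add: S\<sigma>)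
  qed (use dS S\<sigma> cpos[of "\<sigma> y"] in auto)
  have "\<tau> \<le> P"
  proof (rule KEY[OF P0, of "\<lambda>y. \<gamma> (\<sigma> y)"])
    fix y
    have "(\<sigma> has_vector_derivative inverse (c (\<sigma> y))) (at y)"
      using d\<sigma>[of y] by (simp add: has_real_derivative_iff_has_vector_derivative)
    from vector_diff_chain_at[OF this dg] show "((\<lambda>y. \<gamma> (\<sigma> y)) has_vector_derivative \<i> *s gF (\<gamma> (\<sigma> y))) (at y)"
      using cpos[of "\<sigma> y"] by (simp add: o_def g'eq)
    have "\<sigma> (y + P) = \<sigma> y + T" by (rule injS) (simp add: S\<sigma> SP)
    then show "\<gamma> (\<sigma> (y + P)) = \<gamma> (\<sigma> y)" by (simp add: per)
  qed (rule lev)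
  moreover have "action T \<gamma> = P"
  proof -
    have "(c has_integral S T - S 0) {0..T}"
      using dS T by (intro fundamental_theorem_of_calculus)
        (auto simp: has_real_derivative_iff_has_vector_derivative[symmetric] intro: has_field_derivative_at_within)
    then show ?thesis unfolding action_def c_def g'_def P_def S0 by (simp add: integral_unique)
  qed
  ultimately show ?thesis by simp
qed

lemma Ck_on_circle: "Ck_on k (\<lambda>t. cos (2 * t) *\<^sub>R a + sin (2 * t) *\<^sub>R b) (UNIV :: real set)"
proof (induction k arbitrary: a b)
  case 0
  show ?case by (auto intro!: continuous_intros)
next
  case (Suc k)
  show ?case
  proof (rule Ck_on_SucI[OF open_UNIV])
    show "((\<lambda>t. cos (2 * t) *\<^sub>R a + sin (2 * t) *\<^sub>R b) has_derivative
        (\<lambda>h. cos (2 * t) *\<^sub>R ((2 * h) *\<^sub>R b) + sin (2 * t) *\<^sub>R ((- 2 * h) *\<^sub>R a))) (at t)" for t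
      by (auto intro!: derivative_eq_intros simp: algebra_simps)
  qed (rule Suc.IH)
qed

lemma hopf_characteristic:
  assumes e: "norm e = 1" and F: "\<And>t. F (cis (2 * t) *s e) = 1" and g: "\<And>t. gF (cis (2 * t) *s e) = 2 *\<^sub>R (cis (2 * t) *s e)"
  defines "\<gamma> \<equiv> \<lambda>t. cis (2 * t) *s e"
  shows "closed_characteristic {z. F z < 1} pi \<gamma>" "action pi \<gamma> = pi"
proof -
  have \<gamma>: "\<gamma> = (\<lambda>t. cos (2 * t) *\<^sub>R e + sin (2 * t) *\<^sub>R (\<i> *s e))"
    by (rule ext) (simp only: \<gamma>_def cis.code Complex_scale)
  have d: "(\<gamma> has_vector_derivative \<i> *s gF (\<gamma> t)) (at t)" for t
  proof -
    have "\<i> *s gF (\<gamma> t) = (cos (2 * t) *\<^sub>R (2 *\<^sub>R (\<i> *s e)) + sin (2 * t) *\<^sub>R (- 2 *\<^sub>R e))"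
      unfolding \<gamma>_def g unfolding iscale_scaleR cis.code Complex_scale iscale_add by (simp add: algebra_simps)
    moreover have "(\<gamma> has_vector_derivative (cos (2 * t) *\<^sub>R (2 *\<^sub>R (\<i> *s e)) + sin (2 * t) *\<^sub>R (- 2 *\<^sub>R e))) (at t)"
      unfolding \<gamma> has_vector_derivative_def by (auto intro!: derivative_eq_intros simp: algebra_simps)
    ultimately show ?thesis by simp
  qed
  have F': "F (\<gamma> t) = 1" for t using F by (simp add: \<gamma>_def)
  have vd: "vector_derivative \<gamma> (at t) = 1 *\<^sub>R (\<i> *s gF (\<gamma> t))" for t
    using vector_derivative_at[OF d] by simp
  have l1: "liouville_form (\<gamma> t) (vector_derivative \<gamma> (at t)) = 1" for t
    unfolding vd using liouville_ham[OF F[of t], of 1] by (simp add: \<gamma>_def)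
  have ne: False if st: "0 \<le> t" "t < s" "s < pi" "\<gamma> s = \<gamma> t" for s t
  proof -
    have "cis (2 * s) *s e - cis (2 * t) *s e = (cis (2 * t) * (cis (2 * (s - t)) - 1)) *s e"
      by (simp add: right_diff_distrib cis_mult vec_eq_iff left_diff_distrib)
    then have "cmod (cis (2 * (s - t)) - 1) = 0"
      using st(4) unfolding \<gamma>_def by (metis e diff_self norm_cscale norm_zero norm_mult norm_cis mult_1_left mult_1_right)
    moreover have "0 < sin (s - t)" using st by (intro sin_gt_zero) auto
    ultimately show False unfolding cmod_cis_minus_1 by simp
  qed
  have inj: "inj_on \<gamma> {0..<pi}"
  proof (rule inj_onI)
    fix s t assume "s \<in> {0..<pi}" "t \<in> {0..<pi}" "\<gamma> s = \<gamma> t"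
    then show "s = t" using ne[of t s] ne[of s t] by (cases s t rule: linorder_cases) auto
  qed
  show "closed_characteristic {z. F z < 1} pi \<gamma>"
    unfolding closed_characteristic_def frontier_sublevel
  proof (intro conjI allI)
    show "smooth_on \<gamma> UNIV" unfolding \<gamma> by (rule smooth_on_openI[OF open_UNIV Ck_on_circle])
    show "\<gamma> (t + pi) = \<gamma> t" for t by (simp add: \<gamma>_def distrib_left flip: cis_mult)
    show "range \<gamma> \<subseteq> {z. F z = 1}" using F by (auto simp: \<gamma>_def)
    show "vector_derivative \<gamma> (at t) \<in> char_line {z. F z = 1} (\<gamma> t)" for t
      unfolding vd char_line_level[OF F'] by (rule rangeI)
  qed (use inj l1 in auto)
  show "action pi \<gamma> = pi" unfolding action_def l1 by simp
qed

end

context tube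
begin

sublocale smooth_hamiltonian F gF
  by unfold_locales (rule hom_F, rule Ck_on_F(2))

lemma key: "0 < T \<Longrightarrow> (\<And>t. (\<gamma> has_vector_derivative \<i> *s gF (\<gamma> t)) (at t)) \<Longrightarrow>
      (\<And>t. \<gamma> (t + T) = \<gamma> t) \<Longrightarrow> (\<And>t. F (\<gamma> t) = 1) \<Longrightarrow> pi \<le> T"
  using period_ge_pi[of \<gamma> T] unfolding orbit_def by blast

text \<open>The Hopf circle of the direction \<open>k2\<close> is orthogonal to \<open>pp\<close>
  and nearly orthogonal to \<open>qq\<close>, so it avoids both bumps and attains the lower bound of
  \<open>key\<close>.\<close>

lemma sys_eq_pi: "sys {z. F z < 1} = pi"
proof -
  define e :: "complex ^ 'n" where "e = axis k2 1"
  have e: "norm e = 1" by (simp add: e_def norm_eq_sqrt_inner inner_axis_axis)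
  have "F (cis (2 * t) *s e) = 1 \<and> gF (cis (2 * t) *s e) = 2 *\<^sub>R (cis (2 * t) *s e)" for t
  proof -
    define z where "z = cis (2 * t) *s e"
    have n: "norm z = 1" by (simp add: z_def norm_cscale e)
    have z1: "z $ k1 = 0" and z2: "z $ k2 = cis (2 * t)" using k12 by (simp_all add: z_def e_def axis_def)
    have "b1 pp z \<le> 0" by (simp add: b1_def inner_pp z1)
    moreover have "b1 qq z \<le> 0"
    proof -
      have "z \<bullet> qq = - (1 / N) * (\<tau> * cos (2 * t))" unfolding inner_qq z1 z2 by simp
      then have "z \<bullet> qq \<le> \<bar>- (1 / N) * (\<tau> * cos (2 * t))\<bar>" by (simp only: abs_ge_self)
      also have "\<dots> \<le> 1 * (1 / 2000 * 1)"
        unfolding abs_mult using N(1) \<tau> by (intro mult_mono) auto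
      finally show ?thesis by (simp add: b1_def n)
    qed
    ultimately have "U z = 1" "gU z = 0" by (simp_all add: U_def gU_def bump_inactive)
    then show ?thesis unfolding z_def[symmetric] by (simp add: F_def gF_def n)
  qed
  note hopf = hopf_characteristic[OF e conjunct1[OF this] conjunct2[OF this]]
  show ?thesis
    unfolding sys_def
  proof (rule Least_equality)
    show "\<exists>T \<gamma>. closed_characteristic {z. F z < 1} T \<gamma> \<and> pi = action T \<gamma>"
      using hopf by metis
    show "pi \<le> y" if ex: "\<exists>T \<gamma>. closed_characteristic {z. F z < 1} T \<gamma> \<and> y = action T \<gamma>" for y
    proof -
      obtain T \<gamma> where cc: "closed_characteristic {z. F z < 1} T \<gamma>" and y: "y = action T \<gamma>" using ex by blast
      show ?thesis unfolding y by (rule action_lower[OF _ cc], rule key)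
    qed
  qed
qed

end

section \<open>Volume\<close>

text \<open>The change of variables formula of the library concerns \<open>real ^ 'm\<close> with a well-ordered index type \<open>'m\<close>;
  \<open>'n bit0\<close> is such a type with \<open>2 * CARD('n)\<close> elements.\<close>

definition realify :: "complex ^ 'n::finite \<Rightarrow> real ^ 'n bit0" where
  "realify = (SOME T. linear T \<and> (\<forall>z. norm (T z) = norm z) \<and> bij T)"

definition fin_vol :: "(complex ^ 'n::finite) set \<Rightarrow> bool" where
  "fin_vol S \<longleftrightarrow> realify ` S \<in> lmeasurable"

definition vol :: "(complex ^ 'n::finite) set \<Rightarrow> real" where
  "vol S = measure lebesgue (realify ` S)"

lemma realify:
  fixes z :: "complex ^ 'n::finite"
  shows "linear (realify :: complex ^ 'n \<Rightarrow> _)" "norm (realify z) = norm z" "bij (realify :: complex ^ 'n \<Rightarrow> _)"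
proof -
  have "dim (UNIV :: (complex ^ 'n) set) = dim (UNIV :: (real ^ 'n bit0) set)" by simp
  then obtain f :: "complex ^ 'n \<Rightarrow> real ^ 'n bit0" and g where
    fg: "linear f" "\<And>x. norm (f x) = norm x" "\<And>x. g (f x) = x" "\<And>x. f (g x) = x"
    using isometries_subspaces[OF subspace_UNIV subspace_UNIV] by (metis UNIV_I)
  then have "bij f" by (metis bijI')
  then have "\<exists>T :: complex ^ 'n \<Rightarrow> real ^ 'n bit0. linear T \<and> (\<forall>z. norm (T z) = norm z) \<and> bij T"
    using fg by blast
  from someI_ex[OF this] show "linear (realify :: complex ^ 'n \<Rightarrow> _)" "norm (realify z) = norm z"
    "bij (realify :: complex ^ 'n \<Rightarrow> _)" unfolding realify_def by auto
qed

lemma realify_inv: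
  fixes x :: "real ^ 'n::finite bit0" and z :: "complex ^ 'n"
  shows "realify (inv realify x) = x" "inv realify (realify z) = z" "linear (inv (realify :: complex ^ 'n \<Rightarrow> _))"
proof -
  have 1: "realify (inv realify x) = x" for x :: "real ^ 'n bit0"
    by (rule surj_f_inv_f[OF bij_is_surj[OF realify(3)]])
  have 2: "inv realify (realify z) = z" for z :: "complex ^ 'n"
    by (rule inv_f_f[OF bij_is_inj[OF realify(3)]])
  show "realify (inv realify x) = x" "inv realify (realify z) = z" by (rule 1 2)+
  show "linear (inv (realify :: complex ^ 'n \<Rightarrow> _))"
    by (rule linearI) (metis 1 2 linear_add[OF realify(1)], metis 1 2 linear_scale[OF realify(1)])
qed

lemma realify_inner: "realify u \<bullet> realify v = u \<bullet> v"
  unfolding dot_norm linear_add[OF realify(1), symmetric] realify(2) ..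

lemma realify_image: "realify ` S = inv realify -` S"
  by (rule bij_imp_bij_inv[OF realify(3), THEN bij_vimage_eq_inv_image, unfolded inv_inv_eq[OF realify(3)], symmetric])

lemma fin_vol_open: "open S \<Longrightarrow> bounded S \<Longrightarrow> fin_vol S"
  unfolding fin_vol_def
  by (intro lmeasurable_open bounded_linear_image)
    (auto simp: realify_image linear_linear realify realify_inv(3) intro!: open_vimage linear_continuous_on)

lemma fin_vol_compact: "compact S \<Longrightarrow> fin_vol S"
  unfolding fin_vol_def
  by (intro lmeasurable_compact compact_continuous_image linear_continuous_on) (simp_all add: linear_linear realify)

lemma vol_mono: "A \<subseteq> B \<Longrightarrow> fin_vol A \<Longrightarrow> fin_vol B \<Longrightarrow> vol A \<le> vol B"
  unfolding vol_def fin_vol_def by (intro measure_mono_fmeasurable) (auto simp: fmeasurableD)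

lemma fin_vol_Diff: "fin_vol A \<Longrightarrow> fin_vol B \<Longrightarrow> fin_vol (A - B)"
  unfolding fin_vol_def image_set_diff[OF bij_is_inj[OF realify(3)]] by (rule fmeasurable.Diff)

lemma fin_vol_Un: "fin_vol A \<Longrightarrow> fin_vol B \<Longrightarrow> fin_vol (A \<union> B)"
  unfolding fin_vol_def image_Un by (rule fmeasurable.Un)

lemma vol_Diff: "fin_vol A \<Longrightarrow> fin_vol B \<Longrightarrow> B \<subseteq> A \<Longrightarrow> vol (A - B) = vol A - vol B"
  unfolding fin_vol_def vol_def image_set_diff[OF bij_is_inj[OF realify(3)]]
  by (intro measurable_measure_Diff) (auto simp: fmeasurableD)

lemma vol_Un: "fin_vol A \<Longrightarrow> fin_vol B \<Longrightarrow> vol (A \<union> B) \<le> vol A + vol B"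
  unfolding fin_vol_def vol_def image_Un by (intro measure_Un_le) (auto simp: fmeasurableD)

lemma vol_affine:
  fixes S :: "(complex ^ 'n::finite) set"
  shows "vol ((\<lambda>x. m *\<^sub>R x + d) ` S) = \<bar>m\<bar> ^ (2 * CARD('n)) * vol S"
proof -
  have "realify ` (\<lambda>x. m *\<^sub>R x + d) ` S = (\<lambda>x. m *\<^sub>R x + realify d) ` realify ` S"
    by (simp add: image_image linear_add[OF realify(1)] linear_scale[OF realify(1)])
  then show ?thesis using measure_lebesgue_affine[of m "realify d" "realify ` S"] by (simp add: vol_def)
qed

lemma realify_ball: "realify ` ball (0 :: complex ^ 'n::finite) r = ball 0 r"
proof -
  have "realify ` ball (0 :: complex ^ 'n) r = {y. norm (inv (realify :: complex ^ 'n \<Rightarrow> _) y) < r}" by (auto simp: realify_image)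
  also have "\<dots> = {y. norm y < r}"
  proof -
    have "norm (inv (realify :: complex ^ 'n \<Rightarrow> _) y) = norm y" for y
      using realify(2)[of "inv realify y"] by (simp add: realify_inv)
    then show ?thesis by simp
  qed
  finally show ?thesis by auto
qed

lemma vol_ball_pos: "0 < r \<Longrightarrow> 0 < vol (ball 0 r)"
  unfolding vol_def realify_ball by (simp add: content_ball_pos)

text \<open>Preservation of the form means that the transpose of L times J L is J, with J
  invertible; taking determinants, the square of det L is 1.\<close>

lemma symplectic_det:
  fixes M :: "complex ^ 'n \<Rightarrow> complex ^ 'n::finite"
  assumes M: "linear M" and sy: "\<And>u v. symp_form (M u) (M v) = symp_form u v"
  shows "\<bar>det (matrix (\<lambda>x. realify (M (inv realify x))))\<bar> = 1"
proof -
  define J where "J x = realify (\<i> *s inv realify x)" for x :: "real ^ 'n bit0"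
  define L where "L x = realify (M (inv realify x))" for x :: "real ^ 'n bit0"
  have li: "linear (\<lambda>z. \<i> *s (z :: complex ^ 'n))" using bounded_linear_iscale by (rule bounded_linear.linear)
  have lJ: "linear J" and lL: "linear L"
    unfolding J_def[abs_def] L_def[abs_def]
    using linear_compose[OF linear_compose[OF realify_inv(3) li] realify(1)]
      linear_compose[OF linear_compose[OF realify_inv(3) M] realify(1)] by (simp_all add: o_def)
  have "(transpose (matrix L) ** matrix J ** matrix L) *v x = matrix J *v x" for x
  proof -
    have "((transpose (matrix L) ** matrix J ** matrix L) *v x - matrix J *v x) \<bullet> y = 0" for y
    proof -
      have "((transpose (matrix L) ** matrix J ** matrix L) *v x) \<bullet> y = J (L x) \<bullet> L y"
        using lJ lL by (simp add: transpose_matrix_vector dot_lmul_matrix matrix_works flip: matrix_vector_mul_assoc)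
      also have "\<dots> = J x \<bullet> y"
      proof -
        have "J (L x) \<bullet> L y = symp_form (M (inv realify x)) (M (inv realify y))"
          by (simp add: J_def L_def realify_inner realify_inv symp_form_inner)
        also have "\<dots> = symp_form (inv realify x) (inv realify y)" by (rule sy)
        also have "\<dots> = J x \<bullet> realify (inv realify y)" by (simp only: J_def realify_inner symp_form_inner)
        finally show ?thesis by (simp add: realify_inv)
      qed
      finally show ?thesis using lJ by (simp add: inner_diff_left matrix_works)
    qed
    from this[of "(transpose (matrix L) ** matrix J ** matrix L) *v x - matrix J *v x"] show ?thesis by simp
  qed
  then have "transpose (matrix L) ** matrix J ** matrix L = matrix J" unfolding matrix_eq by blast
  then have "det (transpose (matrix L) ** matrix J ** matrix L) = det (matrix J)" by simp
  then have "det (matrix L) * det (matrix J) * det (matrix L) = det (matrix J)" by (simp add: det_mul)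
  moreover have "inj J"
  proof (rule injI)
    fix x y assume "J x = J y"
    then have "\<i> *s (\<i> *s inv realify x) = \<i> *s (\<i> *s inv realify y)" unfolding J_def by (metis realify_inv(2))
    then show "x = y" by simp (metis realify_inv(1))
  qed
  then have "det (matrix J) \<noteq> 0" using det_nz_iff_inj[OF lJ] by simp
  ultimately have "(det (matrix L))\<^sup>2 = 1" by (simp add: power2_eq_square)
  then have "\<bar>det (matrix L)\<bar> = 1" by (auto simp: power2_eq_1_iff)
  then show ?thesis by (simp add: L_def[abs_def])
qed

lemma vol_symplectic_ball:
  fixes \<phi> :: "complex ^ 'n \<Rightarrow> complex ^ 'n::finite"
  assumes sym: "symplectomorphism \<phi>"
  shows "fin_vol (\<phi> ` ball 0 r)" "vol (\<phi> ` ball 0 r) = vol (ball (0 :: complex ^ 'n) r)"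
proof -
  have bij: "bij \<phi>" and sm: "smooth_on \<phi> UNIV"
    and sy: "\<And>z u v. symp_form (frechet_derivative \<phi> (at z) u) (frechet_derivative \<phi> (at z) v) = symp_form u v"
    using sym unfolding symplectomorphism_def diffeomorphism_def by auto
  define f where "f x = realify (\<phi> (inv realify x))" for x
  define f' where "f' x v = realify (frechet_derivative \<phi> (at (inv realify x)) (inv realify v))" for x v
  have d\<phi>: "(\<phi> has_derivative frechet_derivative \<phi> (at z)) (at z)" for z
    using smooth_on_UNIV_C1(1)[OF sm] by (simp add: frechet_derivative_works[symmetric])
  have bl: "bounded_linear realify" "bounded_linear (inv realify)"
    using realify(1) realify_inv(3) by (auto simp: linear_linear)
  have df: "(f has_derivative f' x) (at x)" for x
    unfolding f_def[abs_def] f'_def[abs_def]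
    by (intro bounded_linear.has_derivative[OF bl(1)]
        has_derivative_compose[OF bounded_linear_imp_has_derivative[OF bl(2)] d\<phi>])
  have det: "\<bar>det (matrix (f' x))\<bar> = 1" for x
    unfolding f'_def[abs_def] by (rule symplectic_det[OF has_derivative_linear[OF d\<phi>] sy])
  have inj: "inj_on f S" for S
  proof (rule inj_onI)
    fix x y assume "f x = f y"
    then have "\<phi> (inv realify x) = \<phi> (inv realify y)" unfolding f_def by (metis realify_inv(2))
    then have "inv realify x = inv realify y" using bij by (metis bij_inv_eq_iff)
    then show "x = y" by (metis realify_inv(1))
  qed
  have im: "f ` ball 0 r = realify ` \<phi> ` ball 0 r"
    by (subst realify_ball[symmetric]) (simp add: image_image f_def realify_inv)
  have i1: "(\<lambda>x. \<bar>det (matrix (f' x))\<bar>) integrable_on ball 0 r"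
    unfolding det by (simp add: lmeasurable_iff_integrable_on[symmetric])
  have S: "ball 0 r \<in> sets lebesgue" by simp
  note dw = has_derivative_at_withinI[OF df]
  show "fin_vol (\<phi> ` ball 0 r)"
    unfolding fin_vol_def im[symmetric] measurable_differentiable_image_eq[OF S dw inj] by (rule i1)
  have "measure lebesgue (f ` ball 0 r) = integral (ball (0 :: real ^ 'n bit0) r) (\<lambda>x. 1::real)"
    using measure_differentiable_image_eq[OF S dw inj i1] by (simp add: det)
  then show "vol (\<phi> ` ball 0 r) = vol (ball (0 :: complex ^ 'n) r)"
    unfolding vol_def im[symmetric] realify_ball by (simp only: lmeasure_integral[OF lmeasurable_ball])
qed

text \<open>Volumes of conical shells are thereby reduced to the part of the cone in the unit
  ball.\<close>

lemma vol_cone: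
  fixes C :: "(complex ^ 'n::finite) set"
  assumes C: "open C" and sc: "\<And>c z. 0 < c \<Longrightarrow> z \<in> C \<Longrightarrow> c *\<^sub>R z \<in> C" and r: "0 < r"
  shows "fin_vol {z \<in> C. norm z < r}" "vol {z \<in> C. norm z < r} = r ^ (2 * CARD('n)) * vol {z \<in> C. norm z < 1}"
proof -
  have "{z \<in> C. norm z < r} = C \<inter> ball 0 r" by auto
  then show "fin_vol {z \<in> C. norm z < r}"
    using C by (auto intro!: fin_vol_open open_Int bounded_Int)
  have "{z \<in> C. norm z < r} = (\<lambda>x. r *\<^sub>R x + 0) ` {z \<in> C. norm z < 1}"
  proof (intro equalityI subsetI)
    fix z assume z: "z \<in> {z \<in> C. norm z < r}"
    then have "(1 / r) *\<^sub>R z \<in> {z \<in> C. norm z < 1}" using r sc[of "1 / r" z] by simp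
    moreover have "z = r *\<^sub>R ((1 / r) *\<^sub>R z) + 0" using r by simp
    ultimately show "z \<in> (\<lambda>x. r *\<^sub>R x + 0) ` {z \<in> C. norm z < 1}" by (rule image_eqI[rotated])
  qed (use r sc in auto)
  then show "vol {z \<in> C. norm z < r} = r ^ (2 * CARD('n)) * vol {z \<in> C. norm z < 1}"
    using r by (simp only: vol_affine abs_of_pos)
qed

text \<open>The chord bound on [0, 1] for the convex function (1 + x)^n.\<close>

lemma power_1_plus_le: "0 \<le> x \<Longrightarrow> x \<le> 1 \<Longrightarrow> (1 + x) ^ n - 1 \<le> (2 ^ n - 1) * (x::real)"
proof (induction n)
  case (Suc n)
  have "(1 + x) ^ n \<le> 2 ^ n" using Suc.prems by (intro power_mono) auto
  then have "x * (1 + x) ^ n \<le> x * 2 ^ n" using Suc.prems by (intro mult_left_mono)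
  then show ?case using Suc by (simp add: algebra_simps)
qed simp

text \<open>\<open>eta\<close> at the two thresholds that define the cone \<open>Cq\<close>, hence a
  lower bound for the bump of the dent on it.\<close>

definition bet0 :: real where "bet0 = eta (1 / 5) * eta (2 / 5)"

lemma bet0: "0 < bet0" "bet0 \<le> 1"
proof -
  show "0 < bet0" by (simp add: bet0_def eta_def)
  show "bet0 \<le> 1" unfolding bet0_def using eta_props mult_mono[of "eta (1 / 5)" 1 "eta (2 / 5)" 1] by auto
qed

lemma scale_b:
  assumes "0 < c"
  shows "b1 p (c *\<^sub>R z) = b1 p z" "b2 p \<rho> (c *\<^sub>R z) = b2 p \<rho> z"
proof -
  have "hsq p (c *\<^sub>R z) = c\<^sup>2 * hsq p z"
    by (simp add: hsq_def power_mult_distrib distrib_left)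
  then show "b1 p (c *\<^sub>R z) = b1 p z" "b2 p \<rho> (c *\<^sub>R z) = b2 p \<rho> z"
    using assms by (simp_all add: b1_def b2_def power_mult_distrib)
qed

lemma hproj_add: "hproj p (u + v) = hproj p u + hproj p v"
  by (simp add: hproj_def inner_add_left scaleR_add_left)

lemma norm_axis: "norm (axis k c :: complex ^ 'n::finite) = cmod c"
  unfolding norm_eq_sqrt_inner inner_axis_axis by (simp only: refl if_True)

context tube
begin

text \<open>Outside this cone the domain does not protrude from the unit ball.\<close>

definition Cp :: "(complex ^ 'n) set" where
  "Cp = {z \<in> - {0}. 0 < b1 pp z \<and> 0 < b2 pp l z}"

text \<open>A core of the dent, where its bump is at least \<open>bet0\<close> and the other bump
  vanishes.\<close>

definition Cq :: "(complex ^ 'n) set" where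
  "Cq = {z \<in> - {0}. 1 / 5 < b1 qq z \<and> 2 / 5 < b2 qq (del0 * l) z \<and> b1 pp z < 0}"

text \<open>A disc of radius 1 times a ball of radius l: the common yardstick for the volumes of
  both cones.\<close>

definition Pl :: "(complex ^ 'n) set" where
  "Pl = {z. cmod (z $ k1) \<le> 1 \<and> (norm z)\<^sup>2 - (cmod (z $ k1))\<^sup>2 \<le> l\<^sup>2}"

lemma cones: "open Cp" "open Cq" "\<And>c z. 0 < c \<Longrightarrow> z \<in> Cp \<Longrightarrow> c *\<^sub>R z \<in> Cp" "\<And>c z. 0 < c \<Longrightarrow> z \<in> Cq \<Longrightarrow> c *\<^sub>R z \<in> Cq"
proof -
  have c: "continuous_on (- {0}) (b1 p)" "\<rho> \<noteq> 0 \<Longrightarrow> continuous_on (- {0}) (b2 p \<rho>)" for p :: "complex ^ 'n" and \<rho>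
    unfolding b1_def[abs_def] b2_def[abs_def] hsq_def by (intro continuous_intros; auto)+
  have o: "open (- {0 :: complex ^ 'n})" by auto
  note op = continuous_open_preimage[OF c(1) o] continuous_open_preimage[OF c(2) o]
  have eqs: "Cp = (- {0} \<inter> b1 pp -` {0<..}) \<inter> (- {0} \<inter> b2 pp l -` {0<..})"
    "Cq = (- {0} \<inter> b1 qq -` {1 / 5<..}) \<inter> (- {0} \<inter> b2 qq (del0 * l) -` {2 / 5<..}) \<inter> (- {0} \<inter> b1 pp -` {..<0})"
    unfolding Cp_def Cq_def by auto
  show "open Cp" "open Cq" unfolding eqs using l0 del0 by (intro open_Int op; auto)+
  show "\<And>c z. 0 < c \<Longrightarrow> z \<in> Cp \<Longrightarrow> c *\<^sub>R z \<in> Cp" "\<And>c z. 0 < c \<Longrightarrow> z \<in> Cq \<Longrightarrow> c *\<^sub>R z \<in> Cq"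
    unfolding Cp_def Cq_def by (auto simp: scale_b)
qed

lemma Cp_sub: "{z \<in> Cp. norm z < 1} \<subseteq> Pl"
proof
  fix z assume "z \<in> {z \<in> Cp. norm z < 1}"
  then have z: "z \<noteq> 0" "0 < b2 pp l z" "norm z < 1" by (auto simp: Cp_def)
  have "1 - hsq pp z / (norm z)\<^sup>2 < l\<^sup>2" using z l0 by (simp add: b2_def field_simps)
  then have "(1 - hsq pp z / (norm z)\<^sup>2) * (norm z)\<^sup>2 \<le> l\<^sup>2 * (norm z)\<^sup>2" by (intro mult_right_mono) auto
  also have "\<dots> \<le> l\<^sup>2 * 1" using z by (intro mult_left_mono) (auto simp: power_le_one)
  finally have "(norm z)\<^sup>2 - hsq pp z \<le> l\<^sup>2" using z by (simp add: left_diff_distrib)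
  moreover have "cmod (z $ k1) \<le> 1" using Finite_Cartesian_Product.norm_nth_le[of z k1] z by linarith
  ultimately show "z \<in> Pl" by (simp add: Pl_def hsq_pp)
qed

lemma Pl_compact: "compact Pl"
proof -
  have "closed Pl"
    unfolding Pl_def by (intro closed_Collect_conj closed_Collect_le continuous_intros)
  moreover have "Pl \<subseteq> cball 0 2"
  proof
    fix z assume "z \<in> Pl"
    then have "(cmod (z $ k1))\<^sup>2 \<le> 1" "(norm z)\<^sup>2 - (cmod (z $ k1))\<^sup>2 \<le> l\<^sup>2" by (auto simp: Pl_def power_le_one)
    moreover have "l\<^sup>2 \<le> 1" using l0 l_small by (simp add: power_le_one)
    ultimately have "(norm z)\<^sup>2 \<le> 2\<^sup>2" by simp
    then have "norm z \<le> 2" by (rule power2_le_imp_le) simp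
    then show "z \<in> cball 0 2" by simp
  qed
  ultimately show ?thesis using bounded_subset[OF bounded_cball] compact_eq_bounded_closed by blast
qed

text \<open>A homothetic copy of the set that contains the added cone fits into the removed cone, so the two
  volumes compare up to a factor independent of \<open>l\<close> and need not be computed.\<close>

lemma Cq_core: "(\<lambda>x. (del0 / 4) *\<^sub>R x + (3 / 4 * N) *\<^sub>R qq) ` Pl \<subseteq> {z \<in> Cq. norm z < 1}"
proof
  fix z assume "z \<in> (\<lambda>x. (del0 / 4) *\<^sub>R x + (3 / 4 * N) *\<^sub>R qq) ` Pl"
  then obtain x where x: "x \<in> Pl" and z: "z = (del0 / 4) *\<^sub>R x + (3 / 4 * N) *\<^sub>R qq" by blast
  have q1: "qq \<bullet> qq = 1" using norm_qq by (simp add: norm_eq_1)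
  have x1: "cmod (x $ k1) \<le> 1" and x2: "(norm x)\<^sup>2 - (cmod (x $ k1))\<^sup>2 \<le> l\<^sup>2" using x by (auto simp: Pl_def)
  have x3: "norm (x - hproj pp x) \<le> l"
    by (rule power2_le_imp_le) (use x2 hsq_perp[OF norm_pp, of x] l0 in \<open>auto simp: hsq_pp\<close>)
  have nx: "norm x \<le> 2"
  proof -
    have "norm x \<le> norm (hproj pp x) + norm (x - hproj pp x)"
      using norm_triangle_ineq[of "hproj pp x" "x - hproj pp x"] by simp
    moreover have "norm (hproj pp x) \<le> 1"
      using x1 unfolding hproj_pp norm_axis .
    ultimately show ?thesis using x3 l_small by linarith
  qed
  define d where "d = (del0 / 4) *\<^sub>R x"
  have nd: "norm d \<le> 1 / 128"
  proof -
    have "del0 / 4 * norm x \<le> 1 / 64 / 4 * 2" using del0 nx by (intro mult_mono) auto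
    then show ?thesis using del0 by (simp add: d_def)
  qed
  have zd: "z = d + (3 / 4 * N) *\<^sub>R qq" by (simp add: z d_def)
  have nw: "norm ((3 / 4 * N) *\<^sub>R qq) = 3 / 4 * N" using N(1) norm_qq by simp
  have N2: "1 \<le> N" "N \<le> 1 + 1 / 2000" using N(1,3) \<tau> by auto
  have nz: "norm z \<le> 77 / 100" "74 / 100 \<le> norm z"
  proof -
    show "norm z \<le> 77 / 100" using norm_triangle_ineq[of d "(3 / 4 * N) *\<^sub>R qq"] nd N2 unfolding zd nw by linarith
    have "3 / 4 * N \<le> norm z + norm d" using norm_triangle_ineq4[of z d] nw by (simp add: zd)
    then show "74 / 100 \<le> norm z" using nd N2 by linarith
  qed
  have z0: "z \<noteq> 0" using nz by auto
  have b1q: "1 / 5 < b1 qq z"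
  proof -
    have "\<bar>d \<bullet> qq\<bar> \<le> norm d" using Cauchy_Schwarz_ineq2[of d qq] norm_qq by simp
    moreover have "z \<bullet> qq = d \<bullet> qq + 3 / 4 * N" by (simp add: zd inner_add_left q1)
    ultimately have "74 / 100 \<le> z \<bullet> qq" using nd N2 by linarith
    then have "(74 / 100) / (77 / 100) \<le> (z \<bullet> qq) / norm z" using nz z0 by (intro frac_le) auto
    then show ?thesis unfolding b1_def by (rule less_le_trans[rotated, OF diff_right_mono]) simp
  qed
  \<comment> \<open>The factor \<open>N\<close> in the translation cancels the normalization of
    \<open>qq\<close>: the centre has component - 3/4 along \<open>pp\<close>.\<close>
  have b1p: "b1 pp z < 0"
  proof -
    have "\<bar>d \<bullet> pp\<bar> \<le> norm d" using Cauchy_Schwarz_ineq2[of d pp] norm_pp by simp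
    moreover have "qq \<bullet> pp = - (1 / N)"
      unfolding inner_pp using k12 by (simp add: qq_def axis_def)
    then have "z \<bullet> pp = d \<bullet> pp - 3 / 4" using N(1) by (simp add: zd inner_add_left)
    ultimately have "z \<bullet> pp \<le> 0" using nd by linarith
    then have "(z \<bullet> pp) / norm z \<le> 0" by (simp add: divide_nonpos_nonneg)
    then show ?thesis unfolding b1_def by linarith
  qed
  \<comment> \<open>What counts is the component orthogonal to the complex line of
    \<open>qq\<close>. For x it is at most l, from the ball factor of \<open>Pl\<close>, plus l / 2,
    from the tilt of the disc; scaled by \<open>del0\<close> / 4 this is 3/8 of the radius of the
    dent.\<close>
  have b2q: "2 / 5 < b2 qq (del0 * l) z"
  proof -
    define w where "w = x - hproj pp x"
    have hq: "hproj qq qq = qq"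
      by (simp add: hproj_def q1)
    have hs: "hproj qq (c *\<^sub>R u) = c *\<^sub>R hproj qq u" for c u
      by (simp add: hproj_def scaleR_add_right)
    have "z - hproj qq z = (del0 / 4) *\<^sub>R (x - hproj qq x)"
      unfolding z hproj_add hs by (simp add: hq algebra_simps)
    moreover have "x - hproj qq x = (hproj pp x - hproj qq (hproj pp x)) + (w - hproj qq w)"
      using hproj_add[of qq "hproj pp x" w] by (simp add: w_def)
    moreover have "norm (w - hproj qq w) \<le> l"
    proof -
      have "(norm (w - hproj qq w))\<^sup>2 \<le> (norm w)\<^sup>2" using hsq_perp[OF norm_qq, of w] hsq_nonneg[of qq w] by simp
      then have "norm (w - hproj qq w) \<le> norm w" by (rule power2_le_imp_le) simp
      then show ?thesis using x3 by (simp add: w_def)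
    qed
    moreover have "norm (hproj pp x - hproj qq (hproj pp x)) \<le> l / 2"
    proof -
      define a where "a = x $ k1"
      have pa: "hproj pp x = axis k1 a" by (simp add: hproj_pp a_def)
      have "(norm (axis k1 a - hproj qq (axis k1 a)))\<^sup>2 = (norm (axis k1 a :: complex ^ 'n))\<^sup>2 - hsq qq (axis k1 a)"
        by (rule hsq_perp[OF norm_qq])
      also have "\<dots> = (cmod a)\<^sup>2 - (cmod a)\<^sup>2 / N\<^sup>2"
        unfolding hsq_qq norm_axis using k12 by (simp add: axis_def)
      also have "\<dots> = (cmod a)\<^sup>2 * ((N\<^sup>2 - 1) / N\<^sup>2)" using N(1) by (simp add: field_simps)
      also have "(N\<^sup>2 - 1) / N\<^sup>2 \<le> \<tau>\<^sup>2 / 1" unfolding N(2) by (intro frac_le) auto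
      also have "(cmod a)\<^sup>2 * (\<tau>\<^sup>2 / 1) \<le> 1 * \<tau>\<^sup>2" using x1 by (intro mult_mono) (auto simp: a_def power_le_one)
      finally have "(norm (axis k1 a - hproj qq (axis k1 a)))\<^sup>2 \<le> \<tau>\<^sup>2" by (simp add: mult_left_mono)
      then have "norm (axis k1 a - hproj qq (axis k1 a)) \<le> \<tau>" by (rule power2_le_imp_le) (use \<tau> in simp)
      then show ?thesis unfolding pa by (simp add: \<tau>_def)
    qed
    ultimately have "norm (z - hproj qq z) \<le> del0 / 4 * (l / 2 + l)"
      using norm_triangle_ineq[of "hproj pp x - hproj qq (hproj pp x)" "w - hproj qq w"] del0
      by (simp only: norm_scaleR) (intro mult_mono, auto)
    also have "\<dots> = 3 / 8 * (del0 * l)" by simp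
    finally have "(norm (z - hproj qq z))\<^sup>2 \<le> (3 / 8 * (del0 * l))\<^sup>2" by (intro power_mono) auto
    then have s: "(norm z)\<^sup>2 - hsq qq z \<le> (3 / 8)\<^sup>2 * (del0 * l)\<^sup>2" unfolding hsq_perp[OF norm_qq] power_mult_distrib .
    have n2: "(74 / 100)\<^sup>2 \<le> (norm z)\<^sup>2" using nz by (intro power_mono) auto
    have "1 - hsq qq z / (norm z)\<^sup>2 = ((norm z)\<^sup>2 - hsq qq z) / (norm z)\<^sup>2" using z0 by (simp add: diff_divide_distrib)
    also have "\<dots> \<le> ((3 / 8)\<^sup>2 * (del0 * l)\<^sup>2) / (74 / 100)\<^sup>2"
      using s n2 by (intro frac_le) auto
    finally have "(1 - hsq qq z / (norm z)\<^sup>2) / (del0 * l)\<^sup>2 \<le> ((3 / 8)\<^sup>2 * (del0 * l)\<^sup>2) / (74 / 100)\<^sup>2 / (del0 * l)\<^sup>2"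
      by (intro divide_right_mono) auto
    also have "\<dots> = (3 / 8)\<^sup>2 / (74 / 100)\<^sup>2" using del0 l0 by simp
    also have "\<dots> < 3 / 5" by (simp add: power2_eq_square)
    finally show ?thesis by (simp add: b2_def)
  qed
  show "z \<in> {z \<in> Cq. norm z < 1}" using z0 b1q b2q b1p nz by (simp add: Cq_def)
qed

text \<open>The domain lies in the ball minus a shell of \<open>Cq\<close> plus a shell of
  \<open>Cp\<close>. In units of l^2 times the volume of \<open>Pl\<close>, the gain is at most 2^n
  - 1 and the loss at least \<open>M * bet0\<close> times the homothety factor (\<open>del0\<close>
  / 4)^(2n), which the hypothesis makes at least 2^n.\<close>

lemma vol_sublevel:
  assumes M: "2 ^ CARD('n) \<le> M * bet0 * (del0 / 4) ^ (2 * CARD('n))"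
  shows "fin_vol {z. F z < 1}" "vol {z. F z < 1} < vol (ball (0 :: complex ^ 'n) 1)"
proof -
  let ?n = "CARD('n)" and ?A = "{z. F z < 1}"
  have n1: "1 \<le> ?n" using zero_less_card_finite[where 'a = 'n] by linarith
  define x where "x = M * bet0 * l\<^sup>2"
  have x: "0 \<le> x" "x \<le> 1 / 2"
  proof -
    show "0 \<le> x" using M0 bet0 by (simp add: x_def)
    have "M * l\<^sup>2 * bet0 \<le> M * l\<^sup>2 * 1" using M0 bet0 by (intro mult_left_mono) auto
    then show "x \<le> 1 / 2" using bumps_axioms unfolding bumps_def x_def by (simp add: mult_ac)
  qed
  define a where "a = sqrt (1 - x)"
  define b where "b = sqrt (1 + l\<^sup>2)"
  have a: "0 < a" "a\<^sup>2 = 1 - x" "a \<le> 1" and b: "1 \<le> b" "b\<^sup>2 = 1 + l\<^sup>2" using x by (auto simp: a_def b_def)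
  let ?Q = "\<lambda>r. {z \<in> Cq. norm z < r}" and ?P = "\<lambda>r. {z \<in> Cp. norm z < r}"
  have Q: "fin_vol (?Q r)" "vol (?Q r) = r ^ (2 * ?n) * vol (?Q 1)" if "0 < r" for r
    using vol_cone[OF cones(2,4) that] by auto
  have P: "fin_vol (?P r)" "vol (?P r) = r ^ (2 * ?n) * vol (?P 1)" if "0 < r" for r
    using vol_cone[OF cones(1,3) that] by auto
  have fB: "fin_vol (ball 0 1 :: (complex ^ 'n) set)" by (simp add: fin_vol_open)
  have sub: "?A \<subseteq> (ball 0 1 - (?Q 1 - ?Q a)) \<union> (?P b - ?P 1)"
  proof
    fix z assume "z \<in> ?A"
    then have zU: "(norm z)\<^sup>2 < U z" using U_pos[of z] by (simp add: F_def)
    show "z \<in> (ball 0 1 - (?Q 1 - ?Q a)) \<union> (?P b - ?P 1)"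
    proof (cases "norm z < 1")
      case True
      have "norm z < a" if "z \<in> Cq"
      proof -
        have cq: "1 / 5 < b1 qq z" "2 / 5 < b2 qq (del0 * l) z" "b1 pp z \<le> 0" using that by (auto simp: Cq_def)
        have "bet0 \<le> bump qq (del0 * l) z"
          unfolding bet0_def bump_def using cq by (intro mult_mono eta_mono eta_props) auto
        then have "M * l\<^sup>2 * bet0 \<le> M * l\<^sup>2 * bump qq (del0 * l) z" using M0 by (intro mult_left_mono) auto
        moreover have "bump pp l z = 0" using cq(3) by (simp add: bump_inactive)
        ultimately have "U z \<le> 1 - x" by (simp add: U_def x_def mult_ac)
        then have "(norm z)\<^sup>2 < a\<^sup>2" using zU a by simp
        then show ?thesis by (rule power_less_imp_less_base) (use a in simp)
      qed
      then show ?thesis using True by auto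
    next
      case False
      have Ul: "U z \<le> 1 + l\<^sup>2 * bump pp l z" using M0 bump_bounds(1)[of qq "del0 * l" z] by (simp add: U_def)
      have "1\<^sup>2 \<le> (norm z)\<^sup>2" using False by (intro power_mono) auto
      then have "0 < l\<^sup>2 * bump pp l z" using zU Ul by simp
      then have "bump pp l z \<noteq> 0" by auto
      then have "0 < b1 pp z" "0 < b2 pp l z" using bump_inactive(1)[of pp z l] by fastforce+
      then have "z \<in> Cp" using False by (auto simp: Cp_def)
      moreover have "(norm z)\<^sup>2 < b\<^sup>2"
        using zU Ul mult_left_mono[OF bump_bounds(2)[of pp l z], of "l\<^sup>2"] unfolding b by simp
      then have "norm z < b" by (rule power_less_imp_less_base) (use b in simp)
      ultimately show ?thesis using False by auto
    qed
  qed
  have oA: "open ?A" by (intro open_Collect_less contF continuous_on_const)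
  have "bounded ?A"
  proof (rule bounded_subset[OF bounded_ball])
    show "?A \<subseteq> ball 0 2"
    proof
      fix z assume "z \<in> ?A"
      then have "(norm z)\<^sup>2 < U z" using U_pos[of z] by (simp add: F_def)
      then have "(norm z)\<^sup>2 < 2\<^sup>2" using U_bounds(2)[of z] by simp
      then have "norm z < 2" by (rule power_less_imp_less_base) simp
      then show "z \<in> ball 0 2" by simp
    qed
  qed
  with oA show fA: "fin_vol ?A" by (rule fin_vol_open)
  have bp: "0 < b" using b by simp
  have fPl: "fin_vol Pl" by (rule fin_vol_compact[OF Pl_compact])
  have vP: "vol (?P 1) \<le> vol Pl" by (rule vol_mono[OF Cp_sub P(1) fPl]) simp
  have vQ: "(del0 / 4) ^ (2 * ?n) * vol Pl \<le> vol (?Q 1)"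
  proof -
    have "vol ((\<lambda>x. (del0 / 4) *\<^sub>R x + (3 / 4 * N) *\<^sub>R qq) ` Pl) \<le> vol (?Q 1)"
      by (rule vol_mono[OF Cq_core fin_vol_compact Q(1)])
        (auto intro!: compact_continuous_image Pl_compact continuous_intros)
    then show ?thesis unfolding vol_affine using del0 by simp
  qed
  have Pl0: "0 < vol Pl"
  proof -
    have "ball 0 l \<subseteq> Pl"
    proof
      fix z :: "complex ^ 'n" assume "z \<in> ball 0 l"
      then have "norm z < l" by simp
      moreover have "cmod (z $ k1) \<le> norm z" by (rule Finite_Cartesian_Product.norm_nth_le)
      moreover have "(norm z)\<^sup>2 \<le> l\<^sup>2" using \<open>norm z < l\<close> by (intro power_mono) auto
      moreover have "0 \<le> (cmod (z $ k1))\<^sup>2" by simp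
      ultimately show "z \<in> Pl" using l_small unfolding Pl_def mem_Collect_eq by linarith
    qed
    then have "vol (ball (0 :: complex ^ 'n) l) \<le> vol Pl" by (intro vol_mono fPl fin_vol_open) auto
    moreover have "0 < vol (ball (0 :: complex ^ 'n) l)" by (rule vol_ball_pos) (rule l0)
    ultimately show ?thesis by linarith
  qed
  have "vol ?A \<le> vol ((ball 0 1 - (?Q 1 - ?Q a)) \<union> (?P b - ?P 1))"
    using a bp by (intro vol_mono[OF sub fA] fin_vol_Un fin_vol_Diff fB Q P) auto
  also have "\<dots> \<le> vol (ball 0 1 - (?Q 1 - ?Q a)) + vol (?P b - ?P 1)"
    using a bp by (intro vol_Un fin_vol_Diff fB Q P) auto
  also have "vol (ball 0 1 - (?Q 1 - ?Q a)) = vol (ball (0 :: complex ^ 'n) 1) - vol (?Q 1 - ?Q a)"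
    using a by (intro vol_Diff fin_vol_Diff fB Q) auto
  also have "vol (?Q 1 - ?Q a) = vol (?Q 1) - vol (?Q a)"
    using a by (intro vol_Diff Q) auto
  also have "vol (?P b - ?P 1) = vol (?P b) - vol (?P 1)"
    using b bp by (intro vol_Diff P) auto
  finally have main: "vol ?A \<le> vol (ball (0 :: complex ^ 'n) 1) - (vol (?Q 1) - vol (?Q a)) + (vol (?P b) - vol (?P 1))" .
  have v1: "vol (?P b) - vol (?P 1) \<le> (2 ^ ?n - 1) * l\<^sup>2 * vol Pl"
  proof -
    have "b ^ (2 * ?n) - 1 \<le> (2 ^ ?n - 1) * l\<^sup>2"
      unfolding power_mult b using l0 l_small by (intro power_1_plus_le) (auto simp: power_le_one)
    then have "(b ^ (2 * ?n) - 1) * vol (?P 1) \<le> ((2 ^ ?n - 1) * l\<^sup>2) * vol Pl"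
      using vP by (intro mult_mono) (auto simp: vol_def)
    then show ?thesis unfolding P(2)[OF bp] by (simp add: left_diff_distrib)
  qed
  have v2: "x * vol (?Q 1) \<le> vol (?Q 1) - vol (?Q a)"
  proof -
    have "(1 - x) ^ ?n \<le> (1 - x) ^ 1" using n1 x by (intro power_decreasing) auto
    then have "a ^ (2 * ?n) \<le> 1 - x" unfolding power_mult a(2) by simp
    then have "a ^ (2 * ?n) * vol (?Q 1) \<le> (1 - x) * vol (?Q 1)" by (intro mult_right_mono) (auto simp: vol_def)
    then show ?thesis unfolding Q(2)[OF a(1)] by (simp add: left_diff_distrib)
  qed
  have "2 ^ ?n * (l\<^sup>2 * vol Pl) \<le> (M * bet0 * (del0 / 4) ^ (2 * ?n)) * (l\<^sup>2 * vol Pl)"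
    using M Pl0 by (intro mult_right_mono) auto
  also have "\<dots> = x * ((del0 / 4) ^ (2 * ?n) * vol Pl)" by (simp add: x_def)
  also have "\<dots> \<le> x * vol (?Q 1)" using vQ x by (intro mult_left_mono)
  finally have v3: "2 ^ ?n * (l\<^sup>2 * vol Pl) \<le> x * vol (?Q 1)" .
  have v4: "0 < l\<^sup>2 * vol Pl" using l0 Pl0 by simp
  have "(2 ^ ?n - 1) * l\<^sup>2 * vol Pl = 2 ^ ?n * (l\<^sup>2 * vol Pl) - l\<^sup>2 * vol Pl" by (simp add: algebra_simps)
  then show "vol ?A < vol (ball (0 :: complex ^ 'n) 1)" using main v1 v2 v3 v4 by linarith
qed

lemma ball_capacity_less:
  assumes M: "2 ^ CARD('n) \<le> M * bet0 * (del0 / 4) ^ (2 * CARD('n))"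
  shows "ball_capacity {z. F z < 1} < ereal pi"
proof -
  let ?n = "CARD('n)" and ?A = "{z. F z < 1}"
  have n1: "0 < ?n" by simp
  note vA = vol_sublevel[OF M]
  have vB: "0 < vol (ball (0 :: complex ^ 'n) 1)" by (rule vol_ball_pos) simp
  \<comment> \<open>The capacity is a supremum, so the strict inequality of volumes has to become a
    bound uniform in r, namely r^2 \<le> \<open>s\<close> < 1.\<close>
  define \<theta> where "\<theta> = vol ?A / vol (ball (0 :: complex ^ 'n) 1)"
  have th: "0 \<le> \<theta>" "\<theta> < 1" using vA(2) vB by (auto simp: \<theta>_def vol_def)
  define s where "s = root ?n \<theta>"
  have s: "0 \<le> s" "s < 1" using th n1 real_root_lt_1_iff[OF n1, of \<theta>] by (auto simp: s_def)
  have "ball_capacity ?A \<le> ereal (pi * s)"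
    unfolding ball_capacity_def
  proof (rule Sup_least)
    fix y assume "y \<in> {ereal (pi * r\<^sup>2) | r. 0 < r \<and> (\<exists>\<phi>. symplectomorphism \<phi> \<and> \<phi> ` ball 0 r \<subseteq> ?A)}"
    then obtain r \<phi> where r: "0 < r" "y = ereal (pi * r\<^sup>2)" and sy: "symplectomorphism \<phi>" and sub: "\<phi> ` ball 0 r \<subseteq> ?A" by blast
    have "vol (ball (0 :: complex ^ 'n) r) \<le> vol ?A"
      using vol_mono[OF sub vol_symplectic_ball(1)[OF sy] vA(1)] by (simp only: vol_symplectic_ball(2)[OF sy])
    moreover have "vol (ball (0 :: complex ^ 'n) r) = r ^ (2 * ?n) * vol (ball (0 :: complex ^ 'n) 1)"
    proof -
      have "{z \<in> UNIV. norm z < t} = ball (0 :: complex ^ 'n) t" for t by auto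
      then show ?thesis using vol_cone(2)[of "UNIV :: (complex ^ 'n) set" r] r by simp
    qed
    ultimately have "(r\<^sup>2) ^ ?n \<le> \<theta>" using vB by (simp add: \<theta>_def le_divide_eq power_mult)
    then have "root ?n ((r\<^sup>2) ^ ?n) \<le> s" unfolding s_def using n1 by simp
    then have "r\<^sup>2 \<le> s" using n1 by (simp add: real_root_power_cancel)
    then show "y \<le> ereal (pi * s)" using r by simp
  qed
  also have "\<dots> < ereal pi" using s by simp
  finally show ?thesis .
qed

end

section \<open>The family\<close>

context tube
begin

lemma U_radial: "w \<noteq> 0 \<Longrightarrow> U (w /\<^sub>R norm w) = U w"
  by (rule scale_U) simp

lemma sublevel_star: "{z. F z < 1} = star_domain (\<lambda>z. sqrt (U z))"
proof (intro equalityI subsetI)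
  fix z assume "z \<in> {z. F z < 1}"
  then have zU: "(norm z)\<^sup>2 < U z" using U_pos[of z] by (simp add: F_def)
  show "z \<in> star_domain (\<lambda>z. sqrt (U z))"
  proof (cases "z = 0")
    case True
    have "0 *\<^sub>R pp = z" "pp \<in> sphere 0 1" using norm_pp True by auto
    moreover have "(0::real) < sqrt (U pp)" using U_pos[of pp] by simp
    ultimately show ?thesis unfolding star_domain_def by (intro CollectI exI[of _ "0::real"] exI[of _ pp]) auto
  next
    case False
    have "norm z < sqrt (U (z /\<^sub>R norm z))" unfolding U_radial[OF False] using zU by (intro real_less_rsqrt)
    moreover have "z = norm z *\<^sub>R (z /\<^sub>R norm z)" "z /\<^sub>R norm z \<in> sphere 0 1" using False by auto
    ultimately show ?thesis unfolding star_domain_def by (intro CollectI exI[of _ "norm z"] exI[of _ "z /\<^sub>R norm z"]) auto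
  qed
next
  fix z assume "z \<in> star_domain (\<lambda>z. sqrt (U z))"
  then obtain r w where w: "z = r *\<^sub>R w" "norm w = 1" "0 \<le> r" "r < sqrt (U w)" by (auto simp: star_domain_def)
  show "z \<in> {z. F z < 1}"
  proof (cases "r = 0")
    case True
    then show ?thesis using w F0 by simp
  next
    case False
    then have r: "0 < r" using w by simp
    have "r\<^sup>2 < (sqrt (U w))\<^sup>2" using w by (intro power_strict_mono) auto
    then have "r\<^sup>2 < U w" using U_pos[of w] by simp
    then have "r\<^sup>2 * (1 / U w) < 1" using U_pos[of w] by simp
    then show ?thesis using homF[OF r, of w] w by (simp add: F_def[of w])
  qed
qed

lemma radial_sublevel: "z \<in> sphere 0 1 \<Longrightarrow> radial_fun {z. F z < 1} z = sqrt (U z)"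
  unfolding sublevel_star using U_pos by (intro radial_fun_star_domain) auto

lemma sublevel_star_domains: "{z. F z < 1} \<in> star_domains"
proof -
  have "smooth_on (\<lambda>z. sqrt (U z)) (sphere 0 1)"
    unfolding smooth_on_def
  proof (intro ballI exI conjI allI)
    fix z :: "complex ^ 'n" and k assume z: "z \<in> sphere 0 1"
    show o: "open (- {0 :: complex ^ 'n})" by auto
    show "z \<in> - {0}" using z by auto
    show "Ck_on k (\<lambda>z. sqrt (U z)) (- {0})"
      using U_pos by (intro Ck_on_sqrt Ck_on_F(1) Ck_on_linear bounded_linear_ident o) auto
  qed simp
  then show ?thesis unfolding star_domains_def sublevel_star using U_pos by (intro CollectI exI[of _ "\<lambda>z. sqrt (U z)"]) auto
qed

lemma C1_dist_bound: "\<bar>C1_dist {z. F z < 1} (ball 0 1)\<bar> \<le> (1 + M + K0) * l"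
proof -
  define f where "f w = radial_fun {z. F z < 1} w" for w :: "complex ^ 'n"
  define g where "g w = radial_fun (ball 0 1) w" for w :: "complex ^ 'n"
  have f: "f w = sqrt (U w)" if "norm w = 1" for w unfolding f_def using that by (intro radial_sublevel) simp
  have g: "g w = 1" if "norm w = 1" for w
    unfolding g_def unit_ball_eq_star_domain using that by (intro radial_fun_star_domain) auto
  have S: "sphere (0 :: complex ^ 'n) 1 \<noteq> {}" by simp
  have sup: "0 \<le> (SUP z\<in>sphere 0 1. h z) \<and> (SUP z\<in>sphere 0 1. h z) \<le> c"
    if h: "\<And>z. norm z = 1 \<Longrightarrow> 0 \<le> h z \<and> h z \<le> c" for h :: "complex ^ 'n \<Rightarrow> real" and c
  proof
    have "bdd_above (h ` sphere 0 1)" by (rule bdd_aboveI[of _ c]) (use h in auto)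
    then show "0 \<le> (SUP z\<in>sphere 0 1. h z)"
      by (rule cSUP_upper2[of _ _ pp]) (use h norm_pp in auto)
    show "(SUP z\<in>sphere 0 1. h z) \<le> c" by (rule cSUP_least[OF S]) (use h in auto)
  qed
  have 1: "0 \<le> \<bar>f z - g z\<bar> \<and> \<bar>f z - g z\<bar> \<le> (1 + M) * l" if z: "norm z = 1" for z
  proof -
    have s: "0 \<le> sqrt (U z)" using U_pos[of z] by simp
    have "\<bar>sqrt (U z) - 1\<bar> * 1 \<le> \<bar>sqrt (U z) - 1\<bar> * (sqrt (U z) + 1)" using s by (intro mult_left_mono) auto
    also have "\<dots> = \<bar>(sqrt (U z) - 1) * (sqrt (U z) + 1)\<bar>" using s by (simp add: abs_mult)
    also have "(sqrt (U z) - 1) * (sqrt (U z) + 1) = U z - 1"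
      using U_pos[of z] by (simp add: algebra_simps)
    also have "\<bar>U z - 1\<bar> \<le> (1 + M) * l\<^sup>2" by (rule U_bounds)
    also have "\<dots> \<le> (1 + M) * l" using M0 l0 l_small by (intro mult_left_mono) (auto simp: power2_eq_square mult_left_le)
    finally show ?thesis using f[OF z] g[OF z] by simp
  qed
  have 2: "0 \<le> onorm (frechet_derivative (\<lambda>w. f (w /\<^sub>R norm w) - g (w /\<^sub>R norm w)) (at z)) \<and>
      onorm (frechet_derivative (\<lambda>w. f (w /\<^sub>R norm w) - g (w /\<^sub>R norm w)) (at z)) \<le> K0 * l" if z: "norm z = 1" for z
  proof -
    have z0: "z \<noteq> 0" using z by auto
    have "((\<lambda>w. sqrt (U w) - 1) has_derivative (\<lambda>v. (gU z \<bullet> v) * (inverse (sqrt (U z)) / 2) - 0)) (at z)"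
      by (intro has_derivative_diff has_derivative_const
          has_derivative_compose[OF derivative_U[OF z0] DERIV_real_sqrt[OF U_pos, unfolded has_field_derivative_def], THEN has_derivative_eq_rhs])
        (simp add: fun_eq_iff mult.commute)
    then have "((\<lambda>w. f (w /\<^sub>R norm w) - g (w /\<^sub>R norm w)) has_derivative (\<lambda>v. (gU z \<bullet> v) * (inverse (sqrt (U z)) / 2) - 0)) (at z)"
    proof (rule has_derivative_transform_within_open[where s = "- {0}"])
      fix w :: "complex ^ 'n" assume "w \<in> - {0}"
      then have "w \<noteq> 0" by simp
      then show "sqrt (U w) - 1 = f (w /\<^sub>R norm w) - g (w /\<^sub>R norm w)"
        using f[of "w /\<^sub>R norm w"] g[of "w /\<^sub>R norm w"] U_radial[of w] by simp
    qed (use z0 in auto)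
    from frechet_derivative_at[OF this]
    have fd: "frechet_derivative (\<lambda>w. f (w /\<^sub>R norm w) - g (w /\<^sub>R norm w)) (at z) = (\<lambda>v. (gU z \<bullet> v) * (inverse (sqrt (U z)) / 2))"
      by simp
    have i: "inverse (sqrt (U z)) / 2 \<le> 1" "0 \<le> inverse (sqrt (U z)) / 2"
    proof -
      have "1 / 2 \<le> sqrt (U z)"
        by (rule real_le_rsqrt) (use U_bounds(1)[of z] in \<open>simp add: power2_eq_square\<close>)
      then have "inverse (sqrt (U z)) \<le> inverse (1 / 2)" by (intro le_imp_inverse_le) auto
      then show "inverse (sqrt (U z)) / 2 \<le> 1" by simp
    qed (use U_pos[of z] in simp)
    have "norm ((gU z \<bullet> v) * (inverse (sqrt (U z)) / 2)) \<le> K0 * l * norm v" for v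
    proof -
      have "\<bar>gU z \<bullet> v\<bar> * (inverse (sqrt (U z)) / 2) \<le> (K0 * l * norm v) * 1"
      proof (intro mult_mono i)
        have "\<bar>gU z \<bullet> v\<bar> \<le> norm (gU z) * norm v" by (rule Cauchy_Schwarz_ineq2)
        also have "\<dots> \<le> K0 * l * norm v" using gU_bound[OF z0] z by (intro mult_right_mono) auto
        finally show "\<bar>gU z \<bullet> v\<bar> \<le> K0 * l * norm v" .
      qed (use K0 l0 in auto)
      then show ?thesis using i(2) by (simp add: abs_mult)
    qed
    then have "onorm (\<lambda>v. (gU z \<bullet> v) * (inverse (sqrt (U z)) / 2)) \<le> K0 * l" by (rule onorm_le)
    moreover have "0 \<le> onorm (\<lambda>v. (gU z \<bullet> v) * (inverse (sqrt (U z)) / 2))"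
      by (intro onorm_pos_le bounded_linear_mult_const bounded_linear_inner_right)
    ultimately show ?thesis unfolding fd by blast
  qed
  have "C1_dist {z. F z < 1} (ball 0 1) = (SUP z\<in>sphere 0 1. \<bar>f z - g z\<bar>) +
      (SUP z\<in>sphere 0 1. onorm (frechet_derivative (\<lambda>w. f (w /\<^sub>R norm w) - g (w /\<^sub>R norm w)) (at z)))"
    unfolding C1_dist_def C1_dist_sphere_def f_def g_def ..
  then show ?thesis using sup[of "\<lambda>z. \<bar>f z - g z\<bar>", OF 1] sup[of "\<lambda>z. onorm (frechet_derivative (\<lambda>w. f (w /\<^sub>R norm w) - g (w /\<^sub>R norm w)) (at z))", OF 2]
    by (simp add: distrib_right)
qed

lemma cylindrical_capacity_ge: "ereal pi \<le> cylindrical_capacity i {z. F z < 1}"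
  unfolding cylindrical_capacity_def
proof (rule Inf_greatest)
  fix y assume "y \<in> {ereal (pi * r\<^sup>2) | r. 0 < r \<and> (\<exists>\<phi>. symplectomorphism \<phi> \<and> \<phi> ` {z. F z < 1} \<subseteq> cylinder i r)}"
  then obtain r \<phi> where r: "0 < r" "y = ereal (pi * r\<^sup>2)" and
    sy: "symplectomorphism \<phi>" and sub: "\<phi> ` {z. F z < 1} \<subseteq> cylinder i r" by blast
  have "1 \<le> r" by (rule cylindrical_lower[OF hom_F _ sy sub r(1)], rule key)
  then have "1 \<le> r\<^sup>2" by simp
  then show "ereal pi \<le> y" using r by simp
qed

end

text \<open>In the locale l is fixed; for joint smoothness the tilted axis is written out as a
  function of l and the bumps are differentiated in both variables.\<close>

lemma Ck_on_family:
  fixes k1 k2 :: "'n::finite"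
  assumes W: "open W" "\<And>x. x \<in> W \<Longrightarrow> tube k1 k2 (fst x) M" "\<And>x. x \<in> W \<Longrightarrow> snd x \<noteq> 0"
  shows "Ck_on k (\<lambda>x. sqrt (bumps.U (tube.pp k1) (tube.qq k1 k2 (fst x)) (fst x) del0 M (snd x))) W"
proof -
  define p :: "complex ^ 'n" where "p = axis k1 1"
  define q :: "real \<Rightarrow> complex ^ 'n" where
    "q l = (- (1 / sqrt (1 + (l / 2)\<^sup>2))) *\<^sub>R (axis k1 1 + (l / 2) *\<^sub>R axis k2 1)" for l
  define u where "u x = 1 + (fst x)\<^sup>2 * bump p (fst x) (snd x) - M * (fst x)\<^sup>2 * bump (q (fst x)) (del0 * fst x) (snd x)"
    for x :: "real \<times> (complex ^ 'n)"
  have C1: "Ck_on k (fst :: real \<times> (complex ^ 'n) \<Rightarrow> real) W" "Ck_on k (snd :: real \<times> (complex ^ 'n) \<Rightarrow> _) W"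
    by (rule Ck_on_linear[OF W(1) bounded_linear_fst] Ck_on_linear[OF W(1) bounded_linear_snd])+
  have pos: "0 < fst x" if "x \<in> W" for x using W(2)[OF that] by (simp add: tube_def)
  have "Ck_on k (\<lambda>x. q (fst x)) W"
  proof -
    have p: "0 < 1 + (l / 2)\<^sup>2" for l :: real by (rule add_pos_nonneg) auto
    then show ?thesis
      unfolding q_def
      by (intro Ck_on_scaleR Ck_on_add Ck_on_uminus Ck_on_divide Ck_on_sqrt Ck_on_power Ck_on_const C1 W(1)) auto
  qed
  then have Cu: "Ck_on k u W"
    unfolding u_def[abs_def] using pos del0 W(3)
    by (intro Ck_on_diff Ck_on_add Ck_on_mult Ck_on_power Ck_on_bump Ck_on_const C1 W(1)) auto
  have eq: "bumps.U (tube.pp k1) (tube.qq k1 k2 (fst x)) (fst x) del0 M (snd x) = u x" "0 < u x" if "x \<in> W" for x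
  proof -
    interpret tube k1 k2 "fst x" M by (rule W(2)[OF that])
    have "qq = q (fst x)" by (simp add: qq_def q_def N_def \<tau>_def)
    then show "U (snd x) = u x" unfolding U_def u_def by (simp add: p_def pp_def)
    then show "0 < u x" using U_pos[of "snd x"] by simp
  qed
  have "Ck_on k (\<lambda>x. sqrt (u x)) W" using eq(2) by (intro Ck_on_sqrt Cu W(1))
  then show ?thesis by (rule Ck_on_cong_aux[OF W(1), rotated]) (simp add: eq(1))
qed

theorem proposition1:
  fixes i :: "'n::finite"
  assumes "CARD('n) \<ge> 2"
  shows "\<exists>l0 > 0. \<exists>A :: real \<Rightarrow> (complex ^ 'n) set.
           smooth_family {0<..l0} A \<and>
           ((\<lambda>l. C1_dist (A l) (ball 0 1)) \<longlongrightarrow> 0) (at_right 0) \<and>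
           (\<forall>l \<in> {0<..l0}. ball_capacity (A l) < ereal (sys (A l)) \<and>
                           ereal (sys (A l)) \<le> cylindrical_capacity i (A l))"
proof -
  have "\<exists>k1 k2 :: 'n. k1 \<noteq> k2"
  proof (rule ccontr)
    assume "\<not> (\<exists>k1 k2 :: 'n. k1 \<noteq> k2)"
    then have "(UNIV :: 'n set) = {undefined}" by auto
    then have "CARD('n) = card {undefined :: 'n}" by (rule arg_cong)
    then show False using assms by simp
  qed
  then obtain k1 k2 :: 'n where k12: "k1 \<noteq> k2" by blast
  define B where "B = bet0 * (del0 / 4) ^ (2 * CARD('n))"
  have B: "0 < B" using bet0 del0 by (simp add: B_def)
  \<comment> \<open>The least value that the volume comparison allows. It does not depend on l,
    which is thus free to tend to 0.\<close>
  define M where "M = 2 ^ CARD('n) / B"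
  have M0: "0 \<le> M" using B by (simp add: M_def)
  have M_ge: "2 ^ CARD('n) \<le> M * bet0 * (del0 / 4) ^ (2 * CARD('n))"
    using B unfolding mult.assoc B_def[symmetric] M_def by simp
  have K: "0 < Kbig M"
  proof -
    have "0 \<le> M * (2 + 2 / del0)" using M0 del0 by (intro mult_nonneg_nonneg add_nonneg_nonneg) auto
    then show ?thesis unfolding Kbig_def using M0 by (simp only: distrib_left)
  qed
  \<comment> \<open>Half of the range allowed by \<open>tube\<close>, so that the family extends
    past the end point \<open>l0\<close>, as smoothness on the half-open interval requires an
    extension to an open set.\<close>
  define l0 where "l0 = 1 / (200 * Kbig M)"
  have l0: "0 < l0" using K by (simp add: l0_def)
  have tube: "tube k1 k2 l M" if "0 < l" "l < 2 * l0" for l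
  proof
    have "Kbig M * l \<le> Kbig M * (2 * l0)" using that K by (intro mult_left_mono) auto
    also have "\<dots> = 1 / 100" using K by (simp add: l0_def)
    finally show "Kbig M * l \<le> 1 / 100" .
  qed (use k12 that M0 in auto)
  define A :: "real \<Rightarrow> (complex ^ 'n) set" where
    "A l = {z. bumps.F (tube.pp k1) (tube.qq k1 k2 l) l del0 M z < 1}" for l
  have tl: "tube k1 k2 l M" if "l \<in> {0<..l0}" for l using that l0 by (intro tube) auto
  show ?thesis
  proof (intro exI[of _ l0] exI[of _ A] conjI l0 ballI)
    show "smooth_family {0<..l0} A"
      unfolding smooth_family_def
    proof (intro conjI ballI)
      fix l assume "l \<in> {0<..l0}"
      then interpret tube k1 k2 l M by (rule tl)
      show "A l \<in> star_domains" unfolding A_def by (rule sublevel_star_domains)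
    next
      let ?W = "{0<..<2 * l0} \<times> (- {0 :: complex ^ 'n})"
      show "smooth_on (\<lambda>(l, z). radial_fun (A l) z) ({0<..l0} \<times> sphere 0 1)"
        unfolding smooth_on_def
      proof (intro ballI exI conjI allI)
        fix x :: "real \<times> (complex ^ 'n)" and k assume x: "x \<in> {0<..l0} \<times> sphere 0 1"
        show o: "open ?W" by (intro open_Times) auto
        show "x \<in> ?W" using x l0 by auto
        show "Ck_on k (\<lambda>x. sqrt (bumps.U (tube.pp k1) (tube.qq k1 k2 (fst x)) (fst x) del0 M (snd x))) ?W"
          by (rule Ck_on_family[OF o]) (use tube in auto)
      next
        fix x y :: "real \<times> (complex ^ 'n)" assume y: "y \<in> ?W \<inter> {0<..l0} \<times> sphere 0 1"
        obtain l z where lz: "y = (l, z)" by (cases y)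
        interpret tube k1 k2 l M by (rule tl) (use y lz in auto)
        show "sqrt (bumps.U (tube.pp k1) (tube.qq k1 k2 (fst y)) (fst y) del0 M (snd y)) = (\<lambda>(l, z). radial_fun (A l) z) y"
          using y by (simp add: lz A_def radial_sublevel)
      qed
    qed
    show "((\<lambda>l. C1_dist (A l) (ball 0 1)) \<longlongrightarrow> 0) (at_right 0)"
    proof (rule Lim_null_comparison)
      show "\<forall>\<^sub>F l in at_right 0. norm (C1_dist (A l) (ball 0 1)) \<le> (1 + M + (4 + M * (2 + 2 / del0))) * l"
      proof (rule eventually_at_rightI[of 0 l0])
        fix l assume "l \<in> {0<..<l0}"
        then have "l \<in> {0<..l0}" by auto
        then interpret tube k1 k2 l M by (rule tl)
        show "norm (C1_dist (A l) (ball 0 1)) \<le> (1 + M + (4 + M * (2 + 2 / del0))) * l"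
          unfolding A_def real_norm_def using C1_dist_bound by (simp only: K0_def)
      qed (rule l0)
      have "((\<lambda>l. (1 + M + (4 + M * (2 + 2 / del0))) * l) \<longlongrightarrow> (1 + M + (4 + M * (2 + 2 / del0))) * 0) (at_right 0)"
        by (intro tendsto_intros)
      then show "((\<lambda>l. (1 + M + (4 + M * (2 + 2 / del0))) * l) \<longlongrightarrow> 0) (at_right 0)" by simp
    qed
    fix l assume "l \<in> {0<..l0}"
    then interpret tube k1 k2 l M by (rule tl)
    show "ball_capacity (A l) < ereal (sys (A l))"
      unfolding A_def sys_eq_pi by (rule ball_capacity_less[OF M_ge])
    show "ereal (sys (A l)) \<le> cylindrical_capacity i (A l)"
      unfolding A_def sys_eq_pi by (rule cylindrical_capacity_ge)
  qed
qed

end
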